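(* Let $p$ be prime, $G$ a non-Abelian, special $p$-group and $k$ an integer (implicitly sequences with $|G|\to\infty$) such that $1\ll\log k\ll\log|G|$. Let $r:=\log_p|G^{\mathrm{ab}}|$, $s:=\log_p|[G,G]|$ and $\ell:=r+s=\log_p|G|$. Suppose that $k\ge\ell$. (i) If $k\lesssim\log|G|$, then suppose that $k\gg s^2\log p$ and $k-r\gg s$. (ii) If $k\gg\log|G|$, then suppose only that $s\ll r$. Then the random walk on $G_k$ exhibits cutoff at $\tau_*(k,G^{\mathrm{ab}})=\tau_p(k,\mathbb Z_p^r)$ with high probability conditional that $G_k$ is connected. If $(k-r)p\gg1$, then $G_k$ is connected with high probability. If $k-r\asymp k$ and $p\gg1$, then $\tau_p(k,\mathbb Z_p^r)\eqsim\tau_\infty(k,\mathbb Z_p^r)$.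
   Context: Conventions. All objects are implicitly sequences indexed by $N\to\infty$ with $|G_N|\to\infty$; the index is suppressed. $a\ll b$ (equivalently $b\gg a$) means $a/b\to0$; $a\lesssim b$ means $a/b$ is bounded; $a\asymp b$ means $a\lesssim b\lesssim a$; $a\eqsim b$ means $a/b\to1$. With high probability (whp): with probability tending to 1. $[G,G]$ is the commutator subgroup and $G^{\mathrm{ab}}=G/[G,G]$. A $p$-group is special if it is step-2 nilpotent and its centre $Z(G)$, Frattini subgroup $\Phi(G)$ and commutator subgroup $[G,G]$ are all equal and elementary Abelian (isomorphic to $\mathbb Z_p^s$ for some $s$). In this case $G^{\mathrm{ab}}\cong\mathbb Z_p^r$. Random Cayley graph and walk. For a multiset $Z=[Z_1,\dots,Z_k]$ of elements of $G$, the directed (undirected) Cayley graph $G^+(Z)$ ($G^-(Z)$) is the multigraph with vertex set $G$ and edges $(g,gz)$ (respectively $\{g,gz\}$) for $g\in G$, $z\in Z$; it is connected iff $Z$ generates $G$. The random walk (RW) is in continuous time at rate 1, started from the identity: at each step, from $g$, $z\in Z$ is chosen uniformly and the walk moves to $gz$ for $G^+(Z)$, or to one of $gz$, $gz^{-1}$ with probability $1/2$ each for $G^-(Z)$. $G_k^\pm := G^\pm(Z)$ with $Z_1,\dots,Z_k$ i.i.d. uniform on $G$; $G_k$ means either, and the statement holds in both cases (with the matching sign for the entropic times). $d_{G_k}(t)$ is the total variation distance, given $Z$, between the law of the RW at time $t$ and uniform. Cutoff at $t_N$ whp: for every fixed $\varepsilon\in(0,1)$, $d_{G_k}((1+\varepsilon)t_N)\to0$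 and $d_{G_k}((1-\varepsilon)t_N)\to1$ in probability; "conditional that $G_k$ is connected" means that this convergence is under the law of $Z$ conditioned on $Z$ generating $G$. Entropic times. For a finite Abelian group $A$ and $\gamma\in\mathbb N\cup\{\infty\}$: $\mathbb Z_\infty=\mathbb Z$, $\gamma A=\{\gamma a: a\in A\}$, $\infty A=\{\mathrm{id}\}$. The rate-1 RW on $\mathbb Z_\gamma^k$, started at $0$, at rate 1 selects a coordinate uniformly and adds $+1$ (directed case), or $\pm1$ with probability $1/2$ each (undirected case). $\tau_\gamma(k,A)$ is the time at which the (Shannon, natural-log) entropy of its law equals $\log|A/\gamma A|$, and $\tau_*(k,A)=\max_{\gamma\in\mathbb N\cup\{\infty\}}\tau_\gamma(k,A)$. Thus $\tau_p(k,\mathbb Z_p^r)$ is the time at which the entropy of the rate-1 RW on $\mathbb Z_p^k$ reaches $\log(p^r)$, and $\tau_\infty(k,\mathbb Z_p^r)$ the time at which that of the rate-1 RW on $\mathbb Z^k$ does. *)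

theory Defs
  imports
    "HOL-Probability.Probability"
    "HOL-Algebra.Generated_Groups"
    "HOL-Algebra.Product_Groups"
    "HOL-Library.Extended_Nat"
    "HOL-Library.Landau_Symbols"
    "Graph_Theory.Digraph_Component"
begin

section \<open>Special groups\<close>

definition group_centre :: "('a, 'b) monoid_scheme \<Rightarrow> 'a set" where
  "group_centre G = {x \<in> carrier G. \<forall>g\<in>carrier G. x \<otimes>\<^bsub>G\<^esub> g = g \<otimes>\<^bsub>G\<^esub> x}"

definition maximal_subgroup :: "'a set \<Rightarrow> ('a, 'b) monoid_scheme \<Rightarrow> bool" where
  "maximal_subgroup M G \<longleftrightarrow> subgroup M G \<and> M \<noteq> carrier G \<and>
     (\<forall>H. subgroup H G \<and> M \<subseteq> H \<and> H \<noteq> carrier G \<longrightarrow> H = M)"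

text \<open>The intersection with the carrier gives \<open>\<Phi>(G) = G\<close> if there is no maximal subgroup.\<close>
definition frattini_subgroup :: "('a, 'b) monoid_scheme \<Rightarrow> 'a set" where
  "frattini_subgroup G = carrier G \<inter> \<Inter> {M. maximal_subgroup M G}"

abbreviation commutator_subgroup :: "('a, 'b) monoid_scheme \<Rightarrow> 'a set" where
  "commutator_subgroup G \<equiv> derived G (carrier G)"

definition abelianization :: "('a, 'b) monoid_scheme \<Rightarrow> 'a set monoid" where
  "abelianization G = G Mod commutator_subgroup G"

text \<open>\<open>[G, [G, G]] = 1\<close>. This allows class less than two; non-commutativity is a separate
  hypothesis where it is needed.\<close>
definition step2_nilpotent :: "('a, 'b) monoid_scheme \<Rightarrow> bool" where
  "step2_nilpotent G \<longleftrightarrow>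
     generate G (\<Union>g\<in>carrier G. \<Union>h\<in>commutator_subgroup G.
       {g \<otimes>\<^bsub>G\<^esub> h \<otimes>\<^bsub>G\<^esub> inv\<^bsub>G\<^esub> g \<otimes>\<^bsub>G\<^esub> inv\<^bsub>G\<^esub> h}) = {\<one>\<^bsub>G\<^esub>}"

text \<open>\<open>\<int>\<^sub>\<gamma>\<close>, with \<open>\<int>\<^sub>\<infinity> = \<int>\<close>.\<close>
definition cyc :: "enat \<Rightarrow> int monoid" where
  "cyc \<gamma> = (case \<gamma> of enat n \<Rightarrow> integer_mod_group n | \<infinity> \<Rightarrow> integer_group)"

definition cyc_power :: "enat \<Rightarrow> nat \<Rightarrow> (nat \<Rightarrow> int) monoid" where
  "cyc_power \<gamma> k = product_group {..<k} (\<lambda>_. cyc \<gamma>)"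

definition special_p_group :: "nat \<Rightarrow> ('a, 'b) monoid_scheme \<Rightarrow> bool" where
  "special_p_group p G \<longleftrightarrow>
     group G \<and> (\<exists>n. order G = p ^ n) \<and> step2_nilpotent G \<and>
     group_centre G = frattini_subgroup G \<and>
     frattini_subgroup G = commutator_subgroup G \<and>
     (\<exists>m. G\<lparr>carrier := commutator_subgroup G\<rparr> \<cong> cyc_power (enat p) m)"


section \<open>Random walks\<close>

datatype orientation = Directed | Undirected

definition sign_pmf :: "orientation \<Rightarrow> bool pmf" where
  "sign_pmf \<sigma> = (case \<sigma> of Directed \<Rightarrow> return_pmf True | Undirected \<Rightarrow> bernoulli_pmf (1/2))"

primrec discrete_walk :: "('s \<Rightarrow> 's pmf) \<Rightarrow> 's \<Rightarrow> nat \<Rightarrow> 's pmf" where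
  "discrete_walk K x 0 = return_pmf x"
| "discrete_walk K x (Suc n) = bind_pmf (discrete_walk K x n) K"

text \<open>Law at time \<open>t\<close> of the rate-1 continuous-time walk with jump kernel \<open>K\<close>: the number
  of jumps up to time \<open>t\<close> is Poisson. The case distinction is needed because
  \<^const>\<open>poisson_pmf\<close> is unspecified at rate 0.\<close>
definition walk_law :: "('s \<Rightarrow> 's pmf) \<Rightarrow> 's \<Rightarrow> real \<Rightarrow> 's pmf" where
  "walk_law K x t =
     bind_pmf (if t > 0 then poisson_pmf t else return_pmf 0) (discrete_walk K x)"

text \<open>The multiset \<open>Z\<close> of generators is represented by a list.\<close>
definition cayley_step ::
    "orientation \<Rightarrow> ('a, 'b) monoid_scheme \<Rightarrow> 'a list \<Rightarrow> 'a \<Rightarrow> 'a pmf" where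
  "cayley_step \<sigma> G Z g =
     bind_pmf (pmf_of_set {..<length Z}) (\<lambda>i.
       map_pmf (\<lambda>b. g \<otimes>\<^bsub>G\<^esub> (if b then Z ! i else inv\<^bsub>G\<^esub> (Z ! i))) (sign_pmf \<sigma>))"

definition tv_distance :: "'s pmf \<Rightarrow> 's pmf \<Rightarrow> real" where
  "tv_distance P Q = (SUP A. \<bar>measure_pmf.prob P A - measure_pmf.prob Q A\<bar>)"

definition mixing_distance ::
    "orientation \<Rightarrow> ('a, 'b) monoid_scheme \<Rightarrow> 'a list \<Rightarrow> real \<Rightarrow> real" where
  "mixing_distance \<sigma> G Z t =
     tv_distance (walk_law (cayley_step \<sigma> G Z) \<one>\<^bsub>G\<^esub> t) (pmf_of_set (carrier G))"


section \<open>Random Cayley graphs\<close>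

text \<open>The multigraph \<open>G\<^sup>+(Z)\<close>; its underlying undirected multigraph is \<open>G\<^sup>-(Z)\<close>.
  \<^const>\<open>Digraph_Component.connected\<close> refers to the underlying undirected graph, so
  it expresses connectedness of both.\<close>
definition cayley_graph ::
    "('a, 'b) monoid_scheme \<Rightarrow> 'a list \<Rightarrow> ('a, 'a \<times> nat) pre_digraph" where
  "cayley_graph G Z =
     \<lparr>verts = carrier G, arcs = carrier G \<times> {..<length Z},
      tail = fst, head = (\<lambda>(g, i). g \<otimes>\<^bsub>G\<^esub> Z ! i)\<rparr>"

definition cayley_connected :: "('a, 'b) monoid_scheme \<Rightarrow> 'a list \<Rightarrow> bool" where
  "cayley_connected G Z \<longleftrightarrow> Digraph_Component.connected (cayley_graph G Z)"

lemma cayley_connected_iff_generate: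
  assumes "group G" and Z: "set Z \<subseteq> carrier G"
  shows "cayley_connected G Z \<longleftrightarrow> generate G (set Z) = carrier G"
proof -
  interpret group G by fact
  define H where "H = generate G (set Z)"
  have H: "subgroup H G" unfolding H_def using Z by (rule generate_is_subgroup)
  define E where "E = parcs (mk_symmetric (cayley_graph G Z))"
  have E: "(u, v) \<in> E \<longleftrightarrow> u \<in> carrier G \<and> v \<in> carrier G \<and>
      (\<exists>z\<in>set Z. v = u \<otimes>\<^bsub>G\<^esub> z \<or> u = v \<otimes>\<^bsub>G\<^esub> z)" for u v
    unfolding E_def parcs_mk_symmetric cayley_graph_def using Z
    by (fastforce simp: in_set_conv_nth)
  have conn: "cayley_connected G Z \<longleftrightarrow>
      (\<forall>u\<in>carrier G. \<forall>v\<in>carrier G. (u, v) \<in> rtrancl_on (carrier G) E)"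
    unfolding cayley_connected_def Digraph_Component.connected_def strongly_connected_def
      reachable_def E_def arcs_ends_def arc_to_ends_def
    by (auto simp: cayley_graph_def with_proj_def)
  show ?thesis
  proof
    assume *: "cayley_connected G Z"
    have inv: "v \<in> H" if "(u, v) \<in> rtrancl_on (carrier G) E" "u \<in> H" for u v
      using that
    proof (induction rule: rtrancl_on_induct)
      case base
      then show ?case by simp
    next
      case (step v w)
      then obtain z where z: "z \<in> set Z" "v \<in> carrier G" "w \<in> carrier G"
        "w = v \<otimes>\<^bsub>G\<^esub> z \<or> v = w \<otimes>\<^bsub>G\<^esub> z" using E by blast
      have zH: "z \<in> H" "z \<in> carrier G" using z Z by (auto simp: H_def intro: generate.incl)
      have "w = v \<otimes>\<^bsub>G\<^esub> z \<or> w = v \<otimes>\<^bsub>G\<^esub> inv\<^bsub>G\<^esub> z"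
        using z zH by (metis inv_solve_right)
      then show ?case
        using step zH H by (meson subgroup.m_closed subgroup.m_inv_closed)
    qed
    have "v \<in> H" if "v \<in> carrier G" for v
      using inv[of "\<one>\<^bsub>G\<^esub>" v] that * conn H by (simp add: subgroup.one_closed)
    then show "generate G (set Z) = carrier G"
      using H subgroup.subset unfolding H_def by blast
  next
    assume *: "generate G (set Z) = carrier G"
    have step: "(u, v) \<in> rtrancl_on (carrier G) E" if "(u, v) \<in> E" for u v
      using that E by (meson rtrancl_on_refl rtrancl_on_into_rtrancl_on)
    have reach: "\<forall>u\<in>carrier G. (u, u \<otimes>\<^bsub>G\<^esub> h) \<in> rtrancl_on (carrier G) E"
      if "h \<in> generate G (set Z)" for h
      using that
    proof induction
      case one
      then show ?case by simp
    next
      case (incl h)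
      then have "h \<in> carrier G" using Z by auto
      then show ?case using incl by (auto intro!: step E[THEN iffD2])
    next
      case (inv h)
      then have "h \<in> carrier G" using Z by auto
      then have "u = (u \<otimes>\<^bsub>G\<^esub> inv\<^bsub>G\<^esub> h) \<otimes>\<^bsub>G\<^esub> h" if "u \<in> carrier G" for u
        using that by (simp add: m_assoc)
      moreover have "u \<otimes>\<^bsub>G\<^esub> inv\<^bsub>G\<^esub> h \<in> carrier G" if "u \<in> carrier G" for u
        using that \<open>h \<in> carrier G\<close> by simp
      ultimately show ?case using inv by (blast intro: step E[THEN iffD2])
    next
      case (eng h1 h2)
      then have h: "h1 \<in> carrier G" "h2 \<in> carrier G" using * by auto
      show ?case
      proof
        fix u assume u: "u \<in> carrier G"
        have "(u, u \<otimes>\<^bsub>G\<^esub> h1) \<in> rtrancl_on (carrier G) E"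
          "(u \<otimes>\<^bsub>G\<^esub> h1, (u \<otimes>\<^bsub>G\<^esub> h1) \<otimes>\<^bsub>G\<^esub> h2) \<in> rtrancl_on (carrier G) E"
          using eng u h by auto
        then show "(u, u \<otimes>\<^bsub>G\<^esub> (h1 \<otimes>\<^bsub>G\<^esub> h2)) \<in> rtrancl_on (carrier G) E"
          using u h by (metis m_assoc rtrancl_on_trans)
      qed
    qed
    show "cayley_connected G Z"
      unfolding conn
    proof (intro ballI)
      fix u v assume uv: "u \<in> carrier G" "v \<in> carrier G"
      then have "v = u \<otimes>\<^bsub>G\<^esub> (inv\<^bsub>G\<^esub> u \<otimes>\<^bsub>G\<^esub> v)" by (simp add: m_assoc[symmetric])
      with reach[of "inv\<^bsub>G\<^esub> u \<otimes>\<^bsub>G\<^esub> v"] uv * show "(u, v) \<in> rtrancl_on (carrier G) E"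
        by (metis inv_closed m_closed)
    qed
  qed
qed

definition generators_law :: "('a, 'b) monoid_scheme \<Rightarrow> nat \<Rightarrow> 'a list pmf" where
  "generators_law G k = replicate_pmf k (pmf_of_set (carrier G))"

definition connected_generators_law :: "('a, 'b) monoid_scheme \<Rightarrow> nat \<Rightarrow> 'a list pmf" where
  "connected_generators_law G k = cond_pmf (generators_law G k) {Z. cayley_connected G Z}"


section \<open>Entropic times\<close>

definition lattice_step ::
    "orientation \<Rightarrow> nat \<Rightarrow> enat \<Rightarrow> (nat \<Rightarrow> int) \<Rightarrow> (nat \<Rightarrow> int) pmf" where
  "lattice_step \<sigma> k \<gamma> x =
     bind_pmf (pmf_of_set {..<k}) (\<lambda>i.
       map_pmf (\<lambda>b. x(i := x i \<otimes>\<^bsub>cyc \<gamma>\<^esub> (if b then 1 else -1))) (sign_pmf \<sigma>))"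

definition lattice_walk :: "orientation \<Rightarrow> nat \<Rightarrow> enat \<Rightarrow> real \<Rightarrow> (nat \<Rightarrow> int) pmf" where
  "lattice_walk \<sigma> k \<gamma> t = walk_law (lattice_step \<sigma> k \<gamma>) \<one>\<^bsub>cyc_power \<gamma> k\<^esub> t"

definition shannon_entropy :: "'s pmf \<Rightarrow> real" where
  "shannon_entropy P = (\<Sum>\<^sub>\<infinity>x\<in>set_pmf P. - pmf P x * ln (pmf P x))"

definition multiple_subgroup :: "enat \<Rightarrow> ('a, 'b) monoid_scheme \<Rightarrow> 'a set" where
  "multiple_subgroup \<gamma> A =
     (case \<gamma> of enat n \<Rightarrow> (\<lambda>a. a [^]\<^bsub>A\<^esub> n) ` carrier A | \<infinity> \<Rightarrow> {\<one>\<^bsub>A\<^esub>})"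

text \<open>The infimum selects the first such time. It matters only for \<open>\<gamma> = 1\<close>, where the
  entropy and \<open>log |A/\<gamma>A|\<close> vanish identically and the value is 0. If the target entropy is
  never reached (as for \<open>A = \<int>\<^sub>p\<^sup>r\<close>, \<open>\<gamma> = p\<close>, \<open>k \<le> r\<close> with \<open>r > 0\<close>), the value is not
  meaningful.\<close>
definition entropic_time :: "orientation \<Rightarrow> nat \<Rightarrow> enat \<Rightarrow> ('a, 'b) monoid_scheme \<Rightarrow> real" where
  "entropic_time \<sigma> k \<gamma> A =
     Inf {t. 0 \<le> t \<and>
       shannon_entropy (lattice_walk \<sigma> k \<gamma> t) = ln (real (order (A Mod multiple_subgroup \<gamma> A)))}"

definition max_entropic_time :: "orientation \<Rightarrow> nat \<Rightarrow> ('a, 'b) monoid_scheme \<Rightarrow> real" where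
  "max_entropic_time \<sigma> k A = (GREATEST t. \<exists>\<gamma>\<ge>1. t = entropic_time \<sigma> k \<gamma> A)"


section \<open>Convergence in probability and cutoff\<close>

definition tendsto_in_prob :: "(nat \<Rightarrow> 'z pmf) \<Rightarrow> (nat \<Rightarrow> 'z \<Rightarrow> real) \<Rightarrow> real \<Rightarrow> bool" where
  "tendsto_in_prob M Y c \<longleftrightarrow>
     (\<forall>\<delta>>0. (\<lambda>N. measure_pmf.prob (M N) {z. \<bar>Y N z - c\<bar> > \<delta>}) \<longlonglongrightarrow> 0)"

definition cutoff_in_prob ::
    "(nat \<Rightarrow> 'z pmf) \<Rightarrow> (nat \<Rightarrow> 'z \<Rightarrow> real \<Rightarrow> real) \<Rightarrow> (nat \<Rightarrow> real) \<Rightarrow> bool" where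
  "cutoff_in_prob M d T \<longleftrightarrow>
     (\<forall>\<epsilon>. 0 < \<epsilon> \<and> \<epsilon> < 1 \<longrightarrow>
        tendsto_in_prob M (\<lambda>N z. d N z ((1 + \<epsilon>) * T N)) 0 \<and>
        tendsto_in_prob M (\<lambda>N z. d N z ((1 - \<epsilon>) * T N)) 1)"

end

theory Submission
  imports Defs "HOL-Algebra.FiniteProduct" "HOL-Real_Asymp.Real_Asymp"
begin

text \<open>
  Let \<open>C = [G, G]\<close> be the centre, \<open>V = G / C\<close>, \<open>|V| = p\<^sup>r\<close>, \<open>|C| = p\<^sup>s\<close>. A path of the walk is a word in the
  generators. Its image in the Abelian group \<open>V\<close>, which has exponent \<open>p\<close>, depends only on the net
  numbers of uses of the generators modulo \<open>p\<close>, and these numbers perform the walk on \<open>\<int>\<^sub>p\<^sup>k\<close>. By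
  independence the entropy of that walk at time \<open>k u\<close> is \<open>k h(u)\<close>, where \<open>h\<close> is the entropy of the
  rate-1 walk on \<open>\<int>\<^sub>p\<close>. The entropic time is thus \<open>T = k s\<^sub>0\<close> with \<open>k h(s\<^sub>0) = r log p\<close>; every other
  modulus \<open>\<gamma>\<close> gives a smaller or equal time, since for multiples of \<open>p\<close> and for \<open>\<infinity>\<close> reduction modulo
  \<open>p\<close> loses entropy, and for all others the target entropy is 0.

  Lower bound: slightly before \<open>T\<close> the net numbers concentrate on far fewer than \<open>p\<^sup>r\<close> values, so the walk
  does not even cover a constant proportion of \<open>V\<close> (\<open>mixing_lower\<close>).

  Upper bound: if two words have different net numbers modulo \<open>p\<close>, then they represent the same element
  of \<open>G\<close> with probability at most \<open>1 / |G|\<close> over the random generators (\<open>prob_collision\<close>). The reason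
  is that shifting one generator by a central element of order \<open>p\<close> separates them, and the same argument
  works first in \<open>V\<close> and then in \<open>C\<close>. A second moment argument, restricted to typical net numbers, shows
  that the walk is close to uniform as soon as the entropy exceeds \<open>log |G| = (r + s) log p\<close> by a growing
  amount (\<open>second_moment_tv\<close>, \<open>mixing_upper\<close>). Slightly after \<open>T\<close> the entropy is \<open>r log p\<close> plus the gain
  \<open>k (h((1 + \<epsilon>) s\<^sub>0) - h(s\<^sub>0))\<close>, so this gain has to absorb \<open>s log p\<close>.

  Both bounds therefore need two facts on the one-dimensional walk. First, the gain over a window of
  relative length \<open>\<epsilon>\<close> is at least a constant times \<open>\<epsilon> min(1, h(s\<^sub>0), log p - h(s\<^sub>0))\<close> (\<open>gain_bound\<close>).
  Second, the variance of \<open>- log\<close> of the density is bounded by the entropy production \<open>u h'(u)\<close> up to a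
  logarithmic factor, by a Poincare inequality (\<open>varent_bound\<close>), so Chebyshev's inequality gives the
  concentration. Since \<open>k h(s\<^sub>0) = r log p\<close> and \<open>k (log p - h(s\<^sub>0)) = (k - r) log p\<close>, the gain is of order
  \<open>min(k, r log p, (k - r) log p)\<close>, and the two regimes of the theorem are what makes this much larger
  than \<open>s log p\<close> and than the logarithmic factor (\<open>separation\<close>).

  The generators fail to generate with probability at most \<open>p\<^bsup>r - k\<^esup> / (p - 1) \<le> 1 / 2\<close>
  (\<open>prob_not_generate\<close>), so conditioning on connectedness costs a factor of at most 2. Finally, the
  walks on \<open>\<int>\<close> and \<open>\<int>\<^sub>p\<close> differ in entropy by the conditional entropy of the block of length \<open>p\<close> that
  contains the position, which is small at times far below \<open>p\<^sup>2\<close> (\<open>coord_entropy_infinity_le\<close>); the gain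
  then shows that the two entropic times are asymptotically equal.
\<close>

section \<open>Means over a Poisson number of steps\<close>

definition poisson_mean :: "real \<Rightarrow> (nat \<Rightarrow> 'a::banach) \<Rightarrow> 'a" where
  "poisson_mean s a = (\<Sum>n. (exp (-s) * s ^ n / fact n) *\<^sub>R a n)"

definition bounded_seq :: "(nat \<Rightarrow> 'a::real_normed_vector) \<Rightarrow> bool" where
  "bounded_seq a \<longleftrightarrow> (\<exists>B. \<forall>n. norm (a n) \<le> B)"

lemma bounded_seqI: "(\<And>n. norm (a n) \<le> B) \<Longrightarrow> bounded_seq a"
  unfolding bounded_seq_def by blast

lemma bounded_seq_Suc: "bounded_seq a \<Longrightarrow> bounded_seq (\<lambda>n. a (Suc n))"
  unfolding bounded_seq_def by blast

lemma poisson_weights_sums: "(\<lambda>n. exp (-s) * s ^ n / fact n) sums (1::real)"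
proof -
  have "(\<lambda>n. exp (-s) * (s ^ n /\<^sub>R fact n)) sums (exp (-s) * exp s)"
    by (intro sums_mult exp_converges)
  then show ?thesis by (simp add: exp_minus field_simps)
qed

lemma summable_poisson_mean:
  fixes a :: "nat \<Rightarrow> 'a::banach"
  assumes "bounded_seq a"
  shows "summable (\<lambda>n. (exp (-s) * s ^ n / fact n) *\<^sub>R a n)"
proof -
  obtain B where B: "\<And>n. norm (a n) \<le> B" using assms unfolding bounded_seq_def by blast
  have *: "summable (\<lambda>n. exp (-s) * (\<bar>s\<bar> ^ n /\<^sub>R fact n) * B)"
    by (intro summable_mult summable_mult2 summable_exp_generic)
  show ?thesis
  proof (rule summable_comparison_test'[OF *, of 0])
    fix n
    have "norm ((exp (-s) * s ^ n / fact n) *\<^sub>R a n) = exp (-s) * (\<bar>s\<bar> ^ n /\<^sub>R fact n) * norm (a n)"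
      by (simp add: power_abs abs_mult divide_inverse mult_ac)
    also have "\<dots> \<le> exp (-s) * (\<bar>s\<bar> ^ n /\<^sub>R fact n) * B"
      by (intro mult_left_mono B) auto
    finally show "norm ((exp (-s) * s ^ n / fact n) *\<^sub>R a n) \<le> exp (-s) * (\<bar>s\<bar> ^ n /\<^sub>R fact n) * B" .
  qed
qed

lemma poisson_mean_sums:
  "bounded_seq a \<Longrightarrow> (\<lambda>n. (exp (-s) * s ^ n / fact n) *\<^sub>R a n) sums poisson_mean s a"
  unfolding poisson_mean_def by (intro summable_sums summable_poisson_mean)

lemma poisson_mean_add:
  assumes "bounded_seq a" "bounded_seq b"
  shows "poisson_mean s (\<lambda>n. a n + b n) = poisson_mean s a + poisson_mean s b"
  using sums_add[OF poisson_mean_sums[OF assms(1), of s] poisson_mean_sums[OF assms(2), of s]]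
  unfolding poisson_mean_def by (simp add: sums_iff scaleR_add_right)

lemma poisson_mean_linear:
  assumes "bounded_linear f" "bounded_seq a"
  shows "poisson_mean s (\<lambda>n. f (a n)) = f (poisson_mean s a)"
  using bounded_linear.sums[OF assms(1) poisson_mean_sums[OF assms(2), of s]]
  by (simp add: poisson_mean_def sums_iff linear_simps[OF assms(1)])

lemma bounded_seq_sum:
  assumes "finite A" "\<And>x. x \<in> A \<Longrightarrow> bounded_seq (a x)"
  shows "bounded_seq (\<lambda>n. \<Sum>x\<in>A. a x n)"
proof -
  obtain B where "\<And>x n. x \<in> A \<Longrightarrow> norm (a x n) \<le> B x"
    using assms(2) unfolding bounded_seq_def by metis
  then show ?thesis
    by (intro bounded_seqI[where B = "\<Sum>x\<in>A. B x"]) (intro sum_norm_le, auto)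
qed

lemma poisson_mean_sum:
  assumes "finite A" "\<And>x. x \<in> A \<Longrightarrow> bounded_seq (a x)"
  shows "poisson_mean s (\<lambda>n. \<Sum>x\<in>A. a x n) = (\<Sum>x\<in>A. poisson_mean s (a x))"
proof -
  have "(\<lambda>n. \<Sum>x\<in>A. (exp (-s) * s ^ n / fact n) *\<^sub>R a x n) sums (\<Sum>x\<in>A. poisson_mean s (a x))"
    by (intro sums_sum poisson_mean_sums assms)
  then show ?thesis by (simp add: poisson_mean_def sums_iff scaleR_sum_right)
qed

lemma poisson_mean_const [simp]: "poisson_mean s (\<lambda>_. c) = c"
  using sums_scaleR_left[OF poisson_weights_sums, of s c] by (simp add: poisson_mean_def sums_iff)

lemma poisson_mean_mono:
  fixes a :: "nat \<Rightarrow> real"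
  assumes "0 \<le> s" "bounded_seq a" "bounded_seq b" "\<And>n. a n \<le> b n"
  shows "poisson_mean s a \<le> poisson_mean s b"
  unfolding poisson_mean_def using assms
  by (intro suminf_le summable_poisson_mean) (auto intro!: divide_right_mono mult_left_mono)

lemma poisson_mean_nonneg:
  fixes a :: "nat \<Rightarrow> real"
  assumes "0 \<le> s" "bounded_seq a" "\<And>n. 0 \<le> a n"
  shows "0 \<le> poisson_mean s a"
  using poisson_mean_mono[of s "\<lambda>_. 0" a] assms by (simp add: bounded_seq_def exI[of _ 0])

text \<open>All terms are nonnegative, so a single number of steps already gives a lower
bound.\<close>

lemma poisson_mean_ge_term:
  fixes a :: "nat \<Rightarrow> real"
  assumes "0 \<le> s" "bounded_seq a" "\<And>n. 0 \<le> a n"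
  shows "exp (-s) * s ^ n / fact n * a n \<le> poisson_mean s a"
  using sum_le_suminf[OF summable_poisson_mean[OF assms(2), of s], of "{n}"] assms
  by (auto simp: poisson_mean_def)

lemma poisson_mean_0 [simp]: "poisson_mean 0 a = a 0"
proof -
  have "(\<lambda>n. (exp (-0) * 0 ^ n / fact n) *\<^sub>R a n) = (\<lambda>n. if n = 0 then a 0 else 0)"
    by (auto simp: fun_eq_iff power_0_left)
  then show ?thesis unfolding poisson_mean_def by (simp add: sums_unique[symmetric, OF sums_single])
qed

lemma poisson_mean_power_series:
  fixes a :: "nat \<Rightarrow> real"
  assumes that: "bounded_seq a"
  shows "poisson_mean s a = exp (-s) * (\<Sum>n. a n / fact n * s ^ n)"
proof -
  have "summable (\<lambda>n. exp s * ((exp (-s) * s ^ n / fact n) *\<^sub>R a n))"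
    by (intro summable_mult summable_poisson_mean that)
  then have "summable (\<lambda>n. a n / fact n * s ^ n)"
    by (simp add: exp_minus field_simps)
  from suminf_mult[OF this, of "exp (-s)"] show ?thesis
    unfolding poisson_mean_def by (simp add: field_simps)
qed

text \<open>This is the Kolmogorov equation: one more step is taken at rate 1. All differential
equations below are instances of it.\<close>

lemma DERIV_poisson_mean:
  fixes a :: "nat \<Rightarrow> real"
  assumes "bounded_seq a"
  shows "((\<lambda>s. poisson_mean s a) has_real_derivative
           poisson_mean s (\<lambda>n. a (Suc n)) - poisson_mean s a) (at s)"
proof -
  have S: "summable (\<lambda>n. a n / fact n * y ^ n)" for y
  proof -
    have "summable (\<lambda>n. exp y * ((exp (-y) * y ^ n / fact n) *\<^sub>R a n))"
      by (intro summable_mult summable_poisson_mean assms)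
    then show ?thesis by (simp add: exp_minus field_simps)
  qed
  have d: "diffs (\<lambda>n. a n / fact n) = (\<lambda>n. a (Suc n) / fact n)"
    by (auto simp: diffs_def fun_eq_iff simp del: of_nat_Suc)
  have "((\<lambda>x. \<Sum>n. a n / fact n * x ^ n) has_field_derivative (\<Sum>n. a (Suc n) / fact n * s ^ n)) (at s)"
    using termdiffs_strong_converges_everywhere[OF S, of s] unfolding d .
  then have "((\<lambda>x. exp (-x) * (\<Sum>n. a n / fact n * x ^ n)) has_field_derivative
     exp (-s) * (\<Sum>n. a (Suc n) / fact n * s ^ n) - exp (-s) * (\<Sum>n. a n / fact n * s ^ n)) (at s)"
    by (auto intro!: derivative_eq_intros)
  then show ?thesis
    using poisson_mean_power_series[OF assms] poisson_mean_power_series[OF bounded_seq_Suc[OF assms]]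
    by simp
qed

text \<open>The probability generating function of the Poisson law. For characters \<open>z\<close>
is the mean of the character over one step.\<close>

lemma poisson_mean_geometric:
  fixes z :: complex
  assumes "norm z \<le> 1"
  shows "poisson_mean s (\<lambda>n. z ^ n) = exp (of_real s * (z - 1))"
proof -
  have "(\<lambda>n. exp (-of_real s) * ((of_real s * z) ^ n /\<^sub>R fact n)) sums (exp (- of_real s) * exp (of_real s * z))"
    by (intro sums_mult exp_converges)
  moreover have "exp (-of_real s) * ((of_real s * z) ^ n /\<^sub>R fact n) = (exp (-s) * s ^ n / fact n) *\<^sub>R z ^ n" for n
    by (simp add: scaleR_conv_of_real power_mult_distrib exp_of_real[symmetric] field_simps)
  ultimately have "poisson_mean s (\<lambda>n. z ^ n) = exp (- of_real s) * exp (of_real s * z)"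
    unfolding poisson_mean_def by (simp add: sums_iff)
  then show ?thesis by (simp add: mult_exp_exp algebra_simps)
qed

section \<open>The walk on a cycle\<close>

text \<open>The mean over one step of the walk: the step is \<open>1\<close> in the directed case
and \<open>1\<close> or \<open>- 1\<close> with equal probability in the undirected case.\<close>

definition avg :: "orientation \<Rightarrow> (int \<Rightarrow> real) \<Rightarrow> real" where
  "avg \<sigma> f = (case \<sigma> of Directed \<Rightarrow> f 1 | Undirected \<Rightarrow> (f 1 + f (-1)) / 2)"

definition steps :: "orientation \<Rightarrow> int set" where
  "steps \<sigma> = (case \<sigma> of Directed \<Rightarrow> {1} | Undirected \<Rightarrow> {1, -1})"

lemma avg_mono:
  assumes "\<And>e. e \<in> steps \<sigma> \<Longrightarrow> f e \<le> g e"
  shows "avg \<sigma> f \<le> avg \<sigma> g"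
  using assms[of 1] assms[of "-1"] by (cases \<sigma>) (auto simp: avg_def steps_def)

lemma avg_cong: "(\<And>e. e \<in> steps \<sigma> \<Longrightarrow> f e = g e) \<Longrightarrow> avg \<sigma> f = avg \<sigma> g"
  by (cases \<sigma>) (auto simp: avg_def steps_def)

lemma avg_add: "avg \<sigma> (\<lambda>e. f e + g e) = avg \<sigma> f + avg \<sigma> g"
  and avg_diff: "avg \<sigma> (\<lambda>e. f e - g e) = avg \<sigma> f - avg \<sigma> g"
  and avg_cmult: "avg \<sigma> (\<lambda>e. c * f e) = c * avg \<sigma> f"
  and avg_mult2: "avg \<sigma> (\<lambda>e. f e * c) = avg \<sigma> f * c"
  and avg_const [simp]: "avg \<sigma> (\<lambda>_. c) = c"
  unfolding avg_def by (simp_all split: orientation.split add: field_simps)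

lemma avg_ge: "e \<in> steps \<sigma> \<Longrightarrow> (\<And>e. 0 \<le> f e) \<Longrightarrow> f e / 2 \<le> avg \<sigma> f"
  by (cases \<sigma>) (auto simp: avg_def steps_def)

lemma of_real_avg_sum:
  fixes c :: "'x \<Rightarrow> complex"
  shows "(\<Sum>x\<in>A. of_real (avg \<sigma> (f x)) * c x) = (case \<sigma> of Directed \<Rightarrow> \<Sum>x\<in>A. of_real (f x 1) * c x
    | Undirected \<Rightarrow> ((\<Sum>x\<in>A. of_real (f x 1) * c x) + (\<Sum>x\<in>A. of_real (f x (-1)) * c x)) / 2)"
  unfolding avg_def
  by (simp split: orientation.split
      add: sum.distrib[symmetric] sum_divide_distrib ring_distribs add_divide_distrib)

lemma avg_sum: "avg \<sigma> (\<lambda>e. \<Sum>x\<in>A. f x e) = (\<Sum>x\<in>A. avg \<sigma> (f x))"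
  by (cases \<sigma>) (simp_all add: avg_def sum.distrib[symmetric] sum_divide_distrib)

lemma poisson_mean_avg:
  assumes "\<And>e. bounded_seq (a e)"
  shows "poisson_mean s (\<lambda>n. avg \<sigma> (\<lambda>e. a e n)) = avg \<sigma> (\<lambda>e. poisson_mean s (a e))"
proof (cases \<sigma>)
  case Directed
  then show ?thesis by (simp add: avg_def)
next
  case Undirected
  have "bounded_seq (\<lambda>n. a 1 n + a (-1) n)"
    using bounded_seq_sum[of "{1, -1}" "\<lambda>e n. a e n"] assms by simp
  from poisson_mean_linear[OF bounded_linear_divide this, of s 2] show ?thesis
    using Undirected by (simp add: avg_def poisson_mean_add[OF assms assms])
qed

lemma one_in_steps [simp]: "1 \<in> steps \<sigma>"
  by (cases \<sigma>) (auto simp: steps_def)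

locale cyclic_walk =
  fixes p :: nat and \<sigma> :: orientation
  assumes p: "p \<ge> 2"
begin

abbreviation Zp :: "int set" where "Zp \<equiv> {0..<int p}"

text \<open>Functions on \<open>\<int>\<^sub>p\<close> are represented by periodic functions on the
integers, so that translations need no reduction; sums run over the representatives
\<open>Zp\<close>.\<close>

definition periodic :: "(int \<Rightarrow> 'c) \<Rightarrow> bool" where
  "periodic f \<longleftrightarrow> (\<forall>x. f (x mod int p) = f x)"

lemma periodicD: "periodic f \<Longrightarrow> f (x mod int p) = f x"
  unfolding periodic_def by blast

lemma periodic_shift: "periodic f \<Longrightarrow> periodic (\<lambda>x. f (x + c))"
  unfolding periodic_def by (metis mod_add_left_eq)

lemma periodic_reflect: "periodic f \<Longrightarrow> periodic (\<lambda>x. f (c - x))"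
  unfolding periodic_def by (metis mod_diff_right_eq)

lemma sum_periodic_shift:
  assumes "periodic f"
  shows "(\<Sum>x\<in>Zp. f (x + c)) = (\<Sum>x\<in>Zp. f x)"
proof (rule sum.reindex_bij_witness[of _ "\<lambda>x. (x - c) mod int p" "\<lambda>x. (x + c) mod int p"])
  show "f ((x + c) mod int p) = f (x + c)" for x by (rule periodicD[OF assms])
qed (use p in \<open>auto simp: mod_simps\<close>)

lemma sum_periodic_shift':
  assumes "periodic f"
  shows "(\<Sum>x\<in>Zp. f (x - c)) = (\<Sum>x\<in>Zp. f x)"
  using sum_periodic_shift[OF assms, of "-c"] by simp

lemma periodic_combine:
  "periodic f \<Longrightarrow> periodic g \<Longrightarrow> periodic (\<lambda>x. F (f x) (g x))"
  unfolding periodic_def by simp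

primrec steps_pmf :: "nat \<Rightarrow> int \<Rightarrow> real" where
  "steps_pmf 0 x = of_bool (int p dvd x)"
| "steps_pmf (Suc n) x = avg \<sigma> (\<lambda>e. steps_pmf n (x - e))"

lemma periodic_steps_pmf: "periodic (steps_pmf n)"
proof (induction n)
  case 0
  then show ?case by (auto simp: periodic_def dvd_eq_mod_eq_0)
next
  case (Suc n)
  then show ?case unfolding periodic_def steps_pmf.simps
    by (intro allI avg_cong) (metis mod_diff_left_eq)
qed

lemma steps_pmf_nonneg: "0 \<le> steps_pmf n x"
proof (induction n arbitrary: x)
  case (Suc n)
  have "avg \<sigma> (\<lambda>_. 0) \<le> avg \<sigma> (\<lambda>e. steps_pmf n (x - e))" by (intro avg_mono Suc)
  then show ?case by simp
qed simp

lemma steps_pmf_le_1: "steps_pmf n x \<le> 1"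
proof (induction n arbitrary: x)
  case (Suc n)
  have "avg \<sigma> (\<lambda>e. steps_pmf n (x - e)) \<le> avg \<sigma> (\<lambda>_. 1)" by (intro avg_mono Suc)
  then show ?case by simp
qed simp

lemma sum_Zp_0: "(\<Sum>x\<in>Zp. of_bool (int p dvd x) * f x) = (f 0 :: real)"
proof -
  have "(\<Sum>x\<in>Zp. of_bool (int p dvd x) * f x) = (\<Sum>x\<in>Zp. if x = 0 then f 0 else 0)"
    by (intro sum.cong) (auto dest: zdvd_imp_le)
  then show ?thesis using p by simp
qed

lemma sum_steps_pmf: "(\<Sum>x\<in>Zp. steps_pmf n x) = 1"
proof (induction n)
  case 0
  then show ?case using sum_Zp_0[of "\<lambda>_. 1"] by simp
next
  case (Suc n)
  then show ?case
    by (simp add: avg_sum[symmetric] sum_periodic_shift'[OF periodic_steps_pmf])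
qed

lemma bounded_steps_pmf: "bounded_seq (\<lambda>n. steps_pmf n x)"
  by (rule bounded_seqI[of _ 1]) (use steps_pmf_nonneg steps_pmf_le_1 in auto)

text \<open>The density of the rate-1 walk on \<open>\<int>\<^sub>p\<close> at time
\<open>s\<close>, as a periodic function.\<close>

definition q :: "real \<Rightarrow> int \<Rightarrow> real" where
  "q s x = poisson_mean s (\<lambda>n. steps_pmf n x)"

lemma periodic_q: "periodic (q s)"
  using periodic_steps_pmf by (auto simp: periodic_def q_def)

lemma q_nonneg: "0 \<le> s \<Longrightarrow> 0 \<le> q s x"
  unfolding q_def by (intro poisson_mean_nonneg bounded_steps_pmf steps_pmf_nonneg)

lemma sum_q: "(\<Sum>x\<in>Zp. q s x) = 1"
  unfolding q_def
  by (subst poisson_mean_sum[symmetric]) (auto simp: bounded_steps_pmf sum_steps_pmf)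

lemma q_0: "q 0 x = of_bool (int p dvd x)"
  by (simp add: q_def)

lemma DERIV_q: "((\<lambda>s. q s x) has_real_derivative avg \<sigma> (\<lambda>e. q s (x - e)) - q s x) (at s)"
proof -
  have "poisson_mean s (\<lambda>n. steps_pmf (Suc n) x) = avg \<sigma> (\<lambda>e. q s (x - e))"
    unfolding q_def steps_pmf.simps by (rule poisson_mean_avg[OF bounded_steps_pmf])
  then show ?thesis using DERIV_poisson_mean[OF bounded_steps_pmf, of x s] unfolding q_def by simp
qed


text \<open>Summation by parts: a backward step of one factor is a forward step of the
other.\<close>

lemma sum_avg_shift:
  assumes "periodic f" "periodic g"
  shows "(\<Sum>x\<in>Zp. avg \<sigma> (\<lambda>e. f (x - e)) * g x) = avg \<sigma> (\<lambda>e. \<Sum>x\<in>Zp. f x * g (x + e))"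
proof -
  have "(\<Sum>x\<in>Zp. f (x - e) * g x) = (\<Sum>x\<in>Zp. f x * g (x + e))" for e
    using sum_periodic_shift'[OF periodic_combine[OF assms(1) periodic_shift[OF assms(2), of e], of "(*)"], of e]
    by simp
  then show ?thesis by (simp add: avg_mult2[symmetric] avg_sum[symmetric])
qed

text \<open>The transition operator of the walk: \<open>P s g x\<close> is the mean of
\<open>g\<close> at the position at time \<open>s\<close> of the walk that starts in
\<open>x\<close>.\<close>

definition P :: "real \<Rightarrow> (int \<Rightarrow> real) \<Rightarrow> int \<Rightarrow> real" where
  "P s g x = (\<Sum>y\<in>Zp. q s y * g (x + y))"

lemma periodic_P: "periodic g \<Longrightarrow> periodic (P s g)"
  using periodicD[OF periodic_shift[of g]] unfolding periodic_def P_def by simp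

lemma P_0: "P 0 g x = g x"
  using sum_Zp_0[of "\<lambda>y. g (x + y)"] by (simp add: P_def q_0)

lemma P_at_0: "P s g 0 = (\<Sum>y\<in>Zp. q s y * g y)"
  by (simp add: P_def)

lemma DERIV_sum_q:
  assumes "periodic g"
  shows "((\<lambda>s. \<Sum>y\<in>Zp. q s y * g y) has_real_derivative
     avg \<sigma> (\<lambda>e. \<Sum>y\<in>Zp. q s y * (g (y + e) - g y))) (at s)"
proof -
  have "((\<lambda>s. \<Sum>y\<in>Zp. q s y * g y) has_real_derivative
      (\<Sum>y\<in>Zp. (avg \<sigma> (\<lambda>e. q s (y - e)) - q s y) * g y)) (at s)"
    by (auto intro!: derivative_eq_intros DERIV_q)
  also have "(\<Sum>y\<in>Zp. (avg \<sigma> (\<lambda>e. q s (y - e)) - q s y) * g y) =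
      avg \<sigma> (\<lambda>e. \<Sum>y\<in>Zp. q s y * (g (y + e) - g y))"
    using sum_avg_shift[OF periodic_q assms, of s]
    by (simp add: left_diff_distrib right_diff_distrib sum_subtractf avg_diff)
  finally show ?thesis .
qed

lemma DERIV_P:
  assumes "periodic g"
  shows "((\<lambda>s. P s g x) has_real_derivative avg \<sigma> (\<lambda>e. P s g (x + e) - P s g x)) (at s)"
proof -
  have "periodic (\<lambda>y. g (x + y))" using periodic_shift[OF assms, of x] by (simp add: add.commute)
  from DERIV_sum_q[OF this, of s] show ?thesis
    by (simp add: P_def right_diff_distrib sum_subtractf algebra_simps)
qed

lemma q_convolution: "q (s + t) x = (\<Sum>y\<in>Zp. q s y * q t (x - y))"
proof -
  define Z where "Z u = (\<Sum>y\<in>Zp. q u y * q (s + t - u) (x - y))" for u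
  have "(Z has_real_derivative 0) (at u)" for u
  proof -
    let ?r = "\<lambda>y. q (s + t - u) (x - y)"
    have per: "periodic ?r" by (intro periodic_reflect periodic_q)
    have dr: "((\<lambda>u. q (s + t - u) (x - y)) has_real_derivative
        - (avg \<sigma> (\<lambda>e. q (s + t - u) (x - y - e)) - ?r y)) (at u)" for y
    proof -
      have "((\<lambda>u. s + t - u) has_real_derivative -1) (at u)" by (auto intro!: derivative_eq_intros)
      from DERIV_chain2[OF DERIV_q this, of "x - y"] show ?thesis by simp
    qed
    have "(Z has_real_derivative (\<Sum>y\<in>Zp. (avg \<sigma> (\<lambda>e. q u (y - e)) - q u y) * ?r y +
        - (avg \<sigma> (\<lambda>e. q (s + t - u) (x - y - e)) - ?r y) * q u y)) (at u)"
      unfolding Z_def by (intro DERIV_sum DERIV_mult DERIV_q dr)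
    also have "(\<Sum>y\<in>Zp. (avg \<sigma> (\<lambda>e. q u (y - e)) - q u y) * ?r y +
        - (avg \<sigma> (\<lambda>e. q (s + t - u) (x - y - e)) - ?r y) * q u y) =
        (\<Sum>y\<in>Zp. avg \<sigma> (\<lambda>e. q u (y - e)) * ?r y) - (\<Sum>y\<in>Zp. avg \<sigma> (\<lambda>e. ?r (y + e)) * q u y)"
      by (simp add: algebra_simps sum_subtractf sum.distrib)
    also have "(\<Sum>y\<in>Zp. avg \<sigma> (\<lambda>e. ?r (y + e)) * q u y) = avg \<sigma> (\<lambda>e. \<Sum>y\<in>Zp. q u y * ?r (y + e))"
      by (simp add: avg_cmult avg_sum mult.commute)
    finally show ?thesis using sum_avg_shift[OF periodic_q[of u] per] by simp
  qed
  then have "Z s = Z 0" by (metis DERIV_isconst_all)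
  moreover have "Z 0 = q (s + t) x" unfolding Z_def q_0 by (subst sum_Zp_0) simp
  ultimately show ?thesis by (simp add: Z_def)
qed

text \<open>From 0, going straight to \<open>x\<close> in the positive direction is one admissible
path.\<close>

lemma steps_pmf_lower: "(1/2) ^ nat (x mod int p) \<le> steps_pmf (nat (x mod int p)) x"
proof -
  have *: "(1/2) ^ d \<le> steps_pmf d (int d)" for d
  proof (induction d)
    case (Suc d)
    have "(1/2) ^ Suc d \<le> steps_pmf d (int d) / 2" using Suc by simp
    also have "\<dots> \<le> steps_pmf (Suc d) (int (Suc d))"
      using avg_ge[of 1 \<sigma> "\<lambda>e. steps_pmf d (int (Suc d) - e)"] steps_pmf_nonneg by simp
    finally show ?case .
  qed simp
  show ?thesis using *[of "nat (x mod int p)"] periodicD[OF periodic_steps_pmf] p by simp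
qed

lemma q_ge: assumes "0 \<le> s"
  shows "exp (-s) * s ^ nat (x mod int p) / fact (nat (x mod int p)) * (1/2) ^ nat (x mod int p) \<le> q s x"
  (is "?c * _ \<le> _")
proof -
  have "?c * (1/2) ^ nat (x mod int p) \<le> ?c * steps_pmf (nat (x mod int p)) x"
    using assms by (intro mult_left_mono steps_pmf_lower) auto
  also have "\<dots> \<le> q s x"
    unfolding q_def by (intro poisson_mean_ge_term assms bounded_steps_pmf steps_pmf_nonneg)
  finally show ?thesis .
qed

lemma q_pos: assumes "0 < s" shows "0 < q s x"
proof -
  have "0 < exp (-s) * s ^ nat (x mod int p) / fact (nat (x mod int p)) * (1/2) ^ nat (x mod int p)"
    using assms by simp
  also note q_ge[OF less_imp_le[OF assms]]
  finally show ?thesis .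
qed

section \<open>Fourier analysis on the cycle\<close>

text \<open>The spectral gap of the frequency \<open>j\<close>: the generator multiplies the
character \<open>char j\<close> by a number with real part \<open>- lam j\<close>. In the directed
case this number is not real.\<close>

definition lam :: "nat \<Rightarrow> real" where "lam j = 1 - cos (2 * pi * real j / real p)"

definition char :: "nat \<Rightarrow> int \<Rightarrow> complex" where "char j x = cis (2 * pi * real j * of_int x / real p)"

text \<open>The Fourier coefficients of the density.\<close>

definition F :: "real \<Rightarrow> nat \<Rightarrow> complex" where "F s j = (\<Sum>x\<in>Zp. of_real (q s x) * char j x)"

lemma char_add: "char j (x + y) = char j x * char j y"
  by (simp add: char_def cis_mult ring_distribs add_divide_distrib)

lemma char_period: "char j (int p * m) = 1"
proof -
  have "2 * pi * real j * of_int (int p * m) / real p = 2 * pi * of_int (int j * m)"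
    using p by simp
  then show ?thesis unfolding char_def by (simp only: cis_multiple_2pi Ints_of_int)
qed

lemma periodic_char: "periodic (char j)"
  unfolding periodic_def
proof
  fix x
  have "char j x = char j (int p * (x div int p) + x mod int p)" by simp
  then show "char j (x mod int p) = char j x" by (simp only: char_add char_period mult_1_left)
qed

lemma norm_char [simp]: "norm (char j x) = 1" by (simp add: char_def)

lemma char_minus: "char j (- x) = cnj (char j x)"
  by (simp add: char_def cis_cnj)

lemma char_diff: "char j (x - y) = char j x * cnj (char j y)"
  using char_add[of j x "-y"] by (simp add: char_minus)

definition phi :: "nat \<Rightarrow> complex" where
  "phi j = (case \<sigma> of Directed \<Rightarrow> char j 1 | Undirected \<Rightarrow> (char j 1 + char j (-1)) / 2)"

lemma Re_phi: "Re (phi j) = 1 - lam j"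
  unfolding phi_def by (cases \<sigma>) (simp_all add: char_def lam_def)

lemma norm_phi: "norm (phi j) \<le> 1"
proof -
  have "norm (char j 1 + char j (-1)) \<le> 1 + 1"
    by (rule order_trans[OF norm_triangle_ineq]) simp
  then show ?thesis unfolding phi_def by (simp add: norm_divide split: orientation.split)
qed

lemma phi_mult: "phi j * w =
    (case \<sigma> of Directed \<Rightarrow> char j 1 * w | Undirected \<Rightarrow> (char j 1 * w + char j (-1) * w) / 2)"
  unfolding phi_def by (simp split: orientation.split add: ring_distribs add_divide_distrib)

lemma sum_steps_char: "(\<Sum>x\<in>Zp. of_real (steps_pmf n x) * char j x) = phi j ^ n"
proof (induction n)
  case 0
  have "(\<Sum>x\<in>Zp. of_real (steps_pmf 0 x) * char j x) = (\<Sum>x\<in>Zp. if x = 0 then 1 else 0)"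
    by (intro sum.cong) (auto dest: zdvd_imp_le simp: char_def)
  then show ?case using p by simp
next
  case (Suc n)
  have *: "(\<Sum>x\<in>Zp. of_real (steps_pmf n (x - e)) * char j x) = char j e * phi j ^ n" for e
  proof -
    have "periodic (\<lambda>x. of_real (steps_pmf n x) * char j (x + e))"
      by (intro periodic_combine[OF periodic_steps_pmf periodic_shift[OF periodic_char]])
    from sum_periodic_shift'[OF this, of e]
    have "(\<Sum>x\<in>Zp. of_real (steps_pmf n (x - e)) * char j x) =
        (\<Sum>x\<in>Zp. of_real (steps_pmf n x) * (char j x * char j e))" by (simp add: char_add)
    then show ?thesis by (simp add: Suc[symmetric] sum_distrib_left mult_ac)
  qed
  show ?case
    unfolding steps_pmf.simps of_real_avg_sum * power_Suc phi_mult ..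
qed

lemma F_eq: "F s j = exp (of_real s * (phi j - 1))"
proof -
  have bd: "bounded_seq (\<lambda>n. of_real (steps_pmf n x) * char j x)" for x
    by (rule bounded_seqI[of _ 1]) (use steps_pmf_nonneg steps_pmf_le_1 in \<open>simp add: norm_mult\<close>)
  have "of_real (q s x) * char j x = poisson_mean s (\<lambda>n. of_real (steps_pmf n x) * char j x)" for x
    unfolding q_def
    by (rule poisson_mean_linear[symmetric, OF _ bounded_steps_pmf])
       (intro bounded_linear_mult_const bounded_linear_of_real)
  then have "F s j = (\<Sum>x\<in>Zp. poisson_mean s (\<lambda>n. of_real (steps_pmf n x) * char j x))"
    by (simp add: F_def)
  also have "\<dots> = poisson_mean s (\<lambda>n. \<Sum>x\<in>Zp. of_real (steps_pmf n x) * char j x)"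
    by (intro poisson_mean_sum[symmetric] bd) simp
  finally show ?thesis by (simp add: sum_steps_char poisson_mean_geometric[OF norm_phi])
qed

text \<open>Only the real part of the eigenvalue matters for the modulus; hence the directed and the
undirected walk share all the estimates that start from here.\<close>

lemma norm_F: "(norm (F s j))\<^sup>2 = exp (- 2 * s * lam j)"
  by (simp add: F_eq Re_phi exp_double[symmetric] algebra_simps)

lemma sum_char: "(\<Sum>j<p. char j x) = (if int p dvd x then of_nat p else 0)"
proof (cases "int p dvd x")
  case True
  then obtain m where "x = int p * m" by blast
  then show ?thesis using char_period by simp
next
  case False
  define z where "z = char 1 x"
  have pow: "char j x = z ^ j" for j
  proof -
    have "z ^ j = cis (real j * (2 * pi * real 1 * of_int x / real p))"
      unfolding z_def char_def by (rule Complex.DeMoivre)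
    then show ?thesis unfolding char_def by (simp add: mult_ac)
  qed
  have "z ^ p = 1"
    using char_period[of 1 x] p unfolding pow[symmetric] by (simp add: char_def mult_ac)
  moreover have "z \<noteq> 1"
  proof
    assume "z = 1"
    then have "cos (2 * pi * of_int x / real p) = 1" by (simp add: z_def char_def complex_eq_iff)
    then obtain m where "2 * pi * of_int x / real p = of_int m * 2 * pi"
      by (auto simp: cos_one_2pi_int)
    then have "of_int x = (of_int (m * int p) :: real)" using p by (simp add: field_simps)
    then have "x = m * int p" using of_int_eq_iff by blast
    with False show False by simp
  qed
  ultimately have "(\<Sum>j<p. z ^ j) = 0" by (simp add: sum_gp_strict)
  then show ?thesis using False by (simp add: pow)
qed

lemma parseval: "real p * (\<Sum>x\<in>Zp. (q s x)\<^sup>2) = (\<Sum>j<p. exp (- 2 * s * lam j))"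
proof -
  have "complex_of_real (\<Sum>j<p. exp (- 2 * s * lam j)) = (\<Sum>j<p. F s j * cnj (F s j))"
  proof -
    have "complex_of_real (exp (- 2 * s * lam j)) = F s j * cnj (F s j)" for j
      by (metis norm_F complex_norm_square)
    then show ?thesis by (simp only: of_real_sum)
  qed
  also have "\<dots> = (\<Sum>j<p. \<Sum>x\<in>Zp. \<Sum>y\<in>Zp. of_real (q s x * q s y) * char j (x - y))"
    by (simp add: F_def sum_product char_diff mult_ac)
  also have "\<dots> = (\<Sum>x\<in>Zp. \<Sum>y\<in>Zp. of_real (q s x * q s y) * (\<Sum>j<p. char j (x - y)))"
    by (subst sum.swap, intro sum.cong refl, subst sum.swap) (simp add: sum_distrib_left)
  also have "\<dots> = (\<Sum>x\<in>Zp. \<Sum>y\<in>Zp. if y = x then of_real (real p * (q s x)\<^sup>2) else 0)"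
  proof (intro sum.cong refl)
    fix x y assume xy: "x \<in> Zp" "y \<in> Zp"
    then have "int p dvd x - y \<longleftrightarrow> y = x"
      by (metis atLeastLessThan_iff cancel_comm_monoid_add_class.diff_cancel dvd_0_right mod_eq_dvd_iff mod_pos_pos_trivial)
    then show "of_real (q s x * q s y) * (\<Sum>j<p. char j (x - y)) =
        (if y = x then of_real (real p * (q s x)\<^sup>2) else (0::complex))"
      by (simp add: sum_char power2_eq_square)
  qed
  also have "\<dots> = complex_of_real (real p * (\<Sum>x\<in>Zp. (q s x)\<^sup>2))"
    by (simp add: sum_distrib_left)
  finally show ?thesis using of_real_eq_iff by metis
qed

end

section \<open>Entropy production\<close>

text \<open>Joint convexity of the relative entropy, from the tangent inequality \<open>ln x \<le> x
- 1\<close>. It is used through its consequence that relative entropy contracts under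
convolution.\<close>

lemma log_sum_inequality:
  fixes w f g :: "'x \<Rightarrow> real"
  assumes "finite A" "\<And>i. i \<in> A \<Longrightarrow> 0 \<le> w i" "\<And>i. i \<in> A \<Longrightarrow> 0 < f i" "\<And>i. i \<in> A \<Longrightarrow> 0 < g i"
    and "0 < (\<Sum>i\<in>A. w i * f i)" "0 < (\<Sum>i\<in>A. w i * g i)"
  shows "(\<Sum>i\<in>A. w i * f i) * (ln (\<Sum>i\<in>A. w i * f i) - ln (\<Sum>i\<in>A. w i * g i))
     \<le> (\<Sum>i\<in>A. w i * (f i * (ln (f i) - ln (g i))))"
proof -
  define a where "a = (\<Sum>i\<in>A. w i * f i)"
  define b where "b = (\<Sum>i\<in>A. w i * g i)"
  have ab: "0 < a" "0 < b" using assms by (auto simp: a_def b_def)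
  have "w i * f i * (ln a - ln b + 1) - (a / b) * (w i * g i) \<le> w i * (f i * (ln (f i) - ln (g i)))"
    if i: "i \<in> A" for i
  proof -
    have pos: "0 < f i" "0 < g i" "0 \<le> w i" using assms i by auto
    define T where "T = g i * a / (f i * b)"
    have "ln T \<le> T - 1"
      using pos ab by (intro ln_le_minus_one) (auto simp: T_def)
    then have "ln a - ln b + 1 - T \<le> ln (f i) - ln (g i)"
      using pos ab by (simp add: T_def ln_mult ln_div)
    then have "w i * f i * (ln a - ln b + 1 - T) \<le> w i * f i * (ln (f i) - ln (g i))"
      using pos by (intro mult_left_mono) auto
    moreover have "w i * f i * T = (a / b) * (w i * g i)" using pos ab by (simp add: T_def)
    ultimately show ?thesis by (simp add: algebra_simps)
  qed
  then have "(\<Sum>i\<in>A. w i * f i * (ln a - ln b + 1) - (a / b) * (w i * g i))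
     \<le> (\<Sum>i\<in>A. w i * (f i * (ln (f i) - ln (g i))))" by (rule sum_mono)
  also have "(\<Sum>i\<in>A. w i * f i * (ln a - ln b + 1) - (a / b) * (w i * g i)) = a * (ln a - ln b + 1) - (a / b) * b"
  proof -
    have "(\<Sum>i\<in>A. w i * f i * c - d * (w i * g i)) = a * c - d * b" for c d
      unfolding a_def b_def by (simp add: sum_subtractf sum_distrib_left sum_distrib_right)
    then show ?thesis .
  qed
  also have "\<dots> = a * (ln a - ln b)" using ab by (simp add: algebra_simps)
  finally show ?thesis by (simp add: a_def b_def)
qed

context cyclic_walk begin

definition h :: "real \<Rightarrow> real" where "h s = (\<Sum>x\<in>Zp. - q s x * ln (q s x))"

text \<open>The relative entropy of the density with respect to its translate by a step, averaged
over the step. It is the derivative of the entropy.\<close>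

definition h' :: "real \<Rightarrow> real" where
  "h' s = avg \<sigma> (\<lambda>e. \<Sum>x\<in>Zp. q s x * (ln (q s x) - ln (q s (x + e))))"

lemma DERIV_h:
  assumes "0 < s"
  shows "(h has_real_derivative h' s) (at s)"
proof -
  have per: "periodic (\<lambda>x. ln (q s x))" by (rule periodic_combine[OF periodic_q periodic_q])
  let ?d = "\<lambda>x. avg \<sigma> (\<lambda>e. q s (x - e)) - q s x"
  have "((\<lambda>s. - q s x * ln (q s x)) has_real_derivative - ?d x * ln (q s x) - ?d x) (at s)" for x
  proof -
    have eq: "- ?d x * ln (q s x) + (?d x / q s x) * (- q s x) = - ?d x * ln (q s x) - ?d x"
      using q_pos[OF assms, of x] by simp
    have "((\<lambda>s. - q s x * ln (q s x)) has_real_derivative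
       - ?d x * ln (q s x) + (?d x / q s x) * (- q s x)) (at s)"
    proof (intro DERIV_mult DERIV_minus DERIV_q)
      show "((\<lambda>s. ln (q s x)) has_real_derivative ?d x / q s x) (at s)"
        using DERIV_chain2[OF DERIV_ln_divide[OF q_pos[OF assms, of x]] DERIV_q] by simp
    qed
    then show ?thesis unfolding eq .
  qed
  then have "(h has_real_derivative (\<Sum>x\<in>Zp. - ?d x * ln (q s x) - ?d x)) (at s)"
    unfolding h_def[abs_def] by (intro DERIV_sum)
  also have "(\<Sum>x\<in>Zp. - ?d x * ln (q s x) - ?d x) =
      - ((\<Sum>x\<in>Zp. avg \<sigma> (\<lambda>e. q s (x - e)) * ln (q s x)) - (\<Sum>x\<in>Zp. q s x * ln (q s x)))
      - ((\<Sum>x\<in>Zp. avg \<sigma> (\<lambda>e. q s (x - e)) * 1) - (\<Sum>x\<in>Zp. q s x))"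
    by (simp add: algebra_simps sum_subtractf sum.distrib sum_negf)
  also have "(\<Sum>x\<in>Zp. avg \<sigma> (\<lambda>e. q s (x - e)) * 1) = avg \<sigma> (\<lambda>e. \<Sum>x\<in>Zp. q s x * 1)"
    by (rule sum_avg_shift[OF periodic_q]) (simp add: periodic_def)
  also have "(\<Sum>x\<in>Zp. avg \<sigma> (\<lambda>e. q s (x - e)) * ln (q s x)) = avg \<sigma> (\<lambda>e. \<Sum>x\<in>Zp. q s x * ln (q s (x + e)))"
    by (rule sum_avg_shift[OF periodic_q per])
  also have "- (avg \<sigma> (\<lambda>e. \<Sum>x\<in>Zp. q s x * ln (q s (x + e))) - (\<Sum>x\<in>Zp. q s x * ln (q s x)))
      - (avg \<sigma> (\<lambda>e. \<Sum>x\<in>Zp. q s x * 1) - (\<Sum>x\<in>Zp. q s x)) = h' s"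
    by (simp add: h'_def right_diff_distrib sum_subtractf avg_diff)
  finally show ?thesis .
qed

text \<open>By the semigroup property, the densities at the later time are obtained from those at
the earlier time by convolution, which decreases relative entropy. Hence the entropy is concave in
time.\<close>

lemma h'_antimono:
  assumes "0 < s" "s \<le> t"
  shows "h' t \<le> h' s"
proof (cases "s = t")
  case False
  define a where "a = t - s"
  have a: "0 < a" using assms False by (simp add: a_def)
  have t: "0 < t" using assms by simp
  show ?thesis unfolding h'_def
  proof (rule avg_mono)
    fix e
    define K where "K x = q s x * (ln (q s x) - ln (q s (x + e)))" for x
    have perK: "periodic K" unfolding K_def
      by (rule periodic_combine[OF periodic_q periodic_shift[OF periodic_q], of "\<lambda>u v. u * (ln u - ln v)"])
    have conv: "q t x = (\<Sum>y\<in>Zp. q a y * q s (x - y))" for x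
      using q_convolution[of a s x] by (simp add: a_def)
    have "(\<Sum>x\<in>Zp. q t x * (ln (q t x) - ln (q t (x + e)))) \<le> (\<Sum>x\<in>Zp. \<Sum>y\<in>Zp. q a y * K (x - y))"
    proof (rule sum_mono)
      fix x
      have "q t x * (ln (q t x) - ln (q t (x + e))) \<le> (\<Sum>y\<in>Zp. q a y * (q s (x - y) * (ln (q s (x - y)) - ln (q s (x + e - y)))))"
        unfolding conv
        by (rule log_sum_inequality)
           (use q_pos[OF assms(1)] q_nonneg[of a] a q_pos[OF t] conv in auto)
      then show "q t x * (ln (q t x) - ln (q t (x + e))) \<le> (\<Sum>y\<in>Zp. q a y * K (x - y))"
        by (simp add: K_def algebra_simps)
    qed
    also have "\<dots> = (\<Sum>y\<in>Zp. q a y * (\<Sum>x\<in>Zp. K (x - y)))"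
      by (subst sum.swap) (simp add: sum_distrib_left)
    also have "\<dots> = (\<Sum>x\<in>Zp. K x)"
      by (simp add: sum_periodic_shift'[OF perK] sum_distrib_right[symmetric] sum_q)
    finally show "(\<Sum>x\<in>Zp. q t x * (ln (q t x) - ln (q t (x + e)))) \<le> (\<Sum>x\<in>Zp. q s x * (ln (q s x) - ln (q s (x + e))))"
      by (simp add: K_def)
  qed
qed simp

lemma continuous_h: "continuous_on {0..} h"
proof -
  have c: "continuous_on {0..} (\<lambda>u::real. u * ln u)"
    unfolding continuous_on_def
  proof
    fix u :: real assume "u \<in> {0..}"
    then consider "u = 0" | "0 < u" by force
    then show "((\<lambda>u. u * ln u) \<longlongrightarrow> u * ln u) (at u within {0..})"
    proof cases
      case 1
      have "((\<lambda>u::real. u * ln u) \<longlongrightarrow> 0) (at_right 0)" by real_asymp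
      moreover have "at (0::real) within {0..} = at_right 0"
        by (rule at_within_nhd[of _ UNIV]) auto
      ultimately show ?thesis using 1 by simp
    next
      case 2
      then have "isCont (\<lambda>u. u * ln u) u" by (auto intro!: continuous_intros)
      then show ?thesis by (auto simp: isCont_def intro: tendsto_within_subset)
    qed
  qed
  have q: "continuous_on {0..} (\<lambda>s. q s x)" for x
    by (rule DERIV_continuous_on) (rule has_field_derivative_at_within[OF DERIV_q])
  have "continuous_on {0..} (\<lambda>s. (\<lambda>u. u * ln u) (q s x))" for x
    by (rule continuous_on_compose2[OF c q]) (use q_nonneg in auto)
  then have "continuous_on {0..} (\<lambda>s. \<Sum>x\<in>Zp. - (q s x * ln (q s x)))"
    by (intro continuous_on_sum continuous_on_minus)
  then show ?thesis by (simp add: h_def[abs_def])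
qed

lemma h_0: "h 0 = 0"
  unfolding h_def q_0 by (intro sum.neutral) (auto simp: of_bool_def)

lemma h'_nonneg: assumes "0 < s" shows "0 \<le> h' s"
proof -
  have "avg \<sigma> (\<lambda>e. 0) \<le> h' s" unfolding h'_def
  proof (rule avg_mono)
    fix e
    have "(\<Sum>x\<in>Zp. q s x - q s (x + e)) \<le> (\<Sum>x\<in>Zp. q s x * (ln (q s x) - ln (q s (x + e))))"
    proof (rule sum_mono)
      fix x
      have "ln (q s (x + e) / q s x) \<le> q s (x + e) / q s x - 1"
        using q_pos[OF assms] by (intro ln_le_minus_one) auto
      then have "1 - q s (x + e) / q s x \<le> ln (q s x) - ln (q s (x + e))"
        using ln_divide_pos[OF q_pos[OF assms] q_pos[OF assms], of "x + e" x] by simp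
      then have "q s x * (1 - q s (x + e) / q s x) \<le> q s x * (ln (q s x) - ln (q s (x + e)))"
        using q_pos[OF assms, of x] by (intro mult_left_mono) auto
      then show "q s x - q s (x + e) \<le> q s x * (ln (q s x) - ln (q s (x + e)))"
        using q_pos[OF assms, of x] by (simp add: right_diff_distrib)
    qed
    then show "0 \<le> (\<Sum>x\<in>Zp. q s x * (ln (q s x) - ln (q s (x + e))))"
      by (simp add: sum_subtractf sum_periodic_shift[OF periodic_q])
  qed
  then show ?thesis by simp
qed

lemma h_mvt:
  assumes "0 \<le> a" "a < b"
  obtains z where "a < z" "z < b" "h b - h a = (b - a) * h' z"
proof -
  have c: "continuous_on {a..b} h" by (rule continuous_on_subset[OF continuous_h]) (use assms in auto)
  have d: "(h has_derivative (*) (h' x)) (at x)" if "a < x" "x < b" for x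
    using DERIV_h[of x] that assms by (simp add: has_field_derivative_def)
  obtain z where "a < z" "z < b" "h b - h a = h' z * (b - a)"
    using mvt[OF assms(2) c d] by blast
  then show ?thesis using that[of z] by (simp add: mult.commute)
qed

text \<open>The variance of \<open>g\<close> at time \<open>s\<close> is the increment of \<open>Y
a\<close>, the mean at time \<open>a\<close> of the square of the conditional mean of
\<open>g\<close> at time \<open>s\<close>. The derivative of \<open>Y\<close> is the mean squared
increment of that conditional mean over one step; increments commute with the semigroup, so by
Jensen it is at most the mean squared increment of \<open>g\<close> itself.\<close>

lemma poincare:
  assumes g: "periodic g" and s: "0 < s"
  shows "(\<Sum>x\<in>Zp. q s x * (g x)\<^sup>2) - (\<Sum>x\<in>Zp. q s x * g x)\<^sup>2
     \<le> s * avg \<sigma> (\<lambda>e. \<Sum>x\<in>Zp. q s x * (g (x + e) - g x)\<^sup>2)"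
proof -
  define \<Gamma> where "\<Gamma> = avg \<sigma> (\<lambda>e. \<Sum>x\<in>Zp. q s x * (g (x + e) - g x)\<^sup>2)"
  define Y where "Y a = (\<Sum>x\<in>Zp. q a x * (P (s - a) g x)\<^sup>2)" for a
  have D: "\<exists>d. (Y has_real_derivative d) (at a) \<and> d \<le> \<Gamma>" if a: "0 \<le> a" "a \<le> s" for a
  proof -
    let ?G = "P (s - a) g"
    have perG: "periodic ?G" by (rule periodic_P[OF g])
    have dP: "((\<lambda>a. P (s - a) g x) has_real_derivative - avg \<sigma> (\<lambda>e. ?G (x + e) - ?G x)) (at a)" for x
    proof -
      have "((\<lambda>u. s - u) has_real_derivative -1) (at a)" by (auto intro!: derivative_eq_intros)
      from DERIV_chain2[OF DERIV_P[OF g] this, of x] show ?thesis by simp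
    qed
    have dP2: "((\<lambda>a. (P (s - a) g x)\<^sup>2) has_real_derivative - 2 * ?G x * avg \<sigma> (\<lambda>e. ?G (x + e) - ?G x)) (at a)" for x
      using DERIV_power[OF dP[of x], of 2] by (simp add: algebra_simps)
    have "(Y has_real_derivative (\<Sum>x\<in>Zp. (avg \<sigma> (\<lambda>e. q a (x - e)) - q a x) * (?G x)\<^sup>2 +
         - 2 * ?G x * avg \<sigma> (\<lambda>e. ?G (x + e) - ?G x) * q a x)) (at a)" (is "(_ has_real_derivative ?d) _")
      unfolding Y_def by (intro DERIV_sum DERIV_mult DERIV_q dP2)
    moreover have "?d = avg \<sigma> (\<lambda>e. \<Sum>x\<in>Zp. q a x * (?G (x + e) - ?G x)\<^sup>2)"
    proof -
      have per2: "periodic (\<lambda>x. (?G x)\<^sup>2)" by (rule periodic_combine[OF perG perG])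
      have "?d = (\<Sum>x\<in>Zp. avg \<sigma> (\<lambda>e. q a (x - e)) * (?G x)\<^sup>2) - (\<Sum>x\<in>Zp. q a x * (?G x)\<^sup>2)
          - (\<Sum>x\<in>Zp. avg \<sigma> (\<lambda>e. 2 * ?G x * q a x * (?G (x + e) - ?G x)))"
      proof -
        have "2 * ?G x * q a x * avg \<sigma> (\<lambda>e. ?G (x + e) - ?G x) =
            avg \<sigma> (\<lambda>e. 2 * ?G x * q a x * (?G (x + e) - ?G x))" for x
          by (rule avg_cmult[symmetric])
        then have "(avg \<sigma> (\<lambda>e. q a (x - e)) - q a x) * (?G x)\<^sup>2 +
           - 2 * ?G x * avg \<sigma> (\<lambda>e. ?G (x + e) - ?G x) * q a x =
           avg \<sigma> (\<lambda>e. q a (x - e)) * (?G x)\<^sup>2 - q a x * (?G x)\<^sup>2 -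
           avg \<sigma> (\<lambda>e. 2 * ?G x * q a x * (?G (x + e) - ?G x))" for x
          by (simp only: left_diff_distrib) (simp add: mult_ac)
        then show ?thesis by (simp add: sum_subtractf)
      qed
      also have "\<dots> = avg \<sigma> (\<lambda>e. (\<Sum>x\<in>Zp. q a x * (?G (x + e))\<^sup>2) - (\<Sum>x\<in>Zp. q a x * (?G x)\<^sup>2)
          - (\<Sum>x\<in>Zp. 2 * ?G x * q a x * (?G (x + e) - ?G x)))"
        using sum_avg_shift[OF periodic_q per2, of a] by (simp add: avg_diff avg_sum)
      also have "\<dots> = avg \<sigma> (\<lambda>e. \<Sum>x\<in>Zp. q a x * (?G (x + e) - ?G x)\<^sup>2)"
      proof (intro avg_cong)
        fix e
        have "q a x * (?G (x + e) - ?G x)\<^sup>2 = q a x * (?G (x + e))\<^sup>2 - q a x * (?G x)\<^sup>2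
          - 2 * ?G x * q a x * (?G (x + e) - ?G x)" for x
          by (simp add: power2_eq_square algebra_simps)
        then show "(\<Sum>x\<in>Zp. q a x * (?G (x + e))\<^sup>2) - (\<Sum>x\<in>Zp. q a x * (?G x)\<^sup>2)
          - (\<Sum>x\<in>Zp. 2 * ?G x * q a x * (?G (x + e) - ?G x)) =
          (\<Sum>x\<in>Zp. q a x * (?G (x + e) - ?G x)\<^sup>2)"
          by (simp add: sum_subtractf)
      qed
      finally show ?thesis .
    qed
    moreover have "avg \<sigma> (\<lambda>e. \<Sum>x\<in>Zp. q a x * (?G (x + e) - ?G x)\<^sup>2) \<le> \<Gamma>"
      unfolding \<Gamma>_def
    proof (rule avg_mono)
      fix e
      let ?k = "\<lambda>z. (g (z + e) - g z)\<^sup>2"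
      have perk: "periodic ?k" by (rule periodic_combine[OF periodic_shift[OF g] g])
      have jensen: "(?G (x + e) - ?G x)\<^sup>2 \<le> (\<Sum>y\<in>Zp. q (s - a) y * ?k (x + y))" for x
      proof -
        have "?G (x + e) - ?G x = (\<Sum>y\<in>Zp. q (s - a) y * (g (x + y + e) - g (x + y)))"
        proof -
          have "q (s - a) y * (g (x + y + e) - g (x + y)) =
             q (s - a) y * g (x + e + y) - q (s - a) y * g (x + y)" for y
            by (simp add: right_diff_distrib ac_simps)
          then show ?thesis by (simp add: P_def sum_subtractf)
        qed
        also have "\<dots> = (\<Sum>y\<in>Zp. sqrt (q (s - a) y) * (sqrt (q (s - a) y) * (g (x + y + e) - g (x + y))))"
          using q_nonneg[of "s - a"] a by (simp add: mult.assoc[symmetric])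
        finally have "(?G (x + e) - ?G x)\<^sup>2 \<le> (\<Sum>y\<in>Zp. (sqrt (q (s - a) y))\<^sup>2) *
            (\<Sum>y\<in>Zp. (sqrt (q (s - a) y) * (g (x + y + e) - g (x + y)))\<^sup>2)"
          by (simp only: Cauchy_Schwarz_ineq_sum)
        also have "\<dots> = (\<Sum>y\<in>Zp. q (s - a) y * ?k (x + y))"
          using q_nonneg[of "s - a"] a sum_q[of "s - a"] by (simp add: power_mult_distrib)
        finally show ?thesis .
      qed
      have "(\<Sum>x\<in>Zp. q a x * (?G (x + e) - ?G x)\<^sup>2) \<le> (\<Sum>x\<in>Zp. q a x * (\<Sum>y\<in>Zp. q (s - a) y * ?k (x + y)))"
        using a by (intro sum_mono mult_left_mono jensen q_nonneg) auto
      also have "\<dots> = (\<Sum>x\<in>Zp. q a x * (\<Sum>z\<in>Zp. q (s - a) (z - x) * ?k z))"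
      proof -
        have "(\<Sum>y\<in>Zp. q (s - a) y * ?k (x + y)) = (\<Sum>z\<in>Zp. q (s - a) (z - x) * ?k z)" for x
        proof -
          have "periodic (\<lambda>y. q (s - a) y * ?k (x + y))"
            using periodic_combine[OF periodic_q[of "s - a"] periodic_shift[OF perk, of x], of "(*)"]
            by (simp add: add.commute)
          from sum_periodic_shift'[OF this, of x] show ?thesis by simp
        qed
        then show ?thesis by simp
      qed
      also have "\<dots> = (\<Sum>z\<in>Zp. (\<Sum>x\<in>Zp. q a x * q (s - a) (z - x)) * ?k z)"
        unfolding sum_distrib_left sum_distrib_right mult.assoc by (rule sum.swap)
      also have "\<dots> = (\<Sum>z\<in>Zp. q s z * ?k z)"
        using q_convolution[of a "s - a"] by simp
      finally show "(\<Sum>x\<in>Zp. q a x * (?G (x + e) - ?G x)\<^sup>2) \<le> (\<Sum>z\<in>Zp. q s z * ?k z)" .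
    qed
    ultimately show ?thesis by auto
  qed
  have "Y s - Y 0 \<le> s * \<Gamma>"
  proof -
    obtain d where d: "\<And>a. 0 \<le> a \<Longrightarrow> a \<le> s \<Longrightarrow> (Y has_real_derivative d a) (at a)"
       "\<And>a. 0 \<le> a \<Longrightarrow> a \<le> s \<Longrightarrow> d a \<le> \<Gamma>" using D by metis
    obtain z where z: "0 < z" "z < s" "Y s - Y 0 = (s - 0) * d z"
      using MVT2[OF s, of Y d] d(1) by auto
    then show ?thesis using d(2)[of z] s by (simp add: mult_left_mono)
  qed
  moreover have "Y s = (\<Sum>x\<in>Zp. q s x * (g x)\<^sup>2)" by (simp add: Y_def P_0)
  moreover have "Y 0 = (\<Sum>x\<in>Zp. q s x * g x)\<^sup>2"
    unfolding Y_def q_0 by (subst sum_Zp_0) (simp add: P_at_0)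
  ultimately show ?thesis by (simp add: \<Gamma>_def)
qed

end

section \<open>Variance of the information content\<close>

text \<open>This replaces a squared log-ratio by the integrand of a relative entropy, at the price
of the largest value \<open>L\<close> of the log-ratio.\<close>

lemma square_le_exp_bound:
  fixes y L :: real
  assumes "y \<le> L" "0 \<le> L"
  shows "y\<^sup>2 \<le> 2 * (1 + L) * (exp (-y) - 1 + y)"
proof (cases "0 \<le> y")
  case True
  define f where "f x = 2 * (1 + x) * (exp (-x) - 1 + x) - x\<^sup>2" for x :: real
  have "f 0 \<le> f y"
  proof (rule DERIV_nonneg_imp_nondecreasing[OF True])
    fix x :: real assume x: "0 \<le> x" "x \<le> y"
    have "(f has_real_derivative 2 * x * (1 - exp (-x))) (at x)"
      unfolding f_def by (auto intro!: derivative_eq_intros simp: algebra_simps)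
    moreover have "0 \<le> 2 * x * (1 - exp (-x))" using x by simp
    ultimately show "\<exists>d. (f has_real_derivative d) (at x) \<and> 0 \<le> d" by blast
  qed
  then have "y\<^sup>2 \<le> 2 * (1 + y) * (exp (-y) - 1 + y)" by (simp add: f_def)
  also have "\<dots> \<le> 2 * (1 + L) * (exp (-y) - 1 + y)"
    using assms True exp_ge_add_one_self[of "-y"] by (intro mult_right_mono) auto
  finally show ?thesis .
next
  case False
  have "1 + (-y) + (-y)\<^sup>2 / 2 \<le> exp (-y)"
    using False by (intro exp_lower_Taylor_quadratic) auto
  then have 1: "y\<^sup>2 \<le> 2 * (exp (-y) - 1 + y)" by simp
  have 2: "0 \<le> exp (-y) - 1 + y" using exp_ge_add_one_self[of "-y"] by simp
  note 1
  also have "2 * (exp (-y) - 1 + y) \<le> (2 * (1 + L)) * (exp (-y) - 1 + y)"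
    using assms 2 by (intro mult_right_mono) auto
  finally show ?thesis .
qed

lemma sin_ge_half: fixes x :: real assumes "0 \<le> x" "x \<le> pi / 2" shows "x / 2 \<le> sin x"
proof -
  have "\<bar>sin x - (\<Sum>m<3. sin_coeff m * x ^ m)\<bar> \<le> inverse (fact 3) * \<bar>x\<bar> ^ 3"
    by (rule Maclaurin_sin_bound)
  moreover have "(\<Sum>m<3. sin_coeff m * x ^ m) = x"
    by (simp add: numeral_eq_Suc sin_coeff_def)
  ultimately have 1: "x - x ^ 3 / 6 \<le> sin x" using assms by (simp add: fact_numeral abs_if split: if_splits)
  have "x \<le> 1.6" using assms pi_approx by simp
  then have "x * x \<le> 1.6 * 1.6" using assms by (intro mult_mono) auto
  then have "x * (x * x) \<le> x * 3" using assms by (intro mult_left_mono) auto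
  then show ?thesis using 1 by (simp add: power3_eq_cube)
qed

lemma fact_mult_le: "fact m * fact n \<le> (fact (m + n) :: real)"
proof -
  have "fact m * fact n \<le> (fact (m + n) :: nat)"
    by (rule dvd_imp_le[OF fact_fact_dvd_fact]) simp
  then have "real (fact m * fact n) \<le> real (fact (m + n))" by (simp only: of_nat_le_iff)
  then show ?thesis by simp
qed

lemma ln_div_pos_le: "0 < a \<Longrightarrow> 0 < b \<Longrightarrow> ln a - ln b \<le> a / b - (1::real)"
  using ln_le_minus_one[of "a / b"] ln_divide_pos[of a b] by simp

context cyclic_walk begin

text \<open>A path with \<open>n\<close> steps to \<open>x\<close> extends by one step to \<open>x +
e\<close>, which costs a factor \<open>s / (2 (n + 1))\<close>. For \<open>n < 3 p\<close> this is
at least \<open>s / (6 p)\<close>. Longer paths contribute at most half of the density at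
\<open>x\<close>, because the straight path to \<open>x\<close> alone outweighs them.\<close>

lemma q_ratio_small:
  assumes s: "0 < s" "s \<le> 1" and e: "e \<in> steps \<sigma>"
  shows "s / (12 * real p) * q s x \<le> q s (x + e)"
proof -
  define w where "w n = exp (-s) * s ^ n / fact n" for n
  define a where "a n = steps_pmf n x" for n
  define d where "d = nat (x mod int p)"
  let ?m = "3 * p"
  have d: "d < p" using p by (simp add: d_def nat_less_iff)
  have w: "0 \<le> w n" for n using s by (simp add: w_def)
  have a: "0 \<le> a n" "a n \<le> 1" for n by (auto simp: a_def steps_pmf_nonneg steps_pmf_le_1)
  have qs: "(\<lambda>n. w n * steps_pmf n y) sums q s y" for y
    using poisson_mean_sums[OF bounded_steps_pmf, of s y] by (simp add: w_def q_def)
  have sw: "summable w" using poisson_weights_sums[of s] by (simp add: w_def[abs_def] sums_iff)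
  have swa: "summable (\<lambda>n. w n * a n)" using qs[of x] by (simp add: a_def sums_iff)
  have tail: "(\<Sum>n. w (n + ?m) * a (n + ?m)) \<le> q s x / 2"
  proof -
    have "(\<Sum>n. w (n + ?m) * a (n + ?m)) \<le> (\<Sum>n. exp (-s) * s ^ d / fact ?m * (s ^ n /\<^sub>R fact n))"
    proof (rule suminf_le)
      show "summable (\<lambda>n. w (n + ?m) * a (n + ?m))" using swa by (subst summable_iff_shift)
      show "summable (\<lambda>n. exp (-s) * s ^ d / fact ?m * (s ^ n /\<^sub>R fact n))"
        by (intro summable_mult summable_exp_generic)
      fix n
      have "fact ?m * fact n \<le> (fact (n + ?m) :: real)"
        using fact_mult_le[of ?m n] by (simp only: add.commute)
      then have "s ^ ?m * s ^ n / fact (n + ?m) \<le> s ^ d * s ^ n / (fact ?m * fact n)"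
        using s d by (intro frac_le mult_right_mono power_decreasing) auto
      then have "exp (-s) * (s ^ ?m * s ^ n / fact (n + ?m)) \<le> exp (-s) * (s ^ d * s ^ n / (fact ?m * fact n))"
        by (intro mult_left_mono) auto
      then have "w (n + ?m) \<le> exp (-s) * s ^ d / fact ?m * (s ^ n /\<^sub>R fact n)"
        by (simp add: w_def power_add divide_inverse mult_ac)
      moreover have "w (n + ?m) * a (n + ?m) \<le> w (n + ?m) * 1"
        by (intro mult_left_mono a w)
      ultimately show "w (n + ?m) * a (n + ?m) \<le> exp (-s) * s ^ d / fact ?m * (s ^ n /\<^sub>R fact n)" by simp
    qed
    also have "\<dots> = exp (-s) * s ^ d / fact ?m * exp s"
      unfolding suminf_mult[OF summable_exp_generic] exp_def ..
    also have "\<dots> \<le> exp (-s) * s ^ d / fact ?m * 3"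
    proof (intro mult_left_mono)
      have "exp s \<le> exp 1" using s by simp
      also have "\<dots> \<le> 3" by (rule exp_le)
      finally show "exp s \<le> 3" .
    qed (use s in auto)
    also have "\<dots> \<le> exp (-s) * s ^ d / fact d * (1/2) ^ d / 2"
    proof -
      have "fact d * fact (?m - d) \<le> (fact ?m :: real)"
        using fact_mult_le[of d "?m - d"] d by simp
      moreover have "(2::real) ^ (d + 3) \<le> fact (?m - d)"
      proof -
        have f2: "(2::real) ^ n \<le> fact (Suc n)" for n
        proof (induction n)
          case (Suc n)
          have "(2::real) * 2 ^ n \<le> real (Suc (Suc n)) * fact (Suc n)"
            by (intro mult_mono Suc) auto
          then show ?case by simp
        qed simp
        have "(2::real) ^ (d + 3) \<le> 2 ^ (?m - d - 1)" using d p by (intro power_increasing) auto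
        also have "\<dots> \<le> fact (Suc (?m - d - 1))" by (rule f2)
        also have "Suc (?m - d - 1) = ?m - d" using d by simp
        finally show ?thesis .
      qed
      ultimately have "fact d * 2 ^ (d + 3) \<le> (fact ?m :: real)"
        by (meson fact_ge_zero mult_left_mono order_trans)
      then have "3 / (fact ?m :: real) \<le> 3 / (fact d * 2 ^ (d + 3))"
        by (intro divide_left_mono) auto
      also have "\<dots> \<le> (1/2) ^ d / 2 / fact d"
        by (simp add: power_add power_divide field_simps)
      finally have "exp (-s) * s ^ d * (3 / fact ?m) \<le> exp (-s) * s ^ d * ((1/2) ^ d / 2 / fact d)"
        using s by (intro mult_left_mono) auto
      then show ?thesis by (simp add: mult_ac)
    qed
    also have "\<dots> \<le> q s x / 2" using q_ge[of s x] s by (simp add: d_def)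
    finally show ?thesis .
  qed
  have split: "q s x = (\<Sum>n. w (n + ?m) * a (n + ?m)) + (\<Sum>n<?m. w n * a n)"
    using suminf_split_initial_segment[OF swa, of ?m] qs[of x] by (simp add: sums_iff a_def)
  have "s / (12 * real p) * q s x \<le> s / (6 * real p) * (\<Sum>n<?m. w n * a n)"
  proof -
    have "q s x / 2 \<le> (\<Sum>n<?m. w n * a n)" using split tail by simp
    then have "s / (6 * real p) * (q s x / 2) \<le> s / (6 * real p) * (\<Sum>n<?m. w n * a n)"
      using s by (intro mult_left_mono) auto
    then show ?thesis by simp
  qed
  also have "\<dots> \<le> (\<Sum>n<?m. w (Suc n) * steps_pmf (Suc n) (x + e))"
    unfolding sum_distrib_left
  proof (rule sum_mono)
    fix n assume n: "n \<in> {..<?m}"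
    have "w (Suc n) = w n * (s / real (Suc n))" by (simp add: w_def field_simps)
    moreover have "w n * (s / (3 * real p)) \<le> w n * (s / real (Suc n))"
      using n s w[of n] by (intro mult_left_mono divide_left_mono) auto
    ultimately have 1: "w n * (s / (3 * real p)) \<le> w (Suc n)" by simp
    have 2: "a n / 2 \<le> steps_pmf (Suc n) (x + e)"
      using avg_ge[OF e, of "\<lambda>e'. steps_pmf n (x + e - e')"] steps_pmf_nonneg by (simp add: a_def)
    have "(w n * (s / (3 * real p))) * (a n / 2) \<le> w (Suc n) * steps_pmf (Suc n) (x + e)"
      using w a by (intro mult_mono 1 2) auto
    then show "s / (6 * real p) * (w n * a n) \<le> w (Suc n) * steps_pmf (Suc n) (x + e)"
      by (simp add: mult_ac)
  qed
  also have "\<dots> = (\<Sum>n\<in>Suc ` {..<?m}. w n * steps_pmf n (x + e))" by (simp add: sum.reindex)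
  also have "\<dots> \<le> q s (x + e)"
    using sum_le_suminf[of "\<lambda>n. w n * steps_pmf n (x + e)" "Suc ` {..<?m}"] qs[of "x + e"]
      w steps_pmf_nonneg by (auto simp: sums_iff)
  finally show ?thesis .
qed

text \<open>After time 1 the ratio bound at time 1 is transported by convolution.\<close>

lemma q_ratio:
  assumes s: "0 < s" and e: "e \<in> steps \<sigma>"
  shows "min 1 s / (12 * real p) * q s x \<le> q s (x + e)"
proof (cases "s \<le> 1")
  case True
  then show ?thesis using q_ratio_small[OF s True e] by simp
next
  case False
  have conv: "q s z = (\<Sum>y\<in>Zp. q (s - 1) y * q 1 (z - y))" for z
    using q_convolution[of "s - 1" 1 z] by simp
  have "1 / (12 * real p) * q s x = (\<Sum>y\<in>Zp. q (s - 1) y * (1 / (12 * real p) * q 1 (x - y)))"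
    by (simp add: conv sum_distrib_left mult_ac)
  also have "\<dots> \<le> (\<Sum>y\<in>Zp. q (s - 1) y * q 1 (x - y + e))"
    using False by (intro sum_mono mult_left_mono q_ratio_small e q_nonneg) auto
  also have "\<dots> = q s (x + e)" by (simp add: conv algebra_simps)
  finally show ?thesis using False by simp
qed

text \<open>An upper bound for the logarithm of the ratio of the densities at two neighbouring
points.\<close>

definition L :: "real \<Rightarrow> real" where "L s = ln (12 * real p / min 1 s)"

lemma L_nonneg: assumes "0 < s" shows "0 \<le> L s"
proof -
  have "min 1 s \<le> 12 * real p" using p by auto
  then show ?thesis using assms unfolding L_def by (intro ln_ge_zero) (auto simp: field_simps min_def)
qed

text \<open>The added terms sum to zero; they make every summand nonnegative.\<close>

lemma h'_alt:
  "h' s = avg \<sigma> (\<lambda>e. \<Sum>x\<in>Zp. q s x * (ln (q s x) - ln (q s (x + e))) + q s (x + e) - q s x)"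
  by (simp add: h'_def sum.distrib sum_subtractf sum_periodic_shift[OF periodic_q])

text \<open>The variance of \<open>- ln (q s X)\<close> where \<open>X\<close> has the density
\<open>q s\<close>.\<close>

definition varent :: "real \<Rightarrow> real" where
  "varent s = (\<Sum>x\<in>Zp. q s x * (ln (q s x))\<^sup>2) - (h s)\<^sup>2"

text \<open>The Poincare inequality for \<open>ln (q s)\<close> bounds the variance by mean squared
log-ratios of neighbouring densities; these are compared with the relative entropies in
\<open>h'\<close>.\<close>

lemma varent_bound:
  assumes s: "0 < s"
  shows "varent s \<le> 2 * (1 + L s) * (s * h' s)"
proof -
  have per: "periodic (\<lambda>x. ln (q s x))" by (rule periodic_combine[OF periodic_q periodic_q])
  have "h s = - (\<Sum>x\<in>Zp. q s x * ln (q s x))" by (simp add: h_def sum_negf)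
  then have "varent s = (\<Sum>x\<in>Zp. q s x * (ln (q s x))\<^sup>2) - (\<Sum>x\<in>Zp. q s x * ln (q s x))\<^sup>2"
    by (simp add: varent_def)
  also have "\<dots> \<le> s * avg \<sigma> (\<lambda>e. \<Sum>x\<in>Zp. q s x * (ln (q s (x + e)) - ln (q s x))\<^sup>2)"
    by (rule poincare[OF per s])
  also have "\<dots> \<le> s * (2 * (1 + L s) * h' s)"
  proof (rule mult_left_mono)
    have "avg \<sigma> (\<lambda>e. \<Sum>x\<in>Zp. q s x * (ln (q s (x + e)) - ln (q s x))\<^sup>2) \<le>
      avg \<sigma> (\<lambda>e. 2 * (1 + L s) * (\<Sum>x\<in>Zp. q s x * (ln (q s x) - ln (q s (x + e))) + q s (x + e) - q s x))"
    proof (rule avg_mono)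
      fix e assume e: "e \<in> steps \<sigma>"
      show "(\<Sum>x\<in>Zp. q s x * (ln (q s (x + e)) - ln (q s x))\<^sup>2)
        \<le> 2 * (1 + L s) * (\<Sum>x\<in>Zp. q s x * (ln (q s x) - ln (q s (x + e))) + q s (x + e) - q s x)"
        unfolding sum_distrib_left
      proof (rule sum_mono)
        fix x
        define y where "y = ln (q s x) - ln (q s (x + e))"
        have pos: "0 < q s x" "0 < q s (x + e)" using q_pos[OF s] by auto
        have "q s x * (min 1 s / (12 * real p)) \<le> q s (x + e)" using q_ratio[OF s e, of x] by (simp add: mult.commute)
        then have "q s x \<le> q s (x + e) * (12 * real p / min 1 s)"
          using s p by (simp add: field_simps min_def split: if_splits)
        then have "ln (q s x) \<le> ln (q s (x + e) * (12 * real p / min 1 s))"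
          using pos s p by (subst ln_le_cancel_iff) (auto simp: min_def)
        also have "\<dots> = ln (q s (x + e)) + L s"
          using pos s p unfolding L_def by (subst ln_mult_pos) (auto simp: min_def)
        finally have "y \<le> L s" by (simp add: y_def)
        from square_le_exp_bound[OF this L_nonneg[OF s]]
        have "q s x * y\<^sup>2 \<le> q s x * (2 * (1 + L s) * (exp (-y) - 1 + y))"
          using pos by (intro mult_left_mono) auto
        also have "exp (- y) = q s (x + e) / q s x"
          using pos by (simp add: y_def exp_diff)
        also have "q s x * (2 * (1 + L s) * (q s (x + e) / q s x - 1 + y)) =
          2 * (1 + L s) * (q s x * y + q s (x + e) - q s x)"
          using pos by (simp add: field_simps)
        finally show "q s x * (ln (q s (x + e)) - ln (q s x))\<^sup>2
          \<le> 2 * (1 + L s) * (q s x * (ln (q s x) - ln (q s (x + e))) + q s (x + e) - q s x)"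
          by (simp add: y_def power2_commute)
      qed
    qed
    then show "avg \<sigma> (\<lambda>e. \<Sum>x\<in>Zp. q s x * (ln (q s (x + e)) - ln (q s x))\<^sup>2) \<le> 2 * (1 + L s) * h' s"
      by (simp add: avg_cmult h'_alt)
  qed (use s in auto)
  finally show ?thesis by (simp add: mult_ac)
qed

text \<open>Relative entropy dominates the squared Hellinger distance, and by Cauchy-Schwarz the
latter dominates the squared total variation distance between the density and its translate, which
in turn is tested against the character \<open>char j\<close>.\<close>

lemma h'_ge_character:
  assumes s: "0 < s"
  shows "lam j * exp (- 2 * s * lam j) / 2 \<le> h' s"
proof -
  have "avg \<sigma> (\<lambda>_. lam j * exp (- 2 * s * lam j) / 2) \<le> h' s"
    unfolding h'_alt
  proof (rule avg_mono)
    fix e assume e: "e \<in> steps \<sigma>"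
    define u where "u x = sqrt (q s x)" for x
    have u: "u x * u x = q s x" "0 < u x" for x using q_pos[OF s, of x] by (auto simp: u_def)
    have per: "periodic u" unfolding u_def by (rule periodic_combine[OF periodic_q periodic_q])
    let ?E = "\<Sum>x\<in>Zp. (u (x + e) - u x)\<^sup>2"
    have 1: "?E \<le> (\<Sum>x\<in>Zp. q s x * (ln (q s x) - ln (q s (x + e))) + q s (x + e) - q s x)"
    proof (rule sum_mono)
      fix x
      have "ln (u (x + e)) - ln (u x) \<le> u (x + e) / u x - 1" using u by (intro ln_div_pos_le)
      moreover have "ln (q s y) = 2 * ln (u y)" for y
        using u(2)[of y] unfolding u(1)[symmetric] by (simp add: ln_mult)
      ultimately have "2 * (1 - u (x + e) / u x) \<le> ln (q s x) - ln (q s (x + e))" by simp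
      then have "q s x * (2 * (1 - u (x + e) / u x)) \<le> q s x * (ln (q s x) - ln (q s (x + e)))"
        using q_pos[OF s, of x] by (intro mult_left_mono) auto
      moreover have "q s x * (2 * (1 - u (x + e) / u x)) = 2 * q s x - 2 * (u x * u (x + e))"
        using u(2)[of x] unfolding u(1)[symmetric] by (simp add: field_simps)
      moreover have "(u (x + e) - u x)\<^sup>2 = q s (x + e) + q s x - 2 * (u x * u (x + e))"
        unfolding u(1)[symmetric] by (simp add: power2_eq_square algebra_simps)
      ultimately show "(u (x + e) - u x)\<^sup>2 \<le> q s x * (ln (q s x) - ln (q s (x + e))) + q s (x + e) - q s x"
        by linarith
    qed
    have 2: "(\<Sum>x\<in>Zp. (u (x + e) + u x)\<^sup>2) \<le> 4"
    proof -
      have "(\<Sum>x\<in>Zp. (u (x + e) + u x)\<^sup>2) \<le> (\<Sum>x\<in>Zp. 2 * q s (x + e) + 2 * q s x)"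
      proof (rule sum_mono)
        fix x
        have "0 \<le> (u (x + e) - u x)\<^sup>2" by simp
        then show "(u (x + e) + u x)\<^sup>2 \<le> 2 * q s (x + e) + 2 * q s x"
          unfolding u(1)[symmetric] power2_eq_square by (simp add: algebra_simps)
      qed
      also have "\<dots> = 4"
        by (simp add: sum.distrib sum_distrib_left[symmetric] sum_periodic_shift[OF periodic_q] sum_q)
      finally show ?thesis .
    qed
    have F: "(\<Sum>x\<in>Zp. of_real (q s (x + e) - q s x) * char j x) = (char j (-e) - 1) * F s j"
    proof -
      have "periodic (\<lambda>x. of_real (q s x) * char j (x - e))"
        using periodic_combine[OF periodic_q[of s] periodic_shift[OF periodic_char[of j], of "-e"],
          of "\<lambda>a b. of_real a * b"] by simp
      from sum_periodic_shift[OF this, of e]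
      have "(\<Sum>x\<in>Zp. of_real (q s (x + e)) * char j x) = (\<Sum>x\<in>Zp. of_real (q s x) * char j (x - e))" by simp
      also have "\<dots> = char j (-e) * F s j"
        using char_add[of j _ "-e"] by (simp add: F_def sum_distrib_left mult_ac)
      finally show ?thesis by (simp add: F_def algebra_simps sum_subtractf)
    qed
    have ch: "(norm (char j (-e) - 1))\<^sup>2 = 2 * lam j"
    proof -
      have "e = 1 \<or> e = -1" using e by (cases \<sigma>) (auto simp: steps_def)
      then have "cos (2 * pi * real j * of_int (-e) / real p) = 1 - lam j" by (auto simp: lam_def)
      moreover have "(norm (cis t - 1))\<^sup>2 = 2 * (1 - cos t)" for t
      proof -
        have "(norm (cis t - 1))\<^sup>2 = (cos t - 1)\<^sup>2 + (sin t)\<^sup>2" by (simp add: cmod_power2)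
        then show ?thesis using sin_cos_squared_add[of t] by (simp add: power2_eq_square algebra_simps)
      qed
      ultimately show ?thesis by (simp add: char_def)
    qed
    have "2 * lam j * exp (- 2 * s * lam j) = (norm ((char j (-e) - 1) * F s j))\<^sup>2"
      by (simp only: norm_mult power_mult_distrib ch norm_F)
    moreover have "norm ((char j (-e) - 1) * F s j) \<le> (\<Sum>x\<in>Zp. \<bar>q s (x + e) - q s x\<bar>)"
      unfolding F[symmetric] by (rule order_trans[OF norm_sum]) (simp add: norm_mult flip: of_real_diff)
    moreover have "(\<Sum>x\<in>Zp. \<bar>q s (x + e) - q s x\<bar>) = (\<Sum>x\<in>Zp. \<bar>u (x + e) - u x\<bar> * (u (x + e) + u x))"
    proof (rule sum.cong[OF refl])
      fix x
      have "q s (x + e) - q s x = (u (x + e) - u x) * (u (x + e) + u x)"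
        unfolding u(1)[symmetric] by (simp add: algebra_simps)
      then show "\<bar>q s (x + e) - q s x\<bar> = \<bar>u (x + e) - u x\<bar> * (u (x + e) + u x)"
        using u(2)[of x] u(2)[of "x + e"] by (simp add: abs_mult)
    qed
    ultimately have "2 * lam j * exp (- 2 * s * lam j) \<le> (\<Sum>x\<in>Zp. \<bar>u (x + e) - u x\<bar> * (u (x + e) + u x))\<^sup>2"
      using power_mono[OF _ norm_ge_zero, of "(char j (-e) - 1) * F s j" _ 2] by metis
    also have "\<dots> \<le> (\<Sum>x\<in>Zp. \<bar>u (x + e) - u x\<bar>\<^sup>2) * (\<Sum>x\<in>Zp. (u (x + e) + u x)\<^sup>2)"
      by (rule Cauchy_Schwarz_ineq_sum)
    also have "\<dots> \<le> ?E * 4"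
      using 2 by (simp add: mult_left_mono sum_nonneg)
    finally show "lam j * exp (- 2 * s * lam j) / 2 \<le>
       (\<Sum>x\<in>Zp. q s x * (ln (q s x) - ln (q s (x + e))) + q s (x + e) - q s x)" using 1 by linarith
  qed
  then show ?thesis by simp
qed

end

section \<open>Relaxation to the uniform law\<close>

lemma sum_exp_le:
  fixes b :: real
  assumes "0 < b"
  shows "(\<Sum>m=1..<n. exp (- b * real m)) \<le> 1 / b"
proof -
  have x: "exp (-b) < 1" "0 < exp (-b)" using assms by auto
  have "(\<Sum>m=1..<n. exp (- b * real m)) \<le> exp (-b) / (1 - exp (-b))"
  proof -
    have "(\<Sum>m=1..<n. exp (- b * real m)) = (\<Sum>m=1..<n. exp (-b) ^ m)"
      by (simp add: exp_of_nat_mult[symmetric] mult.commute)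
    also have "\<dots> \<le> (\<Sum>m<n. exp (-b) * exp (-b) ^ m)"
    proof -
      have "(\<Sum>m=1..<n. exp (-b) ^ m) \<le> (\<Sum>m\<in>Suc ` {..<n}. exp (-b) ^ m)"
      proof (rule sum_mono2)
        show "{1..<n} \<subseteq> Suc ` {..<n}"
        proof
          fix x assume "x \<in> {1..<n}"
          then have "x = Suc (x - 1)" "x - 1 \<in> {..<n}" by auto
          then show "x \<in> Suc ` {..<n}" by blast
        qed
      qed auto
      then show ?thesis by (simp add: sum.reindex)
    qed
    also have "\<dots> = exp (-b) * ((1 - exp (-b) ^ n) / (1 - exp (-b)))"
      using x by (simp add: sum_distrib_left[symmetric] sum_gp_strict)
    also have "\<dots> \<le> exp (-b) * (1 / (1 - exp (-b)))"
      using x by (intro mult_left_mono divide_right_mono) auto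
    finally show ?thesis by simp
  qed
  also have "\<dots> \<le> 1 / b"
  proof -
    have "exp b \<ge> 1 + b" by (rule exp_ge_add_one_self)
    then have "exp (-b) * (1 + b) \<le> 1" by (simp add: exp_minus field_simps)
    then have "exp (-b) * b \<le> 1 - exp (-b)" by (simp add: algebra_simps)
    then show ?thesis using x assms by (simp add: field_simps)
  qed
  finally show ?thesis .
qed

context cyclic_walk begin

lemma lam_eq: "lam j = 2 * (sin (pi * real j / real p))\<^sup>2"
  using cos_double_sin[of "pi * real j / real p"] by (simp add: lam_def mult_ac)

lemma lam_ge: assumes "2 * j \<le> p" shows "4 * (real j / real p)\<^sup>2 \<le> lam j"
proof -
  define x where "x = pi * real j / real p"
  have "real j / real p \<le> 1 / 2" using assms p by (simp add: field_simps)
  then have "pi * (real j / real p) \<le> pi * (1 / 2)" by (intro mult_left_mono) auto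
  then have x: "0 \<le> x" "x \<le> pi / 2" by (auto simp: x_def)
  have "3 * (real j / real p) \<le> pi * (real j / real p)"
    using pi_gt3 by (intro mult_right_mono) auto
  then have "3 * (real j / real p) / 2 \<le> sin x" using sin_ge_half[OF x] by (simp add: x_def)
  then have "(3 * (real j / real p) / 2)\<^sup>2 \<le> (sin x)\<^sup>2" by (intro power_mono) auto
  moreover have "(3 * (real j / real p) / 2)\<^sup>2 = 9 / 4 * (real j / real p)\<^sup>2" by (simp add: power2_eq_square)
  ultimately have "lam j \<ge> 9 / 2 * (real j / real p)\<^sup>2" by (simp add: lam_eq x_def)
  moreover have "0 \<le> (real j / real p)\<^sup>2" by simp
  ultimately show ?thesis by linarith
qed

lemma lam_le: "lam j \<le> 20 * (real j / real p)\<^sup>2"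
proof -
  define y where "y = real j / real p"
  have "\<bar>sin (pi * y)\<bar> \<le> \<bar>pi * y\<bar>" by (rule abs_sin_x_le_abs_x)
  then have "(sin (pi * y))\<^sup>2 \<le> (pi * y)\<^sup>2" by (simp add: abs_le_square_iff)
  moreover have "pi\<^sup>2 \<le> 10"
  proof -
    have "pi * pi \<le> 3.15 * 3.15" using pi_approx by (intro mult_mono) auto
    then show ?thesis by (simp add: power2_eq_square)
  qed
  then have "pi\<^sup>2 * y\<^sup>2 \<le> 10 * y\<^sup>2" by (intro mult_right_mono) auto
  moreover have "lam j = 2 * (sin (pi * y))\<^sup>2" by (simp add: lam_eq y_def)
  moreover have "(pi * y)\<^sup>2 = pi\<^sup>2 * y\<^sup>2" by (rule power_mult_distrib)
  ultimately have "lam j \<le> 20 * y\<^sup>2" by linarith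
  then show ?thesis by (simp add: y_def)
qed

lemma lam_reflect: assumes "j \<le> p" shows "lam (p - j) = lam j"
proof -
  have "2 * pi * real (p - j) / real p = 2 * pi - 2 * pi * real j / real p"
    using assms p by (simp add: of_nat_diff field_simps)
  then show ?thesis by (simp add: lam_def cos_diff)
qed

lemma lam_ge_reflect:
  assumes "j < p" shows "4 * (real j / real p)\<^sup>2 \<le> lam j \<or> 4 * (real (p - j) / real p)\<^sup>2 \<le> lam j"
  using lam_ge[of j] lam_ge[of "p - j"] lam_reflect[of j] assms by (cases "2 * j \<le> p") auto

lemma lam_1_le: assumes "0 < j" "j < p" shows "lam 1 \<le> lam j"
proof -
  have *: "lam 1 \<le> lam j" if j: "0 < j" "2 * j \<le> p" for j
  proof -
    have le: "pi * real i / real p \<le> pi" if "i \<le> p" for i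
      using that p by (simp add: field_simps)
    have "cos (2 * pi * real j / real p) \<le> cos (2 * pi * real 1 / real p)"
    proof (rule cos_monotone_0_pi_le)
      show "2 * pi * real 1 / real p \<le> 2 * pi * real j / real p"
        using j by (intro divide_right_mono mult_left_mono) auto
      have "real (2 * j) \<le> real p" using j by (simp only: of_nat_le_iff)
      then show "2 * pi * real j / real p \<le> pi" using p by (simp add: field_simps)
    qed auto
    then show ?thesis by (simp add: lam_def)
  qed
  show ?thesis
  proof (cases "2 * j \<le> p")
    case True then show ?thesis using * assms by simp
  next
    case False
    then have "lam 1 \<le> lam (p - j)" using assms by (intro *) auto
    then show ?thesis using lam_reflect[of j] assms by simp
  qed
qed

text \<open>The gaps grow quadratically in the distance of \<open>j\<close> from 0 modulo
\<open>p\<close>, so the sum is compared with a geometric series.\<close>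

lemma chi_square_bound:
  assumes s: "0 < s"
  shows "(\<Sum>j=1..<p. exp (- 2 * s * lam j)) \<le> real p / sqrt s"
proof -
  define b where "b = sqrt (8 * s) / real p"
  have b: "0 < b" "b\<^sup>2 = 8 * s / (real p)\<^sup>2" using s p by (auto simp: b_def power_divide)
  define g where "g m = exp (1/4) * exp (- b * real m)" for m :: nat
  have key: "exp (- 2 * s * lam j) \<le> g m" if "4 * (real m / real p)\<^sup>2 \<le> lam j" for j m
  proof -
    have "0 \<le> (b * real m - 1/2)\<^sup>2" by simp
    then have "b * real m - 1/4 \<le> b\<^sup>2 * (real m)\<^sup>2" by (simp add: power2_eq_square algebra_simps)
    also have "\<dots> = 2 * s * (4 * (real m / real p)\<^sup>2)" by (simp add: b(2) power_divide)
    also have "\<dots> \<le> 2 * s * lam j" using that s by (intro mult_left_mono) auto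
    finally have "- 2 * s * lam j \<le> 1/4 + - b * real m" by simp
    then show ?thesis unfolding g_def exp_add[symmetric] by simp
  qed
  have g0: "0 \<le> g m" for m by (simp add: g_def)
  have "(\<Sum>j=1..<p. exp (- 2 * s * lam j)) \<le> (\<Sum>j=1..<p. g j + g (p - j))"
  proof (rule sum_mono)
    fix j assume "j \<in> {1..<p}"
    then show "exp (- 2 * s * lam j) \<le> g j + g (p - j)"
      using lam_ge_reflect[of j] key[of j j] key[of "p - j" j] g0[of j] g0[of "p - j"] by force
  qed
  also have "\<dots> = 2 * (\<Sum>j=1..<p. g j)"
  proof -
    have "(\<Sum>j=1..<p. g (p - j)) = (\<Sum>j=1..<p. g j)"
      by (rule sum.reindex_bij_witness[of _ "\<lambda>j. p - j" "\<lambda>j. p - j"]) auto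
    then show ?thesis by (simp add: sum.distrib)
  qed
  also have "(\<Sum>j=1..<p. g j) \<le> exp (1/4) * (1 / b)"
    unfolding g_def sum_distrib_left[symmetric] using sum_exp_le[OF b(1)] by (intro mult_left_mono) auto
  also have "2 * (exp (1/4) * (1 / b)) \<le> real p / sqrt s"
  proof -
    have "exp (1/4) * (3/4) \<le> exp (1/4) * exp (- 1/4 :: real)"
      using exp_ge_add_one_self[of "-1/4::real"] by (intro mult_left_mono) auto
    then have e: "exp (1/4::real) \<le> 4/3" by (simp add: exp_minus)
    have "(8/3)\<^sup>2 \<le> (8::real)" by (simp add: power2_eq_square)
    then have "8/3 \<le> sqrt (8::real)" by (rule real_le_rsqrt)
    then have "2 * exp (1/4) \<le> sqrt (8::real)" using e by linarith
    then have "2 * exp (1/4) * (real p / (sqrt 8 * sqrt s)) \<le> sqrt 8 * (real p / (sqrt 8 * sqrt s))"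
      using s by (intro mult_right_mono) auto
    then show ?thesis by (simp add: b_def real_sqrt_mult)
  qed
  finally show ?thesis by simp
qed

lemma sum_square_eq: "real p * (\<Sum>x\<in>Zp. (q s x)\<^sup>2) = 1 + (\<Sum>j=1..<p. exp (- 2 * s * lam j))"
proof -
  have "{..<p} = insert 0 {1..<p}" using p by auto
  then show ?thesis unfolding parseval by (simp add: lam_def)
qed

text \<open>The relative entropy of the density with respect to the uniform law.\<close>

definition D :: "real \<Rightarrow> real" where "D s = ln (real p) - h s"

text \<open>Relative entropy is at most the chi-square distance, which the Parseval identity
evaluates.\<close>

lemma D_le_chi: assumes s: "0 < s" shows "D s \<le> (\<Sum>j=1..<p. exp (- 2 * s * lam j))"
proof -
  have "D s = (\<Sum>x\<in>Zp. q s x * ln (real p)) - h s"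
    by (simp add: D_def sum_distrib_right[symmetric] sum_q)
  also have "\<dots> = (\<Sum>x\<in>Zp. q s x * (ln (real p) + ln (q s x)))"
    by (simp add: h_def sum_negf distrib_left sum.distrib)
  also have "\<dots> \<le> (\<Sum>x\<in>Zp. q s x * (real p * q s x - 1))"
  proof (intro sum_mono mult_left_mono)
    fix x
    have "ln (real p * q s x) \<le> real p * q s x - 1"
      using p q_pos[OF s] by (intro ln_le_minus_one) auto
    then show "ln (real p) + ln (q s x) \<le> real p * q s x - 1"
      using p q_pos[OF s, of x] by (simp add: ln_mult_pos)
  qed (use s q_nonneg in auto)
  also have "\<dots> = real p * (\<Sum>x\<in>Zp. (q s x)\<^sup>2) - 1"
    by (simp add: right_diff_distrib sum_subtractf sum_q sum_distrib_left power2_eq_square mult_ac)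
  finally show ?thesis by (simp add: sum_square_eq)
qed

text \<open>The Shannon entropy is at least the collision entropy.\<close>

lemma h_ge_renyi: assumes s: "0 < s" shows "- ln (1 / real p + 1 / sqrt s) \<le> h s"
proof -
  let ?S = "\<Sum>x\<in>Zp. (q s x)\<^sup>2"
  have "real p * ?S \<le> real p * (1 / real p + 1 / sqrt s)"
    using sum_square_eq[of s] chi_square_bound[OF s] p by (simp add: distrib_left)
  then have S: "?S \<le> 1 / real p + 1 / sqrt s" using p by simp
  have "?S \<ge> (q s 0)\<^sup>2" using p by (intro member_le_sum) auto
  then have S0: "0 < ?S" using q_pos[OF s, of 0] by (smt (verit) zero_less_power)
  have "- h s = (\<Sum>x\<in>Zp. q s x * ln (q s x))" by (simp add: h_def sum_negf)
  also have "\<dots> \<le> (\<Sum>x\<in>Zp. q s x * (ln ?S + (q s x / ?S - 1)))"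
  proof (intro sum_mono mult_left_mono)
    fix x
    show "ln (q s x) \<le> ln ?S + (q s x / ?S - 1)" using ln_div_pos_le[OF q_pos[OF s, of x] S0] by simp
  qed (use s q_nonneg in auto)
  also have "\<dots> = ln ?S * (\<Sum>x\<in>Zp. q s x) + ?S / ?S - (\<Sum>x\<in>Zp. q s x)"
  proof -
    have "(\<Sum>x\<in>Zp. q s x * (c + (q s x / S - 1))) = c * (\<Sum>x\<in>Zp. q s x) + ?S / S - (\<Sum>x\<in>Zp. q s x)" for c S
      by (simp add: algebra_simps sum.distrib sum_subtractf sum_distrib_left sum_divide_distrib power2_eq_square)
    then show ?thesis .
  qed
  also have "\<dots> = ln ?S" using S0 by (simp add: sum_q)
  also have "\<dots> \<le> ln (1 / real p + 1 / sqrt s)" using S S0 by simp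
  finally show ?thesis by simp
qed

definition c0 :: real where "c0 = exp (-63) / 8"

lemma c0: "0 < c0" "c0 \<le> 1" by (auto simp: c0_def intro: order_trans[of _ 1])

text \<open>The frequency \<open>j\<close> near \<open>p / (4 sqrt s)\<close> has a gap of order
\<open>1 / s\<close>, and its character witnesses entropy production of that order.\<close>

lemma J_medium:
  assumes s: "1 \<le> s" "s \<le> (real p)\<^sup>2"
  shows "c0 \<le> s * h' s"
proof -
  define j where "j = nat \<lceil>real p / (4 * sqrt s)\<rceil>"
  have s1: "1 \<le> sqrt s" "sqrt s \<le> real p" using s by (auto simp: real_le_lsqrt)
  have p0: "0 < real p" using p by simp
  have j1: "real p / (4 * sqrt s) \<le> real j" "real j \<le> real p / (4 * sqrt s) + 1"
    using s1 p0 by (auto simp: j_def) 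
  have "real p / (4 * sqrt s) \<le> real p / 4" using s1 p0 by (intro divide_left_mono) auto
  then have "real j < real p / 4 + 1"
  proof -
    have "real j < real p / (4 * sqrt s) + 1" using s1 p0 by (simp add: j_def) linarith
    then show ?thesis using \<open>real p / (4 * sqrt s) \<le> real p / 4\<close> by linarith
  qed
  then have "4 * j < p + 4" by linarith
  then have j2: "2 * j \<le> p" using p by presburger
  define y where "y = real j / real p"
  have y1: "1 / (4 * sqrt s) \<le> y" using divide_right_mono[OF j1(1), of "real p"] p0 by (simp add: y_def)
  have y2: "y \<le> (5 / 4) / sqrt s"
  proof -
    have "y \<le> (real p / (4 * sqrt s) + 1) / real p" unfolding y_def using j1(2) p0 by (intro divide_right_mono) auto
    also have "\<dots> = 1 / (4 * sqrt s) + 1 / real p" using p0 by (simp add: add_divide_distrib)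
    also have "1 / real p \<le> 1 / sqrt s" using s1 by (intro divide_left_mono mult_pos_pos p0) linarith+
    finally show ?thesis by simp
  qed
  have ss: "s = (sqrt s)\<^sup>2" using s by simp
  have "(1 / (4 * sqrt s))\<^sup>2 \<le> y\<^sup>2" using y1 s1 by (intro power_mono) auto
  then have 1: "s * (4 * (1 / (4 * sqrt s))\<^sup>2) \<le> s * (4 * y\<^sup>2)" using s by (intro mult_left_mono) auto
  have 2: "s * (4 * (1 / (4 * sqrt s))\<^sup>2) = 1/4" using s by (simp add: power_divide power_mult_distrib)
  have l1: "1/4 \<le> s * lam j"
  proof -
    have "s * (4 * y\<^sup>2) \<le> s * lam j" unfolding y_def using s by (intro mult_left_mono lam_ge j2) auto
    with 1 2 show ?thesis by linarith
  qed
  have "y\<^sup>2 \<le> ((5 / 4) / sqrt s)\<^sup>2" using y2 by (intro power_mono) (auto simp: y_def)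
  then have 3: "s * (20 * y\<^sup>2) \<le> s * (20 * ((5 / 4) / sqrt s)\<^sup>2)" using s by (intro mult_left_mono) auto
  have 4: "s * (20 * ((5 / 4) / sqrt s)\<^sup>2) = 31.25" using s by (simp add: power_divide power2_eq_square)
  have l2: "s * lam j \<le> 31.25"
  proof -
    have "s * lam j \<le> s * (20 * y\<^sup>2)" unfolding y_def using s by (intro mult_left_mono lam_le) auto
    with 3 4 show ?thesis by linarith
  qed
  have "c0 = (1/4) * exp (-63) / 2" by (simp add: c0_def)
  also have "\<dots> \<le> s * lam j * exp (- 2 * (s * lam j)) / 2"
    using l1 l2 by (intro divide_right_mono mult_mono) auto
  also have "\<dots> \<le> s * h' s"
    using mult_left_mono[OF h'_ge_character[of s j], of s] s by (simp add: mult_ac)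
  finally show ?thesis .
qed

text \<open>Beyond time \<open>p\<^sup>2\<close> the frequency 1 dominates: both the relative
entropy and the entropy production are governed by its decay.\<close>

lemma J_large:
  assumes s: "(real p)\<^sup>2 \<le> s"
  shows "2 * exp (-40) * D s \<le> s * h' s"
proof -
  have p2: "0 < (real p)\<^sup>2" using p by simp
  then have s0: "0 < s" using s by linarith
  let ?a = "(real p)\<^sup>2"
  have p1: "2 * 1 \<le> p" using p by simp
  have "s * (4 * (real 1 / real p)\<^sup>2) \<le> s * lam 1" using s0 by (intro mult_left_mono lam_ge[OF p1]) auto
  moreover have "?a * (4 * (real 1 / real p)\<^sup>2) \<le> s * (4 * (real 1 / real p)\<^sup>2)" using s by (intro mult_right_mono) auto
  moreover have "?a * (4 * (real 1 / real p)\<^sup>2) = 4" using p by (simp add: power_divide)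
  ultimately have l1: "4 \<le> s * lam 1" by linarith
  have "?a * lam 1 \<le> ?a * (20 * (real 1 / real p)\<^sup>2)" by (intro mult_left_mono lam_le) auto
  moreover have "?a * (20 * (real 1 / real p)\<^sup>2) = 20" using p by (simp add: power_divide)
  ultimately have l2: "?a * lam 1 \<le> 20" by linarith
  have "D s \<le> (\<Sum>j=1..<p. exp (- 2 * s * lam j))" by (rule D_le_chi[OF s0])
  also have "\<dots> \<le> (\<Sum>j=1..<p. exp (- 2 * (s - ?a) * lam 1) * exp (- 2 * ?a * lam j))"
  proof (rule sum_mono)
    fix j assume j: "j \<in> {1..<p}"
    have "(s - ?a) * lam 1 \<le> (s - ?a) * lam j" using s j by (intro mult_left_mono lam_1_le) auto
    then have "- 2 * s * lam j \<le> - 2 * (s - ?a) * lam 1 + - 2 * ?a * lam j" by (simp add: algebra_simps)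
    then show "exp (- 2 * s * lam j) \<le> exp (- 2 * (s - ?a) * lam 1) * exp (- 2 * ?a * lam j)"
      unfolding exp_add[symmetric] by simp
  qed
  also have "\<dots> = exp (- 2 * (s - ?a) * lam 1) * (\<Sum>j=1..<p. exp (- 2 * ?a * lam j))"
    by (simp add: sum_distrib_left)
  also have "\<dots> \<le> exp (- 2 * (s - ?a) * lam 1) * 1"
    using chi_square_bound[OF p2] p by (intro mult_left_mono) auto
  also have "- 2 * (s - ?a) * lam 1 = 2 * (?a * lam 1) + - 2 * s * lam 1" by (simp add: algebra_simps)
  also have "exp (2 * (?a * lam 1) + - 2 * s * lam 1) * 1 \<le> exp 40 * exp (- 2 * s * lam 1)"
    unfolding exp_add[symmetric] using l2 by (simp add: mult.commute)
  finally have "exp (-40) * D s \<le> exp (-40) * (exp 40 * exp (- 2 * s * lam 1))" by (intro mult_left_mono) auto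
  also have "\<dots> = exp (- 2 * s * lam 1)" by (simp add: mult.assoc[symmetric] exp_add[symmetric])
  finally have "2 * exp (-40) * D s \<le> 4 * exp (- 2 * s * lam 1) / 2" by simp
  also have "\<dots> \<le> s * lam 1 * exp (- 2 * s * lam 1) / 2"
    using l1 by (intro divide_right_mono mult_right_mono) auto
  also have "\<dots> \<le> s * h' s"
    using mult_left_mono[OF h'_ge_character[of s 1], of s] s0 by (simp add: mult_ac)
  finally show ?thesis .
qed

end

context cyclic_walk begin

section \<open>Entropy gained over a window of time\<close>

lemma h_antimono_D: "0 \<le> a \<Longrightarrow> a \<le> b \<Longrightarrow> h a \<le> h b"
proof (cases "a = b")
  case False
  assume ab: "0 \<le> a" "a \<le> b"
  with False obtain z where z: "a < z" "z < b" "h b - h a = (b - a) * h' z"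
    using h_mvt[of a b] by auto
  then show ?thesis using h'_nonneg[of z] ab by (smt (verit) mult_nonneg_nonneg)
qed simp

lemma h_nonneg: "0 \<le> s \<Longrightarrow> 0 \<le> h s"
  using h_antimono_D[of 0 s] by (simp add: h_0)

lemma D_nonneg: assumes "0 < s" shows "0 \<le> D s"
proof -
  have "- (\<Sum>x\<in>Zp. q s x * (ln (real p) + ln (q s x))) \<le> (\<Sum>x\<in>Zp. 1 / real p - q s x)"
    unfolding sum_negf[symmetric]
  proof (rule sum_mono)
    fix x
    have pos: "0 < q s x" by (rule q_pos[OF assms])
    have "ln (1 / real p) - ln (q s x) \<le> (1 / real p) / q s x - 1"
      using p pos by (intro ln_div_pos_le) auto
    then have "- (ln (real p) + ln (q s x)) \<le> (1 / real p) / q s x - 1"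
      using p by (simp add: ln_divide_pos)
    then have "q s x * (- (ln (real p) + ln (q s x))) \<le> q s x * ((1 / real p) / q s x - 1)"
      using pos by (intro mult_left_mono) auto
    also have "\<dots> = 1 / real p - q s x" using pos by (simp add: right_diff_distrib)
    finally show "- (q s x * (ln (real p) + ln (q s x))) \<le> 1 / real p - q s x" by (simp add: algebra_simps)
  qed
  also have "\<dots> = 0" using p by (simp add: sum_subtractf sum_q)
  finally have "0 \<le> (\<Sum>x\<in>Zp. q s x * (ln (real p) + ln (q s x)))" by simp
  also have "\<dots> = (\<Sum>x\<in>Zp. q s x * ln (real p)) - h s"
    by (simp add: h_def sum_negf distrib_left sum.distrib)
  also have "\<dots> = D s" by (simp add: D_def sum_distrib_right[symmetric] sum_q)
  finally show ?thesis .
qed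

text \<open>The distance to 0 on the cycle.\<close>

definition len :: "int \<Rightarrow> real" where
  "len x = of_int (min (x mod int p) (int p - x mod int p))"

lemma periodic_len: "periodic len"
  unfolding periodic_def len_def by simp

lemma len_step: assumes "e \<in> steps \<sigma>" shows "len (x + e) - len x \<le> 1"
proof -
  define m where "m = x mod int p"
  have m: "0 \<le> m" "m < int p" using p by (auto simp: m_def)
  have up: "(x + 1) mod int p = (if m + 1 = int p then 0 else m + 1)"
  proof -
    have "(x + 1) mod int p = (m + 1) mod int p" by (simp add: m_def mod_add_left_eq)
    then show ?thesis using m by (auto intro!: mod_pos_pos_trivial)
  qed
  have dn: "(x - 1) mod int p = (if m = 0 then int p - 1 else m - 1)"
  proof -
    have "(x - 1) mod int p = (m - 1) mod int p" by (simp add: m_def mod_diff_left_eq)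
    moreover have "(0 - 1) mod int p = int p - 1" using p by (simp add: zmod_minus1)
    ultimately show ?thesis using m by (auto intro!: mod_pos_pos_trivial)
  qed
  have "e = 1 \<or> e = -1" using assms by (cases \<sigma>) (auto simp: steps_def)
  then show ?thesis
  proof
    assume e: "e = 1"
    show ?thesis unfolding e len_def up m_def[symmetric] using m by (auto simp: min_def)
  next
    assume e: "e = -1"
    then have xe: "x + e = x - 1" by simp
    show ?thesis unfolding xe len_def dn m_def[symmetric] using m by (auto simp: min_def)
  qed
qed

lemma sum_power_len: assumes b: "0 < b" "b < 1" shows "(\<Sum>x\<in>Zp. b powr len x) \<le> (1 + b) / (1 - b)"
proof -
  have "(\<Sum>x\<in>Zp. b powr len x) = (\<Sum>n<p. b powr len (int n))"
    by (rule sum.reindex_bij_witness[of _ int nat]) auto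
  also have "\<dots> \<le> (\<Sum>n<p. b ^ n + (if n = 0 then 0 else b ^ (p - n)))"
  proof (rule sum_mono)
    fix n assume "n \<in> {..<p}"
    then have n: "n < p" by simp
    have "len (int n) = real (min n (p - n))"
      using n by (cases "2 * n \<le> p") (auto simp: len_def min_def of_nat_diff)
    then have "b powr len (int n) = b ^ min n (p - n)" using b by (simp add: powr_realpow)
    moreover have "n = 0 \<Longrightarrow> min n (p - n) = n" by simp
    ultimately show "b powr len (int n) \<le> b ^ n + (if n = 0 then 0 else b ^ (p - n))"
      using b by (auto simp: min_def)
  qed
  also have "\<dots> = (\<Sum>n<p. b ^ n) + (\<Sum>n=1..<p. b ^ (p - n))"
  proof -
    have "{..<p} = insert 0 {1..<p}" using p by auto
    then have "(\<Sum>n<p. (if n = 0 then 0 else b ^ (p - n))) = (\<Sum>n=1..<p. b ^ (p - n))" by simp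
    then show ?thesis by (simp add: sum.distrib)
  qed
  also have "(\<Sum>n=1..<p. b ^ (p - n)) = (\<Sum>n=1..<p. b ^ n)"
    by (rule sum.reindex_bij_witness[of _ "\<lambda>j. p - j" "\<lambda>j. p - j"]) auto
  also have "(\<Sum>n=1..<p. b ^ n) = (\<Sum>n<p. b ^ n) - 1"
  proof -
    have "{..<p} = insert 0 {1..<p}" using p by auto
    then show ?thesis by simp
  qed
  also have "(\<Sum>n<p. b ^ n) + ((\<Sum>n<p. b ^ n) - 1) \<le> 1 / (1 - b) + (1 / (1 - b) - 1)"
  proof -
    have "(\<Sum>n<p. b ^ n) = (1 - b ^ p) / (1 - b)" using b by (simp add: sum_gp_strict)
    also have "\<dots> \<le> 1 / (1 - b)" using b by (intro divide_right_mono) auto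
    finally show ?thesis by linarith
  qed
  also have "\<dots> = (1 + b) / (1 - b)" using b by (simp add: field_simps)
  finally show ?thesis .
qed

lemma mean_len: assumes "0 \<le> s" shows "(\<Sum>x\<in>Zp. q s x * len x) \<le> s"
proof (cases "s = 0")
  case True
  then show ?thesis unfolding True q_0 by (subst sum_Zp_0) (simp add: len_def)
next
  case False
  then have s: "0 < s" using assms by simp
  let ?f = "\<lambda>s. \<Sum>x\<in>Zp. q s x * len x"
  obtain z where z: "0 < z" "z < s" "?f s - ?f 0 = (s - 0) * avg \<sigma> (\<lambda>e. \<Sum>y\<in>Zp. q z y * (len (y + e) - len y))"
    using MVT2[OF s, of ?f "\<lambda>z. avg \<sigma> (\<lambda>e. \<Sum>y\<in>Zp. q z y * (len (y + e) - len y))"]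
      DERIV_sum_q[OF periodic_len] by blast
  have "avg \<sigma> (\<lambda>e. \<Sum>y\<in>Zp. q z y * (len (y + e) - len y)) \<le> avg \<sigma> (\<lambda>_. \<Sum>y\<in>Zp. q z y * 1)"
    using z by (intro avg_mono sum_mono mult_left_mono len_step q_nonneg) auto
  also have "\<dots> = 1" by (simp add: sum_q)
  finally have "s * avg \<sigma> (\<lambda>e. \<Sum>y\<in>Zp. q z y * (len (y + e) - len y)) \<le> s * 1"
    using s by (intro mult_left_mono) auto
  then have "?f s - ?f 0 \<le> s * 1" using z(3) by simp
  moreover have "?f 0 = 0" unfolding q_0 by (subst sum_Zp_0) (simp add: len_def)
  ultimately show ?thesis by simp
qed

text \<open>The Gibbs inequality with a geometric reference density in the distance to 0, whose mean
is at most the number of steps.\<close>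

lemma h_upper:
  assumes s: "0 < s" and b: "0 < b" "b < 1"
  shows "h s \<le> ln ((1 + b) / (1 - b)) + s * ln (1 / b)"
proof -
  define r where "r x = (1 - b) / (1 + b) * b powr len x" for x
  have r: "0 < r x" for x using b by (simp add: r_def)
  have lnr: "ln (r x) = - ln ((1 + b) / (1 - b)) - len x * ln (1 / b)" for x
  proof -
    have "ln (r x) = ln ((1 - b) / (1 + b)) + len x * ln b"
      unfolding r_def using b by (subst ln_mult_pos) (auto simp: ln_powr)
    moreover have "ln ((1 - b) / (1 + b)) = - ln ((1 + b) / (1 - b))"
      using b by (simp add: ln_divide_pos)
    ultimately show ?thesis using b by (simp add: ln_divide_pos)
  qed
  have "(\<Sum>x\<in>Zp. r x) = (1 - b) / (1 + b) * (\<Sum>x\<in>Zp. b powr len x)"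
    by (simp add: r_def sum_distrib_left)
  also have "\<dots> \<le> (1 - b) / (1 + b) * ((1 + b) / (1 - b))"
    using b by (intro mult_left_mono sum_power_len) auto
  also have "\<dots> = 1" using b by simp
  finally have sr: "(\<Sum>x\<in>Zp. r x) \<le> 1" .
  have "(\<Sum>x\<in>Zp. q s x * (ln (r x) - ln (q s x))) \<le> (\<Sum>x\<in>Zp. r x - q s x)"
  proof (rule sum_mono)
    fix x
    have "q s x * (ln (r x) - ln (q s x)) \<le> q s x * (r x / q s x - 1)"
      using q_pos[OF s, of x] r by (intro mult_left_mono ln_div_pos_le) auto
    also have "\<dots> = r x - q s x" using q_pos[OF s, of x] by (simp add: right_diff_distrib)
    finally show "q s x * (ln (r x) - ln (q s x)) \<le> r x - q s x" .
  qed
  then have "(\<Sum>x\<in>Zp. q s x * ln (r x)) + h s \<le> 0"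
    using sr by (simp add: h_def sum_subtractf sum_negf right_diff_distrib sum_q)
  moreover have "(\<Sum>x\<in>Zp. q s x * ln (r x)) =
     - ln ((1 + b) / (1 - b)) - (\<Sum>x\<in>Zp. q s x * len x) * ln (1 / b)"
    by (simp add: lnr right_diff_distrib sum_subtractf sum_negf sum_distrib_right[symmetric] sum_q mult.assoc[symmetric])
  moreover have "(\<Sum>x\<in>Zp. q s x * len x) * ln (1 / b) \<le> s * ln (1 / b)"
    using b s by (intro mult_right_mono mean_len) auto
  ultimately show ?thesis by linarith
qed

text \<open>The bound \<open>h_upper\<close> with \<open>b = s\<close> for small \<open>s\<close>,
where the walk has most likely not moved.\<close>

lemma h_small: assumes s: "0 < s" "s \<le> 1" shows "h s \<le> 5 * s * (1 + ln (1 / s))"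
proof -
  have l0: "0 \<le> ln (1 / s)" using s by simp
  have "h s \<le> 5 * s + 5 * (s * ln (1 / s))"
  proof (cases "s \<le> 1/2")
    case True
    have "ln ((1 + s) / (1 - s)) \<le> (1 + s) / (1 - s) - 1" using s True by (intro ln_le_minus_one) auto
    also have "\<dots> = 2 * s / (1 - s)" using True by (simp add: field_simps)
    also have "\<dots> \<le> 2 * s / (1/2)" using s True by (intro divide_left_mono) auto
    finally have 1: "ln ((1 + s) / (1 - s)) \<le> 4 * s" by simp
    have "s * ln (1 / s) \<ge> 0" using l0 s by simp
    moreover have "h s \<le> ln ((1 + s) / (1 - s)) + s * ln (1 / s)" using h_upper[of s s] s True by simp
    ultimately show ?thesis using 1 s by linarith
  next
    case False
    have "h s \<le> ln 3 + s * ln 2" using h_upper[of s "1/2"] s by simp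
    moreover have "ln (3::real) \<le> 3 - 1" by (rule ln_le_minus_one) simp
    moreover have "ln (2::real) \<le> 2 - 1" by (rule ln_le_minus_one) simp
    then have "s * ln 2 \<le> s * 1" using s by (intro mult_left_mono) auto
    moreover have "s * ln (1 / s) \<ge> 0" using l0 s by simp
    ultimately show ?thesis using False by linarith
  qed
  then show ?thesis by (simp add: algebra_simps)
qed

definition c1 :: real where "c1 = c0 / 6"

text \<open>At small times the mass sits at 0, and its log-ratio to the mass at a neighbour, which
is at most \<open>s\<close>, is already of order \<open>ln (1 / s)\<close>.\<close>

lemma h'_small: assumes s: "0 < s" "s \<le> 1" shows "c1 * (1 + ln (1 / s)) \<le> h' s"
proof (cases "s \<le> exp (-5)")
  case True
  have l5: "5 \<le> ln (1 / s)"
  proof -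
    have "ln s \<le> ln (exp (-5))" using s True by (subst ln_le_cancel_iff) auto
    then show ?thesis using s by (simp add: ln_divide_pos)
  qed
  have q0: "exp (-s) \<le> q s 0" using q_ge[of s 0] s by simp
  have half: "1/2 \<le> exp (-s)"
  proof -
    have "exp (-5::real) \<le> 1/2"
      using exp_ge_add_one_self[of "5::real"] by (simp add: exp_minus field_simps)
    then show ?thesis using True exp_ge_add_one_self[of "-s"] by linarith
  qed
  have "(1 + ln (1 / s)) / 4 \<le> avg \<sigma> (\<lambda>e. \<Sum>x\<in>Zp. q s x * (ln (q s x) - ln (q s (x + e))) + q s (x + e) - q s x)"
  proof (subst avg_const[of \<sigma>, symmetric], rule avg_mono)
    fix e assume "e \<in> steps \<sigma>"
    then have e: "e = 1 \<or> e = -1" by (cases \<sigma>) (auto simp: steps_def)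
    define T where "T x = q s x * (ln (q s x) - ln (q s (x + e))) + q s (x + e) - q s x" for x
    have T: "0 \<le> T x" for x
    proof -
      have pos: "0 < q s x" "0 < q s (x + e)" using q_pos s by auto
      have "q s x * (ln (q s (x + e)) - ln (q s x)) \<le> q s x * (q s (x + e) / q s x - 1)"
        using pos by (intro mult_left_mono ln_div_pos_le) auto
      also have "\<dots> = q s (x + e) - q s x" using pos by (simp add: right_diff_distrib)
      finally show ?thesis by (simp add: T_def algebra_simps)
    qed
    have "q s e + q s 0 \<le> 1"
    proof -
      have "q s e = q s (e mod int p)" using periodicD[OF periodic_q] by simp
      moreover have "e mod int p \<noteq> 0" using e p by (auto simp: zmod_minus1 mod_pos_pos_trivial)
      moreover have "(\<Sum>x\<in>{e mod int p, 0}. q s x) \<le> (\<Sum>x\<in>Zp. q s x)"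
        using s p by (intro sum_mono2 q_nonneg) auto
      ultimately show ?thesis by (simp add: sum_q)
    qed
    then have "q s e \<le> 1 - exp (-s)" using q0 by simp
    also have "\<dots> \<le> s" using exp_ge_add_one_self[of "-s"] by simp
    finally have qe: "ln (q s e) \<le> ln s" using q_pos[OF s(1), of e] s by simp
    have "ln (exp (-s)) \<le> ln (q s 0)" using q0 q_pos[OF s(1), of 0] by (subst ln_le_cancel_iff) auto
    then have "ln (1 / s) - 2 \<le> ln (q s 0) - ln (q s e) - 1" using qe s by (simp add: ln_divide_pos)
    then have "q s 0 * (ln (1 / s) - 2) \<le> q s 0 * (ln (q s 0) - ln (q s e) - 1)"
      using q_pos[OF s(1), of 0] by (intro mult_left_mono) auto
    also have "\<dots> \<le> T 0"
      using q_pos[OF s(1), of e] by (simp add: T_def algebra_simps)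
    also have "T 0 \<le> (\<Sum>x\<in>Zp. T x)" using T p by (intro member_le_sum) auto
    finally have "q s 0 * (ln (1 / s) - 2) \<le> (\<Sum>x\<in>Zp. T x)" .
    moreover have "1/2 * (ln (1 / s) - 2) \<le> q s 0 * (ln (1 / s) - 2)"
      using q0 half l5 by (intro mult_right_mono) auto
    moreover have "(1 + ln (1 / s)) / 4 \<le> 1/2 * (ln (1 / s) - 2)" using l5 by (simp add: field_simps)
    ultimately have "(1 + ln (1 / s)) / 4 \<le> (\<Sum>x\<in>Zp. T x)" by (meson order_trans)
    then show "(1 + ln (1 / s)) / 4 \<le> (\<Sum>x\<in>Zp. q s x * (ln (q s x) - ln (q s (x + e))) + q s (x + e) - q s x)"
      by (simp add: T_def)
  qed
  then have "1 / 4 * (1 + ln (1 / s)) \<le> h' s" by (simp add: h'_alt)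
  moreover have "c1 * (1 + ln (1 / s)) \<le> 1 / 4 * (1 + ln (1 / s))"
    using c0 l5 by (intro mult_right_mono) (auto simp: c1_def)
  ultimately show ?thesis by linarith
next
  case False
  have "ln (exp (-5)) < ln s" using False s by (subst ln_less_cancel_iff) auto
  then have "1 + ln (1 / s) \<le> 6" using s by (simp add: ln_divide_pos)
  then have "c1 * (1 + ln (1 / s)) \<le> c1 * 6" using c0 by (intro mult_left_mono) (auto simp: c1_def)
  also have "\<dots> = c0" by (simp add: c1_def)
  also have "c0 \<le> 1 * h' 1" using p by (intro J_medium one_le_power) auto
  also have "\<dots> \<le> h' s" using h'_antimono[of s 1] s by simp
  finally show ?thesis .
qed

lemma gain_ge:
  assumes "0 < a" "a < b"
  shows "(b - a) * h' b \<le> h b - h a"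
proof -
  obtain z where z: "a < z" "z < b" "h b - h a = (b - a) * h' z" using h_mvt[of a b] assms by auto
  then show ?thesis using h'_antimono[of z b] assms by (simp add: mult_left_mono)
qed

lemma gain_le:
  assumes "0 < a" "a < b"
  shows "h b - h a \<le> (b - a) * h' a"
proof -
  obtain z where z: "a < z" "z < b" "h b - h a = (b - a) * h' z" using h_mvt[of a b] assms by auto
  then show ?thesis using h'_antimono[of a z] assms by (simp add: mult_left_mono)
qed

text \<open>By concavity the gain is at least the length of the window times the derivative at its
end.\<close>

lemma gain_ge_J:
  assumes s: "0 < s" and e: "0 < \<epsilon>" "\<epsilon> \<le> 1"
  shows "\<epsilon> / 2 * ((1 + \<epsilon>) * s * h' ((1 + \<epsilon>) * s)) \<le> h ((1 + \<epsilon>) * s) - h s"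
proof -
  have 1: "s < (1 + \<epsilon>) * s" using s e by simp
  have "\<epsilon> / 2 * ((1 + \<epsilon>) * s) \<le> \<epsilon> / 2 * (2 * s)" using s e by (intro mult_left_mono mult_right_mono) auto
  then have "\<epsilon> / 2 * ((1 + \<epsilon>) * s) * h' ((1 + \<epsilon>) * s) \<le> \<epsilon> * s * h' ((1 + \<epsilon>) * s)"
    using s e by (intro mult_right_mono h'_nonneg) auto
  then show ?thesis using gain_ge[OF s 1] by (simp add: algebra_simps)
qed

lemma gain_explicit:
  assumes s: "0 < s" and e: "0 < \<epsilon>" "\<epsilon> \<le> 1" and le: "(1 + \<epsilon>) * s \<le> (real p)\<^sup>2"
  shows "(1 + \<epsilon>) * s \<le> 1 \<Longrightarrow> \<epsilon> / 2 * c1 * ((1 + \<epsilon>) * s * (1 + ln (1 / ((1 + \<epsilon>) * s)))) \<le> h ((1 + \<epsilon>) * s) - h s"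
    and "1 \<le> (1 + \<epsilon>) * s \<Longrightarrow> \<epsilon> / 2 * c0 \<le> h ((1 + \<epsilon>) * s) - h s"
proof -
  define t where "t = (1 + \<epsilon>) * s"
  have t: "0 < t" using s e by (simp add: t_def)
  {
    assume "(1 + \<epsilon>) * s \<le> 1"
    then have "t * (c1 * (1 + ln (1 / t))) \<le> t * h' t" using t by (intro mult_left_mono h'_small) (auto simp: t_def)
    then have "\<epsilon> / 2 * (t * (c1 * (1 + ln (1 / t)))) \<le> \<epsilon> / 2 * (t * h' t)" by (rule mult_left_mono) (use e in auto)
    moreover have "\<epsilon> / 2 * c1 * (t * (1 + ln (1 / t))) = \<epsilon> / 2 * (t * (c1 * (1 + ln (1 / t))))" by simp
    ultimately show "\<epsilon> / 2 * c1 * ((1 + \<epsilon>) * s * (1 + ln (1 / ((1 + \<epsilon>) * s)))) \<le> h ((1 + \<epsilon>) * s) - h s"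
      using gain_ge_J[OF s e] unfolding t_def[symmetric] by linarith
  next
    assume "1 \<le> (1 + \<epsilon>) * s"
    then have "\<epsilon> / 2 * c0 \<le> \<epsilon> / 2 * (t * h' t)" using e le by (intro mult_left_mono J_medium) (auto simp: t_def)
    then show "\<epsilon> / 2 * c0 \<le> h ((1 + \<epsilon>) * s) - h s"
      using gain_ge_J[OF s e] by (simp add: t_def[symmetric])
  }
qed

definition c2 :: real where "c2 = c0 / 60"

text \<open>Three ranges of time. Up to 1 the production is of order \<open>s (1 + ln (1 /
s))\<close>, which bounds \<open>h s\<close>; up to \<open>p\<^sup>2\<close> it is of order 1;
beyond that it is of the order of \<open>D\<close>.\<close>

lemma gain_bound:
  assumes s: "0 < s" and e: "0 < \<epsilon>" "\<epsilon> \<le> 1"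
  shows "\<epsilon> * c2 * min 1 (min (h s) (D s)) \<le> h ((1 + \<epsilon>) * s) - h s"
proof -
  define t where "t = (1 + \<epsilon>) * s"
  have t: "0 < t" "s < t" using s e by (auto simp: t_def)
  let ?m = "min 1 (min (h s) (D s))"
  have m0: "0 \<le> ?m" using h_nonneg[of s] D_nonneg[OF s] s by simp
  have c2: "0 < c2" using c0 by (simp add: c2_def)
  consider "t \<le> 1" | "1 \<le> t" "t \<le> (real p)\<^sup>2" | "(real p)\<^sup>2 \<le> t" by linarith
  then have "\<epsilon> * c2 * ?m \<le> h t - h s"
  proof cases
    case 1
    have "1 \<le> (real p)\<^sup>2" using p by (intro one_le_power) auto
    then have tp: "(1 + \<epsilon>) * s \<le> (real p)\<^sup>2" using 1 by (simp add: t_def)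
    have "?m \<le> h s" by simp
    also have "\<dots> \<le> h t" using t s by (intro h_antimono_D) auto
    also have "\<dots> \<le> 5 * t * (1 + ln (1 / t))" using t 1 by (intro h_small) auto
    finally have "\<epsilon> * c2 * ?m \<le> \<epsilon> * c2 * (5 * t * (1 + ln (1 / t)))" using e c2 by (intro mult_left_mono) auto
    also have "\<dots> = \<epsilon> / 2 * c1 * (t * (1 + ln (1 / t)))" by (simp add: c1_def c2_def)
    also have "\<dots> \<le> h t - h s" using gain_explicit(1)[OF s e tp] 1 by (simp add: t_def)
    finally show ?thesis .
  next
    case 2
    have "\<epsilon> * c2 * ?m \<le> \<epsilon> * c2 * 1" using e c2 by (intro mult_left_mono) auto
    also have "\<dots> \<le> \<epsilon> / 2 * c0" using e c0 by (simp add: c2_def)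
    also have "\<dots> \<le> h t - h s" using gain_explicit(2)[OF s e] 2 by (simp add: t_def)
    finally show ?thesis .
  next
    case 3
    define \<kappa> where "\<kappa> = \<epsilon> * exp (-40)"
    have k: "0 < \<kappa>" "\<kappa> \<le> 1" using e by (auto simp: \<kappa>_def intro!: mult_le_one)
    have "\<kappa> * D t = \<epsilon> / 2 * (2 * exp (-40) * D t)" by (simp add: \<kappa>_def)
    also have "\<dots> \<le> \<epsilon> / 2 * (t * h' t)" using e 3 by (intro mult_left_mono J_large) auto
    also have "\<dots> \<le> h t - h s" using gain_ge_J[OF s e] by (simp add: t_def)
    finally have "\<kappa> * (D s - (h t - h s)) \<le> h t - h s" by (simp add: D_def)
    then have "\<kappa> * D s \<le> (1 + \<kappa>) * (h t - h s)" by (simp add: algebra_simps)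
    also have "\<dots> \<le> 2 * (h t - h s)"
      using k h_antimono_D[of s t] t s by (intro mult_right_mono) auto
    finally have 1: "\<kappa> / 2 * D s \<le> h t - h s" by simp
    have "\<epsilon> * c2 * ?m \<le> \<epsilon> * c2 * D s" using e c2 by (intro mult_left_mono) auto
    also have "c2 \<le> exp (-40) / 2" unfolding c2_def c0_def by (simp add: field_simps) (smt (verit) exp_less_cancel_iff exp_gt_zero)
    then have "\<epsilon> * c2 * D s \<le> \<kappa> / 2 * D s"
      using e D_nonneg[OF s] by (intro mult_right_mono) (auto simp: \<kappa>_def)
    finally show ?thesis using 1 by linarith
  qed
  then show ?thesis by (simp add: t_def)
qed

end

section \<open>Walks as images of Poisson paths\<close>

lemma prob_bind_pmf:
  "measure_pmf.prob (bind_pmf M N) A = measure_pmf.expectation M (\<lambda>x. measure_pmf.prob (N x) A)"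
proof -
  have "ennreal (measure_pmf.prob (bind_pmf M N) A) = (\<integral>\<^sup>+x. ennreal (measure_pmf.prob (N x) A) \<partial>M)"
    by (simp flip: measure_pmf.emeasure_eq_measure)
  also have "\<dots> = ennreal (measure_pmf.expectation M (\<lambda>x. measure_pmf.prob (N x) A))"
    by (intro nn_integral_eq_integral measure_pmf.integrable_const_bound[where B = 1]) auto
  finally show ?thesis by (simp add: Bochner_Integration.integral_nonneg)
qed

lemma expectation_bounded_integrable:
  fixes f :: "_ \<Rightarrow> real"
  assumes "\<And>x. \<bar>f x\<bar> \<le> B" shows "integrable (measure_pmf M) f"
  using assms by (intro measure_pmf.integrable_const_bound[where B = B]) auto

lemma expectation_poisson:
  fixes f :: "nat \<Rightarrow> real"
  assumes t: "0 < t" and f: "\<And>n. \<bar>f n\<bar> \<le> B"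
  shows "measure_pmf.expectation (poisson_pmf t) f = poisson_mean t f"
proof -
  have bd: "bounded_seq f" by (rule bounded_seqI[of _ B]) (use f in auto)
  have "measure_pmf.expectation (poisson_pmf t) f = infsetsum (\<lambda>n. pmf (poisson_pmf t) n * f n) UNIV"
    by (rule pmf_expectation_eq_infsetsum)
  also have "\<dots> = (\<Sum>n. pmf (poisson_pmf t) n * f n)"
  proof (subst infsetsum_nat)
    have "bounded_seq (\<lambda>n. \<bar>f n\<bar>)" by (rule bounded_seqI[of _ B]) (use f in auto)
    from summable_poisson_mean[OF this, of t]
    have "summable (\<lambda>n. norm (pmf (poisson_pmf t) n * f n))"
      using t by (simp add: abs_mult mult_ac)
    then show "Infinite_Set_Sum.abs_summable_on (\<lambda>n. pmf (poisson_pmf t) n * f n) UNIV"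
      by (simp add: abs_summable_on_nat_iff')
  qed auto
  finally show ?thesis using t by (simp add: poisson_mean_def mult_ac)
qed

lemma prob_walk_law:
  assumes "0 \<le> t"
  shows "measure_pmf.prob (walk_law K x t) A =
    poisson_mean t (\<lambda>n. measure_pmf.prob (discrete_walk K x n) A)"
proof (cases "t = 0")
  case True
  then show ?thesis by (simp add: walk_law_def bind_return_pmf)
next
  case False
  then show ?thesis using assms
    by (simp add: walk_law_def prob_bind_pmf expectation_poisson[where B = 1])
qed

lemma pmf_walk_law:
  assumes "0 \<le> t"
  shows "pmf (walk_law K x t) y = poisson_mean t (\<lambda>n. pmf (discrete_walk K x n) y)"
  using prob_walk_law[OF assms, of K x "{y}"] by (simp add: measure_pmf_single)

lemma map_discrete_walk:
  assumes "\<And>y. map_pmf f (K y) = K' (f y)"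
  shows "map_pmf f (discrete_walk K x n) = discrete_walk K' (f x) n"
proof (induction n)
  case (Suc n)
  then show ?case
    by (simp add: map_bind_pmf assms bind_map_pmf Suc[symmetric])
qed simp

lemma map_walk_law:
  assumes "\<And>y. map_pmf f (K y) = K' (f y)"
  shows "map_pmf f (walk_law K x t) = walk_law K' (f x) t"
  unfolding walk_law_def map_bind_pmf by (simp add: map_discrete_walk[of f K K', OF assms])

text \<open>The law of the list of the independent choices made up to time \<open>t\<close>; every
walk below is a function of such a list, which provides couplings for free.\<close>

definition path_law :: "'e pmf \<Rightarrow> real \<Rightarrow> 'e list pmf" where
  "path_law E t = bind_pmf (if t > 0 then poisson_pmf t else return_pmf 0) (\<lambda>n. replicate_pmf n E)"

lemma discrete_walk_path:
  "discrete_walk (\<lambda>x. map_pmf (\<lambda>e. act e x) E) x n = map_pmf (\<lambda>u. foldr act u x) (replicate_pmf n E)"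
proof (induction n)
  case (Suc n)
  have "discrete_walk (\<lambda>x. map_pmf (\<lambda>e. act e x) E) x (Suc n) =
     bind_pmf (replicate_pmf n E) (\<lambda>u. bind_pmf E (\<lambda>e. return_pmf (act e (foldr act u x))))"
    unfolding discrete_walk.simps Suc by (simp add: map_pmf_def bind_assoc_pmf bind_return_pmf)
  also have "\<dots> = bind_pmf E (\<lambda>e. bind_pmf (replicate_pmf n E) (\<lambda>u. return_pmf (act e (foldr act u x))))"
    by (rule bind_commute_pmf)
  finally show ?case by (simp add: map_pmf_def bind_assoc_pmf bind_return_pmf)
qed simp

lemma walk_law_path:
  "walk_law (\<lambda>x. map_pmf (\<lambda>e. act e x) E) x t = map_pmf (\<lambda>u. foldr act u x) (path_law E t)"
  unfolding walk_law_def path_law_def map_bind_pmf discrete_walk_path ..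

definition sgn_of :: "bool \<Rightarrow> int" where "sgn_of b = (if b then 1 else -1)"

lemma prob_bind_sign:
  "measure_pmf.prob (bind_pmf (sign_pmf \<sigma>) N) A = avg \<sigma> (\<lambda>e. measure_pmf.prob (N (e = 1)) A)"
  unfolding prob_bind_pmf
  by (cases \<sigma>) (simp_all add: sign_pmf_def avg_def)

lemma pmf_bind_sign:
  "pmf (bind_pmf (sign_pmf \<sigma>) N) y = avg \<sigma> (\<lambda>e. pmf (N (e = 1)) y)"
  using prob_bind_sign[of \<sigma> N "{y}"] by (simp add: measure_pmf_single)

definition int_step :: "orientation \<Rightarrow> int \<Rightarrow> int pmf" where
  "int_step \<sigma> x = map_pmf (\<lambda>b. x + sgn_of b) (sign_pmf \<sigma>)"

definition int_walk :: "orientation \<Rightarrow> real \<Rightarrow> int pmf" where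
  "int_walk \<sigma> s = walk_law (int_step \<sigma>) 0 s"

lemma discrete_int_walk_Suc:
  "discrete_walk (int_step \<sigma>) 0 (Suc n) =
    bind_pmf (sign_pmf \<sigma>) (\<lambda>b. map_pmf (\<lambda>x. x + sgn_of b) (discrete_walk (int_step \<sigma>) 0 n))"
proof -
  define M where "M = discrete_walk (int_step \<sigma>) 0 n"
  have "discrete_walk (int_step \<sigma>) 0 (Suc n) = bind_pmf M (\<lambda>x. int_step \<sigma> x)"
    by (simp add: M_def)
  also have "\<dots> = bind_pmf (sign_pmf \<sigma>) (\<lambda>b. map_pmf (\<lambda>x. x + sgn_of b) M)"
    unfolding int_step_def map_pmf_def by (rule bind_commute_pmf)
  finally show ?thesis by (simp add: M_def)
qed

lemma prob_discrete_int_walk_Suc: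
  "measure_pmf.prob (discrete_walk (int_step \<sigma>) 0 (Suc n)) A =
    avg \<sigma> (\<lambda>e. measure_pmf.prob (discrete_walk (int_step \<sigma>) 0 n) {x. x + e \<in> A})"
  unfolding discrete_int_walk_Suc prob_bind_sign
  by (intro avg_cong)
     (auto simp: steps_def sgn_of_def vimage_def split: orientation.splits)

lemma pmf_discrete_int_walk_Suc:
  "pmf (discrete_walk (int_step \<sigma>) 0 (Suc n)) y = avg \<sigma> (\<lambda>e. pmf (discrete_walk (int_step \<sigma>) 0 n) (y - e))"
proof -
  have "{x. x + e \<in> {y}} = {y - e}" for e by auto
  then show ?thesis using prob_discrete_int_walk_Suc[of \<sigma> n "{y}"] by (simp add: measure_pmf_single)
qed

context cyclic_walk begin

lemma prob_discrete_int_walk: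
  "measure_pmf.prob (discrete_walk (int_step \<sigma>) 0 n) {x. int p dvd x - y} = steps_pmf n y"
proof (induction n arbitrary: y)
  case 0
  show ?case by (auto simp: measure_return_pmf indicator_def of_bool_def)
next
  case (Suc n)
  have "{x. x + e \<in> {x. int p dvd x - y}} = {x. int p dvd x - (y - e)}" for e
    by (auto simp: algebra_simps)
  then show ?case by (simp only: prob_discrete_int_walk_Suc Suc steps_pmf.simps)
qed

lemma prob_int_walk: "0 \<le> s \<Longrightarrow> measure_pmf.prob (int_walk \<sigma> s) {x. int p dvd x - y} = q s y"
  by (simp add: int_walk_def prob_walk_law prob_discrete_int_walk q_def)

definition cyc_walk :: "real \<Rightarrow> int pmf" where
  "cyc_walk s = map_pmf (\<lambda>x. x mod int p) (int_walk \<sigma> s)"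

lemma pmf_cyc_walk:
  assumes "0 \<le> s" shows "pmf (cyc_walk s) y = (if y \<in> Zp then q s y else 0)"
proof -
  have *: "pmf (cyc_walk s) y = measure_pmf.prob (int_walk \<sigma> s) {x. x mod int p = y}"
    by (simp add: cyc_walk_def pmf_map vimage_def)
  show ?thesis
  proof (cases "y \<in> Zp")
    case True
    then have "{x. x mod int p = y} = {x. int p dvd x - y}"
      by (auto simp: mod_eq_dvd_iff[symmetric])
    then show ?thesis using * prob_int_walk[OF assms, of y] True by simp
  next
    case False
    then have "{x. x mod int p = y} = {}" using p by auto
    then show ?thesis using * False by (simp only: measure_empty if_False)
  qed
qed

end

section \<open>Independence of the coordinates\<close>

definition lattice_Z :: "orientation \<Rightarrow> nat \<Rightarrow> nat \<Rightarrow> (nat \<Rightarrow> int) pmf" where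
  "lattice_Z \<sigma> k n = discrete_walk (lattice_step \<sigma> k \<infinity>) \<one>\<^bsub>cyc_power \<infinity> k\<^esub> n"

lemma one_cyc_power: "\<one>\<^bsub>cyc_power \<gamma> k\<^esub> = (\<lambda>i. if i < k then 0 else undefined)"
  by (cases \<gamma>) (auto simp: cyc_power_def cyc_def product_group_def restrict_def fun_eq_iff integer_mod_group_def)

lemma lattice_Z_Suc:
  assumes k: "0 < k"
  shows "pmf (lattice_Z \<sigma> k (Suc n)) y =
    (\<Sum>i<k. avg \<sigma> (\<lambda>e. pmf (lattice_Z \<sigma> k n) (y(i := y i - e)))) / real k"
proof -
  define up where "up i b x = x(i := x i + sgn_of b)" for i b and x :: "nat \<Rightarrow> int"
  have "lattice_Z \<sigma> k (Suc n) = bind_pmf (lattice_Z \<sigma> k n) (\<lambda>x. bind_pmf (pmf_of_set {..<k}) (\<lambda>i.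
      bind_pmf (sign_pmf \<sigma>) (\<lambda>b. return_pmf (up i b x))))"
    by (simp add: lattice_Z_def lattice_step_def[abs_def] cyc_def map_pmf_def up_def sgn_of_def)
  also have "\<dots> = bind_pmf (pmf_of_set {..<k}) (\<lambda>i. bind_pmf (sign_pmf \<sigma>) (\<lambda>b. map_pmf (up i b) (lattice_Z \<sigma> k n)))"
    unfolding map_pmf_def by (subst bind_commute_pmf, subst bind_commute_pmf[of "lattice_Z \<sigma> k n"]) rule
  finally have "pmf (lattice_Z \<sigma> k (Suc n)) y =
     (\<Sum>i<k. avg \<sigma> (\<lambda>e. pmf (map_pmf (up i (e = 1)) (lattice_Z \<sigma> k n)) y)) / real k"
    using k by (simp add: pmf_bind_pmf_of_set pmf_bind_sign lessThan_empty_iff)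
  also have "\<dots> = (\<Sum>i<k. avg \<sigma> (\<lambda>e. pmf (lattice_Z \<sigma> k n) (y(i := y i - e)))) / real k"
  proof (intro arg_cong2[where f = "(/)"] sum.cong refl avg_cong)
    fix i e assume "e \<in> steps \<sigma>"
    then have e: "sgn_of (e = 1) = e" by (auto simp: steps_def sgn_of_def split: orientation.splits)
    have inj: "inj (up i b)" for b
      by (rule injI) (auto simp: up_def fun_eq_iff split: if_splits)
    have "y = up i (e = 1) (y(i := y i - e))" by (simp add: up_def e)
    then show "pmf (map_pmf (up i (e = 1)) (lattice_Z \<sigma> k n)) y = pmf (lattice_Z \<sigma> k n) (y(i := y i - e))"
      using pmf_map_inj'[OF inj] by metis
  qed
  finally show ?thesis .
qed

lemma fps_deriv_prod:
  fixes f :: "'i \<Rightarrow> 'a::comm_ring_1 fps"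
  assumes "finite A"
  shows "fps_deriv (\<Prod>i\<in>A. f i) = (\<Sum>i\<in>A. fps_deriv (f i) * (\<Prod>j\<in>A - {i}. f j))"
  using assms
proof (induction rule: finite_induct)
  case (insert a A)
  have "(\<Sum>i\<in>A. fps_deriv (f i) * (\<Prod>j\<in>insert a A - {i}. f j)) =
      f a * (\<Sum>i\<in>A. fps_deriv (f i) * (\<Prod>j\<in>A - {i}. f j))"
    unfolding sum_distrib_left
  proof (rule sum.cong[OF refl])
    fix i assume i: "i \<in> A"
    then have "insert a A - {i} = insert a (A - {i})" using insert by auto
    then show "fps_deriv (f i) * (\<Prod>j\<in>insert a A - {i}. f j) = f a * (fps_deriv (f i) * (\<Prod>j\<in>A - {i}. f j))"
      using insert by (simp add: mult_ac)
  qed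
  moreover have "insert a A - {a} = A" using insert by auto
  ultimately show ?case using insert by (simp add: mult_ac)
qed simp

text \<open>The exponential generating function, in the number of steps, of the probability that one
coordinate is at \<open>y\<close>, with time scaled by \<open>1 / k\<close>.\<close>

definition walk_fps :: "orientation \<Rightarrow> nat \<Rightarrow> int \<Rightarrow> real fps" where
  "walk_fps \<sigma> k y = Abs_fps (\<lambda>n. pmf (discrete_walk (int_step \<sigma>) 0 n) y / (real k ^ n * fact n))"

lemma avg_divide: "avg \<sigma> (\<lambda>e. f e / c) = avg \<sigma> f / c"
  by (simp add: divide_inverse avg_mult2)

lemma walk_fps_deriv:
  assumes "0 < k"
  shows "fps_nth (fps_deriv (walk_fps \<sigma> k y)) n = avg \<sigma> (\<lambda>e. fps_nth (walk_fps \<sigma> k (y - e)) n) / real k"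
  using assms
  by (simp add: walk_fps_def pmf_discrete_int_walk_Suc avg_divide del: discrete_walk.simps of_nat_Suc)

lemma fps_nth_avg:
  "avg \<sigma> (\<lambda>e. fps_nth (f e * g) n) = (\<Sum>i=0..n. avg \<sigma> (\<lambda>e. fps_nth (f e) i) * fps_nth g (n - i))"
  by (simp add: fps_mult_nth avg_sum avg_mult2)

text \<open>The product of the generating functions of the coordinates satisfies the recursion of
the walk on \<open>\<int>\<^sup>k\<close>, by the product rule: each step moves one
coordinate.\<close>

lemma prod_walk_fps:
  assumes k: "0 < k" and x: "\<And>i. i \<ge> k \<Longrightarrow> x i = undefined"
  shows "fact n * fps_nth (\<Prod>i<k. walk_fps \<sigma> k (x i)) n = pmf (lattice_Z \<sigma> k n) x"
  using x
proof (induction n arbitrary: x)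
  case 0
  have "fps_nth (\<Prod>i<k. walk_fps \<sigma> k (x i)) 0 = (\<Prod>i<k. of_bool (x i = 0))"
    by (simp add: fps_prod_nth' walk_fps_def indicator_def)
  also have "\<dots> = of_bool (\<forall>i<k. x i = 0)" by (induction k) (auto simp: less_Suc_eq)
  also have "\<dots> = pmf (lattice_Z \<sigma> k 0) x"
  proof -
    have "(\<lambda>i. if i < k then 0 else undefined) = x \<longleftrightarrow> (\<forall>i<k. x i = 0)"
      using 0 by (auto simp: fun_eq_iff not_less)
    then show ?thesis by (simp add: lattice_Z_def one_cyc_power indicator_def)
  qed
  finally show ?case by simp
next
  case (Suc n)
  let ?P = "\<lambda>x. \<Prod>i<k. walk_fps \<sigma> k (x i)"
  have "fact (Suc n) * fps_nth (?P x) (Suc n) = fact n * fps_nth (fps_deriv (?P x)) n" by simp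
  also have "fps_nth (fps_deriv (?P x)) n = (\<Sum>i<k. fps_nth (fps_deriv (walk_fps \<sigma> k (x i)) * (\<Prod>j\<in>{..<k} - {i}. walk_fps \<sigma> k (x j))) n)"
    by (simp add: fps_deriv_prod fps_sum_nth del: fps_deriv_nth)
  also have "\<dots> = (\<Sum>i<k. avg \<sigma> (\<lambda>e. fps_nth (?P (x(i := x i - e))) n) / real k)"
  proof (rule sum.cong[OF refl])
    fix i assume i: "i \<in> {..<k}"
    let ?R = "\<Prod>j\<in>{..<k} - {i}. walk_fps \<sigma> k (x j)"
    have "fps_nth (fps_deriv (walk_fps \<sigma> k (x i)) * ?R) n =
      (\<Sum>m=0..n. avg \<sigma> (\<lambda>e. fps_nth (walk_fps \<sigma> k (x i - e)) m) * fps_nth ?R (n - m)) / real k"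
      by (simp add: fps_mult_nth walk_fps_deriv[OF k] sum_divide_distrib del: fps_deriv_nth)
    also have "\<dots> = avg \<sigma> (\<lambda>e. fps_nth (walk_fps \<sigma> k (x i - e) * ?R) n) / real k"
      by (simp add: fps_nth_avg)
    also have "(\<lambda>e. walk_fps \<sigma> k (x i - e) * ?R) = (\<lambda>e. ?P (x(i := x i - e)))"
    proof
      fix e
      have "?P (x(i := x i - e)) = walk_fps \<sigma> k (x i - e) * (\<Prod>j\<in>{..<k} - {i}. walk_fps \<sigma> k ((x(i := x i - e)) j))"
        using i by (subst prod.remove[of _ i]) auto
      also have "(\<Prod>j\<in>{..<k} - {i}. walk_fps \<sigma> k ((x(i := x i - e)) j)) = ?R"
        by (rule prod.cong) auto
      finally show "walk_fps \<sigma> k (x i - e) * ?R = ?P (x(i := x i - e))" ..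
    qed
    finally show "fps_nth (fps_deriv (walk_fps \<sigma> k (x i)) * ?R) n = avg \<sigma> (\<lambda>e. fps_nth (?P (x(i := x i - e))) n) / real k" .
  qed
  also have "fact n * \<dots> = (\<Sum>i<k. avg \<sigma> (\<lambda>e. fact n * fps_nth (?P (x(i := x i - e))) n) / real k)"
    by (simp add: sum_distrib_left avg_cmult)
  also have "\<dots> = (\<Sum>i<k. avg \<sigma> (\<lambda>e. pmf (lattice_Z \<sigma> k n) (x(i := x i - e))) / real k)"
    using Suc.prems by (intro sum.cong refl arg_cong2[where f = "(/)"] avg_cong Suc.IH) auto
  also have "\<dots> = pmf (lattice_Z \<sigma> k (Suc n)) x"
    by (simp add: lattice_Z_Suc[OF k] sum_divide_distrib)
  finally show ?case .
qed

lemma walk_fps_eval: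
  assumes k: "0 < k"
  shows "fps_conv_radius (walk_fps \<sigma> k y) = \<infinity>"
    and "eval_fps (walk_fps \<sigma> k y) t = exp (t / k) * poisson_mean (t / k) (\<lambda>n. pmf (discrete_walk (int_step \<sigma>) 0 n) y)"
proof -
  have bd: "bounded_seq (\<lambda>n. pmf (discrete_walk (int_step \<sigma>) 0 n) y)"
    by (rule bounded_seqI[of _ 1]) (simp add: pmf_le_1)
  have eq: "fps_nth (walk_fps \<sigma> k y) n * t ^ n =
    exp (t / k) * ((exp (- (t / k)) * (t / k) ^ n / fact n) *\<^sub>R pmf (discrete_walk (int_step \<sigma>) 0 n) y)" for n t
    by (simp add: walk_fps_def power_divide exp_minus)
  show "fps_conv_radius (walk_fps \<sigma> k y) = \<infinity>"
    unfolding fps_conv_radius_def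
    by (rule conv_radius_inftyI'') (unfold eq, intro summable_mult summable_poisson_mean bd)
  show "eval_fps (walk_fps \<sigma> k y) t = exp (t / k) * poisson_mean (t / k) (\<lambda>n. pmf (discrete_walk (int_step \<sigma>) 0 n) y)"
    unfolding eval_fps_def eq poisson_mean_def by (intro suminf_mult summable_poisson_mean bd)
qed

lemma eval_fps_prod:
  fixes f :: "'i \<Rightarrow> real fps"
  assumes "finite A" "\<And>i. i \<in> A \<Longrightarrow> fps_conv_radius (f i) = \<infinity>"
  shows "fps_conv_radius (\<Prod>i\<in>A. f i) = \<infinity> \<and> eval_fps (\<Prod>i\<in>A. f i) t = (\<Prod>i\<in>A. eval_fps (f i) t)"
  using assms
proof (induction rule: finite_induct)
  case (insert a A)
  then have IH: "fps_conv_radius (prod f A) = \<infinity>" "eval_fps (prod f A) t = (\<Prod>i\<in>A. eval_fps (f i) t)"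
    and fa: "fps_conv_radius (f a) = \<infinity>" by auto
  have "fps_conv_radius (f a * prod f A) \<ge> min (fps_conv_radius (f a)) (fps_conv_radius (prod f A))"
    by (rule fps_conv_radius_mult)
  then have "fps_conv_radius (f a * prod f A) = \<infinity>" using IH fa by simp
  moreover have "eval_fps (f a * prod f A) t = eval_fps (f a) t * eval_fps (prod f A) t"
    by (rule eval_fps_mult) (auto simp: IH fa)
  ultimately show ?case using insert IH by simp
qed simp

lemma pmf_lattice_walk_Z:
  assumes k: "0 < k" and t: "0 \<le> t" and x: "\<And>i. i \<ge> k \<Longrightarrow> x i = undefined"
  shows "pmf (lattice_walk \<sigma> k \<infinity> t) x = (\<Prod>i<k. pmf (int_walk \<sigma> (t / k)) (x i))"
proof -
  have bd: "bounded_seq (\<lambda>n. pmf (lattice_Z \<sigma> k n) x)"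
    by (rule bounded_seqI[of _ 1]) (simp add: pmf_le_1)
  have "pmf (lattice_walk \<sigma> k \<infinity> t) x = poisson_mean t (\<lambda>n. pmf (lattice_Z \<sigma> k n) x)"
    by (simp add: lattice_walk_def pmf_walk_law[OF t] lattice_Z_def)
  also have "\<dots> = exp (-t) * eval_fps (\<Prod>i<k. walk_fps \<sigma> k (x i)) t"
  proof -
    have "fps_nth (\<Prod>i<k. walk_fps \<sigma> k (x i)) n = pmf (lattice_Z \<sigma> k n) x / fact n" for n
      using prod_walk_fps[where n = n and \<sigma> = \<sigma>, OF k x] by (simp add: field_simps)
    then show ?thesis unfolding poisson_mean_power_series[OF bd] eval_fps_def by simp
  qed
  also have "eval_fps (\<Prod>i<k. walk_fps \<sigma> k (x i)) t =
      (\<Prod>i<k. exp (t / k) * pmf (int_walk \<sigma> (t / k)) (x i))"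
    using eval_fps_prod[of "{..<k}" "\<lambda>i. walk_fps \<sigma> k (x i)" t] walk_fps_eval[OF k] t
    by (simp add: int_walk_def pmf_walk_law)
  also have "exp (-t) * \<dots> = exp (-t) * exp (t / k) ^ k * (\<Prod>i<k. pmf (int_walk \<sigma> (t / k)) (x i))"
    by (simp add: prod.distrib)
  also have "exp (-t) * exp (t / k) ^ k = 1"
    using k by (simp add: exp_of_nat_mult[symmetric] exp_add[symmetric])
  finally show ?thesis by simp
qed

lemma lattice_walk_Z_support:
  assumes "x \<in> set_pmf (lattice_walk \<sigma> k \<infinity> t)" "0 < k" "i \<ge> k"
  shows "x i = undefined"
proof -
  have *: "\<forall>x\<in>set_pmf (lattice_Z \<sigma> k n). \<forall>i\<ge>k. x i = undefined" for n
  proof (induction n)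
    case 0
    show ?case by (simp add: lattice_Z_def one_cyc_power)
  next
    case (Suc n)
    then show ?case using assms(2)
      by (force simp: lattice_Z_def lattice_step_def lessThan_empty_iff)
  qed
  then show ?thesis using assms
    by (auto simp: lattice_walk_def walk_law_def lattice_Z_def)
qed

text \<open>Poissonization turns the identity of exponential generating functions into an identity
of probabilities, which is the independence of the coordinates.\<close>

lemma lattice_walk_Z_product:
  assumes k: "0 < k" and t: "0 \<le> t"
  shows "lattice_walk \<sigma> k \<infinity> t = Pi_pmf {..<k} undefined (\<lambda>_. int_walk \<sigma> (t / k))"
proof (rule pmf_eqI)
  fix x
  show "pmf (lattice_walk \<sigma> k \<infinity> t) x = pmf (Pi_pmf {..<k} undefined (\<lambda>_. int_walk \<sigma> (t / k))) x"
  proof (cases "\<forall>i\<ge>k. x i = undefined")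
    case True
    then show ?thesis using pmf_lattice_walk_Z[OF k t, of x] by (subst pmf_Pi) auto
  next
    case False
    then have "x \<notin> set_pmf (lattice_walk \<sigma> k \<infinity> t)" using lattice_walk_Z_support k by blast
    then have "pmf (lattice_walk \<sigma> k \<infinity> t) x = 0" by (simp add: set_pmf_iff)
    moreover have "pmf (Pi_pmf {..<k} undefined (\<lambda>_. int_walk \<sigma> (t / k))) x = 0"
      using False by (subst pmf_Pi) auto
    ultimately show ?thesis by simp
  qed
qed

section \<open>Entropy of discrete laws\<close>

abbreviation surprisal :: "'s pmf \<Rightarrow> 's \<Rightarrow> real" where
  "surprisal P x \<equiv> - ln (pmf P x)"

lemma surprisal_nonneg: "0 \<le> surprisal P x"
  by (cases "pmf P x = 0") (auto simp: pmf_le_1 pmf_nonneg less_le intro!: ln_le_zero_iff[THEN iffD2])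

lemma shannon_entropy_expectation:
  assumes "integrable (measure_pmf P) (surprisal P)"
  shows "shannon_entropy P = measure_pmf.expectation P (surprisal P)"
proof -
  let ?f = "\<lambda>x. pmf P x * surprisal P x"
  have i: "integrable (count_space UNIV) ?f"
  proof -
    have "integrable (measure_pmf P) (\<lambda>x. ln (pmf P x))" using assms by simp
    then have "integrable (density (count_space UNIV) (\<lambda>x. ennreal (pmf P x))) (\<lambda>x. ln (pmf P x))"
      by (simp only: measure_pmf_eq_density)
    moreover have "integrable (density (count_space UNIV) (\<lambda>x. ennreal (pmf P x))) (\<lambda>x. ln (pmf P x)) \<longleftrightarrow>
        integrable (count_space UNIV) (\<lambda>x. pmf P x *\<^sub>R ln (pmf P x))"
      by (rule integrable_density) (auto simp: AE_count_space)
    ultimately have "integrable (count_space UNIV) (\<lambda>x. pmf P x *\<^sub>R ln (pmf P x))" by (rule iffD1[rotated])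
    from Bochner_Integration.integrable_minus[OF this] show ?thesis
      by (simp only: real_scaleR_def mult_minus_right)
  qed
  have "measure_pmf.expectation P (surprisal P) = infsetsum ?f UNIV"
    by (rule pmf_expectation_eq_infsetsum)
  also have "\<dots> = infsum ?f UNIV"
    by (rule infsetsum_infsum) (unfold Infinite_Set_Sum.abs_summable_on_def, rule i)
  also have "\<dots> = infsum ?f (set_pmf P)"
    by (rule infsum_cong_neutral) (auto simp: set_pmf_iff)
  also have "\<dots> = shannon_entropy P"
    unfolding shannon_entropy_def by (rule infsum_cong) simp
  finally show ?thesis ..
qed

lemma surprisal_map_le:
  assumes "x \<in> set_pmf P"
  shows "surprisal (map_pmf f P) (f x) \<le> surprisal P x"
proof -
  have "pmf P x \<le> pmf (map_pmf f P) (f x)"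
  proof -
    have "measure_pmf.prob P {x} \<le> measure_pmf.prob P (f -` {f x})"
      by (rule measure_pmf.finite_measure_mono) auto
    then show ?thesis by (simp add: pmf_map measure_pmf_single)
  qed
  moreover have "0 < pmf P x" using assms by (simp add: pmf_positive)
  ultimately show ?thesis by simp
qed

lemma integrable_surprisal_map:
  assumes "integrable (measure_pmf P) (surprisal P)"
  shows "integrable (measure_pmf (map_pmf f P)) (surprisal (map_pmf f P))"
proof -
  have "integrable (measure_pmf P) (\<lambda>x. surprisal (map_pmf f P) (f x))"
  proof (rule Bochner_Integration.integrable_bound[OF assms])
    show "AE x in P. norm (surprisal (map_pmf f P) (f x)) \<le> norm (surprisal P x)"
    proof (rule AE_pmfI)
      fix x assume "x \<in> set_pmf P"
      from surprisal_map_le[OF this, of f] surprisal_nonneg[of P x] surprisal_nonneg[of "map_pmf f P" "f x"]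
      show "norm (surprisal (map_pmf f P) (f x)) \<le> norm (surprisal P x)"
        unfolding real_norm_def by linarith
    qed
  qed simp
  then show ?thesis by simp
qed

lemma shannon_entropy_map_le:
  assumes "integrable (measure_pmf P) (surprisal P)"
  shows "shannon_entropy (map_pmf f P) \<le> shannon_entropy P"
proof -
  have i: "integrable (measure_pmf P) (\<lambda>x. surprisal (map_pmf f P) (f x))"
    using integrable_surprisal_map[OF assms, of f] by simp
  have "shannon_entropy (map_pmf f P) = measure_pmf.expectation P (\<lambda>x. surprisal (map_pmf f P) (f x))"
    using shannon_entropy_expectation[OF integrable_surprisal_map[OF assms, of f]] by simp
  also have "\<dots> \<le> measure_pmf.expectation P (surprisal P)"
    by (rule integral_mono_AE[OF i assms], rule AE_pmfI, rule surprisal_map_le)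
  also have "\<dots> = shannon_entropy P" by (rule shannon_entropy_expectation[OF assms, symmetric])
  finally show ?thesis .
qed

text \<open>The reference \<open>r\<close> may have total mass below 1. Integrability of the
information content comes out of the same comparison.\<close>

lemma gibbs:
  fixes r :: "'s \<Rightarrow> real"
  assumes r: "\<And>x. x \<in> set_pmf P \<Longrightarrow> 0 < r x"
    and sum: "\<And>F. finite F \<Longrightarrow> F \<subseteq> set_pmf P \<Longrightarrow> (\<Sum>x\<in>F. r x) \<le> 1"
    and i: "integrable (measure_pmf P) (\<lambda>x. - ln (r x))"
  shows "integrable (measure_pmf P) (surprisal P)"
    and "shannon_entropy P \<le> measure_pmf.expectation P (\<lambda>x. - ln (r x))"
proof -
  let ?g = "\<lambda>x. r x / pmf P x"
  have ratio: "(\<integral>\<^sup>+x. ennreal (?g x) \<partial>P) \<le> 1"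
  proof -
    have "(\<integral>\<^sup>+x. ennreal (?g x) \<partial>P) = (\<integral>\<^sup>+x. ennreal (pmf P x) * ennreal (?g x) \<partial>count_space UNIV)"
      by (simp add: measure_pmf_eq_density nn_integral_density)
    also have "\<dots> = (\<integral>\<^sup>+x. ennreal (r x) * indicator (set_pmf P) x \<partial>count_space UNIV)"
    proof (intro nn_integral_cong)
      fix x
      show "ennreal (pmf P x) * ennreal (?g x) = ennreal (r x) * indicator (set_pmf P) x"
      proof (cases "x \<in> set_pmf P")
        case True
        then have "0 < pmf P x" by (simp add: pmf_positive)
        then show ?thesis using True r[OF True] by (simp add: ennreal_mult[symmetric])
      qed (simp add: set_pmf_iff)
    qed
    also have "\<dots> = (\<integral>\<^sup>+x. ennreal (r x) \<partial>count_space (set_pmf P))"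
      by (simp add: nn_integral_count_space_indicator)
    also have "\<dots> \<le> 1"
    proof -
      have r0: "\<And>x. x \<in> set_pmf P \<Longrightarrow> 0 \<le> r x" using r by (auto intro: less_imp_le)
      have sm: "r summable_on set_pmf P"
        by (rule nonneg_bdd_above_summable_on) (auto intro!: bdd_aboveI2[where M = 1] simp: r0 sum)
      then have "Infinite_Sum.abs_summable_on r (set_pmf P)"
        by (rule summable_on_iff_abs_summable_on_real[THEN iffD1])
      then have as: "Infinite_Set_Sum.abs_summable_on r (set_pmf P)"
        by (simp only: abs_summable_equivalent)
      then have "integrable (count_space (set_pmf P)) r"
        by (simp add: Infinite_Set_Sum.abs_summable_on_def)
      then have "(\<integral>\<^sup>+x. ennreal (r x) \<partial>count_space (set_pmf P)) = ennreal (infsetsum r (set_pmf P))"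
        unfolding infsetsum_def by (rule nn_integral_eq_integral) (simp add: AE_count_space r0)
      also have "infsetsum r (set_pmf P) = infsum r (set_pmf P)" by (rule infsetsum_infsum[OF as])
      also have "ennreal (infsum r (set_pmf P)) \<le> 1"
        using infsum_le_finite_sums[OF sm, of 1] sum by simp
      finally show ?thesis .
    qed
    finally show ?thesis .
  qed
  have g0: "AE x in P. 0 \<le> ?g x" using r by (auto simp: AE_measure_pmf_iff pmf_nonneg less_imp_le)
  have ig: "integrable (measure_pmf P) ?g"
    using ratio by (intro integrableI_nonneg) (auto simp: g0 intro: le_less_trans[OF _ ennreal_one_less_top])
  have Eg: "measure_pmf.expectation P ?g \<le> 1"
  proof -
    have "ennreal (measure_pmf.expectation P ?g) \<le> 1"
      using nn_integral_eq_integral[OF ig g0] ratio by simp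
    then show ?thesis by simp
  qed
  have pt: "surprisal P x \<le> - ln (r x) + (?g x - 1)" if x: "x \<in> set_pmf P" for x
  proof -
    have "0 < pmf P x" using x by (simp add: pmf_positive)
    then show ?thesis using ln_le_minus_one[of "?g x"] r[OF x] ln_divide_pos[of "r x" "pmf P x"] by simp
  qed
  have ib: "integrable (measure_pmf P) (\<lambda>x. - ln (r x) + (?g x - 1))"
    by (intro Bochner_Integration.integrable_add i Bochner_Integration.integrable_diff ig) simp
  show 1: "integrable (measure_pmf P) (surprisal P)"
  proof (rule Bochner_Integration.integrable_bound[OF ib])
    show "AE x in P. norm (surprisal P x) \<le> norm (- ln (r x) + (?g x - 1))"
      unfolding AE_measure_pmf_iff
    proof
      fix x assume "x \<in> set_pmf P"
      from pt[OF this] surprisal_nonneg[of P x]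
      show "norm (surprisal P x) \<le> norm (- ln (r x) + (?g x - 1))" by simp
    qed
  qed simp
  have "shannon_entropy P = measure_pmf.expectation P (surprisal P)" by (rule shannon_entropy_expectation[OF 1])
  also have "\<dots> \<le> measure_pmf.expectation P (\<lambda>x. - ln (r x) + (?g x - 1))"
    by (rule integral_mono_AE[OF 1 ib], rule AE_pmfI, rule pt)
  also have "\<dots> = measure_pmf.expectation P (\<lambda>x. - ln (r x)) + (measure_pmf.expectation P ?g - 1)"
    using i ig by simp
  also have "\<dots> \<le> measure_pmf.expectation P (\<lambda>x. - ln (r x))" using Eg by simp
  finally show "shannon_entropy P \<le> measure_pmf.expectation P (\<lambda>x. - ln (r x))" .
qed

lemma surprisal_Pi:
  assumes "finite A" "x \<in> set_pmf (Pi_pmf A d P)"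
  shows "surprisal (Pi_pmf A d P) x = (\<Sum>i\<in>A. surprisal (P i) (x i))"
proof -
  have x: "\<And>i. i \<notin> A \<Longrightarrow> x i = d" "\<And>i. i \<in> A \<Longrightarrow> x i \<in> set_pmf (P i)"
    using assms by (auto simp: set_Pi_pmf PiE_dflt_def)
  have "ln (\<Prod>i\<in>A. pmf (P i) (x i)) = (\<Sum>i\<in>A. ln (pmf (P i) (x i)))"
    using x(2) by (intro ln_prod assms) (auto simp: set_pmf_iff)
  then show ?thesis using x(1) by (subst pmf_Pi'[OF assms(1)]) (auto simp: sum_negf)
qed

lemma Pi_component_integral:
  fixes g :: "'b \<Rightarrow> real"
  assumes "finite A" "i \<in> A" "integrable (measure_pmf (P i)) g"
  shows "integrable (measure_pmf (Pi_pmf A d P)) (\<lambda>x. g (x i))"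
    and "measure_pmf.expectation (Pi_pmf A d P) (\<lambda>x. g (x i)) = measure_pmf.expectation (P i) g"
proof -
  have eq: "map_pmf (\<lambda>x. x i) (Pi_pmf A d P) = P i" using Pi_pmf_component[OF assms(1), of i d P] assms(2) by simp
  have "integrable (map_pmf (\<lambda>x. x i) (Pi_pmf A d P)) g" unfolding eq by (rule assms)
  then show "integrable (measure_pmf (Pi_pmf A d P)) (\<lambda>x. g (x i))" by simp
  have "measure_pmf.expectation (map_pmf (\<lambda>x. x i) (Pi_pmf A d P)) g = measure_pmf.expectation (P i) g"
    unfolding eq ..
  then show "measure_pmf.expectation (Pi_pmf A d P) (\<lambda>x. g (x i)) = measure_pmf.expectation (P i) g" by simp
qed

text \<open>The information content of a product law is the sum of those of its components.\<close>

lemma shannon_entropy_Pi: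
  assumes "finite A" "\<And>i. i \<in> A \<Longrightarrow> integrable (measure_pmf (P i)) (surprisal (P i))"
  shows "integrable (measure_pmf (Pi_pmf A d P)) (surprisal (Pi_pmf A d P))"
    and "shannon_entropy (Pi_pmf A d P) = (\<Sum>i\<in>A. shannon_entropy (P i))"
proof -
  have ae: "AE x in Pi_pmf A d P. (\<Sum>i\<in>A. surprisal (P i) (x i)) = surprisal (Pi_pmf A d P) x"
    by (rule AE_pmfI, rule surprisal_Pi[OF assms(1), symmetric])
  have isum: "integrable (measure_pmf (Pi_pmf A d P)) (\<lambda>x. \<Sum>i\<in>A. surprisal (P i) (x i))"
    by (intro Bochner_Integration.integrable_sum Pi_component_integral(1) assms)
  show 1: "integrable (measure_pmf (Pi_pmf A d P)) (surprisal (Pi_pmf A d P))"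
    by (rule integrable_cong_AE_imp[OF isum]) (use ae in auto)
  have "shannon_entropy (Pi_pmf A d P) = measure_pmf.expectation (Pi_pmf A d P) (surprisal (Pi_pmf A d P))"
    by (rule shannon_entropy_expectation[OF 1])
  also have "\<dots> = measure_pmf.expectation (Pi_pmf A d P) (\<lambda>x. \<Sum>i\<in>A. surprisal (P i) (x i))"
    by (rule integral_cong_AE) (use ae in auto)
  also have "\<dots> = (\<Sum>i\<in>A. measure_pmf.expectation (Pi_pmf A d P) (\<lambda>x. surprisal (P i) (x i)))"
    by (intro Bochner_Integration.integral_sum Pi_component_integral(1) assms)
  also have "\<dots> = (\<Sum>i\<in>A. measure_pmf.expectation (P i) (surprisal (P i)))"
    by (intro sum.cong refl Pi_component_integral(2) assms)
  also have "\<dots> = (\<Sum>i\<in>A. shannon_entropy (P i))"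
    by (intro sum.cong refl shannon_entropy_expectation[symmetric] assms)
  finally show "shannon_entropy (Pi_pmf A d P) = (\<Sum>i\<in>A. shannon_entropy (P i))" .
qed

lemma expectation_pair_pmf_finite:
  fixes f :: "_ \<Rightarrow> real"
  assumes "finite (set_pmf P)" "finite (set_pmf Q)"
  shows "measure_pmf.expectation (pair_pmf P Q) f =
    measure_pmf.expectation P (\<lambda>y. measure_pmf.expectation Q (\<lambda>x. f (y, x)))"
proof -
  have "pair_pmf P Q = bind_pmf P (\<lambda>y. map_pmf (Pair y) Q)" by (simp add: pair_pmf_def map_pmf_def)
  then have "measure_pmf.expectation (pair_pmf P Q) f =
     (\<Sum>y\<in>set_pmf P. pmf P y *\<^sub>R measure_pmf.expectation (map_pmf (Pair y) Q) f)"
    using pmf_expectation_bind[OF assms(1), of "\<lambda>y. map_pmf (Pair y) Q" P f] assms by simp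
  also have "\<dots> = measure_pmf.expectation P (\<lambda>y. measure_pmf.expectation Q (\<lambda>x. f (y, x)))"
    by (subst integral_measure_pmf[OF assms(1)]) auto
  finally show ?thesis .
qed

text \<open>The variance of a sum of independent copies. With Chebyshev it gives the concentration
of the information content.\<close>

lemma variance_Pi:
  fixes g :: "'b \<Rightarrow> real"
  assumes "finite A" and fin: "finite (set_pmf P)"
  shows "measure_pmf.expectation (Pi_pmf A d (\<lambda>_. P)) (\<lambda>x. ((\<Sum>i\<in>A. g (x i)) - card A * measure_pmf.expectation P g)\<^sup>2)
    = card A * measure_pmf.expectation P (\<lambda>y. (g y - measure_pmf.expectation P g)\<^sup>2)"
  using assms(1)
proof (induction rule: finite_induct)
  case (insert a A)
  define m where "m = measure_pmf.expectation P g"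
  let ?Q = "Pi_pmf A d (\<lambda>_. P)"
  define S where "S x = (\<Sum>i\<in>A. g (x i)) - card A * m" for x :: "'a \<Rightarrow> 'b"
  have finQ: "finite (set_pmf ?Q)" using fin insert(1) by (subst set_Pi_pmf) (auto intro: finite_PiE_dflt)
  have int: "integrable (measure_pmf P) f" "integrable (measure_pmf ?Q) f'"
    "integrable (measure_pmf (pair_pmf P ?Q)) f''" for f :: "_ \<Rightarrow> real" and f' :: "_ \<Rightarrow> real" and f'' :: "_ \<Rightarrow> real"
    using fin finQ by (auto intro!: integrable_measure_pmf_finite)
  have ES: "measure_pmf.expectation ?Q S = 0"
  proof -
    have "measure_pmf.expectation ?Q S = (\<Sum>i\<in>A. measure_pmf.expectation ?Q (\<lambda>x. g (x i))) - card A * m"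
      unfolding S_def by (simp add: int)
    also have "\<dots> = (\<Sum>i\<in>A. m) - card A * m"
      unfolding m_def using insert(1) by (intro arg_cong2[where f = "(-)"] sum.cong refl Pi_component_integral(2) int)
    finally show ?thesis by simp
  qed
  have "measure_pmf.expectation (Pi_pmf (insert a A) d (\<lambda>_. P)) (\<lambda>x. ((\<Sum>i\<in>insert a A. g (x i)) - card (insert a A) * m)\<^sup>2)
    = measure_pmf.expectation (pair_pmf P ?Q) (\<lambda>(y, x). ((g y - m) + S x)\<^sup>2)"
  proof -
    have "(\<Sum>i\<in>insert a A. g ((x(a := y)) i)) - real (card (insert a A)) * m = (g y - m) + S x" for y x
    proof -
      have "(\<Sum>i\<in>A. g ((x(a := y)) i)) = (\<Sum>i\<in>A. g (x i))"
        using insert by (intro sum.cong) auto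
      then have "(\<Sum>i\<in>insert a A. g ((x(a := y)) i)) = g y + (\<Sum>i\<in>A. g (x i))" using insert by simp
      moreover have "real (card (insert a A)) * m = m + real (card A) * m"
        using insert by (simp add: distrib_right)
      ultimately show ?thesis by (simp add: S_def)
    qed
    then show ?thesis
      unfolding Pi_pmf_insert[OF insert(1,2)] integral_map_pmf case_prod_unfold by simp
  qed
  also have "\<dots> = measure_pmf.expectation P (\<lambda>y. measure_pmf.expectation ?Q (\<lambda>x. ((g y - m) + S x)\<^sup>2))"
    using expectation_pair_pmf_finite[OF fin finQ] by simp
  also have "\<dots> = measure_pmf.expectation P (\<lambda>y. (g y - m)\<^sup>2 + measure_pmf.expectation ?Q (\<lambda>x. (S x)\<^sup>2))"
  proof -
    have "measure_pmf.expectation ?Q (\<lambda>x. (c + S x)\<^sup>2) = c\<^sup>2 + measure_pmf.expectation ?Q (\<lambda>x. (S x)\<^sup>2)" for c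
    proof -
      have "measure_pmf.expectation ?Q (\<lambda>x. (c + S x)\<^sup>2) = measure_pmf.expectation ?Q (\<lambda>x. c\<^sup>2 + 2 * c * S x + (S x)\<^sup>2)"
        by (simp only: power2_sum) (simp only: add.commute add.left_commute)
      also have "\<dots> = c\<^sup>2 + 2 * c * measure_pmf.expectation ?Q S + measure_pmf.expectation ?Q (\<lambda>x. (S x)\<^sup>2)"
        by (simp add: int)
      finally show ?thesis by (simp add: ES)
    qed
    then show ?thesis by simp
  qed
  also have "\<dots> = measure_pmf.expectation P (\<lambda>y. (g y - m)\<^sup>2) + card A * measure_pmf.expectation P (\<lambda>y. (g y - m)\<^sup>2)"
    using insert.IH by (simp add: int S_def m_def)
  finally show ?case using insert by (simp add: m_def distrib_right)
qed simp

section \<open>Moments of the walk on the integers\<close>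

lemma set_discrete_int_walk: "set_pmf (discrete_walk (int_step \<sigma>) 0 n) \<subseteq> {- int n..int n}"
proof (induction n)
  case (Suc n)
  then show ?case by (force simp: int_step_def sgn_of_def)
qed simp

lemma finite_discrete_int_walk: "finite (set_pmf (discrete_walk (int_step \<sigma>) 0 n))"
  using set_discrete_int_walk by (rule finite_subset) simp

lemma expectation_discrete_int_walk_Suc:
  fixes f :: "int \<Rightarrow> real"
  shows "measure_pmf.expectation (discrete_walk (int_step \<sigma>) 0 (Suc n)) f =
    measure_pmf.expectation (discrete_walk (int_step \<sigma>) 0 n) (\<lambda>x. avg \<sigma> (\<lambda>e. f (x + e)))"
proof -
  let ?D = "discrete_walk (int_step \<sigma>) 0 n"
  have fin: "finite (set_pmf (int_step \<sigma> x))" for x by (simp add: int_step_def)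
  have step: "measure_pmf.expectation (int_step \<sigma> x) f = avg \<sigma> (\<lambda>e. f (x + e))" for x
    by (cases \<sigma>) (auto simp: int_step_def sign_pmf_def avg_def sgn_of_def)
  have "measure_pmf.expectation (discrete_walk (int_step \<sigma>) 0 (Suc n)) f =
     (\<Sum>x\<in>set_pmf ?D. pmf ?D x *\<^sub>R measure_pmf.expectation (int_step \<sigma> x) f)"
    using pmf_expectation_bind[OF finite_discrete_int_walk, of \<sigma> n "int_step \<sigma>" ?D f] fin by simp
  also have "\<dots> = measure_pmf.expectation ?D (\<lambda>x. avg \<sigma> (\<lambda>e. f (x + e)))"
    by (subst integral_measure_pmf[OF finite_discrete_int_walk]) (auto simp: step)
  finally show ?thesis .
qed

definition drift :: "orientation \<Rightarrow> int" where
  "drift \<sigma> = (case \<sigma> of Directed \<Rightarrow> 1 | Undirected \<Rightarrow> 0)"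

lemma second_moment_discrete:
  "measure_pmf.expectation (discrete_walk (int_step \<sigma>) 0 n) (\<lambda>x. (of_int x - c)\<^sup>2) =
    (case \<sigma> of Directed \<Rightarrow> (real n - c)\<^sup>2 | Undirected \<Rightarrow> real n + c\<^sup>2)"
proof (induction n arbitrary: c)
  case 0
  show ?case by (cases \<sigma>) auto
next
  case (Suc n)
  show ?case
  proof (cases \<sigma>)
    case Directed
    have "(of_int (x + 1) - c)\<^sup>2 = (of_int x - (c - 1))\<^sup>2" for x by (simp add: algebra_simps)
    then show ?thesis using Suc[of "c - 1"] Directed
      by (simp only: expectation_discrete_int_walk_Suc avg_def orientation.case) (simp add: algebra_simps)
  next
    case Undirected
    let ?E = "measure_pmf.expectation (discrete_walk (int_step \<sigma>) 0 n)"
    have eq: "((of_int (x + 1) - c)\<^sup>2 + (of_int (x + - 1) - c)\<^sup>2) / 2 = (of_int x - c)\<^sup>2 + 1" for x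
      by (simp add: power2_eq_square field_simps)
    have "measure_pmf.expectation (discrete_walk (int_step \<sigma>) 0 (Suc n)) (\<lambda>x. (of_int x - c)\<^sup>2) =
       ?E (\<lambda>x. (of_int x - c)\<^sup>2 + 1)"
      by (simp only: expectation_discrete_int_walk_Suc avg_def Undirected orientation.case eq)
    also have "\<dots> = ?E (\<lambda>x. (of_int x - c)\<^sup>2) + 1"
      by (simp add: integrable_measure_pmf_finite finite_discrete_int_walk)
    finally show ?thesis using Suc[of c] Undirected by simp
  qed
qed

lemma nn_integral_poisson:
  assumes s: "0 < s" and f: "\<And>n. 0 \<le> f n" and sums: "(\<lambda>n. pmf (poisson_pmf s) n * f n) sums v"
  shows "(\<integral>\<^sup>+n. ennreal (f n) \<partial>poisson_pmf s) = ennreal v"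
proof -
  have "(\<integral>\<^sup>+n. ennreal (f n) \<partial>poisson_pmf s) = (\<integral>\<^sup>+n. ennreal (pmf (poisson_pmf s) n * f n) \<partial>count_space UNIV)"
    by (simp add: measure_pmf_eq_density nn_integral_density ennreal_mult[symmetric] f)
  also have "\<dots> = (\<Sum>n. ennreal (pmf (poisson_pmf s) n * f n))" by (rule nn_integral_count_space_nat)
  also have "\<dots> = ennreal v" by (rule suminf_ennreal_eq[OF _ sums]) (simp add: f)
  finally show ?thesis .
qed

lemma poisson_mean_1: "0 < s \<Longrightarrow> (\<lambda>n. pmf (poisson_pmf s) n * real n) sums s"
proof -
  assume s: "0 < s"
  have "(\<lambda>n. s * (exp (-s) * s ^ n / fact n)) sums (s * 1)"
    by (intro sums_mult poisson_weights_sums)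
  moreover have "s * (exp (-s) * s ^ n / fact n) = pmf (poisson_pmf s) (Suc n) * real (Suc n)" for n
    using s by (simp add: field_simps del: of_nat_Suc)
  ultimately have "(\<lambda>n. pmf (poisson_pmf s) (Suc n) * real (Suc n)) sums s" by simp
  then show ?thesis using sums_Suc_iff[of "\<lambda>n. pmf (poisson_pmf s) n * real n" s] by simp
qed

lemma poisson_mean_2: "0 < s \<Longrightarrow> (\<lambda>n. pmf (poisson_pmf s) n * (real n * real (n - 1))) sums s\<^sup>2"
proof -
  assume s: "0 < s"
  have "(\<lambda>n. s * (pmf (poisson_pmf s) n * real n)) sums (s * s)"
    by (intro sums_mult poisson_mean_1 s)
  moreover have "s * (pmf (poisson_pmf s) n * real n) = pmf (poisson_pmf s) (Suc n) * (real (Suc n) * real (Suc n - 1))" for n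
    using s by (simp add: field_simps del: of_nat_Suc)
  ultimately have "(\<lambda>n. pmf (poisson_pmf s) (Suc n) * (real (Suc n) * real (Suc n - 1))) sums s\<^sup>2"
    by (simp only: power2_eq_square)
  then show ?thesis using sums_Suc_iff[of "\<lambda>n. pmf (poisson_pmf s) n * (real n * real (n - 1))" "s\<^sup>2"] by simp
qed

lemma nn_integral_int_walk:
  assumes "0 < s"
  shows "(\<integral>\<^sup>+x. f x \<partial>int_walk \<sigma> s) = (\<integral>\<^sup>+n. (\<integral>\<^sup>+x. f x \<partial>discrete_walk (int_step \<sigma>) 0 n) \<partial>poisson_pmf s)"
  using assms by (simp add: int_walk_def walk_law_def nn_integral_bind_pmf)

lemma int_walk_0: "int_walk \<sigma> 0 = return_pmf 0"
  by (simp add: int_walk_def walk_law_def bind_return_pmf)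

lemma int_walk_mean_abs:
  assumes "0 \<le> s"
  shows "integrable (measure_pmf (int_walk \<sigma> s)) (\<lambda>x. \<bar>of_int x\<bar> :: real)"
    and "measure_pmf.expectation (int_walk \<sigma> s) (\<lambda>x. \<bar>of_int x\<bar>) \<le> s"
proof -
  have le: "(\<integral>\<^sup>+x. ennreal \<bar>of_int x\<bar> \<partial>int_walk \<sigma> s) \<le> ennreal s"
  proof (cases "s = 0")
    case False
    then have s: "0 < s" using assms by simp
    have "(\<integral>\<^sup>+x. ennreal \<bar>of_int x\<bar> \<partial>discrete_walk (int_step \<sigma>) 0 n) \<le> ennreal (real n)" for n
    proof -
      have "(\<integral>\<^sup>+x. ennreal \<bar>of_int x\<bar> \<partial>discrete_walk (int_step \<sigma>) 0 n) \<le> (\<integral>\<^sup>+x. ennreal (real n) \<partial>discrete_walk (int_step \<sigma>) 0 n)"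
      proof (intro nn_integral_mono_AE AE_pmfI)
        fix x assume "x \<in> set_pmf (discrete_walk (int_step \<sigma>) 0 n)"
        then have "x \<in> {- int n..int n}" using set_discrete_int_walk[of \<sigma> n] by blast
        then have "\<bar>x\<bar> \<le> int n" by auto
        then have "of_int \<bar>x\<bar> \<le> (of_int (int n) :: real)" by (simp only: of_int_le_iff)
        then show "ennreal \<bar>of_int x\<bar> \<le> ennreal (real n)" by (intro ennreal_leI) simp
      qed
      then show ?thesis by simp
    qed
    then have "(\<integral>\<^sup>+x. ennreal \<bar>of_int x\<bar> \<partial>int_walk \<sigma> s) \<le> (\<integral>\<^sup>+n. ennreal (real n) \<partial>poisson_pmf s)"
      unfolding nn_integral_int_walk[OF s] by (intro nn_integral_mono)
    also have "\<dots> = ennreal s" using poisson_mean_1[OF s] by (intro nn_integral_poisson s) auto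
    finally show ?thesis .
  qed (simp add: int_walk_0)
  show 1: "integrable (measure_pmf (int_walk \<sigma> s)) (\<lambda>x. \<bar>of_int x\<bar> :: real)"
    by (rule integrableI_nonneg) (use le in \<open>auto intro: le_less_trans\<close>)
  have "ennreal (measure_pmf.expectation (int_walk \<sigma> s) (\<lambda>x. \<bar>of_int x\<bar>)) \<le> ennreal s"
    using nn_integral_eq_integral[OF 1] le by simp
  then show "measure_pmf.expectation (int_walk \<sigma> s) (\<lambda>x. \<bar>of_int x\<bar>) \<le> s" using assms by simp
qed

text \<open>The centre cannot be chosen as the mean, which need not be an integer; rounding costs a
bounded multiple of the variance in the directed case.\<close>

lemma int_walk_centred:
  assumes s: "0 < s"
  obtains m :: int where "integrable (measure_pmf (int_walk \<sigma> s)) (\<lambda>x. (of_int x - of_int m)\<^sup>2 :: real)"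
    and "measure_pmf.expectation (int_walk \<sigma> s) (\<lambda>x. (of_int x - of_int m)\<^sup>2) \<le> 2 * s"
proof -
  define m where "m = (case \<sigma> of Directed \<Rightarrow> \<lfloor>s\<rfloor> | Undirected \<Rightarrow> 0)"
  define c where "c = (of_int m :: real)"
  define g where "g n = (case \<sigma> of Directed \<Rightarrow> (real n - c)\<^sup>2 | Undirected \<Rightarrow> real n + c\<^sup>2)" for n
  have g0: "0 \<le> g n" for n by (cases \<sigma>) (auto simp: g_def)
  have "\<exists>v. v \<le> 2 * s \<and> (\<lambda>n. pmf (poisson_pmf s) n * g n) sums v"
  proof (cases \<sigma>)
    case Directed
    have "(\<lambda>n. pmf (poisson_pmf s) n * (real n * real (n - 1)) + (1 - 2 * c) * (pmf (poisson_pmf s) n * real n) + c\<^sup>2 * (exp (-s) * s ^ n / fact n))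
       sums (s\<^sup>2 + (1 - 2 * c) * s + c\<^sup>2 * 1)"
      by (intro sums_add sums_mult poisson_mean_1 poisson_mean_2 poisson_weights_sums s)
    moreover have "pmf (poisson_pmf s) n * (real n * real (n - 1)) + (1 - 2 * c) * (pmf (poisson_pmf s) n * real n) + c\<^sup>2 * (exp (-s) * s ^ n / fact n)
      = pmf (poisson_pmf s) n * g n" for n
    proof -
      have "real n * real (n - 1) = real n * real n - real n" by (cases n) (auto simp: algebra_simps)
      moreover have "c\<^sup>2 * (exp (-s) * s ^ n / fact n) = pmf (poisson_pmf s) n * c\<^sup>2" using s by simp
      ultimately show ?thesis by (simp only: g_def Directed orientation.case) (simp add: power2_eq_square algebra_simps del: pmf_poisson)
    qed
    moreover have "s\<^sup>2 + (1 - 2 * c) * s + c\<^sup>2 * 1 \<le> 2 * s"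
    proof -
      have cf: "c = of_int \<lfloor>s\<rfloor>" using Directed by (simp add: c_def m_def)
      have c: "0 \<le> s - c" "s - c < 1" "0 \<le> c"
        unfolding cf using s floor_correct[of s] by (simp_all only: of_int_add of_int_1) (linarith | simp)+
      have "(s - c) * (s - c) \<le> s"
      proof (cases "s < 1")
        case True
        then have "s * s \<le> s * 1" using s by (intro mult_left_mono) auto
        moreover have "c = 0" using True s Directed by (simp add: c_def m_def floor_eq_iff)
        ultimately show ?thesis by simp
      next
        case False
        have "(s - c) * (s - c) \<le> 1 * 1" using c by (intro mult_mono) auto
        then show ?thesis using False by simp
      qed
      then show ?thesis by (simp add: power2_eq_square algebra_simps)
    qed
    ultimately show ?thesis by auto
  next
    case Undirected
    then have "g = real" by (simp add: g_def c_def m_def fun_eq_iff)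
    then show ?thesis using poisson_mean_1[OF s] s by (intro exI[of _ s]) simp
  qed
  then obtain v where v: "v \<le> 2 * s" "(\<lambda>n. pmf (poisson_pmf s) n * g n) sums v" by blast
  have "(\<integral>\<^sup>+x. ennreal ((of_int x - c)\<^sup>2) \<partial>int_walk \<sigma> s) = (\<integral>\<^sup>+n. ennreal (g n) \<partial>poisson_pmf s)"
    unfolding nn_integral_int_walk[OF s]
  proof (intro nn_integral_cong)
    fix n
    have "(\<integral>\<^sup>+x. ennreal ((of_int x - c)\<^sup>2) \<partial>discrete_walk (int_step \<sigma>) 0 n) =
      ennreal (measure_pmf.expectation (discrete_walk (int_step \<sigma>) 0 n) (\<lambda>x. (of_int x - c)\<^sup>2))"
      by (rule nn_integral_eq_integral) (auto intro: integrable_measure_pmf_finite finite_discrete_int_walk)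
    then show "(\<integral>\<^sup>+x. ennreal ((of_int x - c)\<^sup>2) \<partial>discrete_walk (int_step \<sigma>) 0 n) = ennreal (g n)"
      by (simp add: second_moment_discrete g_def)
  qed
  also have "\<dots> = ennreal v" by (rule nn_integral_poisson[OF s g0 v(2)])
  finally have nn: "(\<integral>\<^sup>+x. ennreal ((of_int x - c)\<^sup>2) \<partial>int_walk \<sigma> s) = ennreal v" .
  have 1: "integrable (measure_pmf (int_walk \<sigma> s)) (\<lambda>x. (of_int x - c)\<^sup>2)"
    by (rule integrableI_nonneg) (use nn in auto)
  have "ennreal (measure_pmf.expectation (int_walk \<sigma> s) (\<lambda>x. (of_int x - c)\<^sup>2)) = ennreal v"
    using nn_integral_eq_integral[OF 1] nn by simp
  moreover have "0 \<le> v" using v(2) g0 by (intro sums_le[OF _ sums_zero v(2)]) auto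
  ultimately have "measure_pmf.expectation (int_walk \<sigma> s) (\<lambda>x. (of_int x - c)\<^sup>2) = v" by simp
  then show ?thesis using that[of m] 1 v(1) by (simp add: c_def)
qed

lemma sum_union_le:
  fixes f :: "'x \<Rightarrow> real"
  assumes "finite A" "finite B" "\<And>x. 0 \<le> f x"
  shows "sum f (A \<union> B) \<le> sum f A + sum f B"
  using sum_Un[OF assms(1,2), of f] sum_nonneg[of "A \<inter> B" f] assms(3) by simp

lemma sum_geometric_abs:
  fixes b :: real
  assumes b: "0 < b" "b < 1" and F: "finite F"
  shows "(\<Sum>x\<in>F. b powr \<bar>of_int x\<bar>) \<le> (1 + b) / (1 - b)"
proof -
  define N where "N = (\<Sum>x\<in>F. nat \<bar>x\<bar>)"
  have N: "nat \<bar>x\<bar> \<le> N" if "x \<in> F" for x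
    unfolding N_def using F that by (intro member_le_sum) auto
  have geo: "(\<Sum>n=1..N. b ^ n) \<le> b / (1 - b)"
  proof -
    have "(\<Sum>n=1..N. b ^ n) = (\<Sum>n<N. b * b ^ n)"
      by (rule sum.reindex_bij_witness[of _ Suc "\<lambda>n. n - 1"]) (auto simp: power_Suc[symmetric] simp del: power_Suc)
    also have "\<dots> = b * ((1 - b ^ N) / (1 - b))" using b by (simp add: sum_distrib_left[symmetric] sum_gp_strict)
    also have "\<dots> \<le> b * (1 / (1 - b))" using b by (intro mult_left_mono divide_right_mono) auto
    finally show ?thesis by simp
  qed
  let ?f = "\<lambda>x::int. b powr \<bar>of_int x\<bar>"
  have "F \<subseteq> {0} \<union> int ` {1..N} \<union> (\<lambda>n. - int n) ` {1..N}"
  proof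
    fix x assume x: "x \<in> F"
    show "x \<in> {0} \<union> int ` {1..N} \<union> (\<lambda>n. - int n) ` {1..N}"
    proof (cases x "0::int" rule: linorder_cases)
      case less
      then have "x = - int (nat \<bar>x\<bar>)" "nat \<bar>x\<bar> \<in> {1..N}" using N[OF x] by auto
      then show ?thesis by blast
    next
      case greater
      then have "x = int (nat \<bar>x\<bar>)" "nat \<bar>x\<bar> \<in> {1..N}" using N[OF x] by auto
      then show ?thesis by blast
    qed simp
  qed
  then have "sum ?f F \<le> sum ?f ({0} \<union> int ` {1..N} \<union> (\<lambda>n. - int n) ` {1..N})"
    by (intro sum_mono2) auto
  also have "\<dots> \<le> sum ?f ({0} \<union> int ` {1..N}) + sum ?f ((\<lambda>n. - int n) ` {1..N})"
    by (rule sum_union_le) auto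
  also have "sum ?f ({0} \<union> int ` {1..N}) \<le> sum ?f {0} + sum ?f (int ` {1..N})"
    by (rule sum_union_le) auto
  also have "sum ?f (int ` {1..N}) = (\<Sum>n=1..N. b ^ n)"
    using b by (simp add: sum.reindex powr_realpow)
  also have "sum ?f ((\<lambda>n. - int n) ` {1..N}) = (\<Sum>n=1..N. b ^ n)"
    using b by (subst sum.reindex) (auto simp: powr_realpow inj_on_def)
  finally have "sum ?f F \<le> 1 + (\<Sum>n=1..N. b ^ n) + (\<Sum>n=1..N. b ^ n)" using b by simp
  also have "\<dots> \<le> 1 + b / (1 - b) + b / (1 - b)" using geo by simp
  also have "\<dots> = (1 + b) / (1 - b)" using b by (simp add: field_simps)
  finally show ?thesis .
qed

text \<open>The Gibbs inequality with a two-sided geometric reference law.\<close>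

lemma entropy_int_le:
  fixes X :: "int pmf"
  assumes i: "integrable (measure_pmf X) (\<lambda>x. \<bar>of_int x\<bar> :: real)" and b: "0 < b" "b < 1"
  shows "integrable (measure_pmf X) (surprisal X)"
    and "shannon_entropy X \<le> ln ((1 + b) / (1 - b)) + measure_pmf.expectation X (\<lambda>x. \<bar>of_int x\<bar>) * ln (1 / b)"
proof -
  define r where "r x = (1 - b) / (1 + b) * b powr \<bar>of_int x\<bar>" for x :: int
  have r: "0 < r x" for x using b by (simp add: r_def)
  have lnr: "- ln (r x) = ln ((1 + b) / (1 - b)) + \<bar>of_int x\<bar> * ln (1 / b)" for x
  proof -
    have "ln (r x) = ln ((1 - b) / (1 + b)) + \<bar>of_int x\<bar> * ln b"
      unfolding r_def using b by (subst ln_mult_pos) (auto simp: ln_powr)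
    moreover have "ln ((1 - b) / (1 + b)) = - ln ((1 + b) / (1 - b))"
      using b by (simp add: ln_divide_pos)
    ultimately show ?thesis using b by (simp add: ln_divide_pos)
  qed
  have sum: "(\<Sum>x\<in>F. r x) \<le> 1" if "finite F" for F
  proof -
    have "(\<Sum>x\<in>F. r x) = (1 - b) / (1 + b) * (\<Sum>x\<in>F. b powr \<bar>of_int x\<bar>)"
      by (simp add: r_def sum_distrib_left)
    also have "\<dots> \<le> (1 - b) / (1 + b) * ((1 + b) / (1 - b))"
      using b by (intro mult_left_mono sum_geometric_abs that) auto
    also have "\<dots> = 1" using b by simp
    finally show ?thesis .
  qed
  have ir: "integrable (measure_pmf X) (\<lambda>x. - ln (r x))"
    unfolding lnr by (intro Bochner_Integration.integrable_add integrable_mult_left i) simp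
  show "integrable (measure_pmf X) (surprisal X)" by (rule gibbs(1)[OF r sum ir])
  have "shannon_entropy X \<le> measure_pmf.expectation X (\<lambda>x. - ln (r x))" by (rule gibbs(2)[OF r sum ir])
  also have "\<dots> = ln ((1 + b) / (1 - b)) + measure_pmf.expectation X (\<lambda>x. \<bar>of_int x\<bar>) * ln (1 / b)"
    unfolding lnr using i by simp
  finally show "shannon_entropy X \<le> ln ((1 + b) / (1 - b)) + measure_pmf.expectation X (\<lambda>x. \<bar>of_int x\<bar>) * ln (1 / b)" .
qed

lemma integrable_surprisal_int_walk:
  assumes "0 \<le> s" shows "integrable (measure_pmf (int_walk \<sigma> s)) (surprisal (int_walk \<sigma> s))"
  by (rule entropy_int_le(1)[OF int_walk_mean_abs(1)[OF assms], of "1/2"]) auto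

section \<open>Entropy of one coordinate\<close>

definition reduce :: "enat \<Rightarrow> int \<Rightarrow> int" where
  "reduce \<gamma> x = (case \<gamma> of enat n \<Rightarrow> x mod int n | \<infinity> \<Rightarrow> x)"

lemma cyc_mult: "1 \<le> \<gamma> \<Longrightarrow> x \<otimes>\<^bsub>cyc \<gamma>\<^esub> y = reduce \<gamma> (x + y)"
  by (cases \<gamma>) (auto simp: cyc_def reduce_def integer_mod_group_def one_enat_def)

lemma reduce_add_left: "reduce \<gamma> (reduce \<gamma> x + y) = reduce \<gamma> (x + y)"
  by (cases \<gamma>) (auto simp: reduce_def mod_simps)

lemma reduce_0 [simp]: "reduce \<gamma> 0 = 0"
  by (cases \<gamma>) (auto simp: reduce_def)

definition reduced_walk :: "orientation \<Rightarrow> enat \<Rightarrow> real \<Rightarrow> int pmf" where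
  "reduced_walk \<sigma> \<gamma> s = map_pmf (reduce \<gamma>) (int_walk \<sigma> s)"

lemma lattice_walk_reduce:
  assumes k: "0 < k" and g: "1 \<le> \<gamma>"
  shows "lattice_walk \<sigma> k \<gamma> t =
    map_pmf (\<lambda>x i. if i < k then reduce \<gamma> (x i) else undefined) (lattice_walk \<sigma> k \<infinity> t)"
proof -
  define f where "f x = (\<lambda>i. if i < k then reduce \<gamma> (x i) else undefined)" for x :: "nat \<Rightarrow> int"
  have "map_pmf f (lattice_step \<sigma> k \<infinity> y) = lattice_step \<sigma> k \<gamma> (f y)" for y
  proof -
    have "f (y(i := y i \<otimes>\<^bsub>cyc \<infinity>\<^esub> e)) = (f y)(i := f y i \<otimes>\<^bsub>cyc \<gamma>\<^esub> e)" if "i < k" for i e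
      using that g by (auto simp: f_def fun_eq_iff cyc_mult reduce_add_left) (simp add: reduce_def)
    then show ?thesis using k unfolding lattice_step_def map_bind_pmf
      by (intro bind_pmf_cong refl) (auto simp: pmf.map_comp o_def lessThan_empty_iff)
  qed
  from map_walk_law[of f "lattice_step \<sigma> k \<infinity>" "lattice_step \<sigma> k \<gamma>", OF this]
  have "map_pmf f (lattice_walk \<sigma> k \<infinity> t) = walk_law (lattice_step \<sigma> k \<gamma>) (f \<one>\<^bsub>cyc_power \<infinity> k\<^esub>) t"
    unfolding lattice_walk_def .
  also have "f \<one>\<^bsub>cyc_power \<infinity> k\<^esub> = \<one>\<^bsub>cyc_power \<gamma> k\<^esub>" by (auto simp: f_def one_cyc_power fun_eq_iff)
  finally show ?thesis by (simp add: lattice_walk_def f_def[abs_def])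
qed

lemma lattice_walk_product:
  assumes k: "0 < k" and g: "1 \<le> \<gamma>" and t: "0 \<le> t"
  shows "lattice_walk \<sigma> k \<gamma> t = Pi_pmf {..<k} undefined (\<lambda>_. reduced_walk \<sigma> \<gamma> (t / k))"
proof -
  have "Pi_pmf {..<k} undefined (\<lambda>_. reduced_walk \<sigma> \<gamma> (t / k)) =
     Pi_pmf {..<k} undefined (\<lambda>_. bind_pmf (int_walk \<sigma> (t / k)) (\<lambda>x. return_pmf (reduce \<gamma> x)))"
    by (simp add: reduced_walk_def map_pmf_def)
  also have "\<dots> = bind_pmf (Pi_pmf {..<k} undefined (\<lambda>_. int_walk \<sigma> (t / k)))
      (\<lambda>x. return_pmf (\<lambda>i. if i \<in> {..<k} then reduce \<gamma> (x i) else undefined))"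
    by (subst Pi_pmf_bind[where d' = undefined]) auto
  also have "\<dots> = lattice_walk \<sigma> k \<gamma> t"
    unfolding lattice_walk_reduce[OF k g] lattice_walk_Z_product[OF k t] map_pmf_def by simp
  finally show ?thesis ..
qed

definition coord_entropy :: "orientation \<Rightarrow> enat \<Rightarrow> real \<Rightarrow> real" where
  "coord_entropy \<sigma> \<gamma> s = shannon_entropy (reduced_walk \<sigma> \<gamma> s)"

lemma integrable_surprisal_reduced:
  "0 \<le> s \<Longrightarrow> integrable (measure_pmf (reduced_walk \<sigma> \<gamma> s)) (surprisal (reduced_walk \<sigma> \<gamma> s))"
  unfolding reduced_walk_def by (intro integrable_surprisal_map integrable_surprisal_int_walk)

lemma shannon_entropy_lattice_walk:
  assumes k: "0 < k" and g: "1 \<le> \<gamma>" and t: "0 \<le> t"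
  shows "shannon_entropy (lattice_walk \<sigma> k \<gamma> t) = k * coord_entropy \<sigma> \<gamma> (t / k)"
proof -
  have "0 \<le> t / k" using t by simp
  from shannon_entropy_Pi(2)[of "{..<k}" "\<lambda>_. reduced_walk \<sigma> \<gamma> (t / k)" undefined,
      OF finite_lessThan integrable_surprisal_reduced[OF this]]
  show ?thesis unfolding lattice_walk_product[OF assms] coord_entropy_def by simp
qed

lemma reduced_walk_infinity: "reduced_walk \<sigma> \<infinity> s = int_walk \<sigma> s"
  unfolding reduced_walk_def reduce_def by (simp add: map_pmf_idI)

text \<open>Reduction is a function of the position, and a function of a random variable has at most
its entropy.\<close>

lemma coord_entropy_le_infinity: "0 \<le> s \<Longrightarrow> coord_entropy \<sigma> \<gamma> s \<le> coord_entropy \<sigma> \<infinity> s"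
  unfolding coord_entropy_def reduced_walk_infinity unfolding reduced_walk_def
  by (intro shannon_entropy_map_le integrable_surprisal_int_walk)

lemma coord_entropy_dvd:
  assumes "0 \<le> s" "p dvd n"
  shows "coord_entropy \<sigma> (enat p) s \<le> coord_entropy \<sigma> (enat n) s"
proof -
  have eq: "reduced_walk \<sigma> (enat p) s = map_pmf (\<lambda>x. x mod int p) (reduced_walk \<sigma> (enat n) s)"
    using assms(2) by (simp add: reduced_walk_def reduce_def[abs_def] pmf.map_comp o_def mod_mod_cancel)
  show ?thesis unfolding coord_entropy_def eq
    by (rule shannon_entropy_map_le[OF integrable_surprisal_reduced[OF assms(1)]])
qed

lemma coord_entropy_0: "coord_entropy \<sigma> \<gamma> 0 = 0"
  by (simp add: coord_entropy_def reduced_walk_def int_walk_0 shannon_entropy_def)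

section \<open>Continuity of the entropy in time\<close>

lemma continuous_u_ln_u: "continuous_on {0..} (\<lambda>u::real. u * ln u)"
  unfolding continuous_on_def
proof
  fix u :: real assume "u \<in> {0..}"
  then consider "u = 0" | "0 < u" by force
  then show "((\<lambda>u. u * ln u) \<longlongrightarrow> u * ln u) (at u within {0..})"
  proof cases
    case 1
    have "((\<lambda>u::real. u * ln u) \<longlongrightarrow> 0) (at_right 0)" by real_asymp
    moreover have "at (0::real) within {0..} = at_right 0"
      by (rule at_within_nhd[of _ UNIV]) auto
    ultimately show ?thesis using 1 by simp
  next
    case 2
    then have "isCont (\<lambda>u. u * ln u) u" by (auto intro!: continuous_intros)
    then show ?thesis by (auto simp: isCont_def intro: tendsto_within_subset)
  qed
qed

lemma continuous_prob_int_walk: "continuous_on {0..} (\<lambda>s. measure_pmf.prob (int_walk \<sigma> s) A)"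
proof -
  let ?b = "\<lambda>n. measure_pmf.prob (discrete_walk (int_step \<sigma>) 0 n) A"
  have bd: "bounded_seq ?b" by (rule bounded_seqI[of _ 1]) simp
  have "continuous_on {0..} (\<lambda>s. poisson_mean s ?b)"
    by (rule DERIV_continuous_on) (rule has_field_derivative_at_within[OF DERIV_poisson_mean[OF bd]])
  then show ?thesis
    by (rule continuous_on_cong[THEN iffD1, rotated 2]) (auto simp: int_walk_def prob_walk_law)
qed

lemma continuous_pmf_ln:
  "continuous_on {0..} (\<lambda>s. measure_pmf.prob (int_walk \<sigma> s) A * ln (measure_pmf.prob (int_walk \<sigma> s) A))"
  by (rule continuous_on_compose2[OF continuous_u_ln_u continuous_prob_int_walk]) auto

lemma pmf_reduced: "pmf (reduced_walk \<sigma> \<gamma> s) y = measure_pmf.prob (int_walk \<sigma> s) (reduce \<gamma> -` {y})"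
  by (simp add: reduced_walk_def pmf_map)

text \<open>An exponential moment bound (Chernoff).\<close>

lemma pmf_int_walk_le:
  assumes "0 \<le> s" shows "pmf (int_walk \<sigma> s) x \<le> exp (3 * s) * (1/4) powr \<bar>of_int x\<bar>"
proof -
  let ?b = "\<lambda>n. pmf (discrete_walk (int_step \<sigma>) 0 n) x"
  have bd: "bounded_seq ?b" by (rule bounded_seqI[of _ 1]) (simp add: pmf_le_1)
  have b: "?b n \<le> 4 ^ n * (1/4) powr \<bar>of_int x\<bar>" for n
  proof (cases "x \<in> set_pmf (discrete_walk (int_step \<sigma>) 0 n)")
    case True
    then have "x \<in> {- int n..int n}" using set_discrete_int_walk[of \<sigma> n] by blast
    then have "\<bar>x\<bar> \<le> int n" by auto
    then have "of_int \<bar>x\<bar> \<le> (of_int (int n) :: real)" by (simp only: of_int_le_iff)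
    then have "\<bar>of_int x :: real\<bar> \<le> real n" by simp
    then have "(1/4) powr real n \<le> (1/4 :: real) powr \<bar>of_int x\<bar>" by (intro powr_mono') auto
    then have "4 ^ n * (1/4) powr real n \<le> 4 ^ n * (1/4 :: real) powr \<bar>of_int x\<bar>" by (intro mult_left_mono) auto
    moreover have "4 ^ n * (1/4) powr real n = (1::real)"
    proof -
      have "(1/4::real) powr real n = 1 / 4 ^ n" by (simp add: powr_realpow power_one_over)
      then show ?thesis by simp
    qed
    ultimately show ?thesis using pmf_le_1[of "discrete_walk (int_step \<sigma>) 0 n" x] by linarith
  qed (simp add: set_pmf_iff)
  define c where "c = (1/4::real) powr \<bar>of_int x\<bar>"
  have e: "(\<lambda>n. exp (-s) * c * ((4 * s) ^ n /\<^sub>R fact n)) sums (exp (-s) * c * exp (4 * s))"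
    by (intro sums_mult exp_converges)
  have "poisson_mean s ?b \<le> exp (-s) * c * exp (4 * s)"
  proof (rule sums_le[OF _ poisson_mean_sums[OF bd] e])
    fix n
    have "exp (-s) * s ^ n / fact n * ?b n \<le> exp (-s) * s ^ n / fact n * (4 ^ n * c)"
      unfolding c_def using assms by (intro mult_left_mono b) auto
    also have "\<dots> = exp (-s) * c * ((4 * s) ^ n /\<^sub>R fact n)"
      by (simp add: power_mult_distrib field_simps)
    finally show "(exp (-s) * s ^ n / fact n) *\<^sub>R ?b n \<le> exp (-s) * c * ((4 * s) ^ n /\<^sub>R fact n)"
      by (simp only: real_scaleR_def)
  qed
  also have "\<dots> = (exp (-s) * exp (4 * s)) * c" by simp
  also have "exp (-s) * exp (4 * s) = exp (3 * s)" by (simp add: exp_add[symmetric])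
  also note c_def
  finally show ?thesis using assms by (simp add: int_walk_def pmf_walk_law)
qed

text \<open>This domination, with the exponential tails of the walk, gives the uniform summability
behind the continuity of the entropy.\<close>

lemma minus_u_ln_u_le: assumes "0 \<le> u" "u \<le> (1::real)" shows "\<bar>u * ln u\<bar> \<le> 2 * sqrt u"
proof (cases "u = 0")
  case False
  then have u: "0 < u" using assms by simp
  have "ln (1 / sqrt u) \<le> 1 / sqrt u - 1" using u by (intro ln_le_minus_one) auto
  then have "- ln u \<le> 2 / sqrt u" using u by (simp add: ln_divide_pos ln_sqrt)
  then have "u * - ln u \<le> u * (2 / sqrt u)" using u by (intro mult_left_mono) auto
  also have "\<dots> = 2 * sqrt u" using u by (simp add: field_simps)
  finally show ?thesis using u assms by (simp add: abs_mult)
qed simp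

lemma summable_geometric_int: "(\<lambda>x::int. (1/2::real) powr \<bar>of_int x\<bar>) summable_on UNIV"
proof (rule nonneg_bdd_above_summable_on)
  have "(\<Sum>x\<in>F. (1/2::real) powr \<bar>of_int x\<bar>) \<le> (1 + 1/2) / (1 - 1/2)" if "finite F" for F :: "int set"
    by (rule sum_geometric_abs[OF _ _ that]) auto
  then show "bdd_above (sum (\<lambda>x::int. (1/2::real) powr \<bar>of_int x\<bar>) ` {F. F \<subseteq> UNIV \<and> finite F})"
    by (intro bdd_aboveI2[where M = "(1 + 1/2) / (1 - 1/2)"]) blast
qed simp

lemma shannon_entropy_UNIV: "shannon_entropy P = (\<Sum>\<^sub>\<infinity>x. - (pmf P x * ln (pmf P x)))"
  unfolding shannon_entropy_def by (rule infsum_cong_neutral) (auto simp: set_pmf_iff)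

lemma shannon_entropy_finite:
  assumes "finite F" "set_pmf P \<subseteq> F"
  shows "shannon_entropy P = (\<Sum>x\<in>F. - (pmf P x * ln (pmf P x)))"
proof -
  have "shannon_entropy P = (\<Sum>\<^sub>\<infinity>x\<in>F. - (pmf P x * ln (pmf P x)))"
    unfolding shannon_entropy_def using assms(2) by (intro infsum_cong_neutral) (auto simp: set_pmf_iff)
  then show ?thesis using assms(1) by simp
qed

text \<open>For finite moduli the entropy is a finite sum of continuous functions; for the integers
it is a series that converges uniformly on bounded time intervals.\<close>

lemma continuous_coord_entropy:
  assumes "1 \<le> \<gamma>" shows "continuous_on {0..} (coord_entropy \<sigma> \<gamma>)"
proof (cases \<gamma>)
  case (enat n)
  then have n: "0 < n" using assms by (simp add: one_enat_def)
  have "set_pmf (reduced_walk \<sigma> \<gamma> s) \<subseteq> {0..<int n}" for s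
    using n by (auto simp: reduced_walk_def reduce_def enat)
  then have "coord_entropy \<sigma> \<gamma> = (\<lambda>s. \<Sum>y\<in>{0..<int n}. - (pmf (reduced_walk \<sigma> \<gamma> s) y * ln (pmf (reduced_walk \<sigma> \<gamma> s) y)))"
    unfolding coord_entropy_def by (intro ext shannon_entropy_finite) auto
  then show ?thesis unfolding pmf_reduced
    by (simp only:) (intro continuous_on_sum continuous_on_minus continuous_pmf_ln)
next
  case infinity
  let ?f = "\<lambda>x s. - (pmf (int_walk \<sigma> s) x * ln (pmf (int_walk \<sigma> s) x))"
  have c: "continuous_on {0..T} (\<lambda>s. \<Sum>\<^sub>\<infinity>x. ?f x s)" for T
  proof (rule uniform_limit_theorem)
    show "uniform_limit {0..T} (\<lambda>X s. \<Sum>x\<in>X. ?f x s) (\<lambda>s. \<Sum>\<^sub>\<infinity>x. ?f x s) (finite_subsets_at_top UNIV)"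
    proof (rule Weierstrass_m_test_general)
      fix x s assume s: "s \<in> {0..T}"
      have "norm (?f x s) \<le> 2 * sqrt (pmf (int_walk \<sigma> s) x)"
        using minus_u_ln_u_le[of "pmf (int_walk \<sigma> s) x"] by (simp add: pmf_le_1)
      also have "sqrt (pmf (int_walk \<sigma> s) x) \<le> sqrt (exp (3 * T) * (1/4) powr \<bar>of_int x\<bar>)"
      proof (rule real_sqrt_le_mono)
        have "pmf (int_walk \<sigma> s) x \<le> exp (3 * s) * (1/4) powr \<bar>of_int x\<bar>" using s by (intro pmf_int_walk_le) auto
        also have "\<dots> \<le> exp (3 * T) * (1/4) powr \<bar>of_int x\<bar>" using s by (intro mult_right_mono) auto
        finally show "pmf (int_walk \<sigma> s) x \<le> exp (3 * T) * (1/4) powr \<bar>of_int x\<bar>" .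
      qed
      also have "sqrt (exp (3 * T) * (1/4) powr \<bar>of_int x\<bar>) = sqrt (exp (3 * T)) * (1/2) powr \<bar>of_int x\<bar>"
      proof -
        have "(1/4::real) powr \<bar>of_int x\<bar> = ((1/2) powr \<bar>of_int x\<bar>)\<^sup>2"
          using powr_mult[of "1/2" "1/2" "\<bar>of_int x\<bar>"] by (simp add: power2_eq_square)
        then show ?thesis by (simp add: real_sqrt_mult)
      qed
      finally show "norm (?f x s) \<le> 2 * (sqrt (exp (3 * T)) * (1/2) powr \<bar>of_int x\<bar>)" by simp
    next
      show "(\<lambda>x::int. 2 * (sqrt (exp (3 * T)) * (1/2) powr \<bar>of_int x\<bar>)) summable_on UNIV"
        by (intro summable_on_cmult_right summable_geometric_int)
    qed
    show "\<forall>\<^sub>F X in finite_subsets_at_top UNIV. continuous_on {0..T} (\<lambda>s. \<Sum>x\<in>X. ?f x s)"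
    proof (rule always_eventually, rule allI)
      fix X :: "int set"
      have "continuous_on {0..} (\<lambda>s. pmf (int_walk \<sigma> s) x * ln (pmf (int_walk \<sigma> s) x))" for x
        using continuous_pmf_ln[of \<sigma> "{x}"] by (simp add: measure_pmf_single)
      then have "continuous_on {0..} (\<lambda>s. \<Sum>x\<in>X. ?f x s)"
        by (intro continuous_on_sum continuous_on_minus)
      then show "continuous_on {0..T} (\<lambda>s. \<Sum>x\<in>X. ?f x s)" by (rule continuous_on_subset) auto
    qed
  qed (simp add: finite_subsets_at_top_neq_bot)
  have "coord_entropy \<sigma> \<gamma> = (\<lambda>s. \<Sum>\<^sub>\<infinity>x. ?f x s)"
    by (simp add: coord_entropy_def[abs_def] infinity reduced_walk_infinity shannon_entropy_UNIV fun_eq_iff)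
  moreover have "continuous_on {0..} (\<lambda>s. \<Sum>\<^sub>\<infinity>x. ?f x s)"
    unfolding continuous_on_eq_continuous_within
  proof
    fix s :: real assume s: "s \<in> {0..}"
    have "continuous (at s within {0..s + 1}) (\<lambda>s. \<Sum>\<^sub>\<infinity>x. ?f x s)"
      using c[of "s + 1"] s by (simp add: continuous_on_eq_continuous_within)
    moreover have "at s within {0..s + 1} = at s within {0..}"
      by (rule at_within_nhd[of _ "{..<s + 1}"]) auto
    ultimately show "continuous (at s within {0..}) (\<lambda>s. \<Sum>\<^sub>\<infinity>x. ?f x s)" by simp
  qed
  ultimately show ?thesis by simp
qed

context cyclic_walk begin

lemma reduced_walk_p: "reduced_walk \<sigma> (enat p) s = cyc_walk s"
  by (simp add: reduced_walk_def reduce_def[abs_def] cyc_walk_def)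

lemma set_cyc_walk: "set_pmf (cyc_walk s) \<subseteq> Zp"
  using p by (auto simp: cyc_walk_def)

lemma coord_entropy_p: "0 \<le> s \<Longrightarrow> coord_entropy \<sigma> (enat p) s = h s"
  unfolding coord_entropy_def reduced_walk_p
  by (subst shannon_entropy_finite[OF _ set_cyc_walk]) (auto simp: h_def pmf_cyc_walk)

end

section \<open>Special groups and words in the generators\<close>

definition letter :: "('a, 'b) monoid_scheme \<Rightarrow> 'a list \<Rightarrow> nat \<times> bool \<Rightarrow> 'a" where
  "letter G Z ib = (if snd ib then Z ! fst ib else inv\<^bsub>G\<^esub> (Z ! fst ib))"

text \<open>The letters multiply from the right with the head of the list last, so that extending a
path by \<open>#\<close> is a step of the walk.\<close>

definition word :: "('a, 'b) monoid_scheme \<Rightarrow> 'a list \<Rightarrow> (nat \<times> bool) list \<Rightarrow> 'a" where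
  "word G Z u = foldr (\<lambda>ib g. g \<otimes>\<^bsub>G\<^esub> letter G Z ib) u \<one>\<^bsub>G\<^esub>"

definition net_count :: "nat \<Rightarrow> (nat \<times> bool) list \<Rightarrow> int" where
  "net_count i u = (\<Sum>ib\<leftarrow>u. if fst ib = i then sgn_of (snd ib) else 0)"

lemma word_Nil [simp]: "word G Z [] = \<one>\<^bsub>G\<^esub>" by (simp add: word_def)
lemma word_Cons [simp]: "word G Z (ib # u) = word G Z u \<otimes>\<^bsub>G\<^esub> letter G Z ib" by (simp add: word_def)
lemma net_count_Nil [simp]: "net_count i [] = 0" by (simp add: net_count_def)
lemma net_count_Cons [simp]:
  "net_count i (ib # u) = (if fst ib = i then sgn_of (snd ib) else 0) + net_count i u" by (simp add: net_count_def)

context group begin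

lemma letter_closed: "set Z \<subseteq> carrier G \<Longrightarrow> fst ib < length Z \<Longrightarrow> letter G Z ib \<in> carrier G"
  unfolding letter_def using nth_mem by (auto intro!: inv_closed)

lemma word_closed:
  "set Z \<subseteq> carrier G \<Longrightarrow> fst ` set u \<subseteq> {..<length Z} \<Longrightarrow> word G Z u \<in> carrier G"
  by (induction u) (auto intro!: m_closed letter_closed)

lemma word_append:
  assumes "set Z \<subseteq> carrier G" "fst ` set u \<subseteq> {..<length Z}" "fst ` set v \<subseteq> {..<length Z}"
  shows "word G Z (u @ v) = word G Z v \<otimes> word G Z u"
  using assms(2)
proof (induction u)
  case Nil
  show ?case using word_closed[OF assms(1,3)] by simp
next
  case (Cons ib u)
  then have "word G Z u \<in> carrier G" "letter G Z ib \<in> carrier G"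
    using assms(1) by (auto intro!: word_closed letter_closed)
  then show ?case using Cons word_closed[OF assms(1,3)] by (simp add: m_assoc)
qed

text \<open>A central factor in one generator can be collected to the right; its exponent is the net
number of uses of that generator.\<close>

lemma word_central_shift:
  assumes Z: "set Z \<subseteq> carrier G" and i: "i < length Z"
    and y: "y \<in> group_centre G" and u: "fst ` set u \<subseteq> {..<length Z}"
  shows "word G (Z[i := Z ! i \<otimes> y]) u = word G Z u \<otimes> y [^] net_count i u"
  using u
proof (induction u)
  case (Cons ib u)
  have yc: "y \<in> carrier G" and comm: "\<And>g. g \<in> carrier G \<Longrightarrow> y \<otimes> g = g \<otimes> y"
    using y by (auto simp: group_centre_def)
  have w: "word G Z u \<in> carrier G" using Z Cons by (intro word_closed) auto
  have Zi: "Z ! i \<in> carrier G" using Z i nth_mem by blast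
  have commp: "y [^] (n::int) \<otimes> g = g \<otimes> y [^] n" if g: "g \<in> carrier G" for n g
  proof -
    have nat: "y [^] (m::nat) \<otimes> g = g \<otimes> y [^] m" for m
    proof (induction m)
      case (Suc m)
      then show ?case using g yc by (simp add: m_assoc comm) (simp add: m_assoc[symmetric])
    qed (simp add: g)
    show ?thesis
    proof (cases "0 \<le> n")
      case True
      then show ?thesis using nat[of "nat n"] yc by (metis int_pow_int int_nat_eq)
    next
      case False
      define m where "m = nat (- n)"
      have n: "n = - int m" using False by (simp add: m_def)
      have "inv (y [^] m) \<otimes> g = g \<otimes> inv (y [^] m)"
        using nat[of m] g yc by (metis inv_closed inv_solve_left inv_solve_right m_assoc m_closed nat_pow_closed)
      then show ?thesis using yc by (simp add: n int_pow_neg int_pow_int)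
    qed
  qed
  have l: "letter G (Z[i := Z ! i \<otimes> y]) ib = letter G Z ib \<otimes> y [^] (if fst ib = i then sgn_of (snd ib) else 0)"
  proof (cases "fst ib = i")
    case True
    then show ?thesis using i Zi yc comm[of "inv (Z ! i)"] comm[of "Z ! i"]
      by (auto simp: letter_def sgn_of_def inv_mult_group int_pow_neg commp[of "inv (Z ! i)" "-1", simplified])
        (metis commp int_pow_1 int_pow_neg inv_closed)
  next
    case False
    then show ?thesis using letter_closed[OF Z, of ib] Cons.prems by (auto simp: letter_def)
  qed
  have lc: "letter G Z ib \<in> carrier G" using letter_closed[OF Z] Cons.prems by auto
  have "word G (Z[i := Z ! i \<otimes> y]) (ib # u) =
     (word G Z u \<otimes> y [^] net_count i u) \<otimes> (letter G Z ib \<otimes> y [^] (if fst ib = i then sgn_of (snd ib) else 0))"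
    using Cons by (simp add: l)
  also have "\<dots> = (word G Z u \<otimes> letter G Z ib) \<otimes> (y [^] net_count i u \<otimes> y [^] (if fst ib = i then sgn_of (snd ib) else 0))"
    using w lc yc commp[OF lc] by (simp add: m_assoc) (simp add: m_assoc[symmetric])
  also have "y [^] net_count i u \<otimes> y [^] (if fst ib = i then sgn_of (snd ib) else (0::int)) = y [^] net_count i (ib # u)"
    using yc by (simp add: int_pow_mult[symmetric] add.commute)
  finally show ?case by simp
qed simp

lemma int_pow_eq_one:
  assumes "x \<in> carrier G" "x [^] p = \<one>" "prime (p::nat)" "x [^] (d::int) = \<one>" "\<not> int p dvd d"
  shows "x = \<one>"
proof -
  have "coprime (int p) d" using assms by (simp add: prime_imp_coprime)
  then obtain a b where ab: "a * int p + b * d = 1" by (metis bezout_int coprime_iff_gcd_eq_1)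
  have "x = x [^] (a * int p + b * d)" using assms(1) by (simp add: ab)
  also have "\<dots> = (x [^] int p) [^] a \<otimes> (x [^] d) [^] b"
    using assms(1) by (simp add: int_pow_mult int_pow_pow mult.commute)
  also have "x [^] int p = \<one>" using assms by (simp add: int_pow_int)
  finally show ?thesis using assms(4) by (simp add: int_pow_one)
qed

end

lemma cyc_group: "group (cyc \<gamma>)" "comm_group (cyc \<gamma>)"
  by (cases \<gamma>; simp add: cyc_def comm_group.axioms(2)[OF abelian_integer_mod_group] abelian_integer_group)+

lemma cyc_power_group: "group (cyc_power \<gamma> m)"
  unfolding cyc_power_def by (intro product_group cyc_group)

lemma cyc_power_exponent:
  assumes "x \<in> carrier (cyc_power (enat p) m)"
  shows "x [^]\<^bsub>cyc_power (enat p) m\<^esub> p = \<one>\<^bsub>cyc_power (enat p) m\<^esub>"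
proof -
  have "x [^]\<^bsub>cyc_power (enat p) m\<^esub> n = (\<lambda>i\<in>{..<m}. (int n * x i) mod int p)" for n
  proof (induction n)
    case 0
    show ?case by (auto simp: cyc_power_def cyc_def restrict_def fun_eq_iff)
  next
    case (Suc n)
    then show ?case using assms
      by (auto simp: cyc_power_def cyc_def restrict_def fun_eq_iff algebra_simps mod_simps)
  qed
  then show ?thesis by (auto simp: cyc_power_def cyc_def restrict_def fun_eq_iff)
qed

locale special_group = group G for G (structure) +
  fixes p :: nat
  assumes prime: "prime p"
    and special: "special_p_group p G"
begin

abbreviation C :: "'a set" where "C \<equiv> commutator_subgroup G"

lemma C_centre: "C = group_centre G"
  using special by (simp add: special_p_group_def)

lemma finite_carrier: "finite (carrier G)"
proof -
  obtain n where "order G = p ^ n" using special by (auto simp: special_p_group_def)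
  then have "0 < card (carrier G)" using prime prime_gt_0_nat by (simp add: order_def)
  then show ?thesis by (simp add: card_gt_0_iff)
qed

lemma C_subgroup: "subgroup C G"
  by (intro derived_is_subgroup) simp

lemma C_sub: "C \<subseteq> carrier G" using C_subgroup subgroup.subset by blast

lemma C_normal: "C \<lhd> G"
  using derived_self_is_normal by simp

lemma C_comm: "c \<in> C \<Longrightarrow> g \<in> carrier G \<Longrightarrow> c \<otimes> g = g \<otimes> c"
  unfolding C_centre group_centre_def by blast

lemma C_exponent: assumes c: "c \<in> C" shows "c [^] p = \<one>"
proof -
  let ?H = "G\<lparr>carrier := C\<rparr>"
  obtain m \<phi> where iso: "\<phi> \<in> iso ?H (cyc_power (enat p) m)"
    using special by (auto simp: special_p_group_def is_iso_def)
  interpret H: group ?H by (rule subgroup.subgroup_is_group[OF C_subgroup group_axioms])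
  interpret P: group "cyc_power (enat p) m" by (rule cyc_power_group)
  interpret hom: group_hom ?H "cyc_power (enat p) m" \<phi>
    using iso by unfold_locales (auto simp: iso_def)
  have pw: "c [^]\<^bsub>?H\<^esub> n = c [^] n" for n :: nat
    by (simp add: nat_pow_def)
  have cH: "c \<in> carrier ?H" using c by simp
  have "\<phi> (c [^]\<^bsub>?H\<^esub> p) = \<phi> c [^]\<^bsub>cyc_power (enat p) m\<^esub> p" by (rule hom.hom_nat_pow[OF cH])
  also have "\<dots> = \<one>\<^bsub>cyc_power (enat p) m\<^esub>"
    using hom.hom_closed[OF cH] by (rule cyc_power_exponent)
  also have "\<dots> = \<phi> \<one>\<^bsub>?H\<^esub>" by (rule hom.hom_one[symmetric])
  finally have "c [^]\<^bsub>?H\<^esub> p = \<one>\<^bsub>?H\<^esub>"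
    using iso cH H.nat_pow_closed[OF cH, of p] H.one_closed unfolding iso_def bij_betw_def inj_on_def by blast
  then show ?thesis by (simp add: pw)
qed

lemma pow_p_in_C: assumes x: "x \<in> carrier G" shows "x [^] p \<in> C"
proof -
  have "x [^] p \<otimes> y = y \<otimes> x [^] p" if y: "y \<in> carrier G" for y
  proof -
    define c where "c = y \<otimes> x \<otimes> inv y \<otimes> inv x"
    have c: "c \<in> C" unfolding c_def derived_def using x y by (intro generate.incl) auto
    have cG: "c \<in> carrier G" using c C_sub by auto
    have yx: "y \<otimes> x = c \<otimes> x \<otimes> y" using x y by (simp add: c_def m_assoc)
    have pow: "y \<otimes> x [^] n = c [^] n \<otimes> x [^] n \<otimes> y" for n :: nat
    proof (induction n)
      case (Suc n)
      have "y \<otimes> x [^] Suc n = (y \<otimes> x [^] n) \<otimes> x" using x y by (simp add: m_assoc)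
      also have "\<dots> = c [^] n \<otimes> x [^] n \<otimes> (y \<otimes> x)" using x y cG by (simp add: Suc m_assoc)
      also have "\<dots> = c [^] n \<otimes> (x [^] n \<otimes> c) \<otimes> (x \<otimes> y)" using x y cG by (simp add: yx m_assoc)
      also have "x [^] n \<otimes> c = c \<otimes> x [^] n" using C_comm[OF c] x by simp
      also have "c [^] n \<otimes> (c \<otimes> x [^] n) \<otimes> (x \<otimes> y) = c [^] Suc n \<otimes> x [^] Suc n \<otimes> y"
        using x y cG by (simp add: m_assoc)
      finally show ?case .
    qed (use y in simp)
    show ?thesis using pow[of p] C_exponent[OF c] x y by simp
  qed
  then show ?thesis unfolding C_centre group_centre_def using x by auto
qed

abbreviation V where "V \<equiv> G Mod C"

lemma V_comm: "comm_group V" using derived_quot_is_comm_group .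

lemma V_hom: "(#>) C \<in> hom G V" using C_normal by (rule normal.r_coset_hom_Mod)

end

text \<open>The two words differ by \<open>y\<close> to the power of the difference of the net
numbers, which is prime to the order \<open>p\<close>.\<close>

lemma (in group) central_shift_trivial:
  assumes Z: "set Z \<subseteq> carrier G" and i: "i < length Z" and y: "y \<in> group_centre G"
    and p: "prime p" "y [^] (p::nat) = \<one>"
    and u: "fst ` set u \<subseteq> {..<length Z}" "fst ` set v \<subseteq> {..<length Z}"
    and ne: "\<not> int p dvd net_count i u - net_count i v"
    and eq: "word G Z u = word G Z v" "word G (Z[i := Z ! i \<otimes> y]) u = word G (Z[i := Z ! i \<otimes> y]) v"
  shows "y = \<one>"
proof -
  have yc: "y \<in> carrier G" using y by (simp add: group_centre_def)
  have wc: "word G Z v \<in> carrier G" by (rule word_closed[OF Z u(2)])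
  have "word G Z v \<otimes> y [^] net_count i u = word G Z v \<otimes> y [^] net_count i v"
    using word_central_shift[OF Z i y u(1)] word_central_shift[OF Z i y u(2)] eq by simp
  then have e: "y [^] net_count i u = y [^] net_count i v" using wc yc by simp
  have "y [^] (net_count i u - net_count i v) = \<one>"
    using yc e by (simp add: int_pow_diff)
  then show ?thesis using int_pow_eq_one[OF yc p(2,1) _ ne] by blast
qed

section \<open>Random generators and total variation\<close>

lemma pmf_replicate_uniform:
  assumes "finite A" "A \<noteq> {}"
  shows "pmf (replicate_pmf k (pmf_of_set A)) Z =
    (if set Z \<subseteq> A \<and> length Z = k then 1 / real (card A) ^ k else 0)"
proof (induction k arbitrary: Z)
  case (Suc k)
  have eq: "replicate_pmf (Suc k) (pmf_of_set A) =
      bind_pmf (pmf_of_set A) (\<lambda>x. map_pmf (Cons x) (replicate_pmf k (pmf_of_set A)))"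
    by (simp add: map_pmf_def)
  show ?case
  proof (cases Z)
    case Nil
    have "pmf (map_pmf (Cons x) (replicate_pmf k (pmf_of_set A))) Z = 0" for x
      using Nil by (auto simp: pmf_eq_0_set_pmf)
    then show ?thesis unfolding eq pmf_bind_pmf_of_set[OF assms(2,1)] using Nil by simp
  next
    case (Cons z Z')
    have 1: "pmf (map_pmf (Cons x) (replicate_pmf k (pmf_of_set A))) Z =
       (if x = z then pmf (replicate_pmf k (pmf_of_set A)) Z' else 0)" for x
    proof (cases "x = z")
      case True
      then show ?thesis using Cons pmf_map_inj'[of "Cons z"] by (simp add: inj_def)
    next
      case False
      then show ?thesis using Cons by (auto simp: pmf_eq_0_set_pmf)
    qed
    show ?thesis
      unfolding eq pmf_bind_pmf_of_set[OF assms(2,1)] 1 using Cons Suc assms by simp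
  qed
qed (auto simp: indicator_def)

text \<open>Condition on all entries other than the \<open>i\<close>-th: within the event the
remaining entry is confined to one fibre of \<open>\<psi>\<close>.\<close>

lemma prob_replicate_uniform_fibre:
  assumes A: "finite A" "A \<noteq> {}" and i: "i < k"
    and m: "\<And>v. card {z \<in> A. \<psi> z = v} \<le> m"
    and S: "\<And>Z Z'. \<lbrakk>Z \<in> S; Z' \<in> S; set Z \<subseteq> A; set Z' \<subseteq> A; length Z = k; length Z' = k;
        \<And>j. j < k \<Longrightarrow> j \<noteq> i \<Longrightarrow> Z ! j = Z' ! j\<rbrakk> \<Longrightarrow> \<psi> (Z ! i) = \<psi> (Z' ! i)"
  shows "measure_pmf.prob (replicate_pmf k (pmf_of_set A)) S \<le> real m / real (card A)"
proof -
  define Ls where "Ls n = {Z. set Z \<subseteq> A \<and> length Z = n}" for n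
  have finL: "finite (Ls n)" and cardL: "card (Ls n) = card A ^ n" for n
    using A by (auto simp: Ls_def finite_lists_length_eq card_lists_length_eq)
  define S' where "S' = S \<inter> Ls k"
  define rest where "rest Z = take i Z @ drop (Suc i) Z" for Z :: "'a list"
  have agree: "Z ! j = Z' ! j" if "Z \<in> Ls k" "Z' \<in> Ls k" "rest Z = rest Z'" "j < k" "j \<noteq> i" for Z Z' j
  proof -
    have t: "take i Z = take i Z'" and d: "drop (Suc i) Z = drop (Suc i) Z'"
      using that i by (auto simp: rest_def Ls_def append_eq_append_conv)
    show ?thesis
    proof (cases "j < i")
      case True
      then show ?thesis using t by (metis nth_take)
    next
      case False
      then have "j = Suc i + (j - Suc i)" using that by simp
      then show ?thesis using arg_cong[OF d, of "\<lambda>l. l ! (j - Suc i)"] that by (simp add: Ls_def)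
    qed
  qed
  define v where "v L = \<psi> ((SOME Z. Z \<in> S' \<and> rest Z = L) ! i)" for L
  have inj: "inj_on (\<lambda>Z. (rest Z, Z ! i)) S'"
  proof (rule inj_onI)
    fix Z Z' assume Z: "Z \<in> S'" "Z' \<in> S'" "(rest Z, Z ! i) = (rest Z', Z' ! i)"
    then have "Z ! j = Z' ! j" if "j < k" for j
      using agree[of Z Z' j] that by (cases "j = i") (auto simp: S'_def)
    then show "Z = Z'" using Z by (intro nth_equalityI) (auto simp: S'_def Ls_def)
  qed
  have sub: "(\<lambda>Z. (rest Z, Z ! i)) ` S' \<subseteq> (SIGMA L:Ls (k - 1). {z \<in> A. \<psi> z = v L})"
  proof (clarsimp, intro conjI)
    fix Z assume Z: "Z \<in> S'"
    then have ZL: "Z \<in> Ls k" by (simp add: S'_def)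
    show "rest Z \<in> Ls (k - Suc 0)" using ZL i set_take_subset[of i Z] set_drop_subset[of "Suc i" Z]
      by (auto simp: Ls_def rest_def)
    show "Z ! i \<in> A" using ZL i nth_mem[of i Z] by (auto simp: Ls_def)
    define Z' where "Z' = (SOME Z'. Z' \<in> S' \<and> rest Z' = rest Z)"
    have Z': "Z' \<in> S' \<and> rest Z' = rest Z"
      unfolding Z'_def by (rule someI[of _ Z]) (use Z in auto)
    have "\<psi> (Z ! i) = \<psi> (Z' ! i)"
      using Z Z' by (intro S) (auto simp: S'_def Ls_def intro!: agree[unfolded Ls_def])
    then show "\<psi> (Z ! i) = v (rest Z)" by (simp add: v_def Z'_def)
  qed
  have "card S' \<le> card (SIGMA L:Ls (k - 1). {z \<in> A. \<psi> z = v L})"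
    using A finL by (intro card_inj_on_le[OF inj sub] finite_SigmaI) auto
  also have "\<dots> = (\<Sum>L\<in>Ls (k - 1). card {z \<in> A. \<psi> z = v L})"
    using A finL by (intro card_SigmaI) auto
  also have "\<dots> \<le> (\<Sum>L\<in>Ls (k - 1). m)" by (intro sum_mono m)
  also have "\<dots> = card A ^ (k - 1) * m" by (simp add: cardL)
  finally have card: "card S' \<le> card A ^ (k - 1) * m" .
  have "measure_pmf.prob (replicate_pmf k (pmf_of_set A)) S = measure_pmf.prob (replicate_pmf k (pmf_of_set A)) S'"
  proof (rule measure_prob_cong_0)
    fix Z assume "Z \<in> S - S'" 
    then show "pmf (replicate_pmf k (pmf_of_set A)) Z = 0" by (auto simp: pmf_replicate_uniform[OF A] S'_def Ls_def)
  qed (auto simp: S'_def)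
  also have "\<dots> = (\<Sum>Z\<in>S'. pmf (replicate_pmf k (pmf_of_set A)) Z)"
    using finL by (intro measure_measure_pmf_finite) (auto simp: S'_def)
  also have "\<dots> = real (card S') / real (card A) ^ k"
    by (simp add: pmf_replicate_uniform[OF A] S'_def Ls_def)
  also have "\<dots> \<le> real (card A ^ (k - 1) * m) / real (card A) ^ k"
    using card by (intro divide_right_mono) (auto simp only: of_nat_le_iff zero_le_power of_nat_0_le_iff)
  also have "\<dots> = real m / real (card A)"
    using A i by (cases k) (auto simp: field_simps card_gt_0_iff)
  finally show ?thesis .
qed

lemma tv_bdd: "bdd_above (range (\<lambda>A. \<bar>measure_pmf.prob P A - measure_pmf.prob Q A\<bar>))"
proof (rule bdd_aboveI2)
  fix A
  show "\<bar>measure_pmf.prob P A - measure_pmf.prob Q A\<bar> \<le> 1"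
    using measure_pmf.prob_le_1[of P A] measure_pmf.prob_le_1[of Q A]
      measure_nonneg[of "measure_pmf P" A] measure_nonneg[of "measure_pmf Q" A] by linarith
qed

lemma tv_ge: "\<bar>measure_pmf.prob P A - measure_pmf.prob Q A\<bar> \<le> tv_distance P Q"
  unfolding tv_distance_def by (rule cSUP_upper[OF _ tv_bdd]) simp

lemma tv_le: "(\<And>A. \<bar>measure_pmf.prob P A - measure_pmf.prob Q A\<bar> \<le> c) \<Longrightarrow> tv_distance P Q \<le> c"
  unfolding tv_distance_def by (rule cSUP_least) auto

lemma tv_nonneg: "0 \<le> tv_distance P Q"
  using tv_ge[of P "{}" Q] by simp

lemma tv_le_1: "tv_distance P Q \<le> 1"
proof (rule tv_le)
  fix A
  show "\<bar>measure_pmf.prob P A - measure_pmf.prob Q A\<bar> \<le> 1"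
    using measure_pmf.prob_le_1[of P A] measure_pmf.prob_le_1[of Q A]
      measure_nonneg[of "measure_pmf P" A] measure_nonneg[of "measure_pmf Q" A] by linarith
qed

text \<open>The part of the law that comes from \<open>T\<close> is compared with the uniform law in
\<open>L\<^sup>2\<close>, the rest in \<open>L\<^sup>1\<close>; without the truncation rare paths
would dominate the \<open>L\<^sup>2\<close> norm.\<close>

lemma tv_truncated_L2:
  fixes S :: "'u \<Rightarrow> 'g" and P :: "'u pmf" and \<nu> :: "'g \<Rightarrow> real" and c :: real and T :: "'u set"
  assumes G: "finite \<G>" "\<G> \<noteq> {}" and S: "\<And>u. u \<in> set_pmf P \<Longrightarrow> S u \<in> \<G>"
  defines "\<nu> \<equiv> \<lambda>g. measure_pmf.prob P {u. S u = g \<and> u \<in> T}"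
    and "c \<equiv> measure_pmf.prob P T"
  shows "0 \<le> card \<G> * (\<Sum>g\<in>\<G>. (\<nu> g)\<^sup>2) - c\<^sup>2"
    and "tv_distance (map_pmf S P) (pmf_of_set \<G>) \<le> (1 - c) + sqrt (card \<G> * (\<Sum>g\<in>\<G>. (\<nu> g)\<^sup>2) - c\<^sup>2)"
proof -
  define N where "N = real (card \<G>)"
  have N: "0 < N" using G by (simp add: N_def card_gt_0_iff)
  have c: "0 \<le> c" "c \<le> 1" by (auto simp: c_def)
  have partial: "measure_pmf.prob P {u. S u \<in> A \<and> u \<in> T} = (\<Sum>g\<in>A \<inter> \<G>. \<nu> g)" for A
  proof -
    have "measure_pmf.prob P {u. S u \<in> A \<and> u \<in> T} = measure_pmf.prob P (\<Union>g\<in>A \<inter> \<G>. {u. S u = g \<and> u \<in> T})"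
      by (rule measure_prob_cong_0) (use S in \<open>auto simp: set_pmf_iff[symmetric] pmf_eq_0_set_pmf\<close>)
    also have "\<dots> = (\<Sum>g\<in>A \<inter> \<G>. \<nu> g)"
      unfolding \<nu>_def by (rule measure_pmf.finite_measure_finite_Union) (use G in \<open>auto simp: disjoint_family_on_def\<close>)
    finally show ?thesis .
  qed
  have total: "(\<Sum>g\<in>\<G>. \<nu> g) = c" using partial[of UNIV] by (simp add: c_def)
  have dev: "(\<Sum>g\<in>\<G>. (\<nu> g - c / N)\<^sup>2) = (\<Sum>g\<in>\<G>. (\<nu> g)\<^sup>2) - c\<^sup>2 / N"
  proof -
    have "(\<Sum>g\<in>\<G>. (\<nu> g - c / N)\<^sup>2) = (\<Sum>g\<in>\<G>. (\<nu> g)\<^sup>2) - 2 * (c / N) * (\<Sum>g\<in>\<G>. \<nu> g) + N * (c / N)\<^sup>2"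
    proof -
      have "(\<Sum>g\<in>\<G>. (\<nu> g - d)\<^sup>2) = (\<Sum>g\<in>\<G>. (\<nu> g)\<^sup>2) - 2 * d * (\<Sum>g\<in>\<G>. \<nu> g) + N * d\<^sup>2" for d
      proof -
        have "(\<nu> g - d)\<^sup>2 = (\<nu> g)\<^sup>2 - 2 * d * \<nu> g + d\<^sup>2" for g by (simp add: power2_diff)
        then show ?thesis
          by (simp only: sum.distrib sum_subtractf sum_distrib_left[symmetric] sum_constant N_def)
      qed
      then show ?thesis .
    qed
    also have "\<dots> = (\<Sum>g\<in>\<G>. (\<nu> g)\<^sup>2) - c\<^sup>2 / N"
      using N by (simp add: total power2_eq_square field_simps)
    finally show ?thesis .
  qed
  have eq: "N * (\<Sum>g\<in>\<G>. (\<nu> g - c / N)\<^sup>2) = N * (\<Sum>g\<in>\<G>. (\<nu> g)\<^sup>2) - c\<^sup>2"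
    unfolding dev using N by (simp add: right_diff_distrib)
  have "0 \<le> N * (\<Sum>g\<in>\<G>. (\<nu> g - c / N)\<^sup>2)" using N by (intro mult_nonneg_nonneg sum_nonneg) auto
  then show "0 \<le> card \<G> * (\<Sum>g\<in>\<G>. (\<nu> g)\<^sup>2) - c\<^sup>2" unfolding eq by (simp add: N_def)
  have L1: "(\<Sum>g\<in>\<G>. \<bar>\<nu> g - c / N\<bar>) \<le> sqrt (N * (\<Sum>g\<in>\<G>. (\<nu> g)\<^sup>2) - c\<^sup>2)"
  proof (rule real_le_rsqrt)
    have "(\<Sum>g\<in>\<G>. 1 * \<bar>\<nu> g - c / N\<bar>)\<^sup>2 \<le> (\<Sum>g\<in>\<G>. 1\<^sup>2) * (\<Sum>g\<in>\<G>. \<bar>\<nu> g - c / N\<bar>\<^sup>2)"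
      by (rule Cauchy_Schwarz_ineq_sum)
    then show "(\<Sum>g\<in>\<G>. \<bar>\<nu> g - c / N\<bar>)\<^sup>2 \<le> N * (\<Sum>g\<in>\<G>. (\<nu> g)\<^sup>2) - c\<^sup>2"
      unfolding eq[symmetric] by (simp add: N_def)
  qed
  show "tv_distance (map_pmf S P) (pmf_of_set \<G>) \<le> (1 - c) + sqrt (card \<G> * (\<Sum>g\<in>\<G>. (\<nu> g)\<^sup>2) - c\<^sup>2)"
  proof (rule tv_le)
    fix A
    have 1: "measure_pmf.prob (map_pmf S P) A = (\<Sum>g\<in>A \<inter> \<G>. \<nu> g) + measure_pmf.prob P {u. S u \<in> A \<and> u \<notin> T}"
    proof -
      have "measure_pmf.prob (map_pmf S P) A = measure_pmf.prob P ({u. S u \<in> A \<and> u \<in> T} \<union> {u. S u \<in> A \<and> u \<notin> T})"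
        by (simp add: measure_map_pmf vimage_def) (rule arg_cong[where f = "measure_pmf.prob P"], auto)
      also have "\<dots> = measure_pmf.prob P {u. S u \<in> A \<and> u \<in> T} + measure_pmf.prob P {u. S u \<in> A \<and> u \<notin> T}"
        by (rule measure_pmf.finite_measure_Union) auto
      finally show ?thesis by (simp add: partial)
    qed
    have 2: "0 \<le> measure_pmf.prob P {u. S u \<in> A \<and> u \<notin> T}" "measure_pmf.prob P {u. S u \<in> A \<and> u \<notin> T} \<le> 1 - c"
    proof -
      have "measure_pmf.prob P {u. S u \<in> A \<and> u \<notin> T} \<le> measure_pmf.prob P (- T)"
        by (rule measure_pmf.finite_measure_mono) auto
      also have "\<dots> = 1 - c" unfolding c_def using measure_pmf.prob_compl[of T P] by (simp add: Compl_eq_Diff_UNIV)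
      finally show "measure_pmf.prob P {u. S u \<in> A \<and> u \<notin> T} \<le> 1 - c" .
    qed simp
    define a where "a = real (card (\<G> \<inter> A)) / N"
    have a: "0 \<le> a" "a \<le> 1" using G N by (auto simp: a_def N_def card_mono)
    have 3: "measure_pmf.prob (pmf_of_set \<G>) A = a" using G by (simp add: measure_pmf_of_set a_def N_def)
    have "\<bar>(\<Sum>g\<in>A \<inter> \<G>. \<nu> g) - c * a\<bar> = \<bar>\<Sum>g\<in>A \<inter> \<G>. \<nu> g - c / N\<bar>"
      by (simp add: sum_subtractf a_def Int_commute mult.commute)
    also have "\<dots> \<le> (\<Sum>g\<in>A \<inter> \<G>. \<bar>\<nu> g - c / N\<bar>)" by (rule sum_abs)
    also have "\<dots> \<le> (\<Sum>g\<in>\<G>. \<bar>\<nu> g - c / N\<bar>)" using G by (intro sum_mono2) auto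
    also note L1
    finally have 4: "\<bar>(\<Sum>g\<in>A \<inter> \<G>. \<nu> g) - c * a\<bar> \<le> sqrt (card \<G> * (\<Sum>g\<in>\<G>. (\<nu> g)\<^sup>2) - c\<^sup>2)" by (simp add: N_def)
    define b where "b = (1 - c) * a"
    have b0: "0 \<le> b" unfolding b_def using a c by simp
    have b1: "b \<le> (1 - c) * 1" unfolding b_def by (rule mult_left_mono) (use a c in auto)
    have "\<bar>measure_pmf.prob P {u. S u \<in> A \<and> u \<notin> T} - (1 - c) * a\<bar> \<le> 1 - c"
    proof -
      have "\<bar>m - b\<bar> \<le> 1 - c" if "0 \<le> b" "b \<le> (1 - c) * 1" "0 \<le> m" "m \<le> 1 - c" for m
        using that by (simp add: abs_le_iff)
      then show ?thesis using 2 b0 b1 unfolding b_def[symmetric] by blast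
    qed
    moreover have "measure_pmf.prob (map_pmf S P) A - measure_pmf.prob (pmf_of_set \<G>) A =
       ((\<Sum>g\<in>A \<inter> \<G>. \<nu> g) - c * a) + (measure_pmf.prob P {u. S u \<in> A \<and> u \<notin> T} - (1 - c) * a)"
      unfolding 1 3 by (simp add: algebra_simps)
    ultimately show "\<bar>measure_pmf.prob (map_pmf S P) A - measure_pmf.prob (pmf_of_set \<G>) A\<bar>
      \<le> (1 - c) + sqrt (card \<G> * (\<Sum>g\<in>\<G>. (\<nu> g)\<^sup>2) - c\<^sup>2)" using 4 by linarith
  qed
qed

lemma pmf_prob_mono:
  assumes "\<And>x. x \<in> set_pmf M \<Longrightarrow> x \<in> A \<Longrightarrow> x \<in> B"
  shows "measure_pmf.prob M A \<le> measure_pmf.prob M B"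
  by (rule measure_pmf.finite_measure_mono_AE) (auto intro: AE_pmfI assms)

lemma prob_pair_pmf:
  "measure_pmf.prob (pair_pmf P Q) A = measure_pmf.expectation P (\<lambda>x. measure_pmf.prob Q {y. (x, y) \<in> A})"
proof -
  have "pair_pmf P Q = bind_pmf P (\<lambda>x. map_pmf (Pair x) Q)" by (simp add: pair_pmf_def map_pmf_def)
  then show ?thesis by (simp add: prob_bind_pmf measure_map_pmf vimage_def)
qed

lemma expectation_prob_swap:
  "measure_pmf.expectation M (\<lambda>z. measure_pmf.prob Q {u. R z u}) =
    measure_pmf.expectation Q (\<lambda>u. measure_pmf.prob M {z. R z u})"
proof -
  have "measure_pmf.prob (pair_pmf M Q) {(z, u). R z u} = measure_pmf.prob (pair_pmf Q M) {(u, z). R z u}"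
    by (subst pair_commute_pmf) (simp add: measure_map_pmf vimage_def case_prod_unfold)
  then show ?thesis by (simp add: prob_pair_pmf)
qed

text \<open>Average the bound \<open>tv_truncated_L2\<close> over the random environment
\<open>z\<close>. Pairs with \<open>W u \<noteq> W v\<close> collide as if they were independent and
uniform, so the excess over the uniform law comes from pairs with \<open>W u = W v\<close>;
truncation to \<open>T\<close> bounds their weight by \<open>\<eta>\<close>.\<close>

lemma second_moment_tv:
  fixes S :: "'z \<Rightarrow> 'u \<Rightarrow> 'g" and P :: "'u pmf" and W :: "'u \<Rightarrow> 'w" and \<eta> \<delta> :: real
  assumes G: "finite \<G>" "\<G> \<noteq> {}"
    and S: "\<And>z u. z \<in> set_pmf M \<Longrightarrow> u \<in> set_pmf P \<Longrightarrow> S z u \<in> \<G>"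
    and coll: "\<And>u v. u \<in> set_pmf P \<Longrightarrow> v \<in> set_pmf P \<Longrightarrow> W u \<noteq> W v \<Longrightarrow>
       measure_pmf.prob M {z. S z u = S z v} \<le> 1 / card \<G>"
    and \<eta>: "\<And>w. w \<in> T \<Longrightarrow> pmf (map_pmf W P) w \<le> \<eta>" "0 \<le> \<eta>"
    and d: "0 < \<delta>" and atyp: "measure_pmf.prob (map_pmf W P) (- T) \<le> \<delta> / 2"
  shows "measure_pmf.prob M {z. \<delta> < tv_distance (map_pmf (S z) P) (pmf_of_set \<G>)} \<le> card \<G> * \<eta> / (\<delta> / 2)\<^sup>2"
proof -
  define N where "N = real (card \<G>)"
  have N: "0 < N" using G by (simp add: N_def card_gt_0_iff)
  define T' where "T' = W -` T"
  define c where "c = measure_pmf.prob P T'"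
  have c: "1 - c \<le> \<delta> / 2"
  proof -
    have "measure_pmf.prob (map_pmf W P) (- T) = measure_pmf.prob P (UNIV - T')"
      by (simp add: measure_map_pmf T'_def vimage_Compl Compl_eq_Diff_UNIV[symmetric])
    also have "\<dots> = 1 - c" using measure_pmf.prob_compl[of T' P] by (simp add: c_def)
    finally show ?thesis using atyp by simp
  qed
  define \<kappa> where "\<kappa> z = measure_pmf.prob (pair_pmf P P) {(u, v). S z u = S z v \<and> u \<in> T' \<and> v \<in> T'}" for z
  define Y where "Y z = N * \<kappa> z - c\<^sup>2" for z
  have sq: "(\<Sum>g\<in>\<G>. (measure_pmf.prob P {u. S z u = g \<and> u \<in> T'})\<^sup>2) = \<kappa> z" if z: "z \<in> set_pmf M" for z
  proof -
    have "\<kappa> z = measure_pmf.prob (pair_pmf P P) (\<Union>g\<in>\<G>. {u. S z u = g \<and> u \<in> T'} \<times> {u. S z u = g \<and> u \<in> T'})"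
      unfolding \<kappa>_def by (rule measure_prob_cong_0) (use S[OF z] in \<open>auto simp: pmf_eq_0_set_pmf\<close>)
    also have "\<dots> = (\<Sum>g\<in>\<G>. measure_pmf.prob (pair_pmf P P) ({u. S z u = g \<and> u \<in> T'} \<times> {u. S z u = g \<and> u \<in> T'}))"
      by (rule measure_pmf.finite_measure_finite_Union) (use G in \<open>auto simp: disjoint_family_on_def\<close>)
    also have "\<dots> = (\<Sum>g\<in>\<G>. (measure_pmf.prob P {u. S z u = g \<and> u \<in> T'})\<^sup>2)"
    proof (rule sum.cong[OF refl])
      fix g
      have "measure_pmf.prob (pair_pmf P P) (B \<times> B) = (measure_pmf.prob P B)\<^sup>2" for B
      proof -
        have "measure_pmf.prob P {y. x \<in> B \<and> y \<in> B} = indicator B x * measure_pmf.prob P B" for x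
          by (simp add: indicator_def)
        then show ?thesis by (simp add: prob_pair_pmf power2_eq_square)
      qed
      then show "measure_pmf.prob (pair_pmf P P) ({u. S z u = g \<and> u \<in> T'} \<times> {u. S z u = g \<and> u \<in> T'}) =
        (measure_pmf.prob P {u. S z u = g \<and> u \<in> T'})\<^sup>2" by blast
    qed
    finally show ?thesis ..
  qed
  have Y0: "0 \<le> Y z" and tv: "tv_distance (map_pmf (S z) P) (pmf_of_set \<G>) \<le> (1 - c) + sqrt (Y z)" if z: "z \<in> set_pmf M" for z
    using tv_truncated_L2[OF G, of P "S z" T'] S[OF z] unfolding sq[OF z] by (auto simp: Y_def N_def c_def)
  have E\<kappa>: "measure_pmf.expectation M \<kappa> \<le> c\<^sup>2 / N + \<eta>"
  proof -
    let ?PP = "pair_pmf P P"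
    define g1 where "g1 = (\<lambda>uv. (1 / N) * indicator (T' \<times> T') uv :: real)"
    define g2 where "g2 = (indicator {(u, v). W u = W v \<and> u \<in> T'} :: _ \<Rightarrow> real)"
    have ig: "integrable (measure_pmf ?PP) g1" "integrable (measure_pmf ?PP) g2"
    proof -
      show "integrable (measure_pmf ?PP) g1"
        by (rule expectation_bounded_integrable[where B = "1 / N"]) (use N in \<open>auto simp: g1_def indicator_def\<close>)
      show "integrable (measure_pmf ?PP) g2"
        by (rule expectation_bounded_integrable[where B = 1]) (auto simp: g2_def indicator_def)
    qed
    have "measure_pmf.expectation M \<kappa> = measure_pmf.expectation ?PP (\<lambda>uv. measure_pmf.prob M {z. S z (fst uv) = S z (snd uv) \<and> fst uv \<in> T' \<and> snd uv \<in> T'})"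
      unfolding \<kappa>_def case_prod_unfold by (rule expectation_prob_swap)
    also have "\<dots> \<le> measure_pmf.expectation ?PP (\<lambda>uv. g1 uv + g2 uv)"
    proof (rule integral_mono_AE)
      show "integrable (measure_pmf ?PP) (\<lambda>uv. g1 uv + g2 uv)" by (intro Bochner_Integration.integrable_add ig)
      show "integrable (measure_pmf ?PP) (\<lambda>uv. measure_pmf.prob M {z. S z (fst uv) = S z (snd uv) \<and> fst uv \<in> T' \<and> snd uv \<in> T'})"
        by (rule expectation_bounded_integrable[where B = 1]) simp
      show "AE uv in ?PP. measure_pmf.prob M {z. S z (fst uv) = S z (snd uv) \<and> fst uv \<in> T' \<and> snd uv \<in> T'}
         \<le> g1 uv + g2 uv"
        unfolding g1_def g2_def
      proof (rule AE_pmfI, clarify)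
        fix u v assume "(u, v) \<in> set_pmf ?PP"
        then have uv: "u \<in> set_pmf P" "v \<in> set_pmf P" by auto
        show "measure_pmf.prob M {z. S z (fst (u, v)) = S z (snd (u, v)) \<and> fst (u, v) \<in> T' \<and> snd (u, v) \<in> T'}
         \<le> (1 / N) * indicator (T' \<times> T') (u, v) + indicator {(u, v). W u = W v \<and> u \<in> T'} (u, v)"
        proof (cases "u \<in> T' \<and> v \<in> T'")
          case True
          show ?thesis
          proof (cases "W u = W v")
            case False
            then show ?thesis using coll[OF uv False] True by (simp add: N_def)
          next
            case eq: True
            have "measure_pmf.prob M {z. S z u = S z v} \<le> 1" by simp
            moreover have "0 \<le> 1 / N" using N by simp
            ultimately have "measure_pmf.prob M {z. S z u = S z v} \<le> 1 / N + 1" by linarith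
            then show ?thesis using True eq by simp
          qed
        next
          case False
          then have "{z. S z u = S z v \<and> u \<in> T' \<and> v \<in> T'} = {}" by auto
          then show ?thesis using N by (simp only: fst_conv snd_conv) simp
        qed
      qed
    qed
    also have "\<dots> = measure_pmf.expectation ?PP g1 + measure_pmf.expectation ?PP g2"
      by (rule Bochner_Integration.integral_add[OF ig])
    also have "measure_pmf.expectation ?PP g1 = (1 / N) * measure_pmf.prob ?PP (T' \<times> T')"
      by (simp add: g1_def)
    also have "measure_pmf.expectation ?PP g2 = measure_pmf.prob ?PP {(u, v). W u = W v \<and> u \<in> T'}"
      by (simp add: g2_def)
    also have "measure_pmf.prob ?PP (T' \<times> T') = c\<^sup>2"
    proof -
      have "measure_pmf.prob P {y. x \<in> T' \<and> y \<in> T'} = indicator T' x * c" for x by (simp add: indicator_def c_def)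
      then show ?thesis by (simp add: prob_pair_pmf power2_eq_square c_def)
    qed
    also have "measure_pmf.prob ?PP {(u, v). W u = W v \<and> u \<in> T'} \<le> \<eta>"
    proof -
      have "measure_pmf.prob ?PP {(u, v). W u = W v \<and> u \<in> T'} = measure_pmf.expectation P (\<lambda>u. measure_pmf.prob P {v. W u = W v \<and> u \<in> T'})"
        by (simp add: prob_pair_pmf)
      also have "\<dots> \<le> measure_pmf.expectation P (\<lambda>u. \<eta>)"
      proof (rule integral_mono)
        fix u
        show "measure_pmf.prob P {v. W u = W v \<and> u \<in> T'} \<le> \<eta>"
        proof (cases "u \<in> T'")
          case True
          then have "pmf (map_pmf W P) (W u) \<le> \<eta>" by (intro \<eta>) (simp add: T'_def)
          moreover have "{v. W u = W v} = W -` {W u}" by auto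
          ultimately show ?thesis using True by (simp add: pmf_map)
        next
          case False
          then show ?thesis using \<eta>(2) by simp
        qed
      qed (auto intro!: expectation_bounded_integrable[where B = 1])
      finally show ?thesis by simp
    qed
    finally show ?thesis by simp
  qed
  have i\<kappa>: "integrable (measure_pmf M) \<kappa>"
    by (rule expectation_bounded_integrable[where B = 1]) (simp add: \<kappa>_def)
  then have iY: "integrable (measure_pmf M) Y" unfolding Y_def by (intro Bochner_Integration.integrable_diff integrable_mult_right) auto
  have EY: "measure_pmf.expectation M Y \<le> N * \<eta>"
  proof -
    have "measure_pmf.expectation M Y = N * measure_pmf.expectation M \<kappa> - c\<^sup>2"
      unfolding Y_def using i\<kappa> by simp
    also have "\<dots> \<le> N * (c\<^sup>2 / N + \<eta>) - c\<^sup>2" using E\<kappa> N by simp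
    also have "\<dots> = N * \<eta>" using N by (simp add: distrib_left)
    finally show ?thesis .
  qed
  have "measure_pmf.prob M {z. \<delta> < tv_distance (map_pmf (S z) P) (pmf_of_set \<G>)} \<le>
     measure_pmf.prob M {z. (\<delta> / 2)\<^sup>2 \<le> Y z}"
  proof (rule pmf_prob_mono)
    fix z assume z: "z \<in> set_pmf M" "z \<in> {z. \<delta> < tv_distance (map_pmf (S z) P) (pmf_of_set \<G>)}"
    then have "\<delta> / 2 \<le> sqrt (Y z)" using tv[OF z(1)] c by simp
    then have "(\<delta> / 2)\<^sup>2 \<le> (sqrt (Y z))\<^sup>2" using d by (intro power_mono) auto
    then show "z \<in> {z. (\<delta> / 2)\<^sup>2 \<le> Y z}" using Y0[OF z(1)] by simp
  qed
  also have "\<dots> \<le> measure_pmf.expectation M Y / (\<delta> / 2)\<^sup>2"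
  proof -
    have "measure_pmf.prob M {z \<in> space M. (\<delta> / 2)\<^sup>2 \<le> Y z} \<le> measure_pmf.expectation M Y / (\<delta> / 2)\<^sup>2"
      by (rule integral_Markov_inequality_measure[where A = UNIV]) (use iY Y0 d in \<open>auto simp: AE_measure_pmf_iff\<close>)
    then show ?thesis by simp
  qed
  also have "\<dots> \<le> N * \<eta> / (\<delta> / 2)\<^sup>2" using EY by (intro divide_right_mono) auto
  finally show ?thesis by (simp add: N_def)
qed

section \<open>Monotonicity of the mixing distance\<close>

lemma path_law_0: "path_law E 0 = return_pmf []"
  by (simp add: path_law_def bind_return_pmf)

text \<open>The binomial theorem.\<close>

lemma poisson_convolution:
  assumes "0 < s" "0 < t"
  shows "map_pmf (\<lambda>(m, n). m + n) (pair_pmf (poisson_pmf s) (poisson_pmf t)) = poisson_pmf (s + t)"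
proof (rule pmf_eqI)
  fix n
  let ?PP = "pair_pmf (poisson_pmf s) (poisson_pmf t)"
  have "pmf (map_pmf (\<lambda>(m, n). m + n) ?PP) n = measure_pmf.prob ?PP ((\<lambda>i. (i, n - i)) ` {..n})"
    unfolding pmf_map by (rule arg_cong[where f = "measure_pmf.prob ?PP"]) (auto simp: image_iff)
  also have "\<dots> = (\<Sum>x\<in>(\<lambda>i. (i, n - i)) ` {..n}. pmf ?PP x)" by (rule measure_measure_pmf_finite) simp
  also have "\<dots> = (\<Sum>i\<le>n. pmf (poisson_pmf s) i * pmf (poisson_pmf t) (n - i))"
    by (subst sum.reindex) (auto simp: inj_on_def pmf_pair)
  also have "\<dots> = (\<Sum>i\<le>n. exp (- (s + t)) / fact n * (real (n choose i) * s ^ i * t ^ (n - i)))"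
  proof (rule sum.cong[OF refl])
    fix i assume "i \<in> {..n}"
    then have "real (n choose i) = fact n / (fact i * fact (n - i))" by (simp add: binomial_fact)
    then show "pmf (poisson_pmf s) i * pmf (poisson_pmf t) (n - i) =
       exp (- (s + t)) / fact n * (real (n choose i) * s ^ i * t ^ (n - i))"
      using assms by (simp add: exp_add exp_diff exp_minus field_simps)
  qed
  also have "\<dots> = exp (- (s + t)) / fact n * (s + t) ^ n"
    by (simp add: binomial_ring sum_distrib_left)
  also have "\<dots> = pmf (poisson_pmf (s + t)) n" using assms by simp
  finally show "pmf (map_pmf (\<lambda>(m, n). m + n) ?PP) n = pmf (poisson_pmf (s + t)) n" .
qed

lemma path_law_add:
  assumes "0 \<le> s" "0 \<le> t"
  shows "path_law E (s + t) = bind_pmf (path_law E s) (\<lambda>u. map_pmf (\<lambda>v. u @ v) (path_law E t))"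
proof -
  consider "s = 0" | "t = 0" | "0 < s" "0 < t" using assms by linarith
  then show ?thesis
  proof cases
    case 1
    have "(@) [] = (\<lambda>v :: 'a list. v)" by (simp add: fun_eq_iff)
    then show ?thesis using 1 by (simp add: path_law_0 bind_return_pmf)
  next
    case 2
    then show ?thesis by (simp add: path_law_0 bind_return_pmf' map_pmf_def bind_return_pmf)
  next
    case 3
    have "path_law E (s + t) = bind_pmf (map_pmf (\<lambda>(m, n). m + n) (pair_pmf (poisson_pmf s) (poisson_pmf t))) (\<lambda>n. replicate_pmf n E)"
      using 3 by (simp add: path_law_def poisson_convolution)
    also have "\<dots> = bind_pmf (poisson_pmf s) (\<lambda>m. bind_pmf (poisson_pmf t) (\<lambda>n. replicate_pmf (m + n) E))"
      by (simp add: bind_map_pmf pair_pmf_def bind_assoc_pmf bind_return_pmf)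
    also have "\<dots> = bind_pmf (poisson_pmf s) (\<lambda>m. bind_pmf (poisson_pmf t) (\<lambda>n. bind_pmf (replicate_pmf m E) (\<lambda>u.
       bind_pmf (replicate_pmf n E) (\<lambda>v. return_pmf (u @ v)))))"
      by (simp add: replicate_pmf_distrib)
    also have "\<dots> = bind_pmf (poisson_pmf s) (\<lambda>m. bind_pmf (replicate_pmf m E) (\<lambda>u. bind_pmf (poisson_pmf t) (\<lambda>n.
       bind_pmf (replicate_pmf n E) (\<lambda>v. return_pmf (u @ v)))))"
      by (subst (2) bind_commute_pmf) rule
    also have "\<dots> = bind_pmf (path_law E s) (\<lambda>u. map_pmf (\<lambda>v. u @ v) (path_law E t))"
      using 3 by (simp add: path_law_def map_pmf_def bind_assoc_pmf)
    finally show ?thesis .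
  qed
qed

definition path :: "orientation \<Rightarrow> nat \<Rightarrow> real \<Rightarrow> (nat \<times> bool) list pmf" where
  "path \<sigma> k t = path_law (pair_pmf (pmf_of_set {..<k}) (sign_pmf \<sigma>)) t"

lemma set_path:
  assumes "0 < k" "u \<in> set_pmf (path \<sigma> k t)" shows "fst ` set u \<subseteq> {..<k}"
  using assms by (auto simp: path_def path_law_def set_replicate_pmf lists_def lessThan_empty_iff split: if_splits dest!: in_listsD)

lemma letter_pair: "letter G Z (i, b) = (if b then Z ! i else inv\<^bsub>G\<^esub> (Z ! i))"
  by (simp add: letter_def)

lemma reduce_add_right: "reduce \<gamma> (x + reduce \<gamma> y) = reduce \<gamma> (x + y)"
  using reduce_add_left[of \<gamma> y x] by (simp add: add.commute)

lemma walk_law_cayley: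
  assumes "length Z = k"
  shows "walk_law (cayley_step \<sigma> G Z) \<one>\<^bsub>G\<^esub> t = map_pmf (word G Z) (path \<sigma> k t)"
proof -
  have "cayley_step \<sigma> G Z = (\<lambda>g. map_pmf (\<lambda>ib. g \<otimes>\<^bsub>G\<^esub> letter G Z ib) (pair_pmf (pmf_of_set {..<k}) (sign_pmf \<sigma>)))"
    by (simp add: cayley_step_def[abs_def] assms pair_pmf_def map_pmf_def bind_assoc_pmf bind_return_pmf letter_pair)
  then show ?thesis
    using walk_law_path[of "\<lambda>ib g. g \<otimes>\<^bsub>G\<^esub> letter G Z ib"] by (simp add: path_def word_def[abs_def])
qed

definition counts :: "nat \<Rightarrow> enat \<Rightarrow> (nat \<times> bool) list \<Rightarrow> nat \<Rightarrow> int" where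
  "counts k \<gamma> u i = (if i < k then reduce \<gamma> (net_count i u) else undefined)"

lemma lattice_walk_path:
  assumes k: "0 < k" and g: "1 \<le> \<gamma>"
  shows "lattice_walk \<sigma> k \<gamma> t = map_pmf (counts k \<gamma>) (path \<sigma> k t)"
proof -
  define act where "act ib x = x(fst ib := x (fst ib) \<otimes>\<^bsub>cyc \<gamma>\<^esub> sgn_of (snd ib))" for ib and x :: "nat \<Rightarrow> int"
  have "lattice_step \<sigma> k \<gamma> = (\<lambda>x. map_pmf (\<lambda>ib. act ib x) (pair_pmf (pmf_of_set {..<k}) (sign_pmf \<sigma>)))"
    by (simp add: lattice_step_def[abs_def] pair_pmf_def map_pmf_def bind_assoc_pmf bind_return_pmf act_def sgn_of_def)
  then have "lattice_walk \<sigma> k \<gamma> t = map_pmf (\<lambda>u. foldr act u \<one>\<^bsub>cyc_power \<gamma> k\<^esub>) (path \<sigma> k t)"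
    by (simp add: lattice_walk_def path_def walk_law_path)
  also have "\<dots> = map_pmf (counts k \<gamma>) (path \<sigma> k t)"
  proof (rule map_pmf_cong[OF refl])
    fix u assume "u \<in> set_pmf (path \<sigma> k t)"
    then have "fst ` set u \<subseteq> {..<k}" by (rule set_path[OF k])
    then show "foldr act u \<one>\<^bsub>cyc_power \<gamma> k\<^esub> = counts k \<gamma> u"
    proof (induction u)
      case Nil
      show ?case by (auto simp: counts_def one_cyc_power fun_eq_iff)
    next
      case (Cons ib u)
      then show ?case
        by (auto simp: act_def counts_def fun_eq_iff cyc_mult[OF g] reduce_add_left reduce_add_right add.commute)
    qed
  qed
  finally show ?thesis .
qed

text \<open>The walk at time \<open>t\<close> is the walk at time \<open>s\<close> followed by
independent right multiplications, which preserve the uniform law.\<close>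

lemma (in group) mixing_distance_antimono:
  assumes G: "finite (carrier G)" and Z: "set Z \<subseteq> carrier G" "length Z = k" and k: "0 < k"
    and s: "0 \<le> s" "s \<le> t"
  shows "mixing_distance \<sigma> G Z t \<le> mixing_distance \<sigma> G Z s"
proof -
  let ?U = "pmf_of_set (carrier G)"
  let ?Ps = "map_pmf (word G Z) (path \<sigma> k s)" and ?Pa = "path \<sigma> k (t - s)"
  have ne: "carrier G \<noteq> {}" using one_closed by blast
  have "path \<sigma> k t = bind_pmf ?Pa (\<lambda>u. map_pmf (\<lambda>v. u @ v) (path \<sigma> k s))"
    using path_law_add[of "t - s" s] s by (simp add: path_def)
  then have t: "map_pmf (word G Z) (path \<sigma> k t) = bind_pmf ?Pa (\<lambda>u. map_pmf (\<lambda>v. word G Z (u @ v)) (path \<sigma> k s))"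
    by (simp add: map_bind_pmf pmf.map_comp o_def)
  have "tv_distance (map_pmf (word G Z) (path \<sigma> k t)) ?U \<le> tv_distance ?Ps ?U"
  proof (rule tv_le)
    fix A
    define B where "B u = {x \<in> carrier G. x \<otimes> word G Z u \<in> A}" for u
    have 1: "measure_pmf.prob (map_pmf (word G Z) (path \<sigma> k t)) A = measure_pmf.expectation ?Pa (\<lambda>u. measure_pmf.prob ?Ps (B u))"
      unfolding t prob_bind_pmf
    proof (rule integral_cong_AE)
      show "AE u in ?Pa. measure_pmf.prob (map_pmf (\<lambda>v. word G Z (u @ v)) (path \<sigma> k s)) A = measure_pmf.prob ?Ps (B u)"
      proof (rule AE_pmfI)
        fix u assume "u \<in> set_pmf ?Pa"
        then have u: "fst ` set u \<subseteq> {..<length Z}" using set_path[OF k] Z by blast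
        have "measure_pmf.prob (path \<sigma> k s) {v. word G Z (u @ v) \<in> A} = measure_pmf.prob (path \<sigma> k s) {v. word G Z v \<in> B u}"
        proof (rule measure_prob_cong_0)
          fix v assume v: "v \<in> {v. word G Z (u @ v) \<in> A} - {v. word G Z v \<in> B u}"
          show "pmf (path \<sigma> k s) v = 0"
          proof (rule ccontr)
            assume "pmf (path \<sigma> k s) v \<noteq> 0"
            then have "fst ` set v \<subseteq> {..<length Z}" using set_path[OF k] Z by (metis set_pmf_iff)
            then show False using v word_append[OF Z(1) u] word_closed[OF Z(1)] by (auto simp: B_def)
          qed
        next
          fix v assume v: "v \<in> {v. word G Z v \<in> B u} - {v. word G Z (u @ v) \<in> A}"
          show "pmf (path \<sigma> k s) v = 0"
          proof (rule ccontr)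
            assume "pmf (path \<sigma> k s) v \<noteq> 0"
            then have "fst ` set v \<subseteq> {..<length Z}" using set_path[OF k] Z by (metis set_pmf_iff)
            then show False using v word_append[OF Z(1) u] by (auto simp: B_def)
          qed
        qed
        then show "measure_pmf.prob (map_pmf (\<lambda>v. word G Z (u @ v)) (path \<sigma> k s)) A = measure_pmf.prob ?Ps (B u)"
          by (simp add: measure_map_pmf vimage_def)
      qed
    qed auto
    have 2: "measure_pmf.prob ?U A = measure_pmf.expectation ?Pa (\<lambda>u. measure_pmf.prob ?U (B u))"
    proof -
      have "measure_pmf.expectation ?Pa (\<lambda>u. measure_pmf.prob ?U (B u)) = measure_pmf.expectation ?Pa (\<lambda>u. measure_pmf.prob ?U A)"
      proof (rule integral_cong_AE)
        show "AE u in ?Pa. measure_pmf.prob ?U (B u) = measure_pmf.prob ?U A"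
        proof (rule AE_pmfI)
          fix u assume "u \<in> set_pmf ?Pa"
          then have u: "word G Z u \<in> carrier G" using set_path[OF k] Z by (intro word_closed) blast+
          have "bij_betw (\<lambda>x. x \<otimes> word G Z u) (carrier G) (carrier G)"
          proof -
            have "y = (y \<otimes> inv (word G Z u)) \<otimes> word G Z u \<and> y \<otimes> inv (word G Z u) \<in> carrier G" if "y \<in> carrier G" for y
              using u that by (simp add: m_assoc)
            then have "(\<lambda>x. x \<otimes> word G Z u) ` carrier G = carrier G" using u by (blast intro: image_eqI)
            then show ?thesis using inj_on_multc[OF u] by (simp add: bij_betw_def)
          qed
          then have "map_pmf (\<lambda>x. x \<otimes> word G Z u) ?U = ?U"
            by (rule map_pmf_of_set_bij_betw[OF _ ne G])
          then have "measure_pmf.prob ?U A = measure_pmf.prob ?U {x. x \<otimes> word G Z u \<in> A}"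
            by (metis measure_map_pmf vimage_def)
          also have "\<dots> = measure_pmf.prob ?U (B u)"
            unfolding B_def by (rule measure_prob_cong_0) (use G ne in auto)
          finally show "measure_pmf.prob ?U (B u) = measure_pmf.prob ?U A" ..
        qed
      qed auto
      then show ?thesis by simp
    qed
    have i: "integrable (measure_pmf ?Pa) (\<lambda>u. measure_pmf.prob ?Ps (B u))" "integrable (measure_pmf ?Pa) (\<lambda>u. measure_pmf.prob ?U (B u))"
      by (auto intro!: expectation_bounded_integrable[where B = 1])
    have "\<bar>measure_pmf.prob (map_pmf (word G Z) (path \<sigma> k t)) A - measure_pmf.prob ?U A\<bar> =
       \<bar>measure_pmf.expectation ?Pa (\<lambda>u. measure_pmf.prob ?Ps (B u) - measure_pmf.prob ?U (B u))\<bar>"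
      unfolding 1 2 using i by simp
    also have "\<dots> \<le> measure_pmf.expectation ?Pa (\<lambda>u. \<bar>measure_pmf.prob ?Ps (B u) - measure_pmf.prob ?U (B u)\<bar>)"
      by (rule integral_abs_bound)
    also have "\<dots> \<le> measure_pmf.expectation ?Pa (\<lambda>u. tv_distance ?Ps ?U)"
      using i by (intro integral_mono integrable_abs Bochner_Integration.integrable_diff tv_ge) auto
    finally show "\<bar>measure_pmf.prob (map_pmf (word G Z) (path \<sigma> k t)) A - measure_pmf.prob ?U A\<bar> \<le> tv_distance ?Ps ?U" by simp
  qed
  then show ?thesis unfolding mixing_distance_def walk_law_cayley[OF Z(2)] .
qed

section \<open>Collisions and generation\<close>

lemma pmf_markov:
  fixes f :: "'s \<Rightarrow> real"
  assumes "integrable (measure_pmf M) f" "\<And>x. x \<in> set_pmf M \<Longrightarrow> 0 \<le> f x" "0 < c"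
  shows "measure_pmf.prob M {x. c \<le> f x} \<le> measure_pmf.expectation M f / c"
proof -
  have "AE x in measure_pmf M. 0 \<le> f x" using assms(2) by (simp add: AE_measure_pmf_iff)
  then show ?thesis
    using integral_Markov_inequality_measure[of "measure_pmf M" f UNIV c] assms(1,3) by simp
qed

lemma word_hom:
  assumes "group_hom G A \<phi>" "set Z \<subseteq> carrier G" "fst ` set u \<subseteq> {..<length Z}"
  shows "\<phi> (word G Z u) = word A (map \<phi> Z) u"
  using assms(3)
proof (induction u)
  case Nil
  show ?case using group_hom.hom_one[OF assms(1)] by simp
next
  case (Cons ib u)
  interpret \<phi>: group_hom G A \<phi> by (rule assms)
  have Zi: "Z ! fst ib \<in> carrier G" using assms(2) Cons.prems nth_mem by auto
  have "\<phi> (letter G Z ib) = letter A (map \<phi> Z) ib"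
    using Cons.prems Zi by (auto simp: letter_def)
  moreover have "word G Z u \<in> carrier G" "letter G Z ib \<in> carrier G"
    using assms(2) Cons.prems by (auto intro!: \<phi>.G.word_closed \<phi>.G.letter_closed)
  ultimately show ?case using Cons by (simp add: \<phi>.hom_mult)
qed

text \<open>In the Abelian quotient every element is central, so changing one generator is a central
shift.\<close>

lemma hom_collision:
  assumes A: "comm_group A" and hom: "group_hom G A \<phi>" and p: "prime (p::nat)"
    and exponent: "\<And>v. v \<in> carrier A \<Longrightarrow> v [^]\<^bsub>A\<^esub> p = \<one>\<^bsub>A\<^esub>"
    and Z: "set Z \<subseteq> carrier G" "set Z' \<subseteq> carrier G" "length Z = k" "length Z' = k"
    and i: "i < k" and agree: "\<And>j. j < k \<Longrightarrow> j \<noteq> i \<Longrightarrow> Z ! j = Z' ! j"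
    and u: "fst ` set u \<subseteq> {..<k}" "fst ` set v \<subseteq> {..<k}"
    and ne: "\<not> int p dvd net_count i u - net_count i v"
    and eq: "\<phi> (word G Z u) = \<phi> (word G Z v)" "\<phi> (word G Z' u) = \<phi> (word G Z' v)"
  shows "\<phi> (Z ! i) = \<phi> (Z' ! i)"
proof -
  interpret A: comm_group A by (rule A)
  interpret \<phi>: group_hom G A \<phi> by (rule hom)
  let ?z = "\<phi> (Z ! i)" and ?z' = "\<phi> (Z' ! i)"
  let ?Y = "map \<phi> Z"
  define y where "y = inv\<^bsub>A\<^esub> ?z \<otimes>\<^bsub>A\<^esub> ?z'"
  have "i < length Z" "i < length Z'" by (simp_all only: i Z(3,4))
  then have ZiG: "Z ! i \<in> carrier G" "Z' ! i \<in> carrier G"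
    by (blast intro: subsetD[OF Z(1) nth_mem], blast intro: subsetD[OF Z(2) nth_mem])
  have zA: "?z \<in> carrier A" "?z' \<in> carrier A" by (rule \<phi>.hom_closed, rule ZiG)+
  have yc: "y \<in> carrier A" unfolding y_def by (intro A.m_closed A.inv_closed zA)
  have y: "y \<in> group_centre A" unfolding group_centre_def by (intro CollectI conjI ballI yc A.m_comm[OF yc])
  have zy: "?z \<otimes>\<^bsub>A\<^esub> y = ?z'"
  proof -
    have "?z \<otimes>\<^bsub>A\<^esub> y = (?z \<otimes>\<^bsub>A\<^esub> inv\<^bsub>A\<^esub> ?z) \<otimes>\<^bsub>A\<^esub> ?z'"
      unfolding y_def by (rule A.m_assoc[symmetric, OF zA(1) A.inv_closed[OF zA(1)] zA(2)])
    also have "\<dots> = ?z'" unfolding A.r_inv[OF zA(1)] by (rule A.l_one[OF zA(2)])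
    finally show ?thesis .
  qed
  have Yi: "?Y ! i = ?z" using i Z(3) by simp
  have upd: "map \<phi> Z' = ?Y[i := ?Y ! i \<otimes>\<^bsub>A\<^esub> y]"
  proof (rule nth_equalityI)
    fix j assume "j < length (map \<phi> Z')"
    then have j: "j < k" using Z(4) by simp
    show "map \<phi> Z' ! j = ?Y[i := ?Y ! i \<otimes>\<^bsub>A\<^esub> y] ! j"
    proof (cases "j = i")
      case True
      have "map \<phi> Z' ! i = ?z'" by (rule nth_map) (simp only: Z(4) i)
      moreover have "?Y[i := ?z'] ! i = ?z'" by (rule nth_list_update_eq) (simp only: length_map Z(3) i)
      ultimately show ?thesis unfolding Yi zy True by (simp only:)
    next
      case False
      have "map \<phi> Z' ! j = \<phi> (Z' ! j)" by (rule nth_map) (simp only: Z(4) j)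
      moreover have "?Y ! j = \<phi> (Z ! j)" by (rule nth_map) (simp only: Z(3) j)
      ultimately show ?thesis unfolding nth_list_update_neq[OF False[symmetric]] agree[OF j False] by (simp only:)
    qed
  qed (simp only: length_map length_list_update Z(3,4))
  have wY: "\<phi> (word G Z w) = word A ?Y w" "\<phi> (word G Z' w) = word A (map \<phi> Z') w"
    if "fst ` set w \<subseteq> {..<k}" for w
    by (rule word_hom[OF hom Z(1)], simp only: Z(3) that, rule word_hom[OF hom Z(2)], simp only: Z(4) that)
  have "y = \<one>\<^bsub>A\<^esub>"
  proof (rule A.central_shift_trivial[of ?Y i y p u v])
    show "set ?Y \<subseteq> carrier A"
    proof
      fix a assume "a \<in> set ?Y"
      then obtain z where z: "z \<in> set Z" "a = \<phi> z" by auto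
      show "a \<in> carrier A" unfolding z(2) by (rule \<phi>.hom_closed[OF subsetD[OF Z(1) z(1)]])
    qed
    show "y [^]\<^bsub>A\<^esub> p = \<one>\<^bsub>A\<^esub>" by (rule exponent[OF yc])
    show "word A ?Y u = word A ?Y v" using eq(1) unfolding wY(1)[OF u(1)] wY(1)[OF u(2)] .
    show "word A (?Y[i := ?Y ! i \<otimes>\<^bsub>A\<^esub> y]) u = word A (?Y[i := ?Y ! i \<otimes>\<^bsub>A\<^esub> y]) v"
      using eq(2) unfolding wY(2)[OF u(1)] wY(2)[OF u(2)] upd[symmetric] .
    show "fst ` set u \<subseteq> {..<length ?Y}" "fst ` set v \<subseteq> {..<length ?Y}" using u Z(3) by simp_all
    show "i < length ?Y" using i Z(3) by simp
  qed (rule y p ne)+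
  show ?thesis using zy unfolding \<open>y = \<one>\<^bsub>A\<^esub>\<close> A.r_one[OF zA(1)] .
qed

context special_group begin

lemma V_group: "group V" by (rule comm_group.axioms(2)[OF V_comm])

lemma carrier_V: "carrier V = rcosets C" by (simp add: FactGroup_def)

lemma order_V: "order V * card C = order G"
  using lagrange_finite[OF finite_carrier C_subgroup] by (simp add: order_def carrier_V)

lemma coset_eq: assumes "x \<in> carrier G" "y \<in> carrier G" "C #> x = C #> y" shows "inv x \<otimes> y \<in> C"
proof -
  have "y \<in> C #> x" using assms rcos_self[OF assms(2) C_subgroup] by simp
  then obtain c where c: "c \<in> C" "y = c \<otimes> x" by (auto simp: r_coset_def)
  then have cG: "c \<in> carrier G" using C_sub by auto
  have "inv x \<otimes> y = inv x \<otimes> (x \<otimes> c)" using c C_comm[OF c(1) assms(1)] by simp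
  also have "\<dots> = c" using cG assms(1) by (simp add: m_assoc[symmetric])
  finally show ?thesis using c by simp
qed

lemma V_hom_group: "group_hom G V ((#>) C)"
  by (intro group_hom.intro group_axioms V_group group_hom_axioms.intro V_hom)

lemma V_exponent: assumes "v \<in> carrier V" shows "v [^]\<^bsub>V\<^esub> p = \<one>\<^bsub>V\<^esub>"
proof -
  interpret \<phi>: group_hom G V "(#>) C" by (rule V_hom_group)
  obtain x where x: "x \<in> carrier G" "v = C #> x" using assms by (auto simp: carrier_V RCOSETS_def)
  have "v [^]\<^bsub>V\<^esub> p = C #> (x [^] p)" using \<phi>.hom_nat_pow[OF x(1), of p] x by simp
  also have "C #> (x [^] p) = C" using pow_p_in_C[OF x(1)] x(1) by (intro coset_join2 C_subgroup) auto
  also have "C = \<one>\<^bsub>V\<^esub>" by (simp add: FactGroup_def)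
  finally show ?thesis .
qed

lemma coset_collision:
  assumes Z: "set Z \<subseteq> carrier G" "set Z' \<subseteq> carrier G" "length Z = k" "length Z' = k"
    and i: "i < k" and agree: "\<And>j. j < k \<Longrightarrow> j \<noteq> i \<Longrightarrow> Z ! j = Z' ! j"
    and u: "fst ` set u \<subseteq> {..<k}" "fst ` set v \<subseteq> {..<k}"
    and ne: "\<not> int p dvd net_count i u - net_count i v"
    and eq: "C #> word G Z u = C #> word G Z v" "C #> word G Z' u = C #> word G Z' v"
  shows "C #> (Z ! i) = C #> (Z' ! i)"
  using hom_collision[where \<phi> = "(#>) C" and A = V and G = G and p = p and k = k and i = i
      and Z = Z and Z' = Z' and u = u and v = v, OF V_comm V_hom_group prime V_exponent Z i agree u ne eq] .

text \<open>The quotient determines the entry up to a factor in the centre; the central shift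
argument in the group itself determines this factor.\<close>

lemma collision:
  assumes Z: "set Z \<subseteq> carrier G" "set Z' \<subseteq> carrier G" "length Z = k" "length Z' = k"
    and i: "i < k" and agree: "\<And>j. j < k \<Longrightarrow> j \<noteq> i \<Longrightarrow> Z ! j = Z' ! j"
    and u: "fst ` set u \<subseteq> {..<k}" "fst ` set v \<subseteq> {..<k}"
    and ne: "\<not> int p dvd net_count i u - net_count i v"
    and eq: "word G Z u = word G Z v" "word G Z' u = word G Z' v"
  shows "Z ! i = Z' ! i"
proof -
  have zG: "Z ! i \<in> carrier G" "Z' ! i \<in> carrier G"
    by (rule subsetD[OF Z(1) nth_mem], simp only: Z(3) i, rule subsetD[OF Z(2) nth_mem], simp only: Z(4) i)
  have e: "C #> word G Z u = C #> word G Z v" "C #> word G Z' u = C #> word G Z' v" by (simp_all only: eq)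
  have "C #> (Z ! i) = C #> (Z' ! i)" by (rule coset_collision[OF Z i agree u ne e])
  define y where "y = inv (Z ! i) \<otimes> Z' ! i"
  have yC: "y \<in> C" unfolding y_def by (rule coset_eq[OF zG]) fact
  have "Z ! i \<otimes> y = (Z ! i \<otimes> inv (Z ! i)) \<otimes> Z' ! i"
    unfolding y_def by (rule m_assoc[symmetric, OF zG(1) inv_closed[OF zG(1)] zG(2)])
  then have zy: "Z ! i \<otimes> y = Z' ! i" unfolding r_inv[OF zG(1)] l_one[OF zG(2)] .
  have upd: "Z' = Z[i := Z ! i \<otimes> y]"
  proof (rule nth_equalityI)
    fix j assume "j < length Z'"
    then have j: "j < k" using Z by simp
    show "Z' ! j = Z[i := Z ! i \<otimes> y] ! j"
    proof (cases "j = i")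
      case True
      have "i < length Z" by (simp only: Z(3) i)
      then show ?thesis unfolding True zy by (simp only: nth_list_update_eq)
    next
      case False
      show ?thesis unfolding nth_list_update_neq[OF False[symmetric]] by (rule agree[OF j False, symmetric])
    qed
  qed (simp only: length_list_update Z(3,4))
  have "y = \<one>"
  proof (rule central_shift_trivial[of Z i y p u v])
    show "y \<in> group_centre G" using yC by (simp only: C_centre)
    show "y [^] p = \<one>" by (rule C_exponent[OF yC])
    show "word G (Z[i := Z ! i \<otimes> y]) u = word G (Z[i := Z ! i \<otimes> y]) v"
      unfolding upd[symmetric] by (rule eq(2))
  qed (rule Z(1) prime ne eq(1) | simp only: Z(3) i u)+
  show ?thesis using zy unfolding \<open>y = \<one>\<close> r_one[OF zG(1)] .
qed

lemma card_coset_fibre: "card {z \<in> carrier G. C #> z = v} \<le> card C"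
proof (cases "\<exists>z\<in>carrier G. C #> z = v")
  case True
  then obtain z where z: "z \<in> carrier G" "C #> z = v" by blast
  have fin: "finite C" using C_sub finite_carrier finite_subset by blast
  have "{z' \<in> carrier G. C #> z' = v} \<subseteq> (\<lambda>c. z \<otimes> c) ` C"
  proof
    fix z' assume "z' \<in> {z' \<in> carrier G. C #> z' = v}"
    then have z': "z' \<in> carrier G" "C #> z = C #> z'" using z by auto
    have "inv z \<otimes> z' \<in> C" by (rule coset_eq[OF z(1) z'])
    moreover have "z' = z \<otimes> (inv z \<otimes> z')" using z z' by (simp add: m_assoc[symmetric])
    ultimately show "z' \<in> (\<lambda>c. z \<otimes> c) ` C" by blast
  qed
  then have "card {z' \<in> carrier G. C #> z' = v} \<le> card ((\<lambda>c. z \<otimes> c) ` C)"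
    using fin by (intro card_mono) auto
  also have "\<dots> \<le> card C" using fin by (rule card_image_le)
  finally show ?thesis .
next
  case False
  then have "{z \<in> carrier G. C #> z = v} = {}" by blast
  then show ?thesis by (simp only: card.empty)
qed

lemma prob_collision:
  assumes i: "i < k" and u: "fst ` set u \<subseteq> {..<k}" "fst ` set v \<subseteq> {..<k}"
    and ne: "\<not> int p dvd net_count i u - net_count i v"
  shows "measure_pmf.prob (generators_law G k) {Z. word G Z u = word G Z v} \<le> 1 / card (carrier G)"
proof -
  have "measure_pmf.prob (replicate_pmf k (pmf_of_set (carrier G))) {Z. word G Z u = word G Z v}
     \<le> real 1 / real (card (carrier G))"
  proof (rule prob_replicate_uniform_fibre[where \<psi> = id and i = i])
    fix v
    have "{z \<in> carrier G. id z = v} \<subseteq> {v}" by auto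
    then show "card {z \<in> carrier G. id z = v} \<le> 1" using card_mono[of "{v}"] by simp
  next
    fix Z Z' :: "'a list"
    assume e: "Z \<in> {Z. word G Z u = word G Z v}" "Z' \<in> {Z. word G Z u = word G Z v}"
      and Z: "set Z \<subseteq> carrier G" "set Z' \<subseteq> carrier G" "length Z = k" "length Z' = k"
      and agree: "\<And>j. j < k \<Longrightarrow> j \<noteq> i \<Longrightarrow> Z ! j = Z' ! j"
    have "Z ! i = Z' ! i" by (rule collision[OF Z i agree u ne CollectD[OF e(1)] CollectD[OF e(2)]])
    then show "id (Z ! i) = id (Z' ! i)" by simp
  qed (use i finite_carrier one_closed in auto)
  then show ?thesis by (simp add: generators_law_def)
qed

lemma prob_coset_collision:
  assumes i: "i < k" and u: "fst ` set u \<subseteq> {..<k}" "fst ` set v \<subseteq> {..<k}"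
    and ne: "\<not> int p dvd net_count i u - net_count i v"
  shows "measure_pmf.prob (generators_law G k) {Z. C #> word G Z u = C #> word G Z v} \<le> 1 / order V"
proof -
  have "measure_pmf.prob (replicate_pmf k (pmf_of_set (carrier G))) {Z. C #> word G Z u = C #> word G Z v}
     \<le> real (card C) / real (card (carrier G))"
  proof (rule prob_replicate_uniform_fibre[where \<psi> = "(#>) C" and i = i])
    fix Z Z' :: "'a list"
    assume e: "Z \<in> {Z. C #> word G Z u = C #> word G Z v}" "Z' \<in> {Z. C #> word G Z u = C #> word G Z v}"
      and Z: "set Z \<subseteq> carrier G" "set Z' \<subseteq> carrier G" "length Z = k" "length Z' = k"
      and agree: "\<And>j. j < k \<Longrightarrow> j \<noteq> i \<Longrightarrow> Z ! j = Z' ! j"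
    show "C #> (Z ! i) = C #> (Z' ! i)"
      by (rule coset_collision[OF Z i agree u ne CollectD[OF e(1)] CollectD[OF e(2)]])
  next
    show "carrier G \<noteq> {}" using one_closed by blast
  qed (rule i finite_carrier card_coset_fibre)+
  also have "real (card C) / real (card (carrier G)) = 1 / order V"
  proof -
    have "0 < card (carrier G)" using finite_carrier one_closed by (auto simp: card_gt_0_iff)
    then have "0 < card C" using finite_subset[OF C_sub finite_carrier] subgroup.one_closed[OF C_subgroup] by (auto simp: card_gt_0_iff)
    moreover have "real (card (carrier G)) = real (order V) * real (card C)"
      using arg_cong[OF order_V[symmetric], of real] unfolding order_def of_nat_mult .
    ultimately show ?thesis by simp
  qed
  finally show ?thesis by (simp add: generators_law_def)
qed

text \<open>Since \<open>C\<close> is central, the commutators of \<open>H C\<close> are those of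
\<open>H\<close>. Hence \<open>C = [G, G]\<close> lies in \<open>H\<close>.\<close>

lemma generate_mod_C:
  assumes H: "subgroup H G" and HC: "H <#> C = carrier G"
  shows "H = carrier G"
proof -
  have Hs: "H \<subseteq> carrier G" using H subgroup.subset by blast
  have comm: "g1 \<otimes> g2 \<otimes> inv g1 \<otimes> inv g2 \<in> H" if g: "g1 \<in> carrier G" "g2 \<in> carrier G" for g1 g2
  proof -
    obtain h1 c1 where 1: "h1 \<in> H" "c1 \<in> C" "g1 = h1 \<otimes> c1" using g(1) HC unfolding set_mult_def by blast
    obtain h2 c2 where 2: "h2 \<in> H" "c2 \<in> C" "g2 = h2 \<otimes> c2" using g(2) HC unfolding set_mult_def by blast
    have hG: "h1 \<in> carrier G" "h2 \<in> carrier G" and cG: "c1 \<in> carrier G" "c2 \<in> carrier G"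
      using 1 2 Hs C_sub by auto
    have cc: "c1 \<otimes> x = x \<otimes> c1" "c2 \<otimes> x = x \<otimes> c2" if "x \<in> carrier G" for x
      using C_comm 1 2 that by auto
    have swap: "(a \<otimes> c) \<otimes> (b \<otimes> d) = a \<otimes> b \<otimes> (c \<otimes> d)"
      if "a \<in> carrier G" "b \<in> carrier G" "c \<in> carrier G" "d \<in> carrier G" "c \<otimes> b = b \<otimes> c" for a b c d
    proof -
      have "(a \<otimes> c) \<otimes> (b \<otimes> d) = a \<otimes> (c \<otimes> b) \<otimes> d" using that(1-4) by (simp add: m_assoc)
      also have "\<dots> = a \<otimes> b \<otimes> (c \<otimes> d)" unfolding that(5) using that(1-4) by (simp add: m_assoc)
      finally show ?thesis .
    qed
    have "g1 \<otimes> g2 = h1 \<otimes> h2 \<otimes> (c1 \<otimes> c2)"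
      unfolding 1 2 by (rule swap[OF hG cG cc(1)[OF hG(2)]])
    moreover have "g2 \<otimes> g1 = h2 \<otimes> h1 \<otimes> (c1 \<otimes> c2)"
      unfolding 1 2 cc(1)[OF cG(2)] by (rule swap[OF hG(2,1) cG(2,1) cc(2)[OF hG(1)]])
    moreover have "g1 \<otimes> g2 \<otimes> inv g1 \<otimes> inv g2 = (g1 \<otimes> g2) \<otimes> inv (g2 \<otimes> g1)"
      using g by (simp add: inv_mult_group m_assoc)
    ultimately have "g1 \<otimes> g2 \<otimes> inv g1 \<otimes> inv g2 = (h1 \<otimes> h2) \<otimes> inv (h2 \<otimes> h1)"
    proof -
      assume a: "g1 \<otimes> g2 = h1 \<otimes> h2 \<otimes> (c1 \<otimes> c2)" "g2 \<otimes> g1 = h2 \<otimes> h1 \<otimes> (c1 \<otimes> c2)"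
        "g1 \<otimes> g2 \<otimes> inv g1 \<otimes> inv g2 = (g1 \<otimes> g2) \<otimes> inv (g2 \<otimes> g1)"
      define c where "c = c1 \<otimes> c2"
      have c: "c \<in> carrier G" using cG by (simp add: c_def)
      have "inv (h2 \<otimes> h1 \<otimes> c) = inv c \<otimes> inv (h2 \<otimes> h1)" using hG c by (intro inv_mult_group) auto
      moreover have "(a \<otimes> c) \<otimes> (inv c \<otimes> b) = a \<otimes> (c \<otimes> inv c) \<otimes> b" if "a \<in> carrier G" "b \<in> carrier G" for a b
        using that c inv_closed[OF c] by (simp only: m_assoc m_closed)
      ultimately have "(h1 \<otimes> h2 \<otimes> c) \<otimes> inv (h2 \<otimes> h1 \<otimes> c) = h1 \<otimes> h2 \<otimes> (c \<otimes> inv c) \<otimes> inv (h2 \<otimes> h1)"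
        using hG by simp
      also have "\<dots> = (h1 \<otimes> h2) \<otimes> inv (h2 \<otimes> h1)" using hG c by simp
      finally show ?thesis using a by (simp add: c_def)
    qed
    then show ?thesis using 1 2 H by (simp add: subgroup.m_closed subgroup.m_inv_closed)
  qed
  have "C \<subseteq> H" unfolding derived_def
    by (rule generate_subgroup_incl[OF _ H]) (use comm in auto)
  then have "H <#> C \<subseteq> H" using H by (auto simp: set_mult_def subgroup.m_closed)
  then show ?thesis using HC Hs by auto
qed

lemma order_V_power: "\<exists>m. order V = p ^ m"
proof -
  obtain n where "order G = p ^ n" using special by (auto simp: special_p_group_def)
  then have "order V dvd p ^ n" using order_V by (metis dvd_triv_left)
  then show ?thesis using prime divides_primepow_nat by blast
qed

lemma proper_subgroup_card:
  assumes H: "subgroup H V" "H \<noteq> carrier V"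
  shows "p * card H \<le> order V"
proof -
  have fV: "finite (carrier V)" using finite_carrier by (auto simp: carrier_V RCOSETS_def)
  obtain m where m: "order V = p ^ m" using order_V_power by blast
  define d where "d = card (rcosets\<^bsub>V\<^esub> H)"
  have lag: "d * card H = order V"
    using group.lagrange_finite[OF V_group fV H(1)] by (simp add: d_def)
  have "d dvd p ^ m" using lag m by (metis dvd_triv_left)
  then obtain i where i: "d = p ^ i" using prime divides_primepow_nat by blast
  have "i \<noteq> 0"
  proof
    assume "i = 0"
    then have "card H = card (carrier V)" using lag i by (simp add: order_def)
    moreover have "H \<subseteq> carrier V" using H(1) by (rule subgroup.subset)
    ultimately show False using H(2) fV card_subset_eq by blast
  qed
  then have "p \<le> d" using i prime_gt_0_nat[OF prime] self_le_power[of p i] by simp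
  then have "p * card H \<le> d * card H" by (rule mult_le_mono1)
  then show ?thesis using lag by simp
qed

text \<open>The word in which the \<open>i\<close>-th generator is used \<open>w ! i\<close> times.
These words with exponents below \<open>p\<close> represent all classes of net numbers modulo
\<open>p\<close>.\<close>

definition power_word :: "nat list \<Rightarrow> (nat \<times> bool) list" where
  "power_word w = concat (map (\<lambda>i. replicate (w ! i) (i, True)) [0..<length w])"

lemma set_power_word: "fst ` set (power_word w) \<subseteq> {..<length w}"
  by (auto simp: power_word_def)

lemma net_count_append: "net_count i (u @ v) = net_count i u + net_count i v"
  by (simp add: net_count_def)

lemma net_count_power_word: assumes "i < length w" shows "net_count i (power_word w) = int (w ! i)"
proof -
  have rep: "net_count i (replicate n (j, True)) = (if i = j then int n else 0)" for n j
    by (induction n) (auto simp: sgn_of_def)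
  have "net_count i (concat (map (\<lambda>j. replicate (w ! j) (j, True)) [0..<n])) = (if i < n then int (w ! i) else 0)" for n
    by (induction n) (auto simp: net_count_append rep less_Suc_eq)
  then show ?thesis using assms by (simp add: power_word_def)
qed

text \<open>Count the pairs of words \<open>power_word w\<close> that agree modulo \<open>C\<close>.
Their mean number is close to the least possible number, that of the equidistributed case. If the
generators do not generate, the words lie in a proper subgroup of \<open>V\<close>, which has index
at least \<open>p\<close>, and the number of pairs is at least \<open>p\<close> times larger. Markov
applies to the excess over the least number.\<close>

lemma prob_not_generate:
  assumes k: "0 < k"
  shows "measure_pmf.prob (generators_law G k) {Z. generate G (set Z) \<noteq> carrier G} \<le> order V / ((p - 1) * p ^ k)"
proof -
  define Ws where "Ws = {w. set w \<subseteq> {..<p} \<and> length w = k}"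
  have finW: "finite Ws" and cardW: "card Ws = p ^ k"
    by (auto simp: Ws_def finite_lists_length_eq card_lists_length_eq)
  have p2: "2 \<le> p" using prime by (rule prime_ge_2_nat)
  define n where "n = real (order V)"
  have fV: "finite (carrier V)"
    using finite_carrier by (auto simp: carrier_V RCOSETS_def)
  have n: "0 < n" using fV group.is_monoid[OF V_group] monoid.one_closed by (auto simp: n_def order_def card_gt_0_iff)
  define M where "M = generators_law G k"
  define f where "f Z w = C #> word G Z (power_word w)" for Z w
  define \<kappa> where "\<kappa> Z = (\<Sum>w\<in>Ws. \<Sum>w'\<in>Ws. of_bool (f Z w = f Z w') :: real)" for Z
  have setM: "set Z \<subseteq> carrier G \<and> length Z = k" if "Z \<in> set_pmf M" for Z
  proof -
    have "set_pmf (pmf_of_set (carrier G)) = carrier G" using finite_carrier one_closed by (intro set_pmf_of_set) auto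
    then show ?thesis using that by (auto simp: M_def generators_law_def set_replicate_pmf)
  qed
  have E: "measure_pmf.expectation M \<kappa> \<le> p ^ k + (p ^ k)\<^sup>2 / n"
  proof -
    have i1: "integrable (measure_pmf M) (\<lambda>Z. of_bool (f Z w = f Z w') :: real)" for w w'
      by (rule expectation_bounded_integrable[where B = 1]) auto
    have "measure_pmf.expectation M \<kappa> = (\<Sum>w\<in>Ws. \<Sum>w'\<in>Ws. measure_pmf.expectation M (\<lambda>Z. of_bool (f Z w = f Z w')))"
      unfolding \<kappa>_def by (simp add: i1 Bochner_Integration.integral_sum Bochner_Integration.integrable_sum)
    also have "\<dots> \<le> (\<Sum>w\<in>Ws. \<Sum>w'\<in>Ws. of_bool (w = w') + 1 / n)"
    proof (intro sum_mono)
      fix w w' assume w: "w \<in> Ws" "w' \<in> Ws"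
      have eq: "measure_pmf.expectation M (\<lambda>Z. of_bool (f Z w = f Z w')) = measure_pmf.prob M {Z. f Z w = f Z w'}"
      proof -
        have "(\<lambda>Z. of_bool (f Z w = f Z w') :: real) = indicator {Z. f Z w = f Z w'}" by (auto simp: indicator_def)
        then show ?thesis by simp
      qed
      show "measure_pmf.expectation M (\<lambda>Z. of_bool (f Z w = f Z w')) \<le> of_bool (w = w') + 1 / n"
      proof (cases "w = w'")
        case True
        have "measure_pmf.prob M {Z. f Z w = f Z w'} \<le> 1" by simp
        moreover have "0 \<le> 1 / n" using n by simp
        ultimately show ?thesis unfolding eq using True by simp
      next
        case False
        then obtain i where i: "i < k" "w ! i \<noteq> w' ! i" using w by (auto simp: Ws_def list_eq_iff_nth_eq)
        have len: "length w = k" "length w' = k" and sub: "set w \<subseteq> {..<p}" "set w' \<subseteq> {..<p}"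
          using w by (simp_all add: Ws_def)
        have "w ! i \<in> {..<p}" "w' ! i \<in> {..<p}"
          by (rule subsetD[OF sub(1) nth_mem], simp only: len i, rule subsetD[OF sub(2) nth_mem], simp only: len i)
        then have "int (w ! i) mod int p \<noteq> int (w' ! i) mod int p" using i(2) by simp
        then have "\<not> int p dvd int (w ! i) - int (w' ! i)" unfolding mod_eq_dvd_iff .
        then have "\<not> int p dvd net_count i (power_word w) - net_count i (power_word w')"
          using net_count_power_word[of i w] net_count_power_word[of i w'] i(1) unfolding len by simp
        then have "measure_pmf.prob M {Z. f Z w = f Z w'} \<le> 1 / n"
          unfolding M_def f_def n_def 
          using set_power_word[of w] set_power_word[of w'] unfolding len by (intro prob_coset_collision[OF i(1)])
        then show ?thesis unfolding eq using False by simp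
      qed
    qed
    also have "\<dots> = p ^ k + (p ^ k)\<^sup>2 / n"
    proof -
      have "(\<Sum>w'\<in>Ws. of_bool (w = w') + 1 / n) = 1 + p ^ k / n" if "w \<in> Ws" for w
        using finW that by (simp add: sum.distrib cardW of_bool_def)
      then show ?thesis by (simp add: cardW power2_eq_square distrib_left)
    qed
    finally show ?thesis .
  qed
  have CS: "(p ^ k)\<^sup>2 / real (card (f Z ` Ws)) \<le> \<kappa> Z" for Z
  proof -
    define I where "I = f Z ` Ws"
    have "0 < card Ws" using cardW p2 by simp
    then have I: "finite I" "0 < card I" using finW by (auto simp: I_def card_gt_0_iff)
    define N where "N v = real (card {w \<in> Ws. f Z w = v})" for v
    have group: "(\<Sum>v\<in>I. \<Sum>w\<in>{w \<in> Ws. f Z w = v}. g w) = (\<Sum>w\<in>Ws. g w)" for g :: "_ \<Rightarrow> real"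
      by (rule sum.group) (use finW I in \<open>auto simp: I_def\<close>)
    have tot: "(\<Sum>v\<in>I. N v) = p ^ k" using group[of "\<lambda>_. 1"] by (simp add: N_def cardW)
    have "\<kappa> Z = (\<Sum>w\<in>Ws. N (f Z w))"
    proof -
      have "(\<Sum>w'\<in>Ws. of_bool (f Z w = f Z w')) = N (f Z w)" for w
      proof -
        have "{w' \<in> Ws. f Z w = f Z w'} = {w' \<in> Ws. f Z w' = f Z w}" by auto
        then show ?thesis
          unfolding N_def by (simp add: of_bool_def sum.inter_filter[OF finW, symmetric])
      qed
      then show ?thesis by (simp add: \<kappa>_def)
    qed
    also have "\<dots> = (\<Sum>v\<in>I. \<Sum>w\<in>{w \<in> Ws. f Z w = v}. N (f Z w))" by (rule group[symmetric])
    also have "\<dots> = (\<Sum>v\<in>I. (N v)\<^sup>2)"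
      by (rule sum.cong[OF refl]) (simp add: N_def power2_eq_square)
    finally have k2: "\<kappa> Z = (\<Sum>v\<in>I. (N v)\<^sup>2)" .
    have "(\<Sum>v\<in>I. 1 * N v)\<^sup>2 \<le> (\<Sum>v\<in>I. 1\<^sup>2) * (\<Sum>v\<in>I. (N v)\<^sup>2)" by (rule Cauchy_Schwarz_ineq_sum)
    then have "(p ^ k)\<^sup>2 \<le> real (card I) * \<kappa> Z" by (simp add: tot k2)
    then show ?thesis using I by (simp add: I_def[symmetric] field_simps)
  qed
  have range: "f Z ` Ws \<subseteq> (#>) C ` generate G (set Z)" if Z: "set Z \<subseteq> carrier G \<and> length Z = k" for Z
  proof
    fix v assume "v \<in> f Z ` Ws"
    then obtain w where w: "w \<in> Ws" "v = f Z w" by blast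
    have "word G Z u \<in> generate G (set Z)" if "fst ` set u \<subseteq> {..<k}" for u
      using that
    proof (induction u)
      case (Cons ib u)
      then have "Z ! fst ib \<in> set Z" using Z by auto
      then have "letter G Z ib \<in> generate G (set Z)" by (auto simp: letter_def intro: generate.incl generate.inv)
      then show ?case using Cons by (auto intro: generate.eng)
    qed (simp add: generate.one)
    then show "v \<in> (#>) C ` generate G (set Z)"
      using w set_power_word[of w] by (auto simp: f_def Ws_def)
  qed
  have lower: "(p ^ k)\<^sup>2 / n \<le> \<kappa> Z" if Z: "Z \<in> set_pmf M" for Z
  proof -
    have sub: "generate G (set Z) \<subseteq> carrier G" using setM[OF Z] by (intro generate_incl) simp
    have "f Z ` Ws \<subseteq> carrier V"
      by (rule order_trans[OF range[OF setM[OF Z]]]) (use sub in \<open>auto simp: carrier_V RCOSETS_def\<close>)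
    then have "real (card (f Z ` Ws)) \<le> n" using fV by (simp add: n_def order_def card_mono)
    moreover have "0 < card Ws" using cardW p2 by simp
    then have "0 < card (f Z ` Ws)" using finW by (auto simp: card_gt_0_iff)
    ultimately have "(p ^ k)\<^sup>2 / n \<le> (p ^ k)\<^sup>2 / real (card (f Z ` Ws))"
      using n by (intro divide_left_mono) auto
    then show ?thesis using CS[of Z] by linarith
  qed
  have upper: "p * ((p ^ k)\<^sup>2 / n) \<le> \<kappa> Z" if Z: "Z \<in> set_pmf M" "generate G (set Z) \<noteq> carrier G" for Z
  proof -
    let ?H = "generate G (set Z)"
    have Zc: "set Z \<subseteq> carrier G \<and> length Z = k" by (rule setM[OF Z(1)])
    have H: "subgroup ?H G" using Zc by (intro generate_is_subgroup) simp
    have IH: "subgroup ((#>) C ` ?H) V" by (rule group_hom.subgroup_img_is_subgroup[OF V_hom_group H])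
    have "(#>) C ` ?H \<noteq> carrier V"
    proof
      assume eq: "(#>) C ` ?H = carrier V"
      have "carrier G \<subseteq> ?H <#> C"
      proof
        fix g assume g: "g \<in> carrier G"
        then have "C #> g \<in> (#>) C ` ?H" unfolding eq by (auto simp: carrier_V RCOSETS_def)
        then obtain h where h: "h \<in> ?H" "C #> g = C #> h" by blast
        have hG: "h \<in> carrier G" by (rule subgroup.mem_carrier[OF H h(1)])
        have "inv h \<otimes> g \<in> C" using coset_eq[OF hG g] h by simp
        moreover have "g = h \<otimes> (inv h \<otimes> g)" by (rule inv_solve_left[THEN iffD1, OF _ _ _ refl]) (use hG g in auto)
        ultimately show "g \<in> ?H <#> C" using h by (auto simp: set_mult_def)
      qed
      moreover have "?H <#> C \<subseteq> carrier G" 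
        by (intro set_mult_closed C_sub subgroup.subset[OF H])
      ultimately have "?H = carrier G" by (intro generate_mod_C[OF H]) auto
      with Z show False by simp
    qed
    then have "p * card ((#>) C ` ?H) \<le> order V" by (rule proper_subgroup_card[OF IH])
    moreover have "finite ((#>) C ` ?H)" by (rule finite_subset[OF subgroup.subset[OF IH] fV])
    then have "card (f Z ` Ws) \<le> card ((#>) C ` ?H)" using range[OF Zc] by (intro card_mono) auto
    ultimately have "p * card (f Z ` Ws) \<le> order V" by (meson mult_le_mono2 order_trans)
    then have le: "real p * real (card (f Z ` Ws)) \<le> n"
      unfolding n_def of_nat_mult[symmetric] of_nat_le_iff .
    have "0 < card Ws" using cardW p2 by simp
    then have pos: "0 < card (f Z ` Ws)" using finW by (auto simp: card_gt_0_iff)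
    have "p * ((p ^ k)\<^sup>2 / n) \<le> p * ((p ^ k)\<^sup>2 / (real p * real (card (f Z ` Ws))))"
      using le pos p2 n by (intro mult_left_mono divide_left_mono) auto
    also have "\<dots> = (p ^ k)\<^sup>2 / real (card (f Z ` Ws))" using p2 by simp
    finally show ?thesis using CS[of Z] by linarith
  qed
  define Y where "Y Z = \<kappa> Z - (p ^ k)\<^sup>2 / n" for Z
  define a where "a = (real p - 1) * ((p ^ k)\<^sup>2 / n)"
  have a: "0 < a" using p2 n by (simp add: a_def)
  have ik: "integrable (measure_pmf M) \<kappa>"
    unfolding \<kappa>_def by (intro Bochner_Integration.integrable_sum expectation_bounded_integrable[where B = 1]) auto
  then have iY: "integrable (measure_pmf M) Y" unfolding Y_def by simp
  have "measure_pmf.prob M {Z. generate G (set Z) \<noteq> carrier G} \<le> measure_pmf.prob M {Z. a \<le> Y Z}"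
  proof (rule pmf_prob_mono)
    fix Z assume "Z \<in> set_pmf M" "Z \<in> {Z. generate G (set Z) \<noteq> carrier G}"
    then have "p * ((p ^ k)\<^sup>2 / n) \<le> \<kappa> Z" by (intro upper) auto
    then show "Z \<in> {Z. a \<le> Y Z}" unfolding a_def Y_def left_diff_distrib by simp
  qed
  also have "\<dots> \<le> measure_pmf.expectation M Y / a"
    by (rule pmf_markov[OF iY _ a]) (use lower in \<open>simp add: Y_def\<close>)
  also have "\<dots> \<le> p ^ k / a"
  proof (intro divide_right_mono)
    have "measure_pmf.expectation M Y = measure_pmf.expectation M \<kappa> - (p ^ k)\<^sup>2 / n"
      unfolding Y_def by (subst Bochner_Integration.integral_diff[OF ik]) auto
    then show "measure_pmf.expectation M Y \<le> p ^ k" using E by simp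
  qed (use a in simp)
  also have "\<dots> = order V / ((p - 1) * p ^ k)"
    using p2 n by (simp add: a_def n_def power2_eq_square of_nat_diff)
  finally show ?thesis by (simp add: M_def)
qed

end

context cyclic_walk begin

section \<open>Bounds for the mixing distance at a fixed group\<close>

lemma expectation_cyc_walk:
  fixes f :: "int \<Rightarrow> real"
  assumes "0 \<le> s"
  shows "measure_pmf.expectation (cyc_walk s) f = (\<Sum>x\<in>Zp. q s x * f x)"
proof -
  have "measure_pmf.expectation (cyc_walk s) f = (\<Sum>x\<in>Zp. f x * pmf (cyc_walk s) x)"
    by (rule integral_measure_pmf_real) (use set_cyc_walk[of s] in blast)+
  also have "\<dots> = (\<Sum>x\<in>Zp. q s x * f x)"
    by (rule sum.cong[OF refl]) (simp add: pmf_cyc_walk[OF assms])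
  finally show ?thesis .
qed

lemma expectation_surprisal_cyc_walk:
  assumes s: "0 \<le> s"
  shows "measure_pmf.expectation (cyc_walk s) (surprisal (cyc_walk s)) = h s"
  using coord_entropy_p[OF s] shannon_entropy_expectation[OF integrable_surprisal_reduced[OF s, of \<sigma> "enat p"]]
  unfolding coord_entropy_def reduced_walk_p by simp

lemma variance_surprisal_cyc_walk:
  assumes s: "0 \<le> s"
  shows "measure_pmf.expectation (cyc_walk s) (\<lambda>x. (surprisal (cyc_walk s) x - h s)\<^sup>2) = varent s"
proof -
  define Y where "Y x = - ln (q s x)" for x
  have S: "surprisal (cyc_walk s) x = Y x" if "x \<in> Zp" for x
    using that by (simp add: pmf_cyc_walk[OF s] Y_def)
  have m: "(\<Sum>x\<in>Zp. q s x * Y x) = h s"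
  proof -
    have "(\<Sum>x\<in>Zp. q s x * Y x) = (\<Sum>x\<in>Zp. q s x * surprisal (cyc_walk s) x)"
      by (rule sum.cong[OF refl]) (simp only: S)
    then show ?thesis
      using expectation_surprisal_cyc_walk[OF s] unfolding expectation_cyc_walk[OF s] by (simp only:)
  qed
  have "measure_pmf.expectation (cyc_walk s) (\<lambda>x. (surprisal (cyc_walk s) x - h s)\<^sup>2)
      = (\<Sum>x\<in>Zp. q s x * (surprisal (cyc_walk s) x - h s)\<^sup>2)" by (rule expectation_cyc_walk[OF s])
  also have "\<dots> = (\<Sum>x\<in>Zp. q s x * (Y x - h s)\<^sup>2)" by (rule sum.cong[OF refl]) (simp only: S)
  also have "\<dots> = (\<Sum>x\<in>Zp. q s x * (ln (q s x))\<^sup>2 - 2 * h s * (q s x * Y x) + (h s)\<^sup>2 * q s x)"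
    by (rule sum.cong[OF refl]) (simp add: power2_diff Y_def algebra_simps)
  also have "\<dots> = (\<Sum>x\<in>Zp. q s x * (ln (q s x))\<^sup>2) - 2 * h s * h s + (h s)\<^sup>2 * 1"
    unfolding sum.distrib sum_subtractf sum_distrib_left[symmetric] m sum_q ..
  also have "\<dots> = varent s" by (simp add: varent_def power2_eq_square)
  finally show ?thesis .
qed

lemma lattice_walk_p:
  fixes s :: real
  assumes "0 < k" "0 \<le> s"
  shows "lattice_walk \<sigma> k (enat p) (k * s) = Pi_pmf {..<k} undefined (\<lambda>_. cyc_walk s)"
proof -
  have "1 \<le> enat p" using p by (simp add: one_enat_def)
  then show ?thesis using lattice_walk_product[of k "enat p" "k * s" \<sigma>] assms by (simp add: reduced_walk_p)
qed

lemma lattice_walk_typical: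
  fixes s a :: real
  assumes k: "0 < k" and s: "0 \<le> s" and a: "0 < a"
  shows "measure_pmf.prob (lattice_walk \<sigma> k (enat p) (k * s))
     {w. a \<le> \<bar>surprisal (lattice_walk \<sigma> k (enat p) (k * s)) w - k * h s\<bar>} \<le> k * varent s / a\<^sup>2"
proof -
  define M where "M = Pi_pmf {..<k} undefined (\<lambda>_. cyc_walk s)"
  define f where "f w = ((\<Sum>i<k. surprisal (cyc_walk s) (w i)) - k * h s)\<^sup>2" for w
  have fin: "finite (set_pmf (cyc_walk s))" by (rule finite_subset[OF set_cyc_walk]) simp
  have finM: "finite (set_pmf M)"
    unfolding M_def by (rule finite_subset[OF set_Pi_pmf_subset'] ) (use fin in \<open>auto intro!: finite_PiE_dflt\<close>)
  have "measure_pmf.prob M {w. a \<le> \<bar>surprisal M w - k * h s\<bar>} \<le> measure_pmf.prob M {w. a\<^sup>2 \<le> f w}"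
  proof (rule pmf_prob_mono)
    fix w assume w: "w \<in> set_pmf M" "w \<in> {w. a \<le> \<bar>surprisal M w - k * h s\<bar>}"
    have "surprisal M w = (\<Sum>i<k. surprisal (cyc_walk s) (w i))"
      using surprisal_Pi[of "{..<k}" w undefined "\<lambda>_. cyc_walk s"] w(1) unfolding M_def by simp
    then have "a \<le> \<bar>(\<Sum>i<k. surprisal (cyc_walk s) (w i)) - k * h s\<bar>" using w(2) by simp
    then have "a\<^sup>2 \<le> \<bar>(\<Sum>i<k. surprisal (cyc_walk s) (w i)) - k * h s\<bar>\<^sup>2" using a by (intro power_mono) auto
    then show "w \<in> {w. a\<^sup>2 \<le> f w}" by (simp add: f_def)
  qed
  also have "\<dots> \<le> measure_pmf.expectation M f / a\<^sup>2"
    by (rule pmf_markov) (use a finM in \<open>auto intro: integrable_measure_pmf_finite simp: f_def\<close>)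
  also have "measure_pmf.expectation M f = k * varent s"
    using variance_Pi[of "{..<k}" "cyc_walk s" undefined "surprisal (cyc_walk s)"] fin
    unfolding expectation_surprisal_cyc_walk[OF s] variance_surprisal_cyc_walk[OF s] M_def f_def by simp
  finally show ?thesis unfolding lattice_walk_p[OF k s] M_def .
qed

lemma varent_le_gain:
  assumes s: "0 < s" and e: "0 < \<epsilon>" "\<epsilon> \<le> 1"
  shows "varent ((1 + \<epsilon>) * s) \<le> 4 * (1 + L s) / \<epsilon> * (h ((1 + \<epsilon>) * s) - h s)"
proof -
  define s1 where "s1 = (1 + \<epsilon>) * s"
  have le: "s \<le> s1" and s1: "0 < s1" using s e by (auto simp: s1_def)
  have "L s1 \<le> L s" unfolding L_def
  proof (subst ln_le_cancel_iff)
    show "12 * real p / min 1 s1 \<le> 12 * real p / min 1 s" using s le p by (intro divide_left_mono) auto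
  qed (use s s1 p in auto)
  have "varent s1 \<le> 2 * (1 + L s1) * (s1 * h' s1)" by (rule varent_bound[OF s1])
  also have "\<dots> \<le> 2 * (1 + L s) * (s1 * h' s1)"
    using \<open>L s1 \<le> L s\<close> s1 h'_nonneg[of s1] by (intro mult_right_mono mult_nonneg_nonneg) auto
  also have "\<dots> \<le> 2 * (1 + L s) * (2 / \<epsilon> * (h s1 - h s))"
  proof (intro mult_left_mono)
    have "\<epsilon> / 2 * (s1 * h' s1) \<le> h s1 - h s" using gain_ge_J[OF s e] by (simp add: s1_def)
    then have "2 / \<epsilon> * (\<epsilon> / 2 * (s1 * h' s1)) \<le> 2 / \<epsilon> * (h s1 - h s)" using e by (intro mult_left_mono) auto
    then show "s1 * h' s1 \<le> 2 / \<epsilon> * (h s1 - h s)" using e by simp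
  qed (use L_nonneg[OF s] in simp)
  also have "\<dots> = 4 * (1 + L s) / \<epsilon> * (h s1 - h s)"
  proof -
    have "2 * x * (2 / \<epsilon> * y) = 4 * x / \<epsilon> * y" for x y :: real by simp
    then show ?thesis .
  qed
  finally show ?thesis unfolding s1_def .
qed

text \<open>Right below \<open>s\<close> the entropy production might be large compared with the
entropy deficit \<open>h s - h x\<close>. On the window from \<open>(1 - \<epsilon>) s\<close> to
\<open>(1 - \<epsilon> / 2) s\<close> the mean value theorem for the reciprocal of the deficit
yields a time \<open>x\<close> at which the variance is controlled by the square of the deficit.
Since the mixing distance decreases in time, one such time is enough.\<close>

lemma intermediate_time:
  assumes s: "0 < s" and e: "0 < \<epsilon>" "\<epsilon> < 1" and B: "0 < min 1 (min (h s) (D s))"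
  obtains x where "(1 - \<epsilon>) * s < x" "x < s" "\<epsilon> / 2 * c2 * min 1 (min (h s) (D s)) \<le> h s - h x"
    and "varent x \<le> 8 * (1 + L s + ln (1 / (1 - \<epsilon>))) / (\<epsilon>\<^sup>2 * c2 * min 1 (min (h s) (D s))) * (h s - h x)\<^sup>2"
proof -
  define B where "B = min 1 (min (h s) (D s))"
  have B0: "0 < B" using B by (simp add: B_def)
  have c2: "0 < c2" using c0 by (simp add: c2_def)
  define a where "a = (1 - \<epsilon>) * s"
  define b where "b = (1 - \<epsilon> / 2) * s"
  have ab: "0 < a" "a < b" "b < s" "b - a = \<epsilon> / 2 * s" "s - b = \<epsilon> / 2 * s"
    using s e by (auto simp: a_def b_def algebra_simps)
  define \<Phi> where "\<Phi> x = h s - h x" for x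
  have J: "c2 * B \<le> s * h' s"
  proof -
    have "1 * c2 * min 1 (min (h s) (D s)) \<le> h ((1 + 1) * s) - h s" by (rule gain_bound[OF s]) auto
    also have "\<dots> \<le> ((1 + 1) * s - s) * h' s" by (rule gain_le) (use s in auto)
    finally show ?thesis by (simp add: B_def)
  qed
  have Fb: "\<epsilon> / 2 * c2 * B \<le> \<Phi> b"
  proof -
    have "\<epsilon> / 2 * (c2 * B) \<le> \<epsilon> / 2 * (s * h' s)" using J e by (intro mult_left_mono) auto
    also have "\<dots> = (s - b) * h' s" by (simp only: ab(5) mult.assoc)
    also have "\<dots> \<le> h s - h b" by (rule gain_ge) (use ab in auto)
    finally show ?thesis by (simp add: \<Phi>_def mult.assoc)
  qed
  have Fb0: "0 < \<epsilon> / 2 * c2 * B" using e c2 B0 by simp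
  have Fpos: "\<Phi> b \<le> \<Phi> x" if "a \<le> x" "x \<le> b" for x
    using h_antimono_D[of x b] that ab by (simp add: \<Phi>_def)
  have der: "((\<lambda>x. inverse (\<Phi> x)) has_real_derivative h' x / (\<Phi> x)\<^sup>2) (at x)" if "a \<le> x" "x \<le> b" for x
  proof -
    have x0: "0 < x" using that ab by simp
    have "\<Phi> x \<noteq> 0" using Fpos[OF that] Fb Fb0 by simp
    then show ?thesis unfolding \<Phi>_def
      using DERIV_h[OF x0] by (auto intro!: derivative_eq_intros simp: power2_eq_square divide_simps)
  qed
  obtain x where x: "a < x" "x < b" "inverse (\<Phi> b) - inverse (\<Phi> a) = (b - a) * (h' x / (\<Phi> x)\<^sup>2)"
    using MVT2[OF ab(2), of "\<lambda>x. inverse (\<Phi> x)" "\<lambda>x. h' x / (\<Phi> x)\<^sup>2"] der by auto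
  have x0: "0 < x" using x ab by simp
  have Fx: "\<Phi> b \<le> \<Phi> x" by (rule Fpos) (use x in auto)
  have Fx0: "0 < \<Phi> x" using Fx Fb Fb0 by linarith
  have "(b - a) * (h' x / (\<Phi> x)\<^sup>2) \<le> inverse (\<Phi> b)"
  proof -
    have "0 < \<Phi> a" using Fpos[of a] Fb Fb0 ab by simp
    then have "0 \<le> inverse (\<Phi> a)" by simp
    then show ?thesis using x(3) by linarith
  qed
  also have "\<dots> \<le> inverse (\<epsilon> / 2 * c2 * B)" using Fb Fb0 by (rule le_imp_inverse_le)
  finally have key: "\<epsilon> / 2 * s * (h' x / (\<Phi> x)\<^sup>2) \<le> 2 / (\<epsilon> * c2 * B)"
    unfolding ab(4) using e c2 B0 by (simp add: field_simps)
  have "h' x \<le> 4 / (\<epsilon>\<^sup>2 * c2 * B) * (\<Phi> x)\<^sup>2 / s"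
    using key s e c2 B0 Fx0 by (simp add: field_simps power2_eq_square)
  then have "s * h' x \<le> s * (4 / (\<epsilon>\<^sup>2 * c2 * B) * (\<Phi> x)\<^sup>2 / s)" using s by (intro mult_left_mono) auto
  also have "\<dots> = 4 / (\<epsilon>\<^sup>2 * c2 * B) * (\<Phi> x)\<^sup>2" using s by simp
  finally have sh: "s * h' x \<le> 4 / (\<epsilon>\<^sup>2 * c2 * B) * (\<Phi> x)\<^sup>2" .
  have Lx: "L x \<le> L s + ln (1 / (1 - \<epsilon>))"
  proof -
    have "(1 - \<epsilon>) * min 1 s \<le> min 1 x"
    proof -
      have "(1 - \<epsilon>) * min 1 s \<le> 1 * 1" using e s by (intro mult_mono) auto
      moreover have "(1 - \<epsilon>) * min 1 s \<le> (1 - \<epsilon>) * s" using e by (intro mult_left_mono) auto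
      ultimately show ?thesis using x(1) by (simp add: a_def)
    qed
    moreover have "0 < (1 - \<epsilon>) * min 1 s" using e s by simp
    ultimately have "12 * real p / min 1 x \<le> 12 * real p / ((1 - \<epsilon>) * min 1 s)"
      using x0 by (intro divide_left_mono) auto
    also have "\<dots> = 12 * real p / min 1 s * (1 / (1 - \<epsilon>))" by simp
    finally have "ln (12 * real p / min 1 x) \<le> ln (12 * real p / min 1 s * (1 / (1 - \<epsilon>)))"
      using x0 p by (intro ln_mono) auto
    also have "\<dots> = L s + ln (1 / (1 - \<epsilon>))" unfolding L_def by (rule ln_mult_pos) (use s e p in auto)
    finally show ?thesis by (simp add: L_def)
  qed
  have "varent x \<le> 2 * (1 + L x) * (x * h' x)" by (rule varent_bound[OF x0])
  also have "\<dots> \<le> 2 * (1 + L s + ln (1 / (1 - \<epsilon>))) * (s * h' x)"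
    using Lx L_nonneg[OF x0] x ab x0 h'_nonneg[of x] by (intro mult_mono mult_right_mono mult_nonneg_nonneg) auto
  also have "\<dots> \<le> 2 * (1 + L s + ln (1 / (1 - \<epsilon>))) * (4 / (\<epsilon>\<^sup>2 * c2 * B) * (\<Phi> x)\<^sup>2)"
    using sh Lx L_nonneg[OF x0] by (intro mult_left_mono) auto
  also have "\<dots> = 8 * (1 + L s + ln (1 / (1 - \<epsilon>))) / (\<epsilon>\<^sup>2 * c2 * B) * (\<Phi> x)\<^sup>2" by simp
  finally have v: "varent x \<le> 8 * (1 + L s + ln (1 / (1 - \<epsilon>))) / (\<epsilon>\<^sup>2 * c2 * B) * (\<Phi> x)\<^sup>2" .
  show ?thesis
    by (rule that[of x]) (use x ab v Fx Fb in \<open>auto simp: a_def B_def \<Phi>_def\<close>)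
qed

end

text \<open>In an Abelian group only the net numbers matter.\<close>

lemma (in comm_group) word_eq_finprod:
  assumes Y: "set Y \<subseteq> carrier G" "length Y = k" and u: "fst ` set u \<subseteq> {..<k}"
  shows "word G Y u = finprod G (\<lambda>i. Y ! i [^] net_count i u) {..<k}"
  using u
proof (induction u)
  case Nil
  have Yc: "Y ! i \<in> carrier G" if "i < k" for i by (rule subsetD[OF Y(1) nth_mem]) (simp only: Y(2) that)
  have "finprod G (\<lambda>i. Y ! i [^] net_count i []) {..<k} = finprod G (\<lambda>i. \<one>) {..<k}"
    by (rule finprod_cong') (auto simp: Yc)
  then show ?case by (simp only: word_Nil finprod_one_eqI)
next
  case (Cons ib u)
  have Yc: "Y ! i \<in> carrier G" if "i < k" for i by (rule subsetD[OF Y(1) nth_mem]) (simp only: Y(2) that)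
  have i: "fst ib < k" using Cons.prems by simp
  define g where "g i = (if fst ib = i then Y ! i [^] sgn_of (snd ib) else \<one>)" for i
  have l: "letter G Y ib = Y ! fst ib [^] sgn_of (snd ib)"
    using Yc[OF i] by (simp add: letter_def sgn_of_def int_pow_neg)
  have "finprod G (\<lambda>i. Y ! i [^] net_count i (ib # u)) {..<k} = finprod G (\<lambda>i. Y ! i [^] net_count i u \<otimes> g i) {..<k}"
  proof (rule finprod_cong')
    fix j assume "j \<in> {..<k}"
    then have j: "Y ! j \<in> carrier G" using Yc by simp
    show "Y ! j [^] net_count j (ib # u) = Y ! j [^] net_count j u \<otimes> g j"
    proof (cases "fst ib = j")
      case True
      have "net_count j (ib # u) = net_count j u + sgn_of (snd ib)" using True by simp
      then show ?thesis using True j by (simp only: g_def int_pow_mult if_True simp_thms)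
    next
      case False
      then show ?thesis using j by (simp add: g_def)
    qed
  qed (auto simp: Yc g_def)
  also have "\<dots> = finprod G (\<lambda>i. Y ! i [^] net_count i u) {..<k} \<otimes> finprod G g {..<k}"
    by (rule finprod_multf) (auto simp: Yc g_def)
  also have "finprod G g {..<k} = Y ! fst ib [^] sgn_of (snd ib)"
    unfolding g_def using finprod_singleton[of "fst ib" "{..<k}" "\<lambda>i. Y ! i [^] sgn_of (snd ib)"] i Yc by auto
  also have "finprod G (\<lambda>i. Y ! i [^] net_count i u) {..<k} = word G Y u" by (rule Cons.IH[symmetric]) (use Cons.prems in simp)
  finally show ?case by (simp only: word_Cons l)
qed

lemma (in group) int_pow_mod:
  assumes x: "x \<in> carrier G" "x [^] (p::nat) = \<one>"
  shows "x [^] (n mod int p) = x [^] (n::int)"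
proof -
  have "x [^] n = x [^] (n mod int p + int p * (n div int p))" by simp
  also have "\<dots> = x [^] (n mod int p) \<otimes> (x [^] int p) [^] (n div int p)"
    using x(1) by (simp only: int_pow_mult int_pow_pow)
  also have "x [^] int p = \<one>" using x(2) by (simp only: int_pow_int)
  finally show ?thesis using x(1) by simp
qed

text \<open>Conditioning on an event of probability at least a half.\<close>

lemma prob_cond_pmf_le:
  assumes "1 / 2 \<le> measure_pmf.prob M S"
  shows "measure_pmf.prob (cond_pmf M S) X \<le> 2 * measure_pmf.prob M X"
proof -
  have ne: "set_pmf M \<inter> S \<noteq> {}"
  proof
    assume "set_pmf M \<inter> S = {}"
    then have "measure_pmf.prob M S = 0" by (simp add: measure_pmf_zero_iff)
    then show False using assms by simp
  qed
  have "emeasure (measure_pmf (cond_pmf M S)) X = emeasure (uniform_measure (measure_pmf M) S) X"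
    by (simp only: cond_pmf.rep_eq[OF ne])
  also have "\<dots> = emeasure (measure_pmf M) (S \<inter> X) / emeasure (measure_pmf M) S"
    by (rule emeasure_uniform_measure) auto
  finally have "ennreal (measure_pmf.prob (cond_pmf M S) X)
      = ennreal (measure_pmf.prob M (S \<inter> X)) / ennreal (measure_pmf.prob M S)"
    by (simp only: measure_pmf.emeasure_eq_measure)
  also have "\<dots> = ennreal (measure_pmf.prob M (S \<inter> X) / measure_pmf.prob M S)"
    by (rule divide_ennreal) (use assms in auto)
  finally have "measure_pmf.prob (cond_pmf M S) X = measure_pmf.prob M (S \<inter> X) / measure_pmf.prob M S"
    by (subst (asm) ennreal_inj) (auto intro: divide_nonneg_nonneg)
  also have "\<dots> \<le> measure_pmf.prob M X / (1 / 2)"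
    by (rule frac_le) (use assms in \<open>auto intro: measure_pmf.finite_measure_mono\<close>)
  finally show ?thesis by simp
qed

locale special_walk = special_group G p + cyclic_walk p \<sigma>
  for G (structure) and p :: nat and \<sigma> :: orientation +
  fixes k r s :: nat
  assumes order_quotient: "order V = p ^ r" and card_centre: "card C = p ^ s" and k0: "0 < k"
begin

lemma card_carrier: "card (carrier G) = p ^ (r + s)"
  using order_V unfolding order_quotient card_centre by (simp add: order_def power_add)

lemma set_generators_law:
  assumes "Z \<in> set_pmf (generators_law G k)" shows "set Z \<subseteq> carrier G" "length Z = k"
proof -
  have "set_pmf (pmf_of_set (carrier G)) = carrier G" using finite_carrier one_closed by (intro set_pmf_of_set) auto
  then show "set Z \<subseteq> carrier G" "length Z = k" using assms by (auto simp: generators_law_def set_replicate_pmf)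
qed

lemma one_le_p: "1 \<le> enat p" using p by (simp add: one_enat_def)

text \<open>Truncate to the net numbers whose probability is at most \<open>exp (- R)\<close>, with
\<open>R\<close> halfway between the entropies at the times \<open>k s\<^sub>0\<close> and \<open>(1
+ \<epsilon>) k s\<^sub>0\<close>; by Chebyshev they have almost full probability. The first
condition on the gain makes \<open>exp R\<close> much larger than the order of
\<open>G\<close>.\<close>

lemma mixing_upper:
  fixes s0 \<epsilon> \<delta> g B :: real
  assumes s0: "0 < s0" and eq: "k * h s0 = r * ln p" and e: "0 < \<epsilon>" "\<epsilon> \<le> 1" and d: "0 < \<delta>"
    and g_def: "g = h ((1 + \<epsilon>) * s0) - h s0"
    and big: "4 * (s * ln p) \<le> k * g" "32 * (1 + L s0) / (\<epsilon> * \<delta>) \<le> k * g" "0 < g"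
  shows "measure_pmf.prob (generators_law G k) {Z. \<delta> < mixing_distance \<sigma> G Z ((1 + \<epsilon>) * (k * s0))}
    \<le> exp (- (k * g / 4)) / (\<delta> / 2)\<^sup>2"
proof -
  define s1 where "s1 = (1 + \<epsilon>) * s0"
  define t where "t = k * s1"
  have t: "(1 + \<epsilon>) * (k * s0) = t" by (simp add: t_def s1_def)
  have s1: "0 < s1" using s0 e by (simp add: s1_def)
  define P where "P = path \<sigma> k t"
  define Lw where "Lw = lattice_walk \<sigma> k (enat p) t"
  have LP: "map_pmf (counts k (enat p)) P = Lw"
    unfolding Lw_def P_def by (rule lattice_walk_path[OF k0 one_le_p, symmetric])
  have kg: "0 < k * g" using k0 big(3) by simp
  define R where "R = k * h s1 - k * g / 2"
  have Req: "R = r * ln p + k * g / 2"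
    using eq by (simp add: R_def g_def s1_def algebra_simps)
  (* R exceeds the logarithm of the order of G by at least k g / 4 *)
  define T where "T = {w. pmf Lw w \<le> exp (- R)}"
  have atyp: "measure_pmf.prob Lw (- T) \<le> \<delta> / 2"
  proof -
    have "measure_pmf.prob Lw (- T) \<le> measure_pmf.prob Lw {w. k * g / 2 \<le> \<bar>surprisal Lw w - k * h s1\<bar>}"
    proof (rule pmf_prob_mono)
      fix w assume w: "w \<in> set_pmf Lw" "w \<in> - T"
      have "exp (- R) < pmf Lw w" using w(2) by (simp add: T_def)
      then have "- R < ln (pmf Lw w)" using ln_less_cancel_iff[of "exp (- R)" "pmf Lw w"] pmf_positive[OF w(1)] by simp
      then have "k * g / 2 \<le> - (surprisal Lw w - k * h s1)" by (simp add: R_def)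
      then have "k * g / 2 \<le> \<bar>surprisal Lw w - k * h s1\<bar>"
        using abs_ge_minus_self[of "surprisal Lw w - k * h s1"] by (rule order_trans)
      then show "w \<in> {w. k * g / 2 \<le> \<bar>surprisal Lw w - k * h s1\<bar>}" unfolding mem_Collect_eq .
    qed
    also have "\<dots> \<le> k * varent s1 / (k * g / 2)\<^sup>2"
      unfolding Lw_def t_def by (rule lattice_walk_typical) (use k0 s1 kg in auto)
    also have "\<dots> \<le> k * (4 * (1 + L s0) / \<epsilon> * g) / (k * g / 2)\<^sup>2"
      unfolding s1_def g_def by (intro divide_right_mono mult_left_mono varent_le_gain s0 e) auto
    also have "\<dots> = 16 * (1 + L s0) / \<epsilon> / (k * g)"
      using kg e k0 big(3) by (simp add: power2_eq_square field_simps)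
    also have "\<dots> \<le> \<delta> / 2"
      using big(2) kg e d by (simp add: field_simps)
    finally show ?thesis .
  qed
  have coll: "measure_pmf.prob (generators_law G k) {z. word G z u = word G z v} \<le> 1 / card (carrier G)"
    if uv: "u \<in> set_pmf P" "v \<in> set_pmf P" "counts k (enat p) u \<noteq> counts k (enat p) v" for u v
  proof -
    obtain i where i: "counts k (enat p) u i \<noteq> counts k (enat p) v i" using uv(3) by (auto simp: fun_eq_iff)
    then have ik: "i < k" by (auto simp: counts_def split: if_splits)
    have "net_count i u mod int p \<noteq> net_count i v mod int p" using i ik by (simp add: counts_def reduce_def)
    then have "\<not> int p dvd net_count i u - net_count i v" unfolding mod_eq_dvd_iff .
    then show ?thesis
      by (rule prob_collision[OF ik set_path[OF k0 uv(1)[unfolded P_def]] set_path[OF k0 uv(2)[unfolded P_def]]])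
  qed
  have "measure_pmf.prob (generators_law G k) {Z. \<delta> < mixing_distance \<sigma> G Z t}
    \<le> measure_pmf.prob (generators_law G k) {Z. \<delta> < tv_distance (map_pmf (word G Z) P) (pmf_of_set (carrier G))}"
    by (rule pmf_prob_mono) (use set_generators_law in \<open>simp add: mixing_distance_def walk_law_cayley P_def\<close>)
  also have "\<dots> \<le> card (carrier G) * exp (- R) / (\<delta> / 2)\<^sup>2"
  proof (rule second_moment_tv[where W = "counts k (enat p)" and T = T])
    show "word G z u \<in> carrier G" if "z \<in> set_pmf (generators_law G k)" "u \<in> set_pmf P" for z u
    proof (rule word_closed)
      show "set z \<subseteq> carrier G" by (rule set_generators_law[OF that(1)])
      show "fst ` set u \<subseteq> {..<length z}"
        unfolding set_generators_law(2)[OF that(1)] by (rule set_path[OF k0 that(2)[unfolded P_def]])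
    qed
    show "measure_pmf.prob (map_pmf (counts k (enat p)) P) (- T) \<le> \<delta> / 2" unfolding LP by (rule atyp)
    show "pmf (map_pmf (counts k (enat p)) P) w \<le> exp (- R)" if "w \<in> T" for w
      using that unfolding LP by (simp add: T_def)
    show "carrier G \<noteq> {}" using one_closed by blast
  qed (use finite_carrier d coll in auto)
  also have "\<dots> \<le> exp (- (k * g / 4)) / (\<delta> / 2)\<^sup>2"
  proof (rule divide_right_mono)
    have "real (card (carrier G)) = exp ((r + s) * ln p)"
      using p unfolding card_carrier by (simp add: exp_of_nat_mult flip: of_nat_add)
    then have "card (carrier G) * exp (- R) = exp ((r + s) * ln p - R)" by (simp add: exp_diff exp_minus field_simps)
    also have "\<dots> \<le> exp (- (k * g / 4))" using big(1) unfolding Req by (simp add: algebra_simps)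
    finally show "card (carrier G) * exp (- R) \<le> exp (- (k * g / 4))" .
  qed simp
  finally show ?thesis unfolding t .
qed

text \<open>At the time \<open>k x\<close> of \<open>intermediate_time\<close> the net numbers lie
with high probability in a set \<open>T\<close> with at most \<open>exp R\<close> elements, where
\<open>R\<close> is well below \<open>r ln p\<close>. The union of the cosets of \<open>C\<close>
that correspond to \<open>T\<close> then carries almost all of the law of the walk but little of the
uniform law.\<close>

lemma mixing_lower:
  fixes s0 \<epsilon> \<delta> g B :: real
  assumes s0: "0 < s0" and eq: "k * h s0 = r * ln p" and e: "0 < \<epsilon>" "\<epsilon> < 1"
    and B_def: "B = min 1 (min (h s0) (D s0))" and B0: "0 < B" and Z: "set Z \<subseteq> carrier G" "length Z = k"
  shows "1 - 32 * (1 + L s0 + ln (1 / (1 - \<epsilon>))) / (\<epsilon>\<^sup>2 * c2 * (k * B)) - exp (- (\<epsilon> * c2 * (k * B) / 4))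
    \<le> mixing_distance \<sigma> G Z ((1 - \<epsilon>) * (k * s0))"
proof -
  obtain x where x: "(1 - \<epsilon>) * s0 < x" "x < s0" "\<epsilon> / 2 * c2 * B \<le> h s0 - h x"
    "varent x \<le> 8 * (1 + L s0 + ln (1 / (1 - \<epsilon>))) / (\<epsilon>\<^sup>2 * c2 * B) * (h s0 - h x)\<^sup>2"
    using intermediate_time[OF s0 e B0[unfolded B_def]] unfolding B_def by blast
  define f where "f = h s0 - h x"
  have c2: "0 < c2" using c0 by (simp add: c2_def)
  have f: "0 < f"
  proof -
    have "0 < \<epsilon> / 2 * c2 * B" using e c2 B0 by simp
    then show ?thesis using x(3) unfolding f_def by (rule less_le_trans)
  qed
  have x0: "0 < x" using x(1) s0 e by (meson less_trans mult_pos_pos diff_gt_0_iff_gt)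
  define t where "t = k * x"
  define P where "P = path \<sigma> k t"
  define Lw where "Lw = lattice_walk \<sigma> k (enat p) t"
  have LP: "map_pmf (counts k (enat p)) P = Lw"
    unfolding Lw_def P_def by (rule lattice_walk_path[OF k0 one_le_p, symmetric])
  define R where "R = k * h x + k * f / 2"
  have Req: "R = r * ln p - k * f / 2" using eq by (simp add: R_def f_def algebra_simps)
  have kf: "0 < k * f" using k0 f by simp
  define T where "T = {w \<in> set_pmf Lw. exp (- R) \<le> pmf Lw w}"
  have cardT: "card W \<le> exp R" if W: "finite W" "W \<subseteq> T" for W
  proof -
    have "card W * exp (- R) = (\<Sum>w\<in>W. exp (- R))" by simp
    also have "\<dots> \<le> (\<Sum>w\<in>W. pmf Lw w)" using W by (intro sum_mono) (auto simp: T_def)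
    also have "\<dots> = measure_pmf.prob Lw W" using W by (simp add: measure_measure_pmf_finite)
    also have "\<dots> \<le> 1" by simp
    finally show ?thesis by (simp add: exp_minus field_simps)
  qed
  (* a set of points of probability at least exp (- R) cannot be large *)
  have finT: "finite T"
  proof (rule ccontr)
    assume "infinite T"
    then obtain W where W: "finite W" "card W = Suc (nat \<lceil>exp R\<rceil>)" "W \<subseteq> T"
      using infinite_arbitrarily_large[of T "Suc (nat \<lceil>exp R\<rceil>)"] by auto
    have "real (Suc (nat \<lceil>exp R\<rceil>)) \<le> exp R" using cardT[OF W(1,3)] unfolding W(2) .
    then show False by linarith
  qed
  have typical: "1 - 32 * (1 + L s0 + ln (1 / (1 - \<epsilon>))) / (\<epsilon>\<^sup>2 * c2 * (k * B)) \<le> measure_pmf.prob Lw T"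
  proof -
    have "measure_pmf.prob Lw (- T) \<le> measure_pmf.prob Lw {w. k * f / 2 \<le> \<bar>surprisal Lw w - k * h x\<bar>}"
    proof (rule pmf_prob_mono)
      fix w assume w: "w \<in> set_pmf Lw" "w \<in> - T"
      have "pmf Lw w < exp (- R)" using w by (simp add: T_def)
      then have "ln (pmf Lw w) < - R" using ln_less_cancel_iff[of "pmf Lw w" "exp (- R)"] pmf_positive[OF w(1)] by simp
      then have "k * f / 2 \<le> surprisal Lw w - k * h x" by (simp add: R_def)
      then have "k * f / 2 \<le> \<bar>surprisal Lw w - k * h x\<bar>"
        using abs_ge_self[of "surprisal Lw w - k * h x"] by (rule order_trans)
      then show "w \<in> {w. k * f / 2 \<le> \<bar>surprisal Lw w - k * h x\<bar>}" unfolding mem_Collect_eq .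
    qed
    also have "\<dots> \<le> k * varent x / (k * f / 2)\<^sup>2"
      unfolding Lw_def t_def by (rule lattice_walk_typical) (use k0 x0 kf in auto)
    also have "\<dots> \<le> k * (8 * (1 + L s0 + ln (1 / (1 - \<epsilon>))) / (\<epsilon>\<^sup>2 * c2 * B) * f\<^sup>2) / (k * f / 2)\<^sup>2"
      unfolding f_def by (intro divide_right_mono mult_left_mono x(4)) auto
    also have "\<dots> = 32 * (1 + L s0 + ln (1 / (1 - \<epsilon>))) / (\<epsilon>\<^sup>2 * c2 * (k * B))"
    proof -
      have "k * (8 * c / d * f\<^sup>2) / (k * f / 2)\<^sup>2 = 32 * c / (k * d)" for c d :: real
        using f k0 by (simp add: power2_eq_square divide_simps)
      from this[of "1 + L s0 + ln (1 / (1 - \<epsilon>))" "\<epsilon>\<^sup>2 * c2 * B"] show ?thesis by (simp add: mult_ac)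
    qed
    finally have "measure_pmf.prob Lw (- T) \<le> 32 * (1 + L s0 + ln (1 / (1 - \<epsilon>))) / (\<epsilon>\<^sup>2 * c2 * (k * B))" .
    moreover have "measure_pmf.prob Lw (- T) = 1 - measure_pmf.prob Lw T"
      using measure_pmf.prob_compl[of T Lw] by (simp add: Compl_eq_Diff_UNIV)
    ultimately show ?thesis by linarith
  qed
  define Y where "Y = map ((#>) C) Z"
  have Y: "set Y \<subseteq> carrier V" "length Y = k"
    unfolding Y_def using Z by (auto simp: carrier_V RCOSETS_def)
  define \<Theta> where "\<Theta> w = finprod V (\<lambda>i. Y ! i [^]\<^bsub>V\<^esub> (w i :: int)) {..<k}" for w
  have proj: "C #> word G Z u = \<Theta> (counts k (enat p) u)" if u: "fst ` set u \<subseteq> {..<k}" for u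
  proof -
    have Yc: "Y ! i \<in> carrier V" if "i < k" for i by (rule subsetD[OF Y(1) nth_mem]) (simp only: Y(2) that)
    have u': "fst ` set u \<subseteq> {..<length Z}" using u Z(2) by (simp only:)
    have "C #> word G Z u = word V Y u" unfolding Y_def by (rule word_hom[OF V_hom_group Z(1) u'])
    also have "\<dots> = finprod V (\<lambda>i. Y ! i [^]\<^bsub>V\<^esub> net_count i u) {..<k}"
      by (rule comm_group.word_eq_finprod[OF V_comm Y u])
    also have "\<dots> = \<Theta> (counts k (enat p) u)"
      unfolding \<Theta>_def
    proof (rule comm_monoid.finprod_cong'[OF comm_group.axioms(1)[OF V_comm] refl])
      show "(\<lambda>i. Y ! i [^]\<^bsub>V\<^esub> counts k (enat p) u i) \<in> {..<k} \<rightarrow> carrier V"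
        using Yc group.int_pow_closed[OF V_group] by auto
      fix i assume "i \<in> {..<k}"
      then have i: "i < k" by simp
      show "Y ! i [^]\<^bsub>V\<^esub> net_count i u = Y ! i [^]\<^bsub>V\<^esub> counts k (enat p) u i"
        using group.int_pow_mod[OF V_group Yc[OF i] V_exponent[OF Yc[OF i]], of "net_count i u"] i
        by (simp add: counts_def reduce_def)
    qed
    finally show ?thesis .
  qed
  (* the test set: all elements whose coset has typical net numbers *)
  define A where "A = (\<Union>v\<in>\<Theta> ` T. {z \<in> carrier G. C #> z = v})"
  have Asub: "A \<subseteq> carrier G" by (auto simp: A_def)
  have cardA: "real (card A) \<le> exp R * card C"
  proof -
    have "card A \<le> (\<Sum>v\<in>\<Theta> ` T. card {z \<in> carrier G. C #> z = v})"
      unfolding A_def by (rule card_UN_le) (use finT in simp)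
    also have "\<dots> \<le> (\<Sum>v\<in>\<Theta> ` T. card C)" by (rule sum_mono) (rule card_coset_fibre)
    also have "\<dots> = card (\<Theta> ` T) * card C" by simp
    also have "\<dots> \<le> card T * card C" using finT by (intro mult_right_mono card_image_le) auto
    finally have "real (card A) \<le> real (card T) * real (card C)" unfolding of_nat_mult[symmetric] of_nat_le_iff .
    also have "\<dots> \<le> exp R * card C" using cardT[OF finT order_refl] by (intro mult_right_mono) auto
    finally show ?thesis .
  qed
  have unif: "measure_pmf.prob (pmf_of_set (carrier G)) A \<le> exp (- (\<epsilon> * c2 * (k * B) / 4))"
  proof -
    have "measure_pmf.prob (pmf_of_set (carrier G)) A = card A / card (carrier G)"
      using Asub finite_carrier one_closed by (subst measure_pmf_of_set) (auto simp: Int_absorb1)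
    also have "\<dots> \<le> exp R * card C / card (carrier G)" using cardA by (intro divide_right_mono) auto
    also have "\<dots> = exp R / p ^ r" using p unfolding card_carrier card_centre by (simp add: power_add)
    also have "\<dots> = exp (- (k * f / 2))"
    proof -
      have "real p ^ r = exp (r * ln p)" using p by (simp add: exp_of_nat_mult)
      then show ?thesis unfolding Req by (simp add: exp_diff[symmetric])
    qed
    also have "\<dots> \<le> exp (- (\<epsilon> * c2 * (k * B) / 4))"
    proof -
      have "k * (\<epsilon> / 2 * c2 * B) \<le> k * f" unfolding f_def by (intro mult_left_mono x(3)) simp
      then show ?thesis by (simp add: mult_ac)
    qed
    finally show ?thesis .
  qed
  have walk: "measure_pmf.prob Lw T \<le> measure_pmf.prob (map_pmf (word G Z) P) A"
  proof -
    have "measure_pmf.prob Lw T = measure_pmf.prob P (counts k (enat p) -` T)" by (simp flip: LP)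
    also have "\<dots> \<le> measure_pmf.prob P (word G Z -` A)"
    proof (rule pmf_prob_mono)
      fix u assume u: "u \<in> set_pmf P" "u \<in> counts k (enat p) -` T"
      have fu: "fst ` set u \<subseteq> {..<k}" by (rule set_path[OF k0 u(1)[unfolded P_def]])
      have "word G Z u \<in> carrier G" by (rule word_closed[OF Z(1)]) (use fu Z(2) in simp)
      moreover have "C #> word G Z u \<in> \<Theta> ` T" unfolding proj[OF fu] using u(2) by simp
      ultimately show "u \<in> word G Z -` A" unfolding A_def by blast
    qed
    finally show ?thesis by simp
  qed
  have "1 - 32 * (1 + L s0 + ln (1 / (1 - \<epsilon>))) / (\<epsilon>\<^sup>2 * c2 * (k * B)) - exp (- (\<epsilon> * c2 * (k * B) / 4))
    \<le> measure_pmf.prob (map_pmf (word G Z) P) A - measure_pmf.prob (pmf_of_set (carrier G)) A"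
    using typical walk unif by linarith
  also have "\<dots> \<le> tv_distance (map_pmf (word G Z) P) (pmf_of_set (carrier G))"
    using tv_ge[of "map_pmf (word G Z) P" A "pmf_of_set (carrier G)"] by linarith
  also have "\<dots> = mixing_distance \<sigma> G Z t" by (simp only: mixing_distance_def walk_law_cayley[OF Z(2)] P_def)
  also have "\<dots> \<le> mixing_distance \<sigma> G Z ((1 - \<epsilon>) * (k * s0))"
  proof (rule mixing_distance_antimono[OF finite_carrier Z k0])
    show "0 \<le> (1 - \<epsilon>) * (k * s0)" using e s0 by simp
    have "k * ((1 - \<epsilon>) * s0) \<le> k * x" using x(1) by (intro mult_left_mono) auto
    then show "(1 - \<epsilon>) * (k * s0) \<le> t" by (simp add: t_def mult_ac)
  qed
  finally show ?thesis .
qed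

lemma prob_disconnected:
  assumes "r < k"
  shows "measure_pmf.prob (generators_law G k) {Z. \<not> cayley_connected G Z} \<le> 1 / ((real p - 1) * p ^ (k - r))"
proof -
  have "measure_pmf.prob (generators_law G k) {Z. \<not> cayley_connected G Z}
      \<le> measure_pmf.prob (generators_law G k) {Z. generate G (set Z) \<noteq> carrier G}"
  proof (rule pmf_prob_mono)
    fix Z assume "Z \<in> set_pmf (generators_law G k)" "Z \<in> {Z. \<not> cayley_connected G Z}"
    then show "Z \<in> {Z. generate G (set Z) \<noteq> carrier G}"
      using cayley_connected_iff_generate[OF group_axioms set_generators_law(1)] by simp
  qed
  also have "\<dots> \<le> order V / ((p - 1) * p ^ k)" by (rule prob_not_generate[OF k0])
  also have "\<dots> = 1 / ((real p - 1) * p ^ (k - r))"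
  proof -
    have "real p ^ k = real p ^ r * real p ^ (k - r)" using assms by (simp flip: power_add)
    then show ?thesis using p by (simp add: order_quotient of_nat_diff)
  qed
  finally show ?thesis .
qed

lemma prob_conditioned_le:
  assumes "r < k"
  shows "measure_pmf.prob (connected_generators_law G k) X \<le> 2 * measure_pmf.prob (generators_law G k) X"
  unfolding connected_generators_law_def
proof (rule prob_cond_pmf_le)
  have "2 \<le> p ^ (k - r)" using assms p self_le_power[of p "k - r"] by simp
  then have "1 * 2 \<le> (real p - 1) * p ^ (k - r)" using p by (intro mult_mono) (auto simp flip: of_nat_power)
  then have "1 / ((real p - 1) * p ^ (k - r)) \<le> 1 / 2" by (intro divide_left_mono) auto
  then have "measure_pmf.prob (generators_law G k) {Z. \<not> cayley_connected G Z} \<le> 1 / 2"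
    using prob_disconnected[OF assms] by linarith
  moreover have "measure_pmf.prob (generators_law G k) {Z. \<not> cayley_connected G Z}
      = 1 - measure_pmf.prob (generators_law G k) {Z. cayley_connected G Z}"
    using measure_pmf.prob_compl[of "{Z. cayley_connected G Z}" "generators_law G k"]
    by (simp add: Compl_eq_Diff_UNIV[symmetric] Collect_neg_eq)
  ultimately show "1 / 2 \<le> measure_pmf.prob (generators_law G k) {Z. cayley_connected G Z}" by linarith
qed

end

section \<open>Entropic times\<close>

text \<open>In exponent \<open>p\<close> the power map with exponent \<open>n\<close> is trivial if
\<open>p\<close> divides \<open>n\<close>, and bijective otherwise.\<close>

lemma order_quotient_multiple_subgroup:
  fixes A :: "('x, 'y) monoid_scheme"
  assumes A: "comm_group A" and fin: "finite (carrier A)" and p: "prime (p::nat)"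
    and exponent: "\<And>x. x \<in> carrier A \<Longrightarrow> x [^]\<^bsub>A\<^esub> p = \<one>\<^bsub>A\<^esub>"
  shows "order (A Mod multiple_subgroup \<gamma> A) = (if \<forall>n. \<gamma> = enat n \<longrightarrow> p dvd n then order A else 1)"
proof -
  interpret comm_group A by (rule A)
  have quot: "order (A Mod H) * card H = order A" if "subgroup H A" for H
    using lagrange_finite[OF fin that] by (simp add: order_def FactGroup_def)
  have triv: "order (A Mod {\<one>\<^bsub>A\<^esub>}) = order A" using quot[OF triv_subgroup] by simp
  show ?thesis
  proof (cases "\<forall>n. \<gamma> = enat n \<longrightarrow> p dvd n")
    case True
    have "multiple_subgroup \<gamma> A = {\<one>\<^bsub>A\<^esub>}"
    proof (cases \<gamma>)
      case (enat n)
      then obtain m where n: "n = p * m" using True by (auto elim: dvdE)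
      have "x [^]\<^bsub>A\<^esub> n = \<one>\<^bsub>A\<^esub>" if "x \<in> carrier A" for x
        using exponent[OF that] that unfolding n by (simp add: nat_pow_pow[symmetric])
      then have "(\<lambda>a. a [^]\<^bsub>A\<^esub> n) ` carrier A = {\<one>\<^bsub>A\<^esub>}" using one_closed by force
      then show ?thesis by (simp add: multiple_subgroup_def enat)
    qed (simp add: multiple_subgroup_def)
    then show ?thesis unfolding if_P[OF True] using triv by (simp only:)
  next
    case False
    then obtain n where n: "\<gamma> = enat n" "\<not> p dvd n" by blast
    have "multiple_subgroup \<gamma> A = carrier A"
    proof
      show "multiple_subgroup \<gamma> A \<subseteq> carrier A" by (auto simp: multiple_subgroup_def n)
      show "carrier A \<subseteq> multiple_subgroup \<gamma> A"
      proof
        fix x assume x: "x \<in> carrier A"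
        have "coprime n p" using prime_imp_coprime[OF p n(2)] by (simp only: coprime_commute)
        moreover have "n \<noteq> 0" using n(2) by (rule contrapos_nn) simp
        ultimately obtain a b where ab: "n * a = p * b + 1" using bezout_nat[of n p] by (metis coprime_iff_gcd_eq_1)
        have "(x [^]\<^bsub>A\<^esub> a) [^]\<^bsub>A\<^esub> n = x [^]\<^bsub>A\<^esub> (p * b + 1)"
          using x by (simp only: nat_pow_pow mult.commute[of a n] ab)
        also have "\<dots> = (x [^]\<^bsub>A\<^esub> p) [^]\<^bsub>A\<^esub> b \<otimes>\<^bsub>A\<^esub> x" using x by (simp add: nat_pow_pow)
        also have "\<dots> = x" using x by (simp add: exponent)
        finally have "x = (x [^]\<^bsub>A\<^esub> a) [^]\<^bsub>A\<^esub> n" by simp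
        then show "x \<in> multiple_subgroup \<gamma> A" using x unfolding multiple_subgroup_def n enat.case by blast
      qed
    qed
    moreover have "order (A Mod carrier A) = 1"
    proof -
      have "0 < order A" using fin one_closed by (auto simp: order_def card_gt_0_iff)
      then show ?thesis using quot[OF subgroup_self] by (simp add: order_def)
    qed
    ultimately show ?thesis unfolding if_not_P[OF False] by (simp only:)
  qed
qed

text \<open>Quantitatively, \<open>D s \<le> p / sqrt s\<close>; the time is chosen to make this at
most \<open>ln p - c\<close>.\<close>

lemma (in cyclic_walk) h_approaches_ln_p:
  assumes "c < ln (real p)"
  shows "\<exists>s>0. c \<le> h s"
proof -
  define d where "d = ln p - c"
  have d: "0 < d" using assms by (simp add: d_def)
  define s where "s = (p / d)\<^sup>2"
  have p0: "0 < real p" using p by simp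
  have s: "0 < s" using d p0 by (simp add: s_def)
  have "D s \<le> p / sqrt s" using D_le_chi[OF s] chi_square_bound[OF s] by linarith
  also have "\<dots> = d" using d p0 by (simp add: s_def real_sqrt_abs)
  finally have "c \<le> h s" by (simp add: D_def d_def)
  then show ?thesis using s by blast
qed

definition reach_times :: "orientation \<Rightarrow> nat \<Rightarrow> enat \<Rightarrow> real \<Rightarrow> real set" where
  "reach_times \<sigma> k \<gamma> c = {t. 0 \<le> t \<and> k * coord_entropy \<sigma> \<gamma> (t / k) = c}"

lemma entropic_time_eq_Inf:
  assumes "0 < k" "1 \<le> \<gamma>"
  shows "entropic_time \<sigma> k \<gamma> A = Inf (reach_times \<sigma> k \<gamma> (ln (real (order (A Mod multiple_subgroup \<gamma> A)))))"
  unfolding entropic_time_def reach_times_def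
  by (rule arg_cong[where f = Inf], rule Collect_cong) (use shannon_entropy_lattice_walk[OF assms] in \<open>auto\<close>)

lemma continuous_scaled_coord_entropy:
  fixes k :: nat
  assumes "0 < k" "1 \<le> \<gamma>"
  shows "continuous_on {0..} (\<lambda>t. k * coord_entropy \<sigma> \<gamma> (t / k))"
  by (intro continuous_intros continuous_on_compose2[OF continuous_coord_entropy[OF assms(2)]])
     (use assms in auto)

text \<open>The intermediate value theorem, starting from entropy 0 at time 0.\<close>

lemma reach_times_below:
  assumes k: "0 < k" and g: "1 \<le> \<gamma>" and t: "0 \<le> t" "0 \<le> c" "c \<le> k * coord_entropy \<sigma> \<gamma> (t / k)"
  obtains u where "u \<in> reach_times \<sigma> k \<gamma> c" "u \<le> t"
proof -
  have "\<exists>u\<ge>0. u \<le> t \<and> k * coord_entropy \<sigma> \<gamma> (u / k) = c"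
  proof (rule IVT')
    show "k * coord_entropy \<sigma> \<gamma> (0 / k) \<le> c" using t(2) by (simp add: coord_entropy_0)
    show "continuous_on {0..t} (\<lambda>t. k * coord_entropy \<sigma> \<gamma> (t / k))"
      by (rule continuous_on_subset[OF continuous_scaled_coord_entropy[OF k g]]) auto
  qed (use t in auto)
  then obtain u where "0 \<le> u" "u \<le> t" "k * coord_entropy \<sigma> \<gamma> (u / k) = c" by blast
  then show ?thesis by (intro that[of u]) (auto simp: reach_times_def)
qed

lemma Inf_reach_times:
  assumes k: "0 < k" and g: "1 \<le> \<gamma>" and ne: "reach_times \<sigma> k \<gamma> c \<noteq> {}"
  shows "Inf (reach_times \<sigma> k \<gamma> c) \<in> reach_times \<sigma> k \<gamma> c"
proof (rule closed_contains_Inf[OF ne])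
  show "bdd_below (reach_times \<sigma> k \<gamma> c)" by (rule bdd_belowI[of _ 0]) (simp add: reach_times_def)
  have "reach_times \<sigma> k \<gamma> c = {0..} \<inter> (\<lambda>t. k * coord_entropy \<sigma> \<gamma> (t / k)) -` {c}"
    by (auto simp: reach_times_def)
  then show "closed (reach_times \<sigma> k \<gamma> c)"
    using continuous_closed_preimage[OF continuous_scaled_coord_entropy[OF k g], of "{c}" \<sigma>] by simp
qed

lemma Inf_reach_times_le: "u \<in> reach_times \<sigma> k \<gamma> c \<Longrightarrow> Inf (reach_times \<sigma> k \<gamma> c) \<le> u"
  by (rule cInf_lower) (auto intro!: bdd_belowI[of _ 0] simp: reach_times_def)

text \<open>The target entropy is \<open>r ln p\<close> for \<open>\<gamma> = \<infinity>\<close>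
and for multiples of \<open>p\<close>, and 0 for all other \<open>\<gamma>\<close>. In the former
case the entropy modulo \<open>\<gamma>\<close> dominates the entropy modulo \<open>p\<close>, so
its target is reached no later.\<close>

lemma entropic_times_exponent_p:
  fixes A :: "('x, 'y) monoid_scheme"
  assumes A: "comm_group A" and p: "prime (p::nat)"
    and exponent: "\<And>x. x \<in> carrier A \<Longrightarrow> x [^]\<^bsub>A\<^esub> p = \<one>\<^bsub>A\<^esub>"
    and order: "order A = p ^ r" and k: "r < k"
  defines "c \<equiv> real r * ln (real p)"
  shows "entropic_time \<sigma> k (enat p) A = Inf (reach_times \<sigma> k (enat p) c)"
    and "entropic_time \<sigma> k \<infinity> A = Inf (reach_times \<sigma> k \<infinity> c)"
    and "max_entropic_time \<sigma> k A = entropic_time \<sigma> k (enat p) A"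
    and "Inf (reach_times \<sigma> k (enat p) c) \<in> reach_times \<sigma> k (enat p) c"
    and "Inf (reach_times \<sigma> k \<infinity> c) \<in> reach_times \<sigma> k \<infinity> c"
    and "Inf (reach_times \<sigma> k \<infinity> c) \<le> Inf (reach_times \<sigma> k (enat p) c)"
proof -
  have p2: "2 \<le> p" using p by (rule prime_ge_2_nat)
  interpret cw: cyclic_walk p \<sigma> by unfold_locales (rule p2)
  have k0: "0 < k" using k by simp
  have p1: "1 \<le> enat p" using p2 by (simp add: one_enat_def)
  have i1: "1 \<le> (\<infinity>::enat)" by simp
  have fin: "finite (carrier A)" using order p2 by (intro card_ge_0_finite) (simp add: order_def)
  have c0: "0 \<le> c" using p2 by (simp add: c_def)
  have lnc: "ln (real (order A)) = c" using p2 by (simp add: order c_def ln_realpow)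
  have quot: "order (A Mod multiple_subgroup \<gamma> A) = (if \<forall>n. \<gamma> = enat n \<longrightarrow> p dvd n then order A else 1)" for \<gamma>
    by (rule order_quotient_multiple_subgroup[OF A fin p exponent])
  have t: "ln (real (order (A Mod multiple_subgroup \<gamma> A))) = (if \<forall>n. \<gamma> = enat n \<longrightarrow> p dvd n then c else 0)" for \<gamma>
    unfolding quot by (cases "\<forall>n. \<gamma> = enat n \<longrightarrow> p dvd n") (simp_all only: if_P if_not_P lnc of_nat_1 ln_one simp_thms if_True if_False)
  show ep: "entropic_time \<sigma> k (enat p) A = Inf (reach_times \<sigma> k (enat p) c)"
    unfolding entropic_time_eq_Inf[OF k0 p1] t by simp
  show ei: "entropic_time \<sigma> k \<infinity> A = Inf (reach_times \<sigma> k \<infinity> c)"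
    unfolding entropic_time_eq_Inf[OF k0 i1] t by simp
  have ne: "reach_times \<sigma> k (enat p) c \<noteq> {}"
  proof -
    have "c / k < ln p"
    proof -
      have "real r * ln p < real k * ln p" using k p2 by (intro mult_strict_right_mono) auto
      then show ?thesis using k0 by (simp add: c_def field_simps)
    qed
    then obtain s where s: "0 < s" "c / k \<le> cw.h s" using cw.h_approaches_ln_p by blast
    have "c \<le> k * coord_entropy \<sigma> (enat p) (k * s / k)"
      using s k0 by (simp add: cw.coord_entropy_p field_simps)
    then obtain u where "u \<in> reach_times \<sigma> k (enat p) c"
      using reach_times_below[OF k0 p1, of "k * s" c \<sigma>] s c0 by auto
    then show ?thesis by blast
  qed
  show pin: "Inf (reach_times \<sigma> k (enat p) c) \<in> reach_times \<sigma> k (enat p) c" by (rule Inf_reach_times[OF k0 p1 ne])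
  define T where "T = Inf (reach_times \<sigma> k (enat p) c)"
  have T: "0 \<le> T" "k * coord_entropy \<sigma> (enat p) (T / k) = c"
    using pin by (simp_all add: T_def reach_times_def)
  have below: "\<exists>u. u \<in> reach_times \<sigma> k \<gamma> c \<and> u \<le> T" if g: "1 \<le> \<gamma>" "\<forall>n. \<gamma> = enat n \<longrightarrow> p dvd n" for \<gamma>
  proof -
    have Tk: "0 \<le> T / k" using T(1) by simp
    have "coord_entropy \<sigma> (enat p) (T / k) \<le> coord_entropy \<sigma> \<gamma> (T / k)"
    proof (cases \<gamma>)
      case (enat n)
      then show ?thesis using coord_entropy_dvd[OF Tk, of p n \<sigma>] g(2) by simp
    next
      case infinity
      then show ?thesis using coord_entropy_le_infinity[OF Tk] by simp
    qed
    then have "c \<le> k * coord_entropy \<sigma> \<gamma> (T / k)" unfolding T(2)[symmetric] by (intro mult_left_mono) auto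
    then show ?thesis using reach_times_below[OF k0 g(1) T(1) c0, of \<sigma>] by metis
  qed
  obtain u where u: "u \<in> reach_times \<sigma> k \<infinity> c" "u \<le> T" using below[OF i1] by auto
  show "Inf (reach_times \<sigma> k \<infinity> c) \<in> reach_times \<sigma> k \<infinity> c" by (rule Inf_reach_times[OF k0 i1]) (use u in blast)
  show "Inf (reach_times \<sigma> k \<infinity> c) \<le> Inf (reach_times \<sigma> k (enat p) c)"
    using Inf_reach_times_le[OF u(1)] u(2) unfolding T_def by (rule order_trans)
  show "max_entropic_time \<sigma> k A = entropic_time \<sigma> k (enat p) A"
    unfolding max_entropic_time_def
  proof (rule Greatest_equality)
    show "\<exists>\<gamma>\<ge>1. entropic_time \<sigma> k (enat p) A = entropic_time \<sigma> k \<gamma> A" using p1 by blast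
    fix y assume "\<exists>\<gamma>\<ge>1. y = entropic_time \<sigma> k \<gamma> A"
    then obtain \<gamma> where g: "1 \<le> \<gamma>" "y = entropic_time \<sigma> k \<gamma> A" by blast
    have "y \<le> T"
    proof (cases "\<forall>n. \<gamma> = enat n \<longrightarrow> p dvd n")
      case True
      have y: "y = Inf (reach_times \<sigma> k \<gamma> c)"
        unfolding g(2) entropic_time_eq_Inf[OF k0 g(1)] t if_P[OF True] ..
      obtain u where "u \<in> reach_times \<sigma> k \<gamma> c" "u \<le> T" using below[OF g(1) True] by blast
      then show ?thesis unfolding y using Inf_reach_times_le order_trans by blast
    next
      case False
      have y: "y = Inf (reach_times \<sigma> k \<gamma> 0)"
        unfolding g(2) entropic_time_eq_Inf[OF k0 g(1)] t if_not_P[OF False] ..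
      have "0 \<in> reach_times \<sigma> k \<gamma> 0" by (simp add: reach_times_def coord_entropy_0)
      then have "y \<le> 0" unfolding y by (rule Inf_reach_times_le)
      then show ?thesis using T(1) by simp
    qed
    then show "y \<le> entropic_time \<sigma> k (enat p) A" by (simp only: ep T_def)
  qed
qed

lemma comm_group_cyc_power: "comm_group (cyc_power \<gamma> m)"
proof (rule group.group_comm_groupI[OF cyc_power_group])
  fix x y assume "x \<in> carrier (cyc_power \<gamma> m)" "y \<in> carrier (cyc_power \<gamma> m)"
  then have xy: "x i \<in> carrier (cyc \<gamma>)" "y i \<in> carrier (cyc \<gamma>)" if "i < m" for i
    using that by (auto simp: cyc_power_def product_group_def)
  interpret c: comm_group "cyc \<gamma>" by (rule cyc_group)
  show "x \<otimes>\<^bsub>cyc_power \<gamma> m\<^esub> y = y \<otimes>\<^bsub>cyc_power \<gamma> m\<^esub> x"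
    unfolding cyc_power_def product_group_def monoid.simps
    by (rule restrict_ext) (use c.m_comm xy in auto)
qed

lemma order_cyc_power: assumes "0 < p" shows "order (cyc_power (enat p) m) = p ^ m"
  using assms by (simp add: order_def cyc_power_def product_group_def cyc_def card_PiE carrier_integer_mod_group)

context special_group begin

lemma order_C_power: "\<exists>m. card C = p ^ m"
proof -
  obtain n where "order G = p ^ n" using special by (auto simp: special_p_group_def)
  then have "card C dvd p ^ n" using order_V by (metis dvd_triv_right)
  then show ?thesis using prime divides_primepow_nat by blast
qed

lemma commutator_in_C:
  assumes "x \<in> carrier G" "y \<in> carrier G" shows "x \<otimes> y \<otimes> inv x \<otimes> inv y \<in> C"
  unfolding derived_def by (rule generate.incl) (use assms in blast)

lemma nonabelian_card_C:
  assumes "\<not> comm_group G" shows "card C \<noteq> 1"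
proof
  assume "card C = 1"
  then obtain c where "C = {c}" by (rule card_1_singletonE)
  then have C1: "C = {\<one>}" using subgroup.one_closed[OF C_subgroup] by auto
  have "comm_group G"
  proof (rule group_comm_groupI)
    fix x y assume xy: "x \<in> carrier G" "y \<in> carrier G"
    have "x \<otimes> y \<otimes> inv x \<otimes> inv y = \<one>" using commutator_in_C[OF xy] unfolding C1 by simp
    then have "x \<otimes> y \<otimes> inv (y \<otimes> x) = \<one>" using xy by (simp add: inv_mult_group m_assoc)
    then show "x \<otimes> y = y \<otimes> x" using xy by (metis inv_equality inv_inv m_closed inv_closed)
  qed
  with assms show False by blast
qed

lemma nonabelian_order_V:
  assumes "\<not> comm_group G" shows "order V \<noteq> 1"
proof
  assume "order V = 1"
  then have "card C = card (carrier G)" using order_V by (simp add: order_def)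
  then have C: "C = carrier G" using card_subset_eq[OF finite_carrier C_sub] by blast
  have "comm_group G" by (rule group_comm_groupI) (use C C_comm in blast)
  with assms show False by blast
qed

end

section \<open>Comparison of the walks on the integers and on the cycle\<close>

lemma sum_pmf_le_1: "finite F \<Longrightarrow> (\<Sum>x\<in>F. pmf P x) \<le> 1"
  by (metis measure_measure_pmf_finite measure_pmf.prob_le_1)

text \<open>The Gibbs inequality with the product of the two marginals as reference; the reference
has mass at most 1 because the pair determines the point.\<close>

lemma shannon_entropy_subadditive:
  fixes f :: "'s \<Rightarrow> 'b" and g :: "'s \<Rightarrow> 'c"
  assumes inj: "inj_on (\<lambda>x. (f x, g x)) (set_pmf P)"
    and i: "integrable (measure_pmf (map_pmf f P)) (surprisal (map_pmf f P))"
      "integrable (measure_pmf (map_pmf g P)) (surprisal (map_pmf g P))"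
  shows "shannon_entropy P \<le> shannon_entropy (map_pmf f P) + shannon_entropy (map_pmf g P)"
proof -
  define a where "a x = pmf (map_pmf f P) (f x)" for x
  define b where "b x = pmf (map_pmf g P) (g x)" for x
  have pos: "0 < a x" "0 < b x" if "x \<in> set_pmf P" for x
    using that by (auto simp: a_def b_def intro!: pmf_positive)
  have ia: "integrable (measure_pmf P) (\<lambda>x. - ln (a x))" "integrable (measure_pmf P) (\<lambda>x. - ln (b x))"
    using i unfolding a_def b_def by (simp_all only: integrable_map_pmf_eq)
  have sum: "(\<Sum>x\<in>F. a x * b x) \<le> 1" if F: "finite F" "F \<subseteq> set_pmf P" for F
  proof -
    have "(\<Sum>x\<in>F. a x * b x) = (\<Sum>(u, v)\<in>(\<lambda>x. (f x, g x)) ` F. pmf (map_pmf f P) u * pmf (map_pmf g P) v)"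
      by (subst sum.reindex[OF inj_on_subset[OF inj F(2)]]) (simp add: a_def b_def)
    also have "\<dots> \<le> (\<Sum>(u, v)\<in>f ` F \<times> g ` F. pmf (map_pmf f P) u * pmf (map_pmf g P) v)"
      by (rule sum_mono2) (use F in auto)
    also have "\<dots> = (\<Sum>u\<in>f ` F. pmf (map_pmf f P) u) * (\<Sum>v\<in>g ` F. pmf (map_pmf g P) v)"
      by (simp only: sum_product sum.cartesian_product)
    also have "\<dots> \<le> 1 * 1"
      by (rule mult_mono) (use F in \<open>auto intro!: sum_pmf_le_1 sum_nonneg\<close>)
    finally show ?thesis by simp
  qed
  have AE: "AE x in measure_pmf P. - ln (a x * b x) = - ln (a x) + - ln (b x)"
    using pos by (auto simp: AE_measure_pmf_iff ln_mult_pos)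
  have iab: "integrable (measure_pmf P) (\<lambda>x. - ln (a x * b x))"
    using integrable_cong_AE[OF _ _ AE] Bochner_Integration.integrable_add[OF ia] by simp
  have "shannon_entropy P \<le> measure_pmf.expectation P (\<lambda>x. - ln (a x * b x))"
    by (rule gibbs(2)) (use pos sum iab in \<open>auto intro: mult_pos_pos\<close>)
  also have "\<dots> = measure_pmf.expectation P (\<lambda>x. - ln (a x) + - ln (b x))"
    by (rule integral_cong_AE[OF _ _ AE]) auto
  also have "\<dots> = measure_pmf.expectation P (\<lambda>x. - ln (a x)) + measure_pmf.expectation P (\<lambda>x. - ln (b x))"
    by (rule Bochner_Integration.integral_add[OF ia])
  also have "\<dots> = shannon_entropy (map_pmf f P) + shannon_entropy (map_pmf g P)"
    unfolding shannon_entropy_expectation[OF i(1)] shannon_entropy_expectation[OF i(2)] integral_map_pmf a_def b_def ..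
  finally show ?thesis .
qed

text \<open>The index of the block of length \<open>p\<close> around 0 that contains
\<open>x\<close> vanishes unless \<open>2 \<bar>x\<bar> \<ge> p\<close>, so it can be dominated by a
square.\<close>

lemma block_le_square:
  fixes x :: int
  assumes p: "2 \<le> (p::nat)"
  shows "\<bar>of_int ((x + int (p div 2)) div int p)\<bar> \<le> 6 / (real p)\<^sup>2 * (of_int x)\<^sup>2"
proof -
  define b where "b = (x + int (p div 2)) div int p"
  have p0: "0 < int p" using p by simp
  have dm: "x + int (p div 2) = b * int p + (x + int (p div 2)) mod int p" by (simp add: b_def)
  have md: "0 \<le> (x + int (p div 2)) mod int p" "(x + int (p div 2)) mod int p < int p" using p0 by auto
  have half: "int p - 1 \<le> 2 * int (p div 2)" "2 * int (p div 2) \<le> int p" by presburger+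
  have main: "\<bar>b\<bar> * (int p * int p) \<le> 6 * (x * x)"
  proof (cases "b = 0")
    case True then show ?thesis by simp
  next
    case False
    have "int p \<le> 2 * \<bar>x\<bar> \<and> \<bar>b\<bar> * int p \<le> \<bar>x\<bar> + int p"
    proof (cases "0 < b")
      case True
      then have ge: "1 * int p \<le> b * int p" using p0 by (intro mult_right_mono) auto
      have "\<bar>b\<bar> * int p = b * int p" using True by simp
      then show ?thesis using ge dm md half by linarith
    next
      case False
      with \<open>b \<noteq> 0\<close> have "b * int p \<le> (- 1) * int p" using p0 by (intro mult_right_mono) auto
      moreover have "\<bar>b\<bar> * int p = - (b * int p)" using False by simp
      ultimately show ?thesis using dm md half by linarith
    qed
    then have h: "int p \<le> 2 * \<bar>x\<bar>" "\<bar>b\<bar> * int p \<le> 3 * \<bar>x\<bar>" by auto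
    have "\<bar>b\<bar> * (int p * int p) = (\<bar>b\<bar> * int p) * int p" by simp
    also have "\<dots> \<le> (3 * \<bar>x\<bar>) * (2 * \<bar>x\<bar>)" by (rule mult_mono[OF h(2,1)]) auto
    finally show ?thesis by simp
  qed
  have "real_of_int (\<bar>b\<bar> * (int p * int p)) \<le> real_of_int (6 * (x * x))" using main by (simp only: of_int_le_iff)
  then have "\<bar>real_of_int b\<bar> * (real p)\<^sup>2 \<le> 6 * (real_of_int x)\<^sup>2" by (simp add: power2_eq_square)
  then show ?thesis using p unfolding b_def[symmetric] by (simp add: field_simps)
qed

lemma one_plus_ln_le_sqrt: assumes "0 < (y::real)" shows "1 + ln y \<le> 2 * sqrt y"
proof -
  have "ln (sqrt y) \<le> sqrt y - 1" using assms by (intro ln_le_minus_one) auto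
  then show ?thesis using assms by (simp add: ln_sqrt)
qed

lemma ln_le_sqrt: assumes "0 < (y::real)" shows "ln y \<le> 2 * sqrt y"
  using one_plus_ln_le_sqrt[OF assms] by simp

context cyclic_walk begin

text \<open>The position is determined by its residue and by its block around an integer close to
the mean. The mean absolute block index is at most \<open>u\<close> by the second moment, so the
entropy of the block is of order \<open>u ln (1 / u)\<close>.\<close>

lemma coord_entropy_infinity_le:
  assumes s: "0 < s" and u: "u = 12 * s / (real p)\<^sup>2" "u \<le> 1 / 2"
  shows "coord_entropy \<sigma> \<infinity> s \<le> h s + (4 * u + u * ln (1 / u))"
proof -
  define X where "X = int_walk \<sigma> s"
  have u0: "0 < u" using s p by (simp add: u)
  obtain m :: int where m: "integrable (measure_pmf X) (\<lambda>x. (of_int x - of_int m)\<^sup>2 :: real)"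
    "measure_pmf.expectation X (\<lambda>x. (of_int x - of_int m)\<^sup>2) \<le> 2 * s"
    using int_walk_centred[OF s] unfolding X_def by metis
  define g where "g x = (x - m + int (p div 2)) div int p" for x
  define f where "f x = x mod int p" for x
  have X: "map_pmf f X = cyc_walk s" by (simp add: f_def[abs_def] X_def cyc_walk_def)
  have Hf: "shannon_entropy (map_pmf f X) = h s"
    using coord_entropy_p[of s] s unfolding X coord_entropy_def reduced_walk_p by simp
  have if': "integrable (measure_pmf (map_pmf f X)) (surprisal (map_pmf f X))"
    unfolding X by (rule integrable_measure_pmf_finite[OF finite_subset[OF set_cyc_walk]]) simp
  have g6: "\<bar>of_int (g x)\<bar> \<le> 6 / (real p)\<^sup>2 * (of_int x - of_int m)\<^sup>2" for x
    using block_le_square[OF p, of "x - m"] by (simp add: g_def)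
  have ig: "integrable (measure_pmf X) (\<lambda>x. \<bar>of_int (g x)\<bar> :: real)"
    by (rule Bochner_Integration.integrable_bound[OF integrable_mult_right[OF m(1), of "6 / (real p)\<^sup>2"]])
       (use g6 in \<open>auto intro: order_trans[OF _ abs_ge_self]\<close>)
  have Eg: "measure_pmf.expectation X (\<lambda>x. \<bar>of_int (g x)\<bar>) \<le> u"
  proof -
    have "measure_pmf.expectation X (\<lambda>x. \<bar>of_int (g x)\<bar>)
        \<le> measure_pmf.expectation X (\<lambda>x. 6 / (real p)\<^sup>2 * (of_int x - of_int m)\<^sup>2)"
      by (rule integral_mono[OF ig integrable_mult_right[OF m(1)]]) (rule g6)
    also have "\<dots> = 6 / (real p)\<^sup>2 * measure_pmf.expectation X (\<lambda>x. (of_int x - of_int m)\<^sup>2)"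
      by (rule integral_mult_right_zero)
    also have "\<dots> \<le> 6 / (real p)\<^sup>2 * (2 * s)" by (rule mult_left_mono[OF m(2)]) simp
    finally show ?thesis by (simp add: u)
  qed
  have iY: "integrable (measure_pmf (map_pmf g X)) (\<lambda>y. \<bar>of_int y\<bar> :: real)"
    using ig by (simp only: integrable_map_pmf_eq)
  have EY: "measure_pmf.expectation (map_pmf g X) (\<lambda>y. \<bar>of_int y\<bar>) \<le> u"
    using Eg by (simp only: integral_map_pmf)
  have "u < 1" using u(2) by simp
  note ent = entropy_int_le[OF iY u0 this]
  have "shannon_entropy (map_pmf g X) \<le> ln ((1 + u) / (1 - u)) + measure_pmf.expectation (map_pmf g X) (\<lambda>x. \<bar>of_int x\<bar>) * ln (1 / u)"
    by (rule ent(2))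
  also have "\<dots> \<le> 4 * u + u * ln (1 / u)"
  proof (rule add_mono)
    have "ln ((1 + u) / (1 - u)) \<le> (1 + u) / (1 - u) - 1" using u0 u(2) by (intro ln_le_minus_one) auto
    also have "\<dots> = 2 * u / (1 - u)" using u(2) by (simp add: field_simps)
    also have "\<dots> \<le> 2 * u / (1 / 2)" using u0 u(2) by (intro divide_left_mono) auto
    finally show "ln ((1 + u) / (1 - u)) \<le> 4 * u" by simp
    show "measure_pmf.expectation (map_pmf g X) (\<lambda>x. \<bar>of_int x\<bar>) * ln (1 / u) \<le> u * ln (1 / u)"
      using EY u0 u(2) by (intro mult_right_mono) auto
  qed
  finally have Hg: "shannon_entropy (map_pmf g X) \<le> 4 * u + u * ln (1 / u)" .
  have inj: "inj_on (\<lambda>x. (f x, g x)) (set_pmf X)"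
  proof (rule inj_onI)
    fix x y assume "(f x, g x) = (f y, g y)"
    then have e: "x mod int p = y mod int p" "(x - m + int (p div 2)) div int p = (y - m + int (p div 2)) div int p"
      by (simp_all add: f_def g_def)
    define c where "c = - m + int (p div 2)"
    have c: "x - m + int (p div 2) = x + c" "y - m + int (p div 2) = y + c" by (simp_all add: c_def)
    have "(x + c) mod int p = (y + c) mod int p" by (rule mod_add_cong[OF e(1) refl])
    moreover have "(x + c) div int p = (y + c) div int p" using e(2) unfolding c .
    ultimately have "x + c = y + c" by (metis div_mult_mod_eq)
    then show "x = y" by simp
  qed
  have "coord_entropy \<sigma> \<infinity> s = shannon_entropy X" by (simp add: coord_entropy_def reduced_walk_infinity X_def)
  also have "\<dots> \<le> shannon_entropy (map_pmf f X) + shannon_entropy (map_pmf g X)"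
    by (rule shannon_entropy_subadditive[OF inj if' ent(1)])
  finally show ?thesis using Hf Hg by linarith
qed

text \<open>The gain over the window from \<open>s\<close> to \<open>(1 + \<epsilon>) s\<close>
exceeds the entropy lost by reduction modulo \<open>p\<close>: up to time 1 both are proportional to
\<open>s\<close> up to logarithms, but the loss has an additional factor of order \<open>1 /
p\<^sup>2\<close>; later the gain is bounded below and the loss is small.\<close>

lemma time_ratio_le:
  assumes s: "0 < s" and eq: "h s' = coord_entropy \<sigma> \<infinity> s" and e: "0 < \<epsilon>" "\<epsilon> \<le> 1"
    and u: "u = 12 * s / (real p)\<^sup>2" "u \<le> 1 / 2" "6 * sqrt u < \<epsilon> / 2 * c0"
    and large: "12 * (5 + 2 * ln p) / (real p)\<^sup>2 < \<epsilon> / 2 * c1"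
  shows "s' \<le> (1 + \<epsilon>) * s"
proof -
  have u0: "0 < u" using s p by (simp add: u)
  define s1 where "s1 = (1 + \<epsilon>) * s"
  have s1: "0 < s1" "s \<le> s1" "s1 \<le> 2 * s" using s e by (auto simp: s1_def)
  have le: "s1 \<le> (real p)\<^sup>2"
  proof -
    have "12 * s / (real p)\<^sup>2 \<le> 1 / 2" using u(1,2) by (simp only:)
    then have "24 * s \<le> (real p)\<^sup>2" using p by (simp add: field_simps)
    then show ?thesis using s1 s by linarith
  qed
  note gain = gain_explicit[OF s e le[unfolded s1_def]]
  have "4 * u + u * ln (1 / u) < h s1 - h s"
  proof (cases "1 \<le> s1")
    case True
    have "u * ln (1 / u) \<le> u * (2 * sqrt (1 / u))" using u0 by (intro mult_left_mono ln_le_sqrt) auto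
    also have "\<dots> = 2 * (u / sqrt u)" by (simp add: real_sqrt_divide)
    also have "\<dots> = 2 * sqrt u" using u0 by (simp only: real_div_sqrt less_imp_le)
    finally have "u * ln (1 / u) \<le> 2 * sqrt u" .
    moreover have "u \<le> sqrt u"
      using u0 u(2) real_le_rsqrt[of u u] mult_left_le[of u u] by (simp add: power2_eq_square)
    ultimately show ?thesis using u(3) gain(2) True unfolding s1_def by linarith
  next
    case False
    define l where "l = ln (1 / s1)"
    have l: "0 \<le> l" using False s1 by (simp add: l_def)
    have "ln (1 / u) \<le> 2 * ln p + l + 1"
    proof -
      have "1 / u = (real p)\<^sup>2 / (12 * s)" by (simp add: u)
      also have "\<dots> \<le> (real p)\<^sup>2 * (1 / s1)"
      proof -
        have "s1 \<le> 12 * s" using s1 s by linarith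
        then have "1 / (12 * s) \<le> 1 / s1" using s s1 by (intro divide_left_mono) auto
        then have "(real p)\<^sup>2 * (1 / (12 * s)) \<le> (real p)\<^sup>2 * (1 / s1)" by (intro mult_left_mono) auto
        then show ?thesis by simp
      qed
      finally have "ln (1 / u) \<le> ln ((real p)\<^sup>2 * (1 / s1))" using u0 by (intro ln_mono) auto
      also have "\<dots> = 2 * ln p + l" using s1 p unfolding l_def by (subst ln_mult_pos) (auto simp: ln_realpow)
      finally show ?thesis by simp
    qed
    then have "u * ln (1 / u) \<le> u * (2 * ln p + l + 1)" using u0 by (intro mult_left_mono) auto
    then have "4 * u + u * ln (1 / u) \<le> u * (5 + 2 * ln p + l)" by (simp add: algebra_simps)
    also have "\<dots> \<le> u * ((5 + 2 * ln p) * (1 + l))"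
    proof -
      have "1 * l \<le> (5 + 2 * ln p) * l" using l p by (intro mult_right_mono) auto
      then have "5 + 2 * ln p + l \<le> (5 + 2 * ln p) * (1 + l)" unfolding distrib_left by simp
      then show ?thesis using u0 by (intro mult_left_mono) auto
    qed
    also have "\<dots> = 12 * (5 + 2 * ln p) / (real p)\<^sup>2 * (s * (1 + l))" by (simp add: u)
    also have "\<dots> < \<epsilon> / 2 * c1 * (s * (1 + l))"
      using large l s by (intro mult_strict_right_mono mult_pos_pos) auto
    also have "\<dots> \<le> \<epsilon> / 2 * c1 * (s1 * (1 + l))"
      using s1 l e c0 by (intro mult_left_mono mult_right_mono) (auto simp: c1_def)
    also have "\<dots> \<le> h s1 - h s" using gain(1) False by (simp add: s1_def l_def mult_ac)
    finally show ?thesis .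
  qed
  then have "h s' < h s1" using coord_entropy_infinity_le[OF s u(1,2)] eq by linarith
  moreover have "h s1 \<le> h s'" if "s1 < s'" using that s1 by (intro h_antimono_D) auto
  ultimately show ?thesis unfolding s1_def[symmetric] by fastforce
qed

text \<open>If the entropy stays below \<open>(1 - \<kappa>) ln p\<close>, then by the collision
entropy bound the time stays below \<open>p\<^sup>2\<close> by a power of \<open>p\<close>.\<close>

lemma sqrt_time_le:
  assumes s: "0 < s" and le: "h s \<le> (1 - \<kappa>) * ln p" and big: "1 < real p powr \<kappa>"
  shows "sqrt s \<le> real p / (real p powr \<kappa> - 1)"
proof -
  have p0: "0 < real p" using p by simp
  have pos: "0 < 1 / real p + 1 / sqrt s" using s p0 by (intro add_pos_pos) auto
  have "- ln (1 / real p + 1 / sqrt s) \<le> (1 - \<kappa>) * ln p" using h_ge_renyi[OF s] le by linarith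
  then have "exp (- ((1 - \<kappa>) * ln p)) \<le> exp (ln (1 / real p + 1 / sqrt s))" by (subst exp_le_cancel_iff) linarith
  also have "\<dots> = 1 / real p + 1 / sqrt s" using pos by simp
  finally have "real p powr \<kappa> / real p \<le> 1 / real p + 1 / sqrt s"
  proof -
    have "exp (- ((1 - \<kappa>) * ln p)) = real p powr \<kappa> / real p"
      using p0 by (simp add: powr_def left_diff_distrib exp_diff)
    then show "exp (- ((1 - \<kappa>) * ln p)) \<le> 1 / real p + 1 / sqrt s \<Longrightarrow> ?thesis" by simp
  qed
  then have "(real p powr \<kappa> - 1) / real p \<le> 1 / sqrt s" by (simp add: diff_divide_distrib)
  then show ?thesis using big p0 s by (simp add: field_simps)
qed

end

context special_walk begin

section \<open>Cutoff\<close>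

lemma ln_2_le: "2 / 3 \<le> ln (2::real)" "ln 2 \<le> ln (real p)"
  using ln2_ge_two_thirds p by (auto intro: ln_mono)

text \<open>By \<open>k h(s\<^sub>0) = r ln p\<close> and \<open>k D(s\<^sub>0) = (k - r) ln
p\<close> the right-hand side is the minimum of \<open>k\<close>, \<open>r ln p\<close> and
\<open>(k - r) ln p\<close>. The logarithm on the left is large only if \<open>s\<^sub>0\<close> is
small; then the entropy is far from \<open>ln p\<close>, so that \<open>(k - r) ln p\<close> is at
least \<open>k / 3\<close>, and \<open>h_small\<close> bounds the logarithm by a multiple of
\<open>1 + ln k\<close>.\<close>

lemma separation:
  fixes s0 M :: real
  assumes s0: "0 < s0" and eq: "k * h s0 = r * ln p" and s1: "1 \<le> s" and r1: "1 \<le> r" and rk: "r < k"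
    and M: "1 \<le> M" and X: "48 * M * (s * ln p) \<le> k" "48 * M * (s * ln p) \<le> r * ln p"
      "48 * M * (s * ln p) \<le> (k - r) * ln p"
    and lnk: "48 * M * ln k \<le> k" "48 * M * ln k \<le> r * ln p"
  shows "M * (s * ln p + 1 + ln (1 / min 1 s0)) \<le> k * min 1 (min (h s0) (D s0))"
proof -
  define X where "X = s * ln p"
  define K where "K = X + 1 + ln (1 / min 1 s0)"
  have kpos: "0 < real k" using rk by simp
  have kD: "k * D s0 = (k - r) * ln p"
    using eq rk by (simp add: D_def right_diff_distrib left_diff_distrib of_nat_diff)
  have Xl: "ln 2 \<le> X"
  proof -
    have "1 * ln (real p) \<le> s * ln p" using s1 ln_2_le by (intro mult_right_mono) auto
    then show ?thesis using ln_2_le unfolding X_def by linarith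
  qed
  have X23: "2 / 3 \<le> X" using Xl ln_2_le by linarith
  have k1: "0 \<le> ln (real k)" using rk by simp
  have three: "M * K \<le> k \<and> M * K \<le> k * h s0 \<and> M * K \<le> k * D s0"
  proof (cases "1 / 1000 \<le> s0")
    case True
    (* 2 ^ 10 is a power of 2 above 1000, so that ln 2 \<le> X applies *)
    have "ln (1 / min 1 s0) \<le> ln (2 ^ 10)" using True by (intro ln_mono) (auto simp: min_def field_simps)
    also have "\<dots> = 10 * ln 2" using ln_realpow[of 2 10] by simp
    finally have "K \<le> 13 * X" using Xl X23 unfolding K_def by linarith
    then have "M * K \<le> M * (48 * X)" using M X23 by (intro mult_left_mono) auto
    then show ?thesis using X unfolding eq kD X_def by (simp add: mult_ac)
  next
    case False
    have s0l: "s0 < 1" using False by simp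
    have sq: "s0 * sqrt (1 / s0) = sqrt s0" using s0 real_div_sqrt[of s0] by (simp add: real_sqrt_divide)
    have hs: "h s0 \<le> 10 * sqrt s0"
    proof -
      have "h s0 \<le> 5 * s0 * (1 + ln (1 / s0))" using s0 s0l by (intro h_small) auto
      also have "\<dots> \<le> 5 * s0 * (2 * sqrt (1 / s0))"
        using s0 by (intro mult_left_mono one_plus_ln_le_sqrt) auto
      also have "\<dots> = 10 * (s0 * sqrt (1 / s0))" by simp
      finally show ?thesis unfolding sq .
    qed
    (* 1 / 1000 < (1 / 30)^2, and 10 / 30 is at most half of ln 2 *)
    have "sqrt s0 \<le> 1 / 30" using False s0 by (intro real_le_lsqrt) (auto simp: power2_eq_square)
    then have "h s0 \<le> 1 / 3" using hs by linarith
    then have D: "1 / 3 \<le> D s0" using ln_2_le by (simp add: D_def)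
    have kD3: "k / 3 \<le> k * D s0" using mult_left_mono[OF D, of "real k"] kpos by simp
    have "2 / 3 \<le> k * h s0"
    proof -
      have "1 * ln (real p) \<le> r * ln p" using r1 ln_2_le by (intro mult_right_mono) auto
      then show ?thesis using eq ln_2_le by linarith
    qed
    also have "\<dots> \<le> k * (10 * sqrt s0)" using hs by (intro mult_left_mono) auto
    finally have "1 / (15 * k) \<le> sqrt s0" using kpos by (simp add: field_simps)
    then have "(1 / (15 * k))\<^sup>2 \<le> (sqrt s0)\<^sup>2" using kpos by (intro power_mono) auto
    then have "1 / (15 * real k)\<^sup>2 \<le> s0" using s0 by (simp add: power_divide)
    then have "1 / s0 \<le> 2 ^ 8 * (real k)\<^sup>2" using s0 kpos by (simp add: field_simps power2_eq_square)
    then have "ln (1 / s0) \<le> ln (2 ^ 8 * (real k)\<^sup>2)" using s0 by (intro ln_mono) auto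
    also have "\<dots> = 8 * ln 2 + 2 * ln k" using kpos ln_realpow[of 2 8] by (subst ln_mult_pos) (auto simp: ln_realpow)
    finally have "ln (1 / min 1 s0) \<le> 8 * ln 2 + 2 * ln k" using s0l by (simp add: min_def)
    then have "K \<le> 11 * X + 2 * ln k" using Xl X23 unfolding K_def by linarith
    then have "M * K \<le> M * (11 * X + 2 * ln k)" using M by (intro mult_left_mono) auto
    then have MK: "M * K \<le> 11 * (M * X) + 2 * (M * ln k)" by (simp add: distrib_left mult_ac)
    have "48 * (M * X) \<le> k" "48 * (M * X) \<le> k * h s0" "48 * (M * ln k) \<le> k" "48 * (M * ln k) \<le> k * h s0"
      using X lnk unfolding eq X_def by (simp_all add: mult_ac)
    moreover have "0 \<le> M * X" "0 \<le> M * ln k" using M X23 k1 by simp_all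
    ultimately show ?thesis using MK kD3 by linarith
  qed
  then have "M * K / k \<le> min 1 (min (h s0) (D s0))" using kpos by (simp add: field_simps)
  then have "M * K \<le> min 1 (min (h s0) (D s0)) * k" unfolding pos_divide_le_eq[OF kpos] .
  then show ?thesis unfolding K_def X_def by (simp only: mult.commute)
qed

text \<open>All logarithmic terms are absorbed by the quantity of \<open>separation\<close>.\<close>

lemma L_le:
  assumes s0: "0 < s0" and s1: "1 \<le> s"
  shows "1 + L s0 \<le> 6 * (s * ln p + 1 + ln (1 / min 1 s0))" "0 \<le> ln (1 / min 1 s0)"
    "2 / 3 \<le> s * ln p"
proof -
  define m where "m = ln (1 / min 1 s0)"
  have lp: "ln p \<le> s * ln p" using s1 ln_2_le mult_right_mono[of 1 "real s" "ln p"] by simp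
  then show X: "2 / 3 \<le> s * ln p" using ln_2_le by linarith
  show m: "0 \<le> ln (1 / min 1 s0)" using s0 by simp
  have "L s0 = ln (12 * (real p * (1 / min 1 s0)))" by (simp add: L_def)
  also have "\<dots> = ln 12 + (ln p + ln (1 / min 1 s0))"
    using s0 p by (simp add: ln_mult_pos del: times_divide_eq_right)
  also have "ln (12::real) \<le> ln (2 ^ 4)" by (intro ln_mono) auto
  also have "ln ((2::real) ^ 4) = 4 * ln 2" using ln_realpow[of 2 4] by simp
  finally have "L s0 \<le> 4 * ln 2 + (ln p + ln (1 / min 1 s0))" by simp
  then show "1 + L s0 \<le> 6 * (s * ln p + 1 + ln (1 / min 1 s0))" 
  proof -
    define Y where "Y = s * ln p"
    have "ln p \<le> Y" "2 / 3 \<le> Y" "0 \<le> m" using lp X m by (simp_all add: Y_def m_def)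
    moreover have "L s0 \<le> 4 * ln 2 + (ln p + m)" using \<open>L s0 \<le> _\<close> by (simp only: m_def)
    ultimately have "1 + L s0 \<le> 6 * (Y + 1 + m)" using ln_2_le by argo
    then show ?thesis by (simp only: Y_def m_def)
  qed
qed

lemma c2_pos: "0 < c2" using c0 by (simp add: c2_def)

lemma cutoff_upper:
  fixes s0 M \<epsilon> \<delta> :: real
  assumes s0: "0 < s0" and eq: "k * h s0 = r * ln p" and s1: "1 \<le> s" and rk: "r < k"
    and sep: "M * (s * ln p + 1 + ln (1 / min 1 s0)) \<le> k * min 1 (min (h s0) (D s0))"
    and e: "0 < \<epsilon>" "\<epsilon> < 1" and d: "0 < \<delta>"
    and M: "4 \<le> M * (\<epsilon> * c2)" "192 \<le> M * (\<epsilon>\<^sup>2 * c2 * \<delta>)" "0 < M"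
  shows "measure_pmf.prob (connected_generators_law G k) {Z. \<bar>mixing_distance \<sigma> G Z ((1 + \<epsilon>) * (k * s0)) - 0\<bar> > \<delta>}
    \<le> 32 / (\<delta>\<^sup>2 * \<epsilon> * c2) / M"
proof -
  define X where "X = s * ln p"
  define K where "K = X + 1 + ln (1 / min 1 s0)"
  define B where "B = min 1 (min (h s0) (D s0))"
  define g where "g = h ((1 + \<epsilon>) * s0) - h s0"
  have K: "1 + L s0 \<le> 6 * K" "1 \<le> K" "X \<le> K" using L_le[OF s0 s1] by (simp_all add: K_def X_def)
  have MKB: "M * K \<le> k * B" using sep by (simp add: K_def B_def X_def)
  have "\<epsilon> * c2 * B \<le> g" unfolding B_def g_def by (rule gain_bound[OF s0 e(1)]) (use e in simp)
  then have "k * (\<epsilon> * c2 * B) \<le> k * g" by (intro mult_left_mono) auto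
  moreover have "\<epsilon> * c2 * (M * K) \<le> \<epsilon> * c2 * (k * B)" using MKB e c2_pos by (intro mult_left_mono) auto
  ultimately have kg: "M * (\<epsilon> * c2) * K \<le> k * g" by (simp add: mult_ac)
  have Mc: "0 < M * (\<epsilon> * c2)" using M e c2_pos by simp
  have kgM: "M * (\<epsilon> * c2) \<le> k * g"
    using kg mult_left_mono[OF K(2), of "M * (\<epsilon> * c2)"] Mc by linarith
  have g0: "0 < g"
  proof -
    have "0 < k * g" using kgM Mc by linarith
    then show ?thesis using k0 by (simp add: zero_less_mult_iff)
  qed
  have b1: "4 * X \<le> k * g"
  proof -
    have "4 * X \<le> 4 * K" using K by simp
    also have "\<dots> \<le> M * (\<epsilon> * c2) * K" using M(1) K by (intro mult_right_mono) auto
    finally show ?thesis using kg by linarith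
  qed
  have b2: "32 * (1 + L s0) / (\<epsilon> * \<delta>) \<le> k * g"
  proof -
    have "32 * (1 + L s0) / (\<epsilon> * \<delta>) \<le> 192 * K / (\<epsilon> * \<delta>)" using K e d by (intro divide_right_mono) auto
    also have "\<dots> \<le> (M * (\<epsilon>\<^sup>2 * c2 * \<delta>)) * K / (\<epsilon> * \<delta>)"
      using M(2) K e d by (intro divide_right_mono mult_right_mono) auto
    also have "\<dots> = M * (\<epsilon> * c2) * K" using e d by (simp add: power2_eq_square field_simps)
    finally show ?thesis using kg by linarith
  qed
  have "measure_pmf.prob (connected_generators_law G k) {Z. \<bar>mixing_distance \<sigma> G Z ((1 + \<epsilon>) * (k * s0)) - 0\<bar> > \<delta>}
      = measure_pmf.prob (connected_generators_law G k) {Z. \<delta> < mixing_distance \<sigma> G Z ((1 + \<epsilon>) * (k * s0))}"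
    by (simp add: mixing_distance_def tv_nonneg)
  also have "\<dots> \<le> 2 * measure_pmf.prob (generators_law G k) {Z. \<delta> < mixing_distance \<sigma> G Z ((1 + \<epsilon>) * (k * s0))}"
    by (rule prob_conditioned_le[OF rk])
  also have "\<dots> \<le> 2 * (exp (- (k * g / 4)) / (\<delta> / 2)\<^sup>2)"
    by (intro mult_left_mono mixing_upper[OF s0 eq e(1) _ d g_def b1[unfolded X_def] b2 g0]) (use e in simp_all)
  also have "\<dots> \<le> 2 * (4 / (M * (\<epsilon> * c2)) / (\<delta> / 2)\<^sup>2)"
  proof (intro mult_left_mono divide_right_mono)
    have "M * (\<epsilon> * c2) / 4 \<le> exp (k * g / 4)" using kgM exp_ge_add_one_self[of "k * g / 4"] by linarith
    then have "1 / exp (k * g / 4) \<le> 1 / (M * (\<epsilon> * c2) / 4)" using Mc by (intro divide_left_mono) auto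
    then show "exp (- (k * g / 4)) \<le> 4 / (M * (\<epsilon> * c2))" by (simp add: exp_minus inverse_eq_divide)
  qed simp_all
  also have "\<dots> = 32 / (\<delta>\<^sup>2 * \<epsilon> * c2) / M" using M e d c2_pos by (simp add: power2_eq_square field_simps)
  finally show ?thesis .
qed

lemma cutoff_lower:
  fixes s0 M \<epsilon> \<delta> :: real
  assumes s0: "0 < s0" and eq: "k * h s0 = r * ln p" and s1: "1 \<le> s" and rk: "r < k"
    and sep: "M * (s * ln p + 1 + ln (1 / min 1 s0)) \<le> k * min 1 (min (h s0) (D s0))"
    and e: "0 < \<epsilon>" "\<epsilon> < 1" and M: "0 < M"
      "(32 * (6 + ln (1 / (1 - \<epsilon>))) / (\<epsilon>\<^sup>2 * c2) + 4 / (\<epsilon> * c2)) / M \<le> \<delta>"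
  shows "measure_pmf.prob (connected_generators_law G k) {Z. \<bar>mixing_distance \<sigma> G Z ((1 - \<epsilon>) * (k * s0)) - 1\<bar> > \<delta>} = 0"
proof -
  define X where "X = s * ln p"
  define K where "K = X + 1 + ln (1 / min 1 s0)"
  define B where "B = min 1 (min (h s0) (D s0))"
  define l where "l = ln (1 / (1 - \<epsilon>))"
  have l: "0 \<le> l" using e by (simp add: l_def)
  have K: "1 + L s0 \<le> 6 * K" "1 \<le> K" using L_le[OF s0 s1] by (simp_all add: K_def X_def)
  have MKB: "M * K \<le> k * B" using sep by (simp add: K_def B_def X_def)
  have MK: "0 < M * K" "M \<le> M * K" using M K by simp_all
  have kB: "0 < k * B" using MKB MK by linarith
  then have B0: "0 < B" using k0 by (simp add: zero_less_mult_iff)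
  have t1: "32 * (1 + L s0 + l) / (\<epsilon>\<^sup>2 * c2 * (k * B)) \<le> 32 * (6 + l) / (\<epsilon>\<^sup>2 * c2) / M"
  proof -
    have "l * 1 \<le> l * K" using K l by (intro mult_left_mono) auto
    then have "1 + L s0 + l \<le> (6 + l) * K" using K by (simp add: distrib_right)
    then have "32 * (1 + L s0 + l) / (\<epsilon>\<^sup>2 * c2 * (k * B)) \<le> 32 * ((6 + l) * K) / (\<epsilon>\<^sup>2 * c2 * (k * B))"
      using e c2_pos kB by (intro divide_right_mono) auto
    also have "\<dots> \<le> 32 * ((6 + l) * K) / (\<epsilon>\<^sup>2 * c2 * (M * K))"
      using e c2_pos kB MKB MK K l by (intro divide_left_mono mult_left_mono) auto
    also have "\<dots> = 32 * (6 + l) / (\<epsilon>\<^sup>2 * c2) / M"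
    proof -
      have "32 * ((6 + l) * K) / (\<epsilon>\<^sup>2 * c2 * (M * K)) = 32 * (6 + l) * K / (\<epsilon>\<^sup>2 * c2 * M * K)"
        by (simp only: mult.assoc)
      also have "\<dots> = 32 * (6 + l) / (\<epsilon>\<^sup>2 * c2 * M)"
        using K(2) by (intro nonzero_mult_divide_mult_cancel_right) simp
      finally show ?thesis by simp
    qed
    finally show ?thesis .
  qed
  have t2: "exp (- (\<epsilon> * c2 * (k * B) / 4)) \<le> 4 / (\<epsilon> * c2) / M"
  proof -
    have ec: "0 < \<epsilon> * c2" using e c2_pos by simp
    have "\<epsilon> * c2 * M \<le> \<epsilon> * c2 * (k * B)" using MK MKB ec by (intro mult_left_mono) auto
    then have "\<epsilon> * c2 * M / 4 \<le> exp (\<epsilon> * c2 * (k * B) / 4)"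
      using exp_ge_add_one_self[of "\<epsilon> * c2 * (k * B) / 4"] by linarith
    then have "1 / exp (\<epsilon> * c2 * (k * B) / 4) \<le> 1 / (\<epsilon> * c2 * M / 4)" using ec M by (intro divide_left_mono) auto
    then show ?thesis by (simp add: exp_minus inverse_eq_divide)
  qed
  have "measure_pmf.prob (connected_generators_law G k) {Z. \<bar>mixing_distance \<sigma> G Z ((1 - \<epsilon>) * (k * s0)) - 1\<bar> > \<delta>}
    \<le> 2 * measure_pmf.prob (generators_law G k) {Z. \<bar>mixing_distance \<sigma> G Z ((1 - \<epsilon>) * (k * s0)) - 1\<bar> > \<delta>}"
    by (rule prob_conditioned_le[OF rk])
  also have "measure_pmf.prob (generators_law G k) {Z. \<bar>mixing_distance \<sigma> G Z ((1 - \<epsilon>) * (k * s0)) - 1\<bar> > \<delta>}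
    \<le> measure_pmf.prob (generators_law G k) {}"
  proof (rule pmf_prob_mono)
    fix Z assume Z: "Z \<in> set_pmf (generators_law G k)"
      "Z \<in> {Z. \<bar>mixing_distance \<sigma> G Z ((1 - \<epsilon>) * (k * s0)) - 1\<bar> > \<delta>}"
    define m where "m = mixing_distance \<sigma> G Z ((1 - \<epsilon>) * (k * s0))"
    have "1 - 32 * (1 + L s0 + l) / (\<epsilon>\<^sup>2 * c2 * (k * B)) - exp (- (\<epsilon> * c2 * (k * B) / 4)) \<le> m"
      unfolding m_def l_def by (rule mixing_lower[OF s0 eq e B_def B0 set_generators_law[OF Z(1)]])
    then have "1 - \<delta> \<le> m" using t1 t2 M(2) unfolding l_def[symmetric] add_divide_distrib by linarith
    moreover have "m \<le> 1" by (simp add: m_def mixing_distance_def tv_le_1)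
    ultimately have "\<bar>m - 1\<bar> \<le> \<delta>" by linarith
    then show "Z \<in> {}" using Z(2) by (simp add: m_def)
  qed
  finally show ?thesis using measure_nonneg[of "measure_pmf (connected_generators_law G k)"] by (simp add: order_antisym)
qed

lemma entropic_times:
  assumes r1: "1 \<le> r" and rk: "r < k"
  obtains s0 s1 :: real where "0 < s0" "k * h s0 = r * ln p" "0 < s1" "h s0 = coord_entropy \<sigma> \<infinity> s1" "s1 \<le> s0"
    "max_entropic_time \<sigma> k (abelianization G) = k * s0"
    "entropic_time \<sigma> k (enat p) (cyc_power (enat p) r) = k * s0"
    "entropic_time \<sigma> k \<infinity> (cyc_power (enat p) r) = k * s1"
proof -
  define c where "c = real r * ln (real p)"
  have kpos: "0 < real k" using rk by simp
  have pp: "0 < p" using p by simp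
  note V = entropic_times_exponent_p[OF V_comm prime V_exponent order_quotient rk, of \<sigma>, folded c_def]
  note Z = entropic_times_exponent_p[OF comm_group_cyc_power prime cyc_power_exponent order_cyc_power[OF pp] rk,
      of \<sigma>, folded c_def]
  have c0': "0 < c" using r1 p by (simp add: c_def)
  define T1 where "T1 = Inf (reach_times \<sigma> k (enat p) c)"
  define T2 where "T2 = Inf (reach_times \<sigma> k \<infinity> c)"
  have T1: "0 \<le> T1" "k * coord_entropy \<sigma> (enat p) (T1 / k) = c"
    using Z(4) by (simp_all add: T1_def reach_times_def)
  have T2: "0 \<le> T2" "k * coord_entropy \<sigma> \<infinity> (T2 / k) = c" using Z(5) by (simp_all add: T2_def reach_times_def)
  have "T1 \<noteq> 0" "T2 \<noteq> 0" using T1(2) T2(2) c0' coord_entropy_0 by auto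
  then have pos: "0 < T1 / k" "0 < T2 / k" using T1 T2 kpos by auto
  have hT: "k * h (T1 / k) = c" using T1(2) pos by (simp add: coord_entropy_p)
  show ?thesis
  proof (rule that[of "T1 / k" "T2 / k"])
    show "k * h (T1 / k) = r * ln p" using hT by (simp only: c_def)
    have "k * h (T1 / k) = k * coord_entropy \<sigma> \<infinity> (T2 / k)" using hT T2(2) by simp
    then show "h (T1 / k) = coord_entropy \<sigma> \<infinity> (T2 / k)" using kpos by simp
    show "T2 / k \<le> T1 / k" using Z(6) kpos by (simp add: T1_def T2_def divide_right_mono)
    show "max_entropic_time \<sigma> k (abelianization G) = k * (T1 / k)"
      using V(3) V(1) kpos by (simp add: T1_def abelianization_def)
    show "entropic_time \<sigma> k (enat p) (cyc_power (enat p) r) = k * (T1 / k)" using Z(1) kpos by (simp add: T1_def)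
    show "entropic_time \<sigma> k \<infinity> (cyc_power (enat p) r) = k * (T2 / k)" using Z(2) kpos by (simp add: T2_def)
  qed (rule pos)+
qed

text \<open>The bound \<open>prob_disconnected\<close> with \<open>p\<^bsup>k - r\<^esup> \<ge> k -
r\<close> and \<open>p - 1 \<ge> p / 2\<close>.\<close>

lemma connected_likely:
  assumes "r < k"
  shows "1 - 2 / ((real k - real r) * real p) \<le> measure_pmf.prob (generators_law G k) {Z. cayley_connected G Z}"
proof -
  have "real k - real r \<le> real p ^ (k - r)"
  proof -
    have "k - r < 2 ^ (k - r)" by (rule less_exp)
    also have "(2::nat) ^ (k - r) \<le> p ^ (k - r)" using p by (intro power_mono) auto
    finally have "real (k - r) \<le> real (p ^ (k - r))" unfolding of_nat_le_iff by simp
    then show ?thesis using assms by (simp add: of_nat_diff)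
  qed
  then have "(real p / 2) * (real k - real r) \<le> (real p - 1) * real p ^ (k - r)"
    using p assms by (intro mult_mono) auto
  then have "1 / ((real p - 1) * p ^ (k - r)) \<le> 1 / ((real p / 2) * (real k - real r))"
    using p assms by (intro divide_left_mono) auto
  also have "\<dots> = 2 / ((real k - real r) * real p)" by simp
  finally have "measure_pmf.prob (generators_law G k) {Z. \<not> cayley_connected G Z} \<le> 2 / ((real k - real r) * real p)"
    using prob_disconnected[OF assms] by linarith
  moreover have "measure_pmf.prob (generators_law G k) {Z. \<not> cayley_connected G Z}
      = 1 - measure_pmf.prob (generators_law G k) {Z. cayley_connected G Z}"
    using measure_pmf.prob_compl[of "{Z. cayley_connected G Z}" "generators_law G k"]
    by (simp add: Compl_eq_Diff_UNIV[symmetric] Collect_neg_eq)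
  ultimately show ?thesis by linarith
qed

end

text \<open>The orders of the quotient and of the centre are powers of \<open>p\<close>, so the
logarithms are the exponents. Both exponents are positive because the group is not Abelian; hence
\<open>k > r\<close>.\<close>

lemma special_walk_intro:
  fixes G :: "('a, 'b) monoid_scheme"
  assumes prime: "prime p" and special: "special_p_group p G" and nonabelian: "\<not> comm_group G"
    and r: "real r = log (real p) (real (order (abelianization G)))"
    and s: "real s = log (real p) (real (card (commutator_subgroup G)))" and k: "r + s \<le> k"
  shows "special_walk G p k r s" "1 \<le> r" "1 \<le> s" "r < k" "real (order G) = real p ^ (r + s)"
proof -
  interpret special_group G p
    by (intro special_group.intro special_group_axioms.intro prime special) (use special in \<open>simp add: special_p_group_def\<close>)
  have p2: "2 \<le> p" using prime by (rule prime_ge_2_nat)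
  have lg: "log (real p) (real p ^ m) = m" for m :: nat using p2 by (simp add: log_nat_power)
  obtain m where m: "order V = p ^ m" using order_V_power by blast
  have rm: "r = m" using r lg[of m] unfolding abelianization_def m by simp
  obtain n where n: "card C = p ^ n" using order_C_power by blast
  have sn: "s = n" using s lg[of n] unfolding n by simp
  show r1: "1 \<le> r" using nonabelian_order_V[OF nonabelian] m rm by (cases r) auto
  show s1: "1 \<le> s" using nonabelian_card_C[OF nonabelian] n sn by (cases s) auto
  show "r < k" using k s1 by simp
  show "special_walk G p k r s"
    by (intro special_walk.intro special_group_axioms cyclic_walk.intro special_walk_axioms.intro)
       (use m n rm sn p2 k r1 in auto)
  have "order V * card C = order G" by (rule order_V)
  then show "real (order G) = real p ^ (r + s)" by (simp add: m n rm sn power_add flip: of_nat_power of_nat_mult)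
qed

theorem corollary4p2:
  fixes G :: "nat \<Rightarrow> ('a, 'b) monoid_scheme"
    and p k r s :: "nat \<Rightarrow> nat"
    and \<sigma> :: orientation
  assumes prime: "\<And>N. prime (p N)"
    and special: "\<And>N. special_p_group (p N) (G N)"
    and nonabelian: "\<And>N. \<not> comm_group (G N)"
    and order_infinity: "filterlim (\<lambda>N. real (order (G N))) at_top sequentially"
    and k_lower: "(\<lambda>_. 1) \<in> o(\<lambda>N. ln (real (k N)))"
    and k_upper: "(\<lambda>N. ln (real (k N))) \<in> o(\<lambda>N. ln (real (order (G N))))"
    and r: "\<And>N. real (r N) = log (real (p N)) (real (order (abelianization (G N))))"
    and s: "\<And>N. real (s N) = log (real (p N)) (real (card (commutator_subgroup (G N))))"
    and k_ge: "\<And>N. k N \<ge> r N + s N"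
    and regime:
      "((\<lambda>N. real (k N)) \<in> O(\<lambda>N. ln (real (order (G N)))) \<and>
        (\<lambda>N. (real (s N))\<^sup>2 * ln (real (p N))) \<in> o(\<lambda>N. real (k N)) \<and>
        (\<lambda>N. real (s N)) \<in> o(\<lambda>N. real (k N) - real (r N)))
       \<or>
       ((\<lambda>N. real (k N)) \<in> \<omega>(\<lambda>N. ln (real (order (G N)))) \<and>
        (\<lambda>N. real (s N)) \<in> o(\<lambda>N. real (r N)))"
  shows
    "(\<forall>N. max_entropic_time \<sigma> (k N) (abelianization (G N)) =
          entropic_time \<sigma> (k N) (enat (p N)) (cyc_power (enat (p N)) (r N))) \<and>
     cutoff_in_prob (\<lambda>N. connected_generators_law (G N) (k N))
       (\<lambda>N. mixing_distance \<sigma> (G N))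
       (\<lambda>N. max_entropic_time \<sigma> (k N) (abelianization (G N))) \<and>
     ((\<lambda>_. 1) \<in> o(\<lambda>N. (real (k N) - real (r N)) * real (p N)) \<longrightarrow>
        (\<lambda>N. measure_pmf.prob (generators_law (G N) (k N)) {Z. cayley_connected (G N) Z})
          \<longlonglongrightarrow> 1) \<and>
     ((\<lambda>N. real (k N) - real (r N)) \<in> \<Theta>(\<lambda>N. real (k N)) \<and>
        (\<lambda>_. 1) \<in> o(\<lambda>N. real (p N)) \<longrightarrow>
        (\<lambda>N. entropic_time \<sigma> (k N) (enat (p N)) (cyc_power (enat (p N)) (r N)))
          \<sim>[sequentially]
        (\<lambda>N. entropic_time \<sigma> (k N) \<infinity> (cyc_power (enat (p N)) (r N))))"
proof -
  define logG where "logG N = (r N + s N) * ln (p N)" for N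
  define c2 where "c2 = cyclic_walk.c2"
  note intro = special_walk_intro[OF prime special nonabelian r s k_ge]
  have W: "special_walk (G N) (p N) (k N) (r N) (s N)" for N by (rule intro(1))
  have p2: "2 \<le> p N" for N using prime by (rule prime_ge_2_nat)
  have lp: "2 / 3 \<le> ln (p N)" for N
  proof -
    have "ln 2 \<le> ln (real (p N))" using p2[of N] by (intro ln_mono) auto
    then show ?thesis using ln2_ge_two_thirds by linarith
  qed
  have r1: "1 \<le> r N" and s1: "1 \<le> s N" and rk: "r N < k N" for N by (rule intro(2-4))+
  have lnG: "ln (real (order (G N))) = logG N" for N
    unfolding intro(5) logG_def using p2[of N] by (simp add: ln_realpow)
  have logG0: "0 \<le> logG N" for N using lp[of N] by (simp add: logG_def)
  have lnk0: "0 \<le> ln (real (k N))" for N using rk[of N] by simp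
  have c2: "0 < c2" using special_walk.c2_pos[OF W] by (simp add: c2_def)
  have "\<exists>(s0 :: real) (s1 :: real). 0 < s0 \<and> k N * cyclic_walk.h (p N) \<sigma> s0 = r N * ln (p N) \<and> 0 < s1 \<and>
      cyclic_walk.h (p N) \<sigma> s0 = coord_entropy \<sigma> \<infinity> s1 \<and> s1 \<le> s0 \<and>
      max_entropic_time \<sigma> (k N) (abelianization (G N)) = k N * s0 \<and>
      entropic_time \<sigma> (k N) (enat (p N)) (cyc_power (enat (p N)) (r N)) = k N * s0 \<and>
      entropic_time \<sigma> (k N) \<infinity> (cyc_power (enat (p N)) (r N)) = k N * s1" for N
    using special_walk.entropic_times[OF W r1 rk, of N \<sigma>] by metis
  then obtain s0 :: "nat \<Rightarrow> real" and si :: "nat \<Rightarrow> real" where T: "\<And>N. 0 < s0 N" "\<And>N. k N * cyclic_walk.h (p N) \<sigma> (s0 N) = r N * ln (p N)"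
      "\<And>N. 0 < si N" "\<And>N. cyclic_walk.h (p N) \<sigma> (s0 N) = coord_entropy \<sigma> \<infinity> (si N)" "\<And>N. si N \<le> s0 N"
      "\<And>N. max_entropic_time \<sigma> (k N) (abelianization (G N)) = k N * s0 N"
      "\<And>N. entropic_time \<sigma> (k N) (enat (p N)) (cyc_power (enat (p N)) (r N)) = k N * s0 N"
      "\<And>N. entropic_time \<sigma> (k N) \<infinity> (cyc_power (enat (p N)) (r N)) = k N * si N"
    by metis
  have lnk_large: "eventually (\<lambda>N. C \<le> ln (real (k N))) sequentially" if "0 < C" for C
    using landau_o.smallD[OF k_lower, of "1 / C"] that
    by (auto elim!: eventually_mono simp: field_simps abs_of_nonneg[OF lnk0])
  have lnk_small: "eventually (\<lambda>N. ln (real (k N)) \<le> c * logG N) sequentially" if "0 < c" for c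
    using landau_o.smallD[OF k_upper that] unfolding lnG
    by (auto elim!: eventually_mono simp: abs_of_nonneg[OF lnk0] abs_of_nonneg[OF logG0])
  have quantities: "eventually (\<lambda>N. s N \<le> c * r N \<and> c' * (s N * ln (p N)) \<le> k N \<and>
      c' * (s N * ln (p N)) \<le> (k N - r N) * ln (p N)) sequentially" if c: "0 < c" "1 \<le> c'" for c c' :: real
    using regime
  proof (elim disjE conjE)
    assume i: "(\<lambda>N. real (k N)) \<in> O(\<lambda>N. ln (real (order (G N))))"
      "(\<lambda>N. (real (s N))\<^sup>2 * ln (real (p N))) \<in> o(\<lambda>N. real (k N))"
      "(\<lambda>N. real (s N)) \<in> o(\<lambda>N. real (k N) - real (r N))"
    obtain b where b: "0 < b" "eventually (\<lambda>N. norm (real (k N)) \<le> b * norm (ln (real (order (G N))))) sequentially"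
      using landau_o.bigE[OF i(1)] by blast
    (* s\<^sup>2 ln p is small against k, hence against (r + s) ln p; as s \<ge> 1, this forces s to be small against r *)
    define d where "d = min (1 / 2) (c / 2)"
    have d: "0 < d" "d \<le> 1 / 2" "2 * d \<le> c" using c by (auto simp: d_def)
    have e1: "eventually (\<lambda>N. norm ((real (s N))\<^sup>2 * ln (p N)) \<le> d / b * norm (real (k N))) sequentially"
      using d b by (intro landau_o.smallD[OF i(2)]) simp
    have e2: "eventually (\<lambda>N. norm ((real (s N))\<^sup>2 * ln (p N)) \<le> 1 / c' * norm (real (k N))) sequentially"
      using c by (intro landau_o.smallD[OF i(2)]) simp
    have e3: "eventually (\<lambda>N. norm (real (s N)) \<le> 1 / c' * norm (real (k N) - real (r N))) sequentially"
      using c by (intro landau_o.smallD[OF i(3)]) simp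
    show ?thesis using b(2) e1 e2 e3
    proof eventually_elim
      case (elim N)
      have l: "0 < ln (real (p N))" using lp[of N] by linarith
      have kb: "k N \<le> b * logG N" using elim(1) unfolding lnG using logG0[of N] by simp
      have "(real (s N))\<^sup>2 * ln (p N) \<le> d / b * k N" using elim(2) l by (simp add: abs_mult)
      also have "\<dots> \<le> d / b * (b * logG N)" using d b kb by (intro mult_left_mono) auto
      also have "\<dots> = (d * (r N + s N)) * ln (p N)" using b by (simp add: logG_def)
      finally have "(real (s N))\<^sup>2 \<le> d * (r N + s N)" using l by simp
      moreover have ss: "real (s N) \<le> (real (s N))\<^sup>2" using s1[of N] by (simp add: power2_eq_square)
      moreover have "d * s N \<le> 1 / 2 * s N" "2 * d * r N \<le> c * r N" using d by (intro mult_right_mono; simp)+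
      ultimately have sr: "s N \<le> c * r N" unfolding distrib_left of_nat_add by linarith
      have "c' * (s N * ln (p N)) \<le> c' * ((real (s N))\<^sup>2 * ln (p N))"
        using c ss l by (intro mult_left_mono mult_right_mono) auto
      also have "\<dots> \<le> c' * (1 / c' * k N)" using elim(3) l c by (intro mult_left_mono) (auto simp: abs_mult)
      finally have sk: "c' * (s N * ln (p N)) \<le> k N" using c by simp
      have "c' * s N \<le> c' * (1 / c' * (real (k N) - real (r N)))"
        using elim(4) c rk[of N] by (intro mult_left_mono) auto
      then have "c' * s N \<le> real (k N) - real (r N)" using c by simp
      then have "c' * s N * ln (p N) \<le> (real (k N) - real (r N)) * ln (p N)" using l by (intro mult_right_mono) auto
      then show ?case using sr sk rk[of N] by (simp add: mult.assoc of_nat_diff)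
    qed
  next
    assume ii: "(\<lambda>N. real (k N)) \<in> \<omega>(\<lambda>N. ln (real (order (G N))))" "(\<lambda>N. real (s N)) \<in> o(\<lambda>N. real (r N))"
    have e1: "eventually (\<lambda>N. norm (ln (real (order (G N)))) \<le> 1 / (3 * c') * norm (real (k N))) sequentially"
      using ii(1) c by (intro landau_o.smallD) (simp_all add: smallomega_iff_smallo)
    show ?thesis using e1 landau_o.smallD[OF ii(2) c(1)]
    proof eventually_elim
      case (elim N)
      have l: "2 / 3 \<le> ln (real (p N))" by (rule lp)
      have "logG N \<le> 1 / (3 * c') * k N" using elim(1) unfolding lnG using logG0[of N] by simp
      then have lk: "3 * c' * logG N \<le> k N" using c by (simp add: field_simps)
      have le: "s N * ln (p N) \<le> logG N" "r N * ln (p N) \<le> logG N" using l by (auto simp: logG_def distrib_right)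
      have cl: "1 * logG N \<le> c' * logG N" using c logG0 by (intro mult_right_mono) auto
      have cs: "c' * (s N * ln (p N)) \<le> c' * logG N" using le c by (intro mult_left_mono) auto
      have "2 / 3 * r N \<le> r N * ln (p N)" using mult_left_mono[OF l, of "real (r N)"] by (simp add: mult_ac)
      then have "k N / 2 \<le> real (k N) - real (r N)" using le cl lk by simp
      then have "k N / 2 * (2 / 3) \<le> (real (k N) - real (r N)) * ln (p N)" using l by (intro mult_mono) auto
      then have "k N / 3 \<le> (real (k N) - real (r N)) * ln (p N)" by simp
      moreover have "0 \<le> c' * logG N" using c logG0 by simp
      moreover have "real (s N) \<le> c * real (r N)" using elim(2) by simp
      moreover have "real (k N - r N) = real (k N) - real (r N)" using rk[of N] by (simp add: of_nat_diff)
      ultimately show ?case using cs lk by (simp only: simp_thms) (intro conjI; linarith)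
    qed
  qed
  have sep: "eventually (\<lambda>N. M * (s N * ln (p N) + 1 + ln (1 / min 1 (s0 N)))
      \<le> k N * min 1 (min (cyclic_walk.h (p N) \<sigma> (s0 N)) (cyclic_walk.D (p N) \<sigma> (s0 N)))) sequentially"
    if M: "1 \<le> M" for M
  proof -
    define Q where "Q = 48 * M"
    have Q: "1 \<le> Q" "0 < Q" using M by (auto simp: Q_def)
    have Q4: "0 < 4 * Q" "0 < 1 / (2 * Q)" "0 < min 1 (1 / Q)" using Q by auto
    show ?thesis using quantities[OF Q4(3) Q(1)] lnk_large[OF Q4(1)] lnk_small[OF Q4(2)]
    proof eventually_elim
      case (elim N)
      have l: "0 < ln (real (p N))" using lp[of N] by linarith
      have "min 1 (1 / Q) * real (r N) \<le> 1 * real (r N)" by (rule mult_right_mono) auto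
      moreover have "min 1 (1 / Q) * real (r N) \<le> 1 / Q * real (r N)" by (rule mult_right_mono) auto
      ultimately have sr: "s N \<le> r N" "real (s N) \<le> 1 / Q * r N" using elim(1) by linarith+
      have kpos: "0 < real (k N)" using rk[of N] by simp
      have "4 * Q \<le> 2 * sqrt (k N)" using elim(2) ln_le_sqrt[OF kpos] by linarith
      then have "2 * Q * sqrt (k N) \<le> sqrt (k N) * sqrt (k N)" by (intro mult_right_mono) auto
      then have "2 * Q * sqrt (k N) \<le> k N" by simp
      moreover have "Q * ln (k N) \<le> Q * (2 * sqrt (k N))" using Q by (intro mult_left_mono ln_le_sqrt[OF kpos]) auto
      ultimately have k1: "Q * ln (k N) \<le> k N" by (simp add: mult_ac)
      have "Q * ln (k N) \<le> Q * (1 / (2 * Q) * logG N)" using elim(3) Q by (intro mult_left_mono) auto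
      also have "\<dots> = (r N + s N) / 2 * ln (p N)" using Q by (simp add: logG_def)
      also have "\<dots> \<le> r N * ln (p N)" using sr l by (intro mult_right_mono) auto
      finally have k2: "Q * ln (k N) \<le> r N * ln (p N)" .
      have "Q * s N \<le> Q * (1 / Q * r N)" using sr Q by (intro mult_left_mono) auto
      then have "Q * s N * ln (p N) \<le> r N * ln (p N)" using l Q by (intro mult_right_mono) auto
      then have k3: "Q * (s N * ln (p N)) \<le> r N * ln (p N)" by (simp add: mult.assoc)
      show ?case
        using special_walk.separation[OF W T(1,2) s1 r1 rk M, of N] k1 k2 k3 elim(1) unfolding Q_def by blast
    qed
  qed
  have one: "\<forall>N. max_entropic_time \<sigma> (k N) (abelianization (G N)) =
      entropic_time \<sigma> (k N) (enat (p N)) (cyc_power (enat (p N)) (r N))" by (simp add: T(6,7))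
  have two: "cutoff_in_prob (\<lambda>N. connected_generators_law (G N) (k N)) (\<lambda>N. mixing_distance \<sigma> (G N))
      (\<lambda>N. max_entropic_time \<sigma> (k N) (abelianization (G N)))"
    unfolding cutoff_in_prob_def tendsto_in_prob_def T(6)
  proof (intro allI impI conjI)
    fix \<epsilon> \<delta> :: real assume "0 < \<epsilon> \<and> \<epsilon> < 1" and d: "0 < \<delta>"
    then have e: "0 < \<epsilon>" "\<epsilon> < 1" by auto
    have pos: "0 < \<epsilon> * c2" "0 < \<epsilon>\<^sup>2 * c2 * \<delta>" "0 < \<delta>\<^sup>2 * \<epsilon> * c2" "0 < \<epsilon>\<^sup>2 * c2" using e d c2 by simp_all
    show "(\<lambda>N. measure_pmf.prob (connected_generators_law (G N) (k N))
        {Z. \<delta> < \<bar>mixing_distance \<sigma> (G N) Z ((1 + \<epsilon>) * (k N * s0 N)) - 0\<bar>}) \<longlonglongrightarrow> 0"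
    proof (rule tendstoI)
      fix \<eta> :: real assume \<eta>: "0 < \<eta>"
      (* M dominates each of the finitely many constants that have to be absorbed *)
      define M where "M = 1 + 4 / (\<epsilon> * c2) + 192 / (\<epsilon>\<^sup>2 * c2 * \<delta>) + 32 / (\<delta>\<^sup>2 * \<epsilon> * c2) / \<eta>"
      have nn: "0 \<le> 4 / (\<epsilon> * c2)" "0 \<le> 192 / (\<epsilon>\<^sup>2 * c2 * \<delta>)" "0 \<le> 32 / (\<delta>\<^sup>2 * \<epsilon> * c2) / \<eta>"
        using pos \<eta> by (simp_all add: less_imp_le)
      have M: "1 \<le> M" "4 / (\<epsilon> * c2) \<le> M" "192 / (\<epsilon>\<^sup>2 * c2 * \<delta>) \<le> M" "32 / (\<delta>\<^sup>2 * \<epsilon> * c2) / \<eta> < M"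
        using nn unfolding M_def by linarith+
      have M': "4 \<le> M * (\<epsilon> * c2)" "192 \<le> M * (\<epsilon>\<^sup>2 * c2 * \<delta>)" "0 < M"
        using M(1-3) pos by (simp_all only: pos_divide_le_eq)
      have small: "32 / (\<delta>\<^sup>2 * \<epsilon> * c2) / M < \<eta>"
        using M(4) M'(3) \<eta> by (metis mult.commute pos_divide_less_eq)
      show "eventually (\<lambda>N. dist (measure_pmf.prob (connected_generators_law (G N) (k N))
        {Z. \<delta> < \<bar>mixing_distance \<sigma> (G N) Z ((1 + \<epsilon>) * (k N * s0 N)) - 0\<bar>}) 0 < \<eta>) sequentially"
        using sep[OF M(1)]
      proof eventually_elim
        case (elim N)
        have "measure_pmf.prob (connected_generators_law (G N) (k N))
          {Z. \<delta> < \<bar>mixing_distance \<sigma> (G N) Z ((1 + \<epsilon>) * (k N * s0 N)) - 0\<bar>} \<le> 32 / (\<delta>\<^sup>2 * \<epsilon> * c2) / M"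
          unfolding c2_def by (rule special_walk.cutoff_upper[OF W T(1,2) s1 rk elim e d M'[unfolded c2_def]])
        then show ?case using small by (simp add: dist_real_def)
      qed
    qed
    show "(\<lambda>N. measure_pmf.prob (connected_generators_law (G N) (k N))
        {Z. \<delta> < \<bar>mixing_distance \<sigma> (G N) Z ((1 - \<epsilon>) * (k N * s0 N)) - 1\<bar>}) \<longlonglongrightarrow> 0"
    proof (rule tendsto_eventually)
      define b where "b = 32 * (6 + ln (1 / (1 - \<epsilon>))) / (\<epsilon>\<^sup>2 * c2) + 4 / (\<epsilon> * c2)"
      have "0 \<le> ln (1 / (1 - \<epsilon>))" using e by simp
      then have b: "0 \<le> b" unfolding b_def using pos by (intro add_nonneg_nonneg divide_nonneg_nonneg) auto
      define M where "M = 1 + b / \<delta>"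
      have M: "1 \<le> M" "0 < M" "b / \<delta> \<le> M" using b d by (auto simp: M_def add_pos_nonneg)
      have Mb: "b / M \<le> \<delta>" using M d by (simp add: pos_divide_le_eq mult.commute)
      show "eventually (\<lambda>N. measure_pmf.prob (connected_generators_law (G N) (k N))
        {Z. \<delta> < \<bar>mixing_distance \<sigma> (G N) Z ((1 - \<epsilon>) * (k N * s0 N)) - 1\<bar>} = 0) sequentially"
        using sep[OF M(1)]
      proof eventually_elim
        case (elim N)
        show ?case
          by (rule special_walk.cutoff_lower[OF W T(1,2) s1 rk elim e M(2) Mb[unfolded b_def c2_def]])
      qed
    qed
  qed
  have three: "(\<lambda>N. measure_pmf.prob (generators_law (G N) (k N)) {Z. cayley_connected (G N) Z}) \<longlonglongrightarrow> 1"
    if kr: "(\<lambda>_. 1) \<in> o(\<lambda>N. (real (k N) - real (r N)) * real (p N))"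
  proof (rule tendstoI)
    fix \<eta> :: real assume \<eta>: "0 < \<eta>"
    have "0 < \<eta> / 3" using \<eta> by simp
    from landau_o.smallD[OF kr this]
    show "eventually (\<lambda>N. dist (measure_pmf.prob (generators_law (G N) (k N)) {Z. cayley_connected (G N) Z}) 1 < \<eta>) sequentially"
    proof eventually_elim
      case (elim N)
      define y where "y = (real (k N) - real (r N)) * real (p N)"
      have y: "0 < y" using rk[of N] p2[of N] by (simp add: y_def)
      have "1 \<le> \<eta> / 3 * y" using elim y unfolding y_def[symmetric] by simp
      then have "2 / y < \<eta>" using y \<eta> by (simp add: field_simps)
      moreover have "1 - 2 / y \<le> measure_pmf.prob (generators_law (G N) (k N)) {Z. cayley_connected (G N) Z}"
        unfolding y_def by (rule special_walk.connected_likely[OF W rk])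
      moreover have "measure_pmf.prob (generators_law (G N) (k N)) {Z. cayley_connected (G N) Z} \<le> 1" by simp
      ultimately show ?case by (simp add: dist_real_def)
    qed
  qed
  have four: "(\<lambda>N. entropic_time \<sigma> (k N) (enat (p N)) (cyc_power (enat (p N)) (r N))) \<sim>[sequentially]
      (\<lambda>N. entropic_time \<sigma> (k N) \<infinity> (cyc_power (enat (p N)) (r N)))"
    if kr: "(\<lambda>N. real (k N) - real (r N)) \<in> \<Theta>(\<lambda>N. real (k N))" and p_inf: "(\<lambda>_. 1) \<in> o(\<lambda>N. real (p N))"
    unfolding T(7,8)
  proof (rule asymp_equivI', rule tendstoI)
    fix \<eta> :: real assume \<eta>: "0 < \<eta>"
    define \<epsilon> where "\<epsilon> = min 1 (\<eta> / 2)"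
    have e: "0 < \<epsilon>" "\<epsilon> \<le> 1" "\<epsilon> < \<eta>" using \<eta> by (auto simp: \<epsilon>_def)
    define c0 where "c0 = cyclic_walk.c0"
    define c1 where "c1 = cyclic_walk.c1"
    have cyc: "cyclic_walk (p N)" for N using p2 by (rule cyclic_walk.intro)
    have c01: "0 < \<epsilon> / 2 * c0" "0 < \<epsilon> / 2 * c1"
      using e cyclic_walk.c0(1)[OF cyc] by (simp_all add: c0_def c1_def cyclic_walk.c1_def[OF cyc])
    obtain \<kappa> where \<kappa>: "0 < \<kappa>" "eventually (\<lambda>N. norm (real (k N) - real (r N)) \<ge> \<kappa> * norm (real (k N))) sequentially"
      using landau_omega.bigE[OF bigthetaD2[OF kr]] by blast
    have p_top: "filterlim (\<lambda>N. real (p N)) at_top sequentially"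
      unfolding filterlim_at_top
    proof
      fix Z :: real
      have "0 < 1 / (\<bar>Z\<bar> + 1)" by simp
      from landau_o.smallD[OF p_inf this] show "eventually (\<lambda>N. Z \<le> real (p N)) sequentially"
        by eventually_elim (simp add: field_simps)
    qed
    have lim1: "((\<lambda>x::real. 24 / (x powr \<kappa> - 1)) \<longlongrightarrow> 0) at_top" using \<kappa>(1) by real_asymp
    have lim2: "((\<lambda>x::real. 12 * (5 + 2 * ln x) / x\<^sup>2) \<longlongrightarrow> 0) at_top" by real_asymp
    have lim3: "filterlim (\<lambda>x::real. x powr \<kappa>) at_top at_top" using \<kappa>(1) by real_asymp
    have ev1: "eventually (\<lambda>N. 24 / (real (p N) powr \<kappa> - 1) < min 1 (\<epsilon> / 2 * c0)) sequentially"
      using order_tendstoD(2)[OF filterlim_compose[OF lim1 p_top], of "min 1 (\<epsilon> / 2 * c0)"] c01 by simp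
    have ev2: "eventually (\<lambda>N. 12 * (5 + 2 * ln (real (p N))) / (real (p N))\<^sup>2 < \<epsilon> / 2 * c1) sequentially"
      using order_tendstoD(2)[OF filterlim_compose[OF lim2 p_top], of "\<epsilon> / 2 * c1"] c01 by simp
    have ev3: "eventually (\<lambda>N. 1 < real (p N) powr \<kappa>) sequentially"
      using filterlim_compose[OF lim3 p_top] unfolding filterlim_at_top_dense by blast
    show "eventually (\<lambda>N. dist (k N * s0 N / (k N * si N)) 1 < \<eta>) sequentially"
      using ev1 ev2 ev3 \<kappa>(2)
    proof eventually_elim
      case (elim N)
      define u where "u = 12 * si N / (real (p N))\<^sup>2"
      have kpos: "0 < real (k N)" using rk[of N] by simp
      have p0: "0 < real (p N)" using p2[of N] by simp
      have "\<kappa> * k N \<le> real (k N) - real (r N)" using elim(4) rk[of N] by simp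
      then have "real (r N) \<le> (1 - \<kappa>) * k N" by (simp add: left_diff_distrib)
      then have "r N * ln (p N) \<le> (1 - \<kappa>) * k N * ln (p N)" using lp[of N] by (intro mult_right_mono) auto
      then have "k N * cyclic_walk.h (p N) \<sigma> (s0 N) \<le> k N * ((1 - \<kappa>) * ln (p N))" unfolding T(2) by (simp add: mult_ac)
      then have "cyclic_walk.h (p N) \<sigma> (s0 N) \<le> (1 - \<kappa>) * ln (p N)" using kpos by simp
      then have sq: "sqrt (s0 N) \<le> real (p N) / (real (p N) powr \<kappa> - 1)"
        by (rule cyclic_walk.sqrt_time_le[OF cyc T(1) _ elim(3)])
      have s12: "sqrt 12 \<le> (4::real)" by (rule real_le_lsqrt) auto
      have su: "sqrt u \<le> 4 / (real (p N) powr \<kappa> - 1)"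
      proof -
        have "sqrt u = sqrt 12 * sqrt (si N) / real (p N)" using p0 by (simp add: u_def real_sqrt_mult real_sqrt_divide)
        also have "\<dots> \<le> 4 * sqrt (s0 N) / real (p N)"
          using p0 T(3)[of N] T(5)[of N] s12 by (intro divide_right_mono mult_mono) auto
        also have "\<dots> \<le> 4 * (real (p N) / (real (p N) powr \<kappa> - 1)) / real (p N)"
          using sq p0 by (intro divide_right_mono mult_left_mono) auto
        also have "\<dots> = 4 / (real (p N) powr \<kappa> - 1)" using p0 by simp
        finally show ?thesis .
      qed
      have six: "6 * sqrt u < min 1 (\<epsilon> / 2 * c0)" using su elim(1) by simp
      have u0: "0 \<le> u" using T(3)[of N] by (simp add: u_def)
      have uhalf: "u \<le> 1 / 2"
      proof -
        have "sqrt u \<le> 1 / 6" using six by simp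
        then have "sqrt u * sqrt u \<le> 1 / 6 * (1 / 6)" using u0 by (intro mult_mono) auto
        then show ?thesis using u0 by simp
      qed
      have six': "6 * sqrt u < \<epsilon> / 2 * c0" using six by simp
      have le: "s0 N \<le> (1 + \<epsilon>) * si N"
        by (rule cyclic_walk.time_ratio_le[OF cyc T(3,4) e(1,2) u_def uhalf six'[unfolded c0_def] elim(2)[unfolded c1_def]])
      have "k N * s0 N / (k N * si N) = s0 N / si N" using kpos by simp
      moreover have "1 \<le> s0 N / si N" "s0 N / si N \<le> 1 + \<epsilon>" using le T(3)[of N] T(5)[of N] by (simp_all add: pos_divide_le_eq)
      ultimately show ?case using e(3) by (simp add: dist_real_def)
    qed
  qed
  show ?thesis using one two three four by blast
qed

end
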